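(* Let $M^3$ be a positive definite affine hypersurface of $\mathbb{R}^4$ which admits a pointwise $SO(2)$-symmetry or a pointwise $Z_3$-symmetry, and suppose that the globally defined functions $b,\eta,\lambda$ satisfy $b=0$ and $\eta=\lambda$ on $M^3$. Then $M^3$ is (locally, around each point) affine equivalent to $$F:I\times N^2\to\mathbb{R}^4:\ (t,u,v)\mapsto(u,\ v,\ f(u,v)+\gamma_2(t),\ \gamma_1(t)),$$ where $\psi:N^2\to\mathbb{R}^3:(u,v)\mapsto(u,v,f(u,v))$ is an improper affine sphere with affine normal $(0,0,1)$ and $\gamma=(\gamma_1,\gamma_2):I\to\mathbb{R}^2$ is a curve ($I\subset\mathbb{R}$ an interval). Moreover, if $M^3$ admits a pointwise $SO(2)$-symmetry, then $N^2$ is (an open part of) an elliptic paraboloid.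
   Context: A nondegenerate affine hypersurface $F:M^3\to\mathbb{R}^4$ is an immersion with (equi)affine (Blaschke) normal field $\xi$, inducing $\nabla$, $h$, $S$ by $D_XY=\nabla_XY+h(X,Y)\xi$, $D_X\xi=-SX$ ($D$ the flat connection of $\mathbb{R}^4$), where $h$ (affine metric) is nondegenerate and $|\det(X_1,X_2,X_3,\xi)|=1$ for $h$-orthonormal $X_1,X_2,X_3$; $S$ is the affine shape operator. The difference tensor is $K(X,Y)=\nabla_XY-\widehat\nabla_XY$ ($\widehat\nabla$ the Levi-Civita connection of $h$). Positive definite means $h$ is positive definite. For $p\in M$, $G_p$ is the group of orientation-preserving linear isometries of $(T_pM,h)$ preserving $K$ and $S$. $M$ admits a pointwise $SO(2)$-symmetry (resp. $Z_3$-symmetry) if for every $p$, $G_p$ is the group of all rotations about some axis $\mathbb{R}e_1\subset T_pM$ (resp. the order 3 group generated by the rotation by $2\pi/3$ about $\mathbb{R}e_1$). Equivalently, around each point there is a smooth $h$-orthonormal frame $\{e_1,e_2,e_3\}$ with $$K_{e_1}=\begin{pmatrix}2\lambda&0&0\\0&-\lambda&0\\0&0&-\lambda\end{pmatrix},\ K_{e_2}=\begin{pmatrix}0&-\lambda&0\\-\lambda&\mu&0\\0&0&-\mu\end{pmatrix},\ K_{e_3}=\begin{pmatrix}0&0&-\lambda\\0&0&-\mu\\-\lambda&-\mu&0\end{pmatrix},\ S=\begin{pmatrix}a&0&0\\0&b&0\\0&0&b\end{pmatrix},$$ $\lambda>0$, where for $SO(2)$ $\mu=0$ everywhere, and for $Z_3$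 $\mu>0$ everywhere and $a\neq b$ wherever $\mu=\sqrt2\lambda$. The unit vector field $e_1$ and the functions $\lambda,\mu,a,b$ are globally defined, and $\eta$ is the globally defined function $\eta=h(\widehat\nabla_{e_2}e_1,e_2)=h(\widehat\nabla_{e_3}e_1,e_3)$. An improper affine sphere in $\mathbb{R}^3$ is a nondegenerate affine surface whose affine normal is constant. *)

theory Defs
  imports "HOL-Analysis.Analysis"
begin

section \<open>Smooth maps on open sets\<close>

primrec Ck_on :: "nat \<Rightarrow> 'a::real_normed_vector set \<Rightarrow> ('a \<Rightarrow> 'b::real_normed_vector) \<Rightarrow> bool" where
  "Ck_on 0 U f \<longleftrightarrow> continuous_on U f"
| "Ck_on (Suc k) U f \<longleftrightarrow>
     (\<forall>x\<in>U. f differentiable (at x)) \<and> (\<forall>v. Ck_on k U (\<lambda>x. frechet_derivative f (at x) v))"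

text \<open>Only used for open sets in finite-dimensional spaces.\<close>

definition smooth_on :: "'a::real_normed_vector set \<Rightarrow> ('a \<Rightarrow> 'b::real_normed_vector) \<Rightarrow> bool" where
  "smooth_on U f \<longleftrightarrow> (\<forall>k. Ck_on k U f)"

definition diffeomorphism ::
  "'a::real_normed_vector set \<Rightarrow> 'b::real_normed_vector set \<Rightarrow> ('a \<Rightarrow> 'b) \<Rightarrow> bool" where
  "diffeomorphism U V g \<longleftrightarrow>
     open U \<and> open V \<and> bij_betw g U V \<and> smooth_on U g \<and> smooth_on V (inv_into U g)"

section \<open>Affine hypersurfaces in a coordinate domain\<close>

text \<open>
  Let \<open>F\<close> be an immersion of an open subset of \<open>'a\<close> into \<open>'b\<close> and \<open>\<xi>\<close> a transversal field along \<open>F\<close>.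
  Tangent vectors are elements of \<open>'a\<close>, vector fields are functions \<open>'a \<Rightarrow> 'a\<close>, and \<open>d_push F X Y x\<close>
  is the value at \<open>x\<close> of \<open>D_X (dF Y)\<close>, with \<open>D\<close> the flat connection of the ambient space.
\<close>

definition d_push ::
  "('a::euclidean_space \<Rightarrow> 'b::euclidean_space) \<Rightarrow> ('a \<Rightarrow> 'a) \<Rightarrow> ('a \<Rightarrow> 'a) \<Rightarrow> 'a \<Rightarrow> 'b" where
  "d_push F X Y x = frechet_derivative (\<lambda>y. frechet_derivative F (at y) (Y y)) (at x) (X x)"

text \<open>The decomposition \<open>D_X (dF Y) = dF (\<nabla>_X Y) + h(X,Y) \<xi>\<close>; as \<open>h\<close> is tensorial, its value
  on two tangent vectors is computed with their constant extensions.\<close>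

definition ind_conn ::
  "('a::euclidean_space \<Rightarrow> 'b::euclidean_space) \<Rightarrow> ('a \<Rightarrow> 'b) \<Rightarrow> ('a \<Rightarrow> 'a) \<Rightarrow> ('a \<Rightarrow> 'a) \<Rightarrow> 'a \<Rightarrow> 'a"
  where
  "ind_conn F \<xi> X Y x =
     (THE Z. \<exists>c. d_push F X Y x = frechet_derivative F (at x) Z + c *\<^sub>R \<xi> x)"

definition aff_metric ::
  "('a::euclidean_space \<Rightarrow> 'b::euclidean_space) \<Rightarrow> ('a \<Rightarrow> 'b) \<Rightarrow> 'a \<Rightarrow> 'a \<Rightarrow> 'a \<Rightarrow> real" where
  "aff_metric F \<xi> x v w =
     (THE c. \<exists>Z. d_push F (\<lambda>_. v) (\<lambda>_. w) x = frechet_derivative F (at x) Z + c *\<^sub>R \<xi> x)"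

text \<open>\<open>D_X \<xi> = - dF (S X)\<close>\<close>

definition shape_op ::
  "('a::euclidean_space \<Rightarrow> 'b::euclidean_space) \<Rightarrow> ('a \<Rightarrow> 'b) \<Rightarrow> 'a \<Rightarrow> 'a \<Rightarrow> 'a" where
  "shape_op F \<xi> x v =
     (THE w. frechet_derivative \<xi> (at x) v = - frechet_derivative F (at x) w)"

text \<open>Orthonormality with respect to a possibly indefinite form.\<close>

definition orthonormal :: "('a \<Rightarrow> 'a \<Rightarrow> real) \<Rightarrow> 'a list \<Rightarrow> bool" where
  "orthonormal g Xs \<longleftrightarrow>
     (\<forall>i<length Xs. \<forall>j<length Xs. \<bar>g (Xs ! i) (Xs ! j)\<bar> = (if i = j then 1 else 0))"

text \<open>\<open>F\<close> is a nondegenerate affine hypersurface with (equi)affine normal field \<open>\<xi>\<close>. The matrix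
  in the volume condition has rows \<open>dF X\<^sub>1, \<dots>, dF X\<^sub>n, \<xi>\<close>.\<close>

definition blaschke_hypersurface ::
  "'a::euclidean_space set \<Rightarrow> ('a \<Rightarrow> (real, 'k::{finite,one,plus}) vec) \<Rightarrow>
   ('a \<Rightarrow> (real, 'k) vec) \<Rightarrow> bool" where
  "blaschke_hypersurface U F \<xi> \<longleftrightarrow>
     CARD('k) = Suc DIM('a) \<and> open U \<and> smooth_on U F \<and> smooth_on U \<xi> \<and>
     (\<forall>x\<in>U.
        inj (frechet_derivative F (at x)) \<and>
        \<xi> x \<notin> range (frechet_derivative F (at x)) \<and>
        range (frechet_derivative \<xi> (at x)) \<subseteq> range (frechet_derivative F (at x)) \<and>
        (\<forall>v. (\<forall>w. aff_metric F \<xi> x v w = 0) \<longrightarrow> v = 0) \<and>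
        (\<forall>Xs. length Xs = DIM('a) \<and> orthonormal (aff_metric F \<xi> x) Xs \<longrightarrow>
           \<bar>det (vector (map (frechet_derivative F (at x)) Xs @ [\<xi> x]))\<bar> = 1))"

text \<open>The Christoffel form \<open>\<Gamma>(v,w) = \<nabla>\<^sub>v w\<close> (\<open>v\<close>, \<open>w\<close> constant) of the unique torsion-free
  connection with \<open>\<nabla>g = 0\<close>.\<close>

definition LC_gamma ::
  "('a::euclidean_space \<Rightarrow> 'a \<Rightarrow> 'a \<Rightarrow> real) \<Rightarrow> 'a \<Rightarrow> 'a \<Rightarrow> 'a \<Rightarrow> 'a" where
  "LC_gamma g x =
     (THE \<Gamma>. bilinear \<Gamma> \<and> (\<forall>v w. \<Gamma> v w = \<Gamma> w v) \<and>
        (\<forall>z v w. frechet_derivative (\<lambda>y. g y v w) (at x) z = g x (\<Gamma> z v) w + g x v (\<Gamma> z w)))"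

definition LC_conn ::
  "('a::euclidean_space \<Rightarrow> 'a \<Rightarrow> 'a \<Rightarrow> real) \<Rightarrow> ('a \<Rightarrow> 'a) \<Rightarrow> ('a \<Rightarrow> 'a) \<Rightarrow> 'a \<Rightarrow> 'a" where
  "LC_conn g X Y x = frechet_derivative Y (at x) (X x) + LC_gamma g x (X x) (Y x)"

definition diff_tensor ::
  "('a::euclidean_space \<Rightarrow> 'b::euclidean_space) \<Rightarrow> ('a \<Rightarrow> 'b) \<Rightarrow> 'a \<Rightarrow> 'a \<Rightarrow> 'a \<Rightarrow> 'a" where
  "diff_tensor F \<xi> x v w =
     ind_conn F \<xi> (\<lambda>_. v) (\<lambda>_. w) x - LC_conn (aff_metric F \<xi>) (\<lambda>_. v) (\<lambda>_. w) x"

section \<open>Pointwise symmetry groups\<close>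

definition sym_group ::
  "(real^3 \<Rightarrow> real^4) \<Rightarrow> (real^3 \<Rightarrow> real^4) \<Rightarrow> real^3 \<Rightarrow> (real^3 \<Rightarrow> real^3) set" where
  "sym_group F \<xi> x = {\<phi>. linear \<phi> \<and> det (matrix \<phi>) > 0 \<and>
     (\<forall>v w. aff_metric F \<xi> x (\<phi> v) (\<phi> w) = aff_metric F \<xi> x v w) \<and>
     (\<forall>v w. diff_tensor F \<xi> x (\<phi> v) (\<phi> w) = \<phi> (diff_tensor F \<xi> x v w)) \<and>
     (\<forall>v. shape_op F \<xi> x (\<phi> v) = \<phi> (shape_op F \<xi> x v))}"

text \<open>Rotation by the angle \<open>\<theta>\<close> about \<open>\<real>e1\<close>, for a \<open>g\<close>-orthonormal basis \<open>e1, e2, e3\<close>.\<close>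

definition rot ::
  "(real^3 \<Rightarrow> real^3 \<Rightarrow> real) \<Rightarrow> real^3 \<Rightarrow> real^3 \<Rightarrow> real^3 \<Rightarrow> real \<Rightarrow> real^3 \<Rightarrow> real^3" where
  "rot g e1 e2 e3 \<theta> v =
     g v e1 *\<^sub>R e1 + g v e2 *\<^sub>R (cos \<theta> *\<^sub>R e2 + sin \<theta> *\<^sub>R e3)
                   + g v e3 *\<^sub>R (- sin \<theta> *\<^sub>R e2 + cos \<theta> *\<^sub>R e3)"

definition SO2_at :: "(real^3 \<Rightarrow> real^4) \<Rightarrow> (real^3 \<Rightarrow> real^4) \<Rightarrow> real^3 \<Rightarrow> bool" where
  "SO2_at F \<xi> x \<longleftrightarrow>
     (\<exists>e1 e2 e3. orthonormal (aff_metric F \<xi> x) [e1, e2, e3] \<and>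
        sym_group F \<xi> x = range (rot (aff_metric F \<xi> x) e1 e2 e3))"

definition Z3_at :: "(real^3 \<Rightarrow> real^4) \<Rightarrow> (real^3 \<Rightarrow> real^4) \<Rightarrow> real^3 \<Rightarrow> bool" where
  "Z3_at F \<xi> x \<longleftrightarrow>
     (\<exists>e1 e2 e3. orthonormal (aff_metric F \<xi> x) [e1, e2, e3] \<and>
        sym_group F \<xi> x = range (\<lambda>k::nat. rot (aff_metric F \<xi> x) e1 e2 e3 (2 * pi / 3) ^^ k))"

section \<open>Adapted frames\<close>

text \<open>A smooth \<open>h\<close>-orthonormal frame on the coordinate domain \<open>V\<close> in which \<open>K\<close> and \<open>S\<close> have the
  normal form with functions \<open>l\<close>, \<open>m\<close>, \<open>a\<close>, \<open>b\<close>; the two alternatives at the end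
  are the \<open>SO(2)\<close> and the \<open>Z\<^sub>3\<close> case.\<close>

definition adapted_frame ::
  "(real^3 \<Rightarrow> real^4) \<Rightarrow> (real^3 \<Rightarrow> real^4) \<Rightarrow> (real^3) set \<Rightarrow>
   (real^3 \<Rightarrow> real^3) \<Rightarrow> (real^3 \<Rightarrow> real^3) \<Rightarrow> (real^3 \<Rightarrow> real^3) \<Rightarrow>
   (real^3 \<Rightarrow> real) \<Rightarrow> (real^3 \<Rightarrow> real) \<Rightarrow> (real^3 \<Rightarrow> real) \<Rightarrow> (real^3 \<Rightarrow> real) \<Rightarrow> bool" where
  "adapted_frame F \<xi> V e1 e2 e3 l m a b \<longleftrightarrow>
     open V \<and> smooth_on V e1 \<and> smooth_on V e2 \<and> smooth_on V e3 \<and>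
     (\<forall>x\<in>V. let K = diff_tensor F \<xi> x; S = shape_op F \<xi> x in
        orthonormal (aff_metric F \<xi> x) [e1 x, e2 x, e3 x] \<and>
        K (e1 x) (e1 x) = (2 * l x) *\<^sub>R e1 x \<and>
        K (e1 x) (e2 x) = (- l x) *\<^sub>R e2 x \<and>
        K (e1 x) (e3 x) = (- l x) *\<^sub>R e3 x \<and>
        K (e2 x) (e1 x) = (- l x) *\<^sub>R e2 x \<and>
        K (e2 x) (e2 x) = (- l x) *\<^sub>R e1 x + m x *\<^sub>R e2 x \<and>
        K (e2 x) (e3 x) = (- m x) *\<^sub>R e3 x \<and>
        K (e3 x) (e1 x) = (- l x) *\<^sub>R e3 x \<and>
        K (e3 x) (e2 x) = (- m x) *\<^sub>R e3 x \<and>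
        K (e3 x) (e3 x) = (- l x) *\<^sub>R e1 x + (- m x) *\<^sub>R e2 x \<and>
        S (e1 x) = a x *\<^sub>R e1 x \<and> S (e2 x) = b x *\<^sub>R e2 x \<and> S (e3 x) = b x *\<^sub>R e3 x \<and>
        l x > 0) \<and>
     ((\<forall>x\<in>V. m x = 0) \<or> (\<forall>x\<in>V. m x > 0 \<and> (m x = sqrt 2 * l x \<longrightarrow> a x \<noteq> b x)))"

section \<open>Hypersurfaces parametrized by a manifold\<close>

text \<open>A smooth 3-manifold \<open>X\<close> with atlas \<open>A\<close>; a chart is a pair of a domain and a coordinate map.\<close>

definition smooth_3_manifold :: "'m topology \<Rightarrow> ('m set \<times> ('m \<Rightarrow> real^3)) set \<Rightarrow> bool" where
  "smooth_3_manifold X A \<longleftrightarrow>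
     Hausdorff_space X \<and> second_countable X \<and> (\<Union>(U, \<phi>)\<in>A. U) = topspace X \<and>
     (\<forall>(U, \<phi>)\<in>A. openin X U \<and> open (\<phi> ` U) \<and>
        homeomorphic_map (subtopology X U) (top_of_set (\<phi> ` U)) \<phi>) \<and>
     (\<forall>(U, \<phi>)\<in>A. \<forall>(V, \<psi>)\<in>A. smooth_on (\<phi> ` (U \<inter> V)) (\<psi> \<circ> inv_into U \<phi>))"

definition affine_hypersurface ::
  "('m set \<times> ('m \<Rightarrow> real^3)) set \<Rightarrow> ('m \<Rightarrow> real^4) \<Rightarrow> ('m \<Rightarrow> real^4) \<Rightarrow> bool" where
  "affine_hypersurface A F \<xi> \<longleftrightarrow>
     (\<forall>(U, \<phi>)\<in>A. blaschke_hypersurface (\<phi> ` U) (F \<circ> inv_into U \<phi>) (\<xi> \<circ> inv_into U \<phi>))"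

definition positive_definite ::
  "('m set \<times> ('m \<Rightarrow> real^3)) set \<Rightarrow> ('m \<Rightarrow> real^4) \<Rightarrow> ('m \<Rightarrow> real^4) \<Rightarrow> bool" where
  "positive_definite A F \<xi> \<longleftrightarrow>
     (\<forall>(U, \<phi>)\<in>A. \<forall>x \<in> \<phi> ` U. \<forall>v. v \<noteq> 0 \<longrightarrow>
        aff_metric (F \<circ> inv_into U \<phi>) (\<xi> \<circ> inv_into U \<phi>) x v v > 0)"

definition pointwise_SO2 ::
  "('m set \<times> ('m \<Rightarrow> real^3)) set \<Rightarrow> ('m \<Rightarrow> real^4) \<Rightarrow> ('m \<Rightarrow> real^4) \<Rightarrow> bool" where
  "pointwise_SO2 A F \<xi> \<longleftrightarrow>
     (\<forall>(U, \<phi>)\<in>A. \<forall>x \<in> \<phi> ` U. SO2_at (F \<circ> inv_into U \<phi>) (\<xi> \<circ> inv_into U \<phi>) x)"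

definition pointwise_Z3 ::
  "('m set \<times> ('m \<Rightarrow> real^3)) set \<Rightarrow> ('m \<Rightarrow> real^4) \<Rightarrow> ('m \<Rightarrow> real^4) \<Rightarrow> bool" where
  "pointwise_Z3 A F \<xi> \<longleftrightarrow>
     (\<forall>(U, \<phi>)\<in>A. \<forall>x \<in> \<phi> ` U. Z3_at (F \<circ> inv_into U \<phi>) (\<xi> \<circ> inv_into U \<phi>) x)"

text \<open>\<open>lam\<close>, \<open>b\<close>, \<open>\<eta>\<close> are the functions on the manifold read off from the adapted frames, where
  \<open>\<eta> = h(\<nabla>_{e2} e1, e2) = h(\<nabla>_{e3} e1, e3)\<close> with the Levi-Civita connection of \<open>h\<close>. Every
  adapted frame on every open set yields the same values.\<close>

definition structure_functions ::
  "('m set \<times> ('m \<Rightarrow> real^3)) set \<Rightarrow> ('m \<Rightarrow> real^4) \<Rightarrow> ('m \<Rightarrow> real^4) \<Rightarrow>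
   ('m \<Rightarrow> real) \<Rightarrow> ('m \<Rightarrow> real) \<Rightarrow> ('m \<Rightarrow> real) \<Rightarrow> bool" where
  "structure_functions A F \<xi> lam b \<eta> \<longleftrightarrow>
     (\<forall>(U, \<phi>)\<in>A. \<forall>V e1 e2 e3 l m a b'.
        V \<subseteq> \<phi> ` U \<and>
        adapted_frame (F \<circ> inv_into U \<phi>) (\<xi> \<circ> inv_into U \<phi>) V e1 e2 e3 l m a b' \<longrightarrow>
        (\<forall>x\<in>V. let p = inv_into U \<phi> x; h = aff_metric (F \<circ> inv_into U \<phi>) (\<xi> \<circ> inv_into U \<phi>) in
           lam p = l x \<and> b p = b' x \<and>
           \<eta> p = h x (LC_conn h e2 e1 x) (e2 x) \<and>
           \<eta> p = h x (LC_conn h e3 e1 x) (e3 x)))"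

section \<open>Affine equivalence and the model surfaces\<close>

definition affine_iso :: "(real^'n \<Rightarrow> real^'n) \<Rightarrow> bool" where
  "affine_iso T \<longleftrightarrow> (\<exists>L c. linear L \<and> bij L \<and> T = (\<lambda>x. L x + c))"

text \<open>Near \<open>p\<close>, \<open>F\<close> agrees with the parametrized hypersurface \<open>H : D \<rightarrow> \<real>\<^sup>4\<close> up to an affine
  transformation of \<open>\<real>\<^sup>4\<close> and a diffeomorphism of \<open>D\<close> onto an open neighbourhood of \<open>p\<close>
  (written in a chart).\<close>

definition affine_equivalent_near ::
  "('m set \<times> ('m \<Rightarrow> real^3)) set \<Rightarrow> ('m \<Rightarrow> real^4) \<Rightarrow> 'm \<Rightarrow>
   'd::euclidean_space set \<Rightarrow> ('d \<Rightarrow> real^4) \<Rightarrow> bool" where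
  "affine_equivalent_near A F p D H \<longleftrightarrow>
     (\<exists>(U, \<phi>)\<in>A. p \<in> U \<and>
        (\<exists>W G T. diffeomorphism D W G \<and> W \<subseteq> \<phi> ` U \<and> \<phi> p \<in> W \<and> affine_iso T \<and>
           (\<forall>y\<in>D. T (F (inv_into U \<phi> (G y))) = H y)))"

definition improper_affine_sphere ::
  "(real^2) set \<Rightarrow> (real^2 \<Rightarrow> real^3) \<Rightarrow> (real^2 \<Rightarrow> real^3) \<Rightarrow> bool" where
  "improper_affine_sphere N \<psi> \<xi> \<longleftrightarrow>
     blaschke_hypersurface N \<psi> \<xi> \<and> (\<exists>c. \<forall>x\<in>N. \<xi> x = c)"

definition elliptic_paraboloid :: "(real^3) set \<Rightarrow> bool" where
  "elliptic_paraboloid P \<longleftrightarrow>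
     (\<exists>T. affine_iso T \<and> P = T ` {x. x $ 3 = (x $ 1)\<^sup>2 + (x $ 2)\<^sup>2})"

end

theory Submission
  imports Defs
begin

text \<open>
  The symmetry gives a smooth orthonormal frame \<open>e\<^sub>1, e\<^sub>2, e\<^sub>3\<close> in which \<open>K\<close> and \<open>S\<close> have the normal form.
  In the \<open>SO(2)\<close> case \<open>\<lambda>\<close> may vanish where \<open>a \<noteq> b\<close>, but not on an open set, since the Gauss equation would
  then give \<open>a = b\<close>; so identities need only be verified where \<open>\<lambda> \<noteq> 0\<close>. For \<open>b = 0\<close> and \<open>\<eta> = \<lambda>\<close> the
  Gauss equation makes \<open>e\<^sub>1\<close> geodesic. With \<open>E\<^sub>i = D \<Phi> e\<^sub>i\<close> and \<open>\<zeta> = \<xi> - 2 \<lambda> E\<^sub>1\<close>, both \<open>E\<^sub>1\<close> and \<open>\<zeta>\<close> are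
  constant along \<open>e\<^sub>2, e\<^sub>3\<close>, while along \<open>e\<^sub>1\<close> the derivative of \<open>\<zeta>\<close> is a multiple of \<open>\<zeta>\<close> and that of \<open>E\<^sub>1\<close> is
  \<open>4 \<lambda> E\<^sub>1 + \<zeta>\<close>. Hence the line \<open>\<real>\<zeta>\<close> and the spaces spanned by \<open>E\<^sub>1, \<zeta>\<close> and by \<open>E\<^sub>2, E\<^sub>3, \<zeta>\<close> do not depend
  on the point, and projecting along \<open>\<zeta>\<close> yields product coordinates in which \<open>\<Phi>\<close> is a translation
  hypersurface. On a slice the Hessian of the height \<open>f\<close> has an orthonormal basis of determinant \<open>1\<close>, so
  \<open>det Hess f = 1\<close> and the slice is an improper affine sphere; if \<open>\<mu> = 0\<close>, then \<open>Hess f\<close> is constant and \<open>f\<close>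
  is a quadratic polynomial.
\<close>

section \<open>Calculus of smooth maps\<close>

text \<open>The symmetry hypotheses are pointwise statements about groups, so a smooth frame has to
  be constructed. Its axis is the simple eigenline of the trace form of \<open>K\<close>, whose
  eigenvalues \<open>6 l^2\<close> and \<open>2 (l^2 + m^2)\<close> coincide exactly when
  \<open>m^2 = 2 l^2\<close>. There, if \<open>l \<noteq> 0\<close>, the cubic form has tetrahedral
  symmetry, the group is small only because \<open>a \<noteq> b\<close>, and adding \<open>S\<close>
  separates the eigenvalues. In the plane orthogonal to the axis the remaining cubic turns by three
  times the angle of rotation; hence the angles \<open>\<alpha> / 3\<close>. The combination
  \<open>\<zeta>\<close> is the one that removes the \<open>E 1\<close> component from the
  derivatives of \<open>E 2\<close> and \<open>E 3\<close> within the plane; the unknown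
  \<open>a\<close> then cancels from the derivative of \<open>\<zeta>\<close>. That the spaces are
  constant follows from uniqueness for linear differential equations, in place of the Frobenius
  theorem. In the coordinates \<open>(t, w)\<close> the direction of \<open>t\<close> is that of
  \<open>E 1\<close>, which is constant on slices, and so the height is a function of
  \<open>w\<close> plus a function of \<open>t\<close>.\<close>

abbreviation D :: "('a::real_normed_vector \<Rightarrow> 'b::real_normed_vector) \<Rightarrow> 'a \<Rightarrow> 'a \<Rightarrow> 'b" where
  "D f x \<equiv> frechet_derivative f (at x)"

lemma D_eq: "(f has_derivative f') (at x) \<Longrightarrow> D f x = f'"
  using frechet_derivative_at by metis

lemma has_derivative_D: "f differentiable (at x) \<Longrightarrow> (f has_derivative D f x) (at x)"
  by (simp add: frechet_derivative_works)

lemma D_cong_open: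
  assumes "open U" "x \<in> U" "\<And>y. y \<in> U \<Longrightarrow> f y = g y"
  shows "D f x = D g x"
proof -
  have "(f has_derivative f') (at x) \<longleftrightarrow> (g has_derivative f') (at x)" for f'
    using assms by (metis has_derivative_transform_within_open)
  then show ?thesis
    unfolding frechet_derivative_def by simp
qed

lemma differentiable_cong_open:
  assumes "open U" "x \<in> U" "\<And>y. y \<in> U \<Longrightarrow> f y = g y" "f differentiable (at x)"
  shows "g differentiable (at x)"
  using assms by (metis differentiable_def has_derivative_transform_within_open)

lemma Ck_on_cong:
  assumes "open U" "\<And>y. y \<in> U \<Longrightarrow> f y = g y" "Ck_on k U f"
  shows "Ck_on k U g"
  using assms
proof (induction k arbitrary: f g)
  case 0
  then show ?case by (simp cong: continuous_on_cong)
next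
  case (Suc k)
  have "Ck_on k U (\<lambda>x. D g x v)" for v
    using Suc.IH[of "\<lambda>x. D f x v"] Suc.prems D_cong_open[OF Suc.prems(1) _ Suc.prems(2)] by auto
  then show ?case
    using Suc.prems differentiable_cong_open by (metis Ck_on.simps(2))
qed

text \<open>\<open>Ck_on\<close> is phrased with \<open>frechet_derivative\<close>; this rule
  accepts an explicit derivative instead, so that the inductions below can work with
  formulas.\<close>

lemma Ck_on_SucI:
  assumes "open U" "\<And>x. x \<in> U \<Longrightarrow> (f has_derivative f' x) (at x)" "\<And>v. Ck_on k U (\<lambda>x. f' x v)"
  shows "Ck_on (Suc k) U f"
proof -
  have "Ck_on k U (\<lambda>x. D f x v)" for v
    by (rule Ck_on_cong[OF assms(1) _ assms(3)[of v]]) (simp add: D_eq[OF assms(2)])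
  then show ?thesis
    using assms(2) by (auto simp: differentiable_def)
qed

lemma Ck_on_SucD: "Ck_on (Suc k) U f \<Longrightarrow> Ck_on k U f"
proof (induction k arbitrary: f)
  case 0
  then show ?case
    by (auto intro!: continuous_at_imp_continuous_on differentiable_imp_continuous_within)
qed auto

lemma Ck_on_subset: "Ck_on k U f \<Longrightarrow> V \<subseteq> U \<Longrightarrow> Ck_on k V f"
  by (induction k arbitrary: f) (auto intro: continuous_on_subset)

lemma Ck_on_continuous: "Ck_on k U f \<Longrightarrow> continuous_on U f"
  by (induction k) (auto simp del: Ck_on.simps(2) dest: Ck_on_SucD)

lemma Ck_on_const: "Ck_on k U (\<lambda>x. c)"
  by (induction k arbitrary: c) auto

lemma Ck_on_bounded_linear:
  assumes "open U" "bounded_linear L" "Ck_on k U f"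
  shows "Ck_on k U (\<lambda>x. L (f x))"
  using assms
proof (induction k arbitrary: f)
  case 0
  then show ?case
    by (simp add: bounded_linear.continuous_on)
next
  case (Suc k)
  show ?case
  proof (rule Ck_on_SucI[OF \<open>open U\<close>])
    fix x assume "x \<in> U"
    then show "((\<lambda>x. L (f x)) has_derivative (\<lambda>v. L (D f x v))) (at x)"
      using Suc.prems by (auto intro!: bounded_linear.has_derivative[OF \<open>bounded_linear L\<close>] has_derivative_D)
  qed (use Suc in auto)
qed

lemma Ck_on_add:
  assumes "open U" "Ck_on k U f" "Ck_on k U g"
  shows "Ck_on k U (\<lambda>x. f x + g x)"
  using assms
proof (induction k arbitrary: f g)
  case 0
  then show ?case
    by (simp add: continuous_on_add)
next
  case (Suc k)
  show ?case
  proof (rule Ck_on_SucI[OF \<open>open U\<close>])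
    fix x assume "x \<in> U"
    then show "((\<lambda>x. f x + g x) has_derivative (\<lambda>v. D f x v + D g x v)) (at x)"
      using Suc.prems by (auto intro!: has_derivative_add has_derivative_D)
  qed (use Suc in auto)
qed

lemma Ck_on_bounded_bilinear:
  assumes "open U" "bounded_bilinear B" "Ck_on k U f" "Ck_on k U g"
  shows "Ck_on k U (\<lambda>x. B (f x) (g x))"
  using assms
proof (induction k arbitrary: f g)
  case 0
  then show ?case
    by (simp add: bounded_bilinear.continuous_on)
next
  case (Suc k)
  have fg: "Ck_on k U f" "Ck_on k U g"
    using Suc.prems Ck_on_SucD by blast+
  show ?case
  proof (rule Ck_on_SucI[OF \<open>open U\<close>])
    fix x assume "x \<in> U"
    then show "((\<lambda>x. B (f x) (g x)) has_derivative (\<lambda>v. B (f x) (D g x v) + B (D f x v) (g x))) (at x)"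
      using Suc.prems
      by (auto intro!: bounded_bilinear.FDERIV[OF \<open>bounded_bilinear B\<close>] has_derivative_D)
  qed (use Suc fg in \<open>auto intro!: Ck_on_add\<close>)
qed

lemma Ck_on_sum:
  assumes "open U" "\<And>i. i \<in> I \<Longrightarrow> Ck_on k U (f i)"
  shows "Ck_on k U (\<lambda>x. \<Sum>i\<in>I. f i x)"
  using assms(2)
  by (induction I rule: infinite_finite_induct) (auto intro!: Ck_on_const Ck_on_add assms(1))

lemma linear_eq_sum_Basis:
  fixes f :: "'a::euclidean_space \<Rightarrow> 'b::real_vector"
  assumes "linear f"
  shows "f v = (\<Sum>b\<in>Basis. (v \<bullet> b) *\<^sub>R f b)"
proof -
  have "f v = f (\<Sum>b\<in>Basis. (v \<bullet> b) *\<^sub>R b)"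
    by (simp add: euclidean_representation)
  also have "\<dots> = (\<Sum>b\<in>Basis. (v \<bullet> b) *\<^sub>R f b)"
    by (subst linear_sum[OF assms]) (simp add: linear_scale[OF assms])
  finally show ?thesis .
qed

text \<open>The derivative \<open>D g (f x) (D f x v)\<close> is taken in a direction that varies
  with \<open>x\<close>, while \<open>Ck_on\<close> recurses over fixed directions. Expanding
  \<open>D f x v\<close> in the basis leaves derivatives of \<open>g\<close> in fixed directions, to
  which the induction hypothesis applies; hence \<open>f\<close> has values in a Euclidean
  space.\<close>

lemma Ck_on_compose:
  fixes f :: "'a::real_normed_vector \<Rightarrow> 'b::euclidean_space"
  assumes "open U" "open W" "Ck_on k U f" "Ck_on k W g" "f ` U \<subseteq> W"
  shows "Ck_on k U (\<lambda>x. g (f x))"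
  using assms
proof (induction k arbitrary: g)
  case 0
  then show ?case
    by (auto intro: continuous_on_compose2[of W g U f])
next
  case (Suc k)
  have f: "Ck_on k U f"
    using Suc.prems Ck_on_SucD by blast
  show ?case
  proof (rule Ck_on_SucI[OF \<open>open U\<close>])
    fix x assume x: "x \<in> U"
    have df: "(f has_derivative D f x) (at x)" and dg: "(g has_derivative D g (f x)) (at (f x))"
      using Suc.prems x by (auto intro!: has_derivative_D)
    show "((\<lambda>x. g (f x)) has_derivative (\<lambda>v. \<Sum>b\<in>Basis. (D f x v \<bullet> b) *\<^sub>R D g (f x) b)) (at x)"
      by (rule has_derivative_eq_rhs[OF has_derivative_compose[OF df dg]])
         (rule ext, rule linear_eq_sum_Basis[OF has_derivative_linear[OF dg]])
  next
    fix v
    show "Ck_on k U (\<lambda>x. \<Sum>b\<in>Basis. (D f x v \<bullet> b) *\<^sub>R D g (f x) b)"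
    proof (intro Ck_on_sum Ck_on_bounded_bilinear[OF _ bounded_bilinear_scaleR] \<open>open U\<close>)
      fix b :: 'b
      show "Ck_on k U (\<lambda>x. D f x v \<bullet> b)"
        using Suc.prems by (intro Ck_on_bounded_linear[OF _ bounded_linear_inner_left]) auto
      show "Ck_on k U (\<lambda>x. D g (f x) b)"
        using Suc.prems f by (intro Suc.IH) auto
    qed
  qed
qed

text \<open>The derivative is a polynomial in the function itself, so the induction on the order
  closes.\<close>

lemma Ck_on_inverse_real: "Ck_on k (- {0}) (inverse :: real \<Rightarrow> real)"
proof (induction k)
  case 0
  then show ?case
    by (auto intro!: continuous_intros)
next
  case (Suc k)
  show ?case
  proof (rule Ck_on_SucI)
    fix x :: real assume "x \<in> - {0}"
    then show "(inverse has_derivative (\<lambda>v. - (inverse x * v * inverse x))) (at x)"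
      by (intro has_derivative_inverse') auto
  next
    fix v :: real
    have "Ck_on k (- {0}) (\<lambda>x::real. (- v) * (inverse x * inverse x))"
      by (intro Ck_on_bounded_linear[OF _ bounded_linear_mult_right]
          Ck_on_bounded_bilinear[OF _ bounded_bilinear_mult] Suc) auto
    then show "Ck_on k (- {0}) (\<lambda>x::real. - (inverse x * v * inverse x))"
      by (simp add: algebra_simps)
  qed auto
qed

lemma Ck_on_inverse:
  assumes "open U" "Ck_on k U f" "\<And>x. x \<in> U \<Longrightarrow> f x \<noteq> (0::real)"
  shows "Ck_on k U (\<lambda>x. inverse (f x))"
  using assms by (intro Ck_on_compose[OF _ _ _ Ck_on_inverse_real]) auto

lemma Ck_on_mult:
  fixes f :: "'a::real_normed_vector \<Rightarrow> 'b::real_normed_algebra"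
  assumes "open U" "Ck_on k U f" "Ck_on k U g"
  shows "Ck_on k U (\<lambda>x. f x * g x)"
  by (rule Ck_on_bounded_bilinear[OF assms(1) bounded_bilinear_mult assms(2,3)])

lemma Ck_on_prod:
  fixes f :: "'i \<Rightarrow> 'a::real_normed_vector \<Rightarrow> real"
  assumes "open U" "\<And>i. i \<in> I \<Longrightarrow> Ck_on k U (f i)"
  shows "Ck_on k U (\<lambda>x. \<Prod>i\<in>I. f i x)"
  using assms(2)
  by (induction I rule: infinite_finite_induct) (auto intro!: Ck_on_const Ck_on_mult assms(1))

lemma Ck_on_divide:
  assumes "open U" "Ck_on k U f" "Ck_on k U g" "\<And>x. x \<in> U \<Longrightarrow> g x \<noteq> (0::real)"
  shows "Ck_on k U (\<lambda>x. f x / g x)"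
  unfolding divide_inverse by (intro Ck_on_mult Ck_on_inverse assms)

lemma Ck_on_sqrt_real: "Ck_on k {0<..} sqrt"
proof (induction k)
  case 0
  then show ?case
    by (auto intro!: continuous_intros)
next
  case (Suc k)
  show ?case
  proof (rule Ck_on_SucI)
    fix x :: real assume "x \<in> {0<..}"
    then show "(sqrt has_derivative (\<lambda>v. v * (inverse (sqrt x) / 2))) (at x)"
      by (intro has_derivative_eq_rhs[OF DERIV_real_sqrt[unfolded has_field_derivative_def]]) (auto simp: fun_eq_iff)
  next
    fix v :: real
    show "Ck_on k {0<..} (\<lambda>x. v * (inverse (sqrt x) / 2))"
      by (intro Ck_on_mult Ck_on_divide Ck_on_inverse Ck_on_const Suc) auto
  qed auto
qed

lemma Ck_on_arctan_real: "Ck_on k UNIV arctan"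
proof (cases k)
  case 0
  then show ?thesis
    by (auto intro!: continuous_intros)
next
  case (Suc j)
  have id: "Ck_on n UNIV (\<lambda>x::real. x)" for n
    by (cases n) (auto simp: Ck_on_const)
  have "Ck_on (Suc j) UNIV arctan"
  proof (rule Ck_on_SucI)
    fix x :: real
    show "(arctan has_derivative (\<lambda>v. v * inverse (1 + x * x))) (at x)"
      using DERIV_arctan[of x]
      by (simp add: has_field_derivative_def power2_eq_square mult_commute_abs)
  next
    fix v :: real
    have "1 + x * x \<noteq> 0" for x :: real
      using zero_le_square[of x] by linarith
    then show "Ck_on j UNIV (\<lambda>x. v * inverse (1 + x * x))"
      by (intro Ck_on_mult Ck_on_inverse Ck_on_add Ck_on_const id) auto
  qed auto
  then show ?thesis
    using Suc by simp
qed

lemma Ck_on_cos_sin_real: "Ck_on k UNIV (cos :: real \<Rightarrow> real) \<and> Ck_on k UNIV (sin :: real \<Rightarrow> real)"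
proof (induction k)
  case 0
  then show ?case
    by (auto intro!: continuous_intros)
next
  case (Suc k)
  have "Ck_on (Suc k) UNIV (cos :: real \<Rightarrow> real)"
  proof (rule Ck_on_SucI)
    show "(cos has_derivative (\<lambda>v. (- v) * sin x)) (at x)" for x :: real
      by (rule has_derivative_eq_rhs[OF DERIV_cos[unfolded has_field_derivative_def]]) (auto simp: fun_eq_iff)
    show "Ck_on k UNIV (\<lambda>x. (- v) * sin x)" for v :: real
      using Suc by (intro Ck_on_mult Ck_on_const) auto
  qed auto
  moreover have "Ck_on (Suc k) UNIV (sin :: real \<Rightarrow> real)"
  proof (rule Ck_on_SucI)
    show "(sin has_derivative (\<lambda>v. v * cos x)) (at x)" for x :: real
      using DERIV_sin[of x] by (simp add: has_field_derivative_def mult_commute_abs)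
    show "Ck_on k UNIV (\<lambda>x. v * cos x)" for v :: real
      using Suc by (intro Ck_on_mult Ck_on_const) auto
  qed auto
  ultimately show ?case
    by blast
qed

lemma vec_eq_sum_axis: "(x::real^'n) = (\<Sum>i\<in>UNIV. (x $ i) *\<^sub>R axis i 1)"
  by (simp add: vec_eq_iff axis_def if_distrib[of "\<lambda>c. _ * c"] sum.If_cases)

lemma Ck_on_vec:
  fixes f :: "'a::real_normed_vector \<Rightarrow> real^'n"
  assumes "open U" "\<And>i. Ck_on k U (\<lambda>x. f x $ i)"
  shows "Ck_on k U f"
proof -
  have "Ck_on k U (\<lambda>x. \<Sum>i\<in>UNIV. (f x $ i) *\<^sub>R (axis i 1 :: real^'n))"
    by (intro Ck_on_sum Ck_on_bounded_bilinear[OF _ bounded_bilinear_scaleR] Ck_on_const assms)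
  then show ?thesis
    by (rule Ck_on_cong[OF assms(1), rotated]) (rule vec_eq_sum_axis[symmetric])
qed

lemma Ck_on_vec_nth:
  "open U \<Longrightarrow> Ck_on k U f \<Longrightarrow> Ck_on k U (\<lambda>x. f x $ i)"
  by (rule Ck_on_bounded_linear[OF _ bounded_linear_vec_nth])

lemma Ck_on_det:
  fixes A :: "'a::real_normed_vector \<Rightarrow> real^'n^'n"
  assumes "open U" "\<And>i j. Ck_on k U (\<lambda>x. A x $ i $ j)"
  shows "Ck_on k U (\<lambda>x. det (A x))"
  unfolding det_def by (intro Ck_on_sum Ck_on_mult Ck_on_prod Ck_on_const assms)

text \<open>Cramer's rule writes the solution as a quotient of determinants in the data, so
  \<open>y\<close> inherits their regularity. In this way objects introduced by definite
  descriptions become smooth.\<close>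

lemma Ck_on_solve:
  fixes A :: "'a::real_normed_vector \<Rightarrow> real^'n^'n"
  assumes "open U" "\<And>i j. Ck_on k U (\<lambda>x. A x $ i $ j)" "\<And>i. Ck_on k U (\<lambda>x. w x $ i)"
    and "\<And>x. x \<in> U \<Longrightarrow> det (A x) \<noteq> 0" "\<And>x. x \<in> U \<Longrightarrow> A x *v y x = w x"
  shows "Ck_on k U y"
proof (rule Ck_on_vec[OF assms(1)])
  fix l
  have "Ck_on k U (\<lambda>x. det (\<chi> i j. if j = l then w x $ i else A x $ i $ j) / det (A x))"
  proof (intro Ck_on_divide Ck_on_det assms(1,4))
    fix i j
    show "Ck_on k U (\<lambda>x. (\<chi> i j. if j = l then w x $ i else A x $ i $ j) $ i $ j)"
      using assms(2,3) by (cases "j = l") auto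
  qed (use assms in auto)
  moreover have "det (\<chi> i j. if j = l then w x $ i else A x $ i $ j) / det (A x) = y x $ l" if "x \<in> U" for x
    using cramer[OF assms(4)[OF that], of "y x" "w x"] assms(5)[OF that] by (simp add: vec_eq_iff)
  ultimately show "Ck_on k U (\<lambda>x. y x $ l)"
    by (rule Ck_on_cong[OF assms(1), rotated]) auto
qed

section \<open>Smooth maps: closure rules and rules of differentiation\<close>

named_theorems smooth_rules

lemma smooth_on_cong:
  "open U \<Longrightarrow> (\<And>y. y \<in> U \<Longrightarrow> f y = g y) \<Longrightarrow> smooth_on U f \<Longrightarrow> smooth_on U g"
  unfolding smooth_on_def using Ck_on_cong by blast

lemma smooth_on_subset: "smooth_on U f \<Longrightarrow> V \<subseteq> U \<Longrightarrow> smooth_on V f"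
  unfolding smooth_on_def using Ck_on_subset by blast

lemma smooth_on_continuous: "smooth_on U f \<Longrightarrow> continuous_on U f"
  unfolding smooth_on_def using Ck_on_continuous by blast

lemma smooth_on_differentiable: "smooth_on U f \<Longrightarrow> x \<in> U \<Longrightarrow> f differentiable (at x)"
  unfolding smooth_on_def by (metis Ck_on.simps(2))

lemma smooth_on_has_derivative: "smooth_on U f \<Longrightarrow> x \<in> U \<Longrightarrow> (f has_derivative D f x) (at x)"
  by (intro has_derivative_D smooth_on_differentiable)

lemma linear_D: "smooth_on U f \<Longrightarrow> x \<in> U \<Longrightarrow> linear (D f x)"
  using smooth_on_has_derivative has_derivative_linear by blast

lemma smooth_on_D: "smooth_on U f \<Longrightarrow> smooth_on U (\<lambda>x. D f x v)"
  unfolding smooth_on_def by (metis Ck_on.simps(2))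

lemma smooth_on_const [smooth_rules]: "smooth_on U (\<lambda>x. c)"
  by (simp add: smooth_on_def Ck_on_const)

lemma smooth_on_bounded_linear:
  "open U \<Longrightarrow> bounded_linear L \<Longrightarrow> smooth_on U f \<Longrightarrow> smooth_on U (\<lambda>x. L (f x))"
  unfolding smooth_on_def using Ck_on_bounded_linear by metis

lemma smooth_on_id [smooth_rules]: "smooth_on U (\<lambda>x. x)"
  unfolding smooth_on_def
proof
  fix k show "Ck_on k U (\<lambda>x. x)"
    by (cases k) (auto simp: Ck_on_const)
qed

lemma smooth_on_linear: "bounded_linear L \<Longrightarrow> smooth_on U L"
  using smooth_on_subset[OF smooth_on_bounded_linear[OF open_UNIV _ smooth_on_id]] by auto

lemma smooth_on_add [smooth_rules]:
  "open U \<Longrightarrow> smooth_on U f \<Longrightarrow> smooth_on U g \<Longrightarrow> smooth_on U (\<lambda>x. f x + g x)"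
  unfolding smooth_on_def using Ck_on_add by blast

lemma smooth_on_minus [smooth_rules]: "open U \<Longrightarrow> smooth_on U f \<Longrightarrow> smooth_on U (\<lambda>x. - f x)"
  by (rule smooth_on_bounded_linear[of U uminus]) (auto intro: bounded_linear_minus bounded_linear_ident)

lemma smooth_on_diff [smooth_rules]:
  "open U \<Longrightarrow> smooth_on U f \<Longrightarrow> smooth_on U g \<Longrightarrow> smooth_on U (\<lambda>x. f x - g x)"
  using smooth_on_add[OF _ _ smooth_on_minus, of U f g] by simp

lemma smooth_on_bounded_bilinear:
  "open U \<Longrightarrow> bounded_bilinear B \<Longrightarrow> smooth_on U f \<Longrightarrow> smooth_on U g \<Longrightarrow> smooth_on U (\<lambda>x. B (f x) (g x))"
  unfolding smooth_on_def using Ck_on_bounded_bilinear by metis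

lemmas smooth_on_scaleR [smooth_rules] = smooth_on_bounded_bilinear[OF _ bounded_bilinear_scaleR]

lemma smooth_on_mult [smooth_rules]:
  fixes f :: "'a::real_normed_vector \<Rightarrow> 'b::real_normed_algebra"
  shows "open U \<Longrightarrow> smooth_on U f \<Longrightarrow> smooth_on U g \<Longrightarrow> smooth_on U (\<lambda>x. f x * g x)"
  by (rule smooth_on_bounded_bilinear[OF _ bounded_bilinear_mult])

lemma smooth_on_sum [smooth_rules]:
  "open U \<Longrightarrow> (\<And>i. i \<in> I \<Longrightarrow> smooth_on U (f i)) \<Longrightarrow> smooth_on U (\<lambda>x. \<Sum>i\<in>I. f i x)"
  unfolding smooth_on_def using Ck_on_sum[of U I _ f] by metis

lemma smooth_on_divide [smooth_rules]:
  fixes f :: "'a::real_normed_vector \<Rightarrow> real"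
  shows "open U \<Longrightarrow> smooth_on U f \<Longrightarrow> smooth_on U g \<Longrightarrow> (\<And>x. x \<in> U \<Longrightarrow> g x \<noteq> 0) \<Longrightarrow>
    smooth_on U (\<lambda>x. f x / g x)"
  unfolding smooth_on_def using Ck_on_divide[of U _ f g] by metis

lemma smooth_on_compose:
  fixes f :: "'a::real_normed_vector \<Rightarrow> 'b::euclidean_space"
  shows "open U \<Longrightarrow> open W \<Longrightarrow> smooth_on U f \<Longrightarrow> smooth_on W g \<Longrightarrow> f ` U \<subseteq> W \<Longrightarrow>
    smooth_on U (\<lambda>x. g (f x))"
  unfolding smooth_on_def using Ck_on_compose[of U W _ f g] by metis

lemma smooth_on_sqrt [smooth_rules]:
  "open U \<Longrightarrow> smooth_on U f \<Longrightarrow> (\<And>x. x \<in> U \<Longrightarrow> f x > 0) \<Longrightarrow> smooth_on U (\<lambda>x. sqrt (f x))"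
  by (rule smooth_on_compose[of U "{0<..}"]) (auto simp: smooth_on_def Ck_on_sqrt_real)

lemma smooth_on_arctan [smooth_rules]:
  "open U \<Longrightarrow> smooth_on U f \<Longrightarrow> smooth_on U (\<lambda>x. arctan (f x))"
  by (rule smooth_on_compose[of U UNIV]) (auto simp: smooth_on_def Ck_on_arctan_real)

lemma smooth_on_cos [smooth_rules]:
  fixes f :: "'a::real_normed_vector \<Rightarrow> real"
  shows "open U \<Longrightarrow> smooth_on U f \<Longrightarrow> smooth_on U (\<lambda>x. cos (f x))"
  by (rule smooth_on_compose[of U UNIV]) (auto simp: smooth_on_def Ck_on_cos_sin_real)

lemma smooth_on_sin [smooth_rules]:
  fixes f :: "'a::real_normed_vector \<Rightarrow> real"
  shows "open U \<Longrightarrow> smooth_on U f \<Longrightarrow> smooth_on U (\<lambda>x. sin (f x))"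
  by (rule smooth_on_compose[of U UNIV]) (auto simp: smooth_on_def Ck_on_cos_sin_real)

lemma smooth_on_vec_nth [smooth_rules]:
  "open U \<Longrightarrow> smooth_on U f \<Longrightarrow> smooth_on U (\<lambda>x. f x $ i)"
  by (rule smooth_on_bounded_linear[OF _ bounded_linear_vec_nth])

lemma smooth_on_vec:
  fixes f :: "'a::real_normed_vector \<Rightarrow> real^'n"
  shows "open U \<Longrightarrow> (\<And>i. smooth_on U (\<lambda>x. f x $ i)) \<Longrightarrow> smooth_on U f"
  unfolding smooth_on_def using Ck_on_vec[of U _ f] by metis

lemma smooth_on_det [smooth_rules]:
  fixes A :: "'a::real_normed_vector \<Rightarrow> real^'n^'n"
  shows "open U \<Longrightarrow> (\<And>i j. smooth_on U (\<lambda>x. A x $ i $ j)) \<Longrightarrow> smooth_on U (\<lambda>x. det (A x))"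
  unfolding smooth_on_def using Ck_on_det[of U _ A] by metis

lemma smooth_on_solve:
  fixes A :: "'a::real_normed_vector \<Rightarrow> real^'n^'n"
  assumes "open U" "\<And>i j. smooth_on U (\<lambda>x. A x $ i $ j)" "smooth_on U w"
    and "\<And>x. x \<in> U \<Longrightarrow> det (A x) \<noteq> 0" "\<And>x. x \<in> U \<Longrightarrow> A x *v y x = w x"
  shows "smooth_on U y"
  unfolding smooth_on_def
proof
  fix k
  show "Ck_on k U y"
    by (rule Ck_on_solve[where A = A and w = w])
       (use assms in \<open>auto simp: smooth_on_def Ck_on_vec_nth\<close>)
qed

lemma D_bounded_linear:
  assumes "smooth_on U f" "x \<in> U" "bounded_linear L"
  shows "D (\<lambda>y. L (f y)) x v = L (D f x v)"
  by (subst D_eq[OF bounded_linear.has_derivative[OF assms(3) smooth_on_has_derivative[OF assms(1,2)]]]) simp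

lemma D_vec_nth:
  "smooth_on U f \<Longrightarrow> x \<in> U \<Longrightarrow> D (\<lambda>y. f y $ i) x v = D f x v $ i"
  by (rule D_bounded_linear[OF _ _ bounded_linear_vec_nth])

lemma D_add:
  assumes "smooth_on U f" "smooth_on U g" "x \<in> U"
  shows "D (\<lambda>y. f y + g y) x v = D f x v + D g x v"
  by (subst D_eq[OF has_derivative_add[OF smooth_on_has_derivative smooth_on_has_derivative]])
     (use assms in auto)

lemma D_diff:
  assumes "smooth_on U f" "smooth_on U g" "x \<in> U"
  shows "D (\<lambda>y. f y - g y) x v = D f x v - D g x v"
  by (subst D_eq[OF has_derivative_diff[OF smooth_on_has_derivative smooth_on_has_derivative]])
     (use assms in auto)

lemma D_minus:
  assumes "smooth_on U f" "x \<in> U"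
  shows "D (\<lambda>y. - f y) x v = - D f x v"
  by (subst D_eq[OF has_derivative_minus[OF smooth_on_has_derivative]]) (use assms in auto)

lemma D_sum:
  assumes "\<And>i. i \<in> I \<Longrightarrow> smooth_on U (f i)" "x \<in> U"
  shows "D (\<lambda>y. \<Sum>i\<in>I. f i y) x v = (\<Sum>i\<in>I. D (f i) x v)"
  by (subst D_eq[OF has_derivative_sum[OF smooth_on_has_derivative]]) (use assms in auto)

lemma D_scaleR:
  assumes "smooth_on U c" "smooth_on U f" "x \<in> U"
  shows "D (\<lambda>y. c y *\<^sub>R f y) x v = c x *\<^sub>R D f x v + D c x v *\<^sub>R f x"
  by (subst D_eq[OF has_derivative_scaleR[OF smooth_on_has_derivative smooth_on_has_derivative]])
     (use assms in auto)

lemma D_mult: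
  fixes f :: "'a::real_normed_vector \<Rightarrow> real"
  assumes "smooth_on U f" "smooth_on U g" "x \<in> U"
  shows "D (\<lambda>y. f y * g y) x v = f x * D g x v + D f x v * g x"
  using D_scaleR[OF assms, of v] by simp

subsection \<open>Second derivatives\<close>

lemma smooth_on_D_field [smooth_rules]:
  fixes f :: "'a::euclidean_space \<Rightarrow> 'b::real_normed_vector"
  assumes "open U" "smooth_on U f" "smooth_on U Y"
  shows "smooth_on U (\<lambda>y. D f y (Y y))"
proof -
  have "smooth_on U (\<lambda>y. \<Sum>b\<in>Basis. (Y y \<bullet> b) *\<^sub>R D f y b)"
    by (intro smooth_rules smooth_on_D smooth_on_bounded_linear[OF _ bounded_linear_inner_left] assms)
  then show ?thesis
    by (rule smooth_on_cong[OF assms(1), rotated])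
       (rule linear_eq_sum_Basis[symmetric, OF linear_D[OF assms(2)]])
qed

lemma linear_DD:
  fixes f :: "'a::euclidean_space \<Rightarrow> 'b::real_normed_vector"
  assumes "open U" "smooth_on U f" "x \<in> U"
  shows "linear (\<lambda>w. D (\<lambda>y. D f y w) x v)"
proof
  fix w w' :: 'a and c :: real
  have "D (\<lambda>y. D f y (w + w')) x v = D (\<lambda>y. D f y w + D f y w') x v"
    by (rule D_cong_open[OF assms(1,3), THEN fun_cong]) (rule linear_add[OF linear_D[OF assms(2)]])
  also have "\<dots> = D (\<lambda>y. D f y w) x v + D (\<lambda>y. D f y w') x v"
    by (rule D_add[OF smooth_on_D smooth_on_D]) (rule assms)+
  finally show "D (\<lambda>y. D f y (w + w')) x v = D (\<lambda>y. D f y w) x v + D (\<lambda>y. D f y w') x v" .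
  have "D (\<lambda>y. D f y (c *\<^sub>R w)) x v = D (\<lambda>y. c *\<^sub>R D f y w) x v"
    by (rule D_cong_open[OF assms(1,3), THEN fun_cong]) (rule linear_scale[OF linear_D[OF assms(2)]])
  also have "\<dots> = c *\<^sub>R D (\<lambda>y. D f y w) x v"
    by (subst D_scaleR[OF smooth_on_const smooth_on_D]) (use assms in auto)
  finally show "D (\<lambda>y. D f y (c *\<^sub>R w)) x v = c *\<^sub>R D (\<lambda>y. D f y w) x v" .
qed

text \<open>Expanding \<open>Y\<close> in the basis turns the moving direction into scalar factors,
  for which the ordinary product rule holds; linearity reassembles the two sums.\<close>

lemma D_D_field:
  fixes f :: "'a::euclidean_space \<Rightarrow> 'b::real_normed_vector"
  assumes "open U" "smooth_on U f" "smooth_on U Y" "x \<in> U"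
  shows "D (\<lambda>y. D f y (Y y)) x v = D (\<lambda>y. D f y (Y x)) x v + D f x (D Y x v)"
proof -
  have sY: "smooth_on U (\<lambda>y. Y y \<bullet> b)" for b
    by (intro smooth_on_bounded_linear[OF _ bounded_linear_inner_left] assms)
  have "D (\<lambda>y. D f y (Y y)) x v = D (\<lambda>y. \<Sum>b\<in>Basis. (Y y \<bullet> b) *\<^sub>R D f y b) x v"
    by (rule D_cong_open[OF assms(1,4), THEN fun_cong])
       (rule linear_eq_sum_Basis[OF linear_D[OF assms(2)]])
  also have "\<dots> = (\<Sum>b\<in>Basis. D (\<lambda>y. (Y y \<bullet> b) *\<^sub>R D f y b) x v)"
    by (rule D_sum) (auto intro!: smooth_rules sY smooth_on_D assms)
  also have "\<dots> = (\<Sum>b\<in>Basis. (Y x \<bullet> b) *\<^sub>R D (\<lambda>y. D f y b) x v + (D Y x v \<bullet> b) *\<^sub>R D f x b)"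
    by (intro sum.cong refl, subst D_scaleR[OF sY smooth_on_D])
       (use assms D_bounded_linear[OF assms(3,4) bounded_linear_inner_left] in auto)
  also have "\<dots> = D (\<lambda>y. D f y (Y x)) x v + D f x (D Y x v)"
    by (simp only: sum.distrib linear_eq_sum_Basis[OF linear_DD[OF assms(1,2,4), of v], symmetric]
      linear_eq_sum_Basis[OF linear_D[OF assms(2,4)], symmetric])
  finally show ?thesis .
qed

text \<open>Two applications of the mean value theorem to the second difference of \<open>f\<close>.\<close>

lemma second_difference:
  fixes f :: "'a::euclidean_space \<Rightarrow> real"
  assumes "open U" "smooth_on U f" "t > 0" "ball x (t * (norm v + norm w) + \<epsilon>) \<subseteq> U" "\<epsilon> > 0"
  shows "\<exists>y. dist x y \<le> t * (norm v + norm w) \<and>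
     f (x + t *\<^sub>R v + t *\<^sub>R w) - f (x + t *\<^sub>R v) - f (x + t *\<^sub>R w) + f x = t * t * D (\<lambda>y. D f y v) y w"
proof -
  have dist: "dist x (x + r *\<^sub>R v + s *\<^sub>R w) \<le> t * (norm v + norm w)"
    if "0 \<le> r" "r \<le> t" "0 \<le> s" "s \<le> t" for r s
  proof -
    have "dist x (x + r *\<^sub>R v + s *\<^sub>R w) = norm (r *\<^sub>R v + s *\<^sub>R w)"
      by (subst dist_commute) (simp add: dist_norm add.assoc)
    also have "\<dots> \<le> r * norm v + s * norm w"
      using norm_triangle_ineq[of "r *\<^sub>R v" "s *\<^sub>R w"] that by simp
    also have "\<dots> \<le> t * (norm v + norm w)"
      using that by (simp add: distrib_left add_mono mult_right_mono)
    finally show ?thesis .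
  qed
  have inU: "x + r *\<^sub>R v + s *\<^sub>R w \<in> U" if "0 \<le> r" "r \<le> t" "0 \<le> s" "s \<le> t" for r s
    using dist[OF that] assms(4,5) by (force simp: subset_iff)
  define g where "g r = f (x + r *\<^sub>R v + t *\<^sub>R w) - f (x + r *\<^sub>R v)" for r
  have dg: "(g has_real_derivative (D f (x + r *\<^sub>R v + t *\<^sub>R w) v - D f (x + r *\<^sub>R v) v)) (at r)"
    if "0 \<le> r" "r \<le> t" for r
  proof -
    have l: "((\<lambda>r. x + r *\<^sub>R v + s *\<^sub>R w) has_derivative (\<lambda>d. d *\<^sub>R v)) (at r)" for s
      by (auto intro!: derivative_eq_intros)
    have "((\<lambda>r. f (x + r *\<^sub>R v + s *\<^sub>R w)) has_derivative (\<lambda>d. D f (x + r *\<^sub>R v + s *\<^sub>R w) (d *\<^sub>R v))) (at r)"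
      if "0 \<le> s" "s \<le> t" for s
      by (rule has_derivative_compose[OF l smooth_on_has_derivative[OF assms(2) inU]])
         (use that \<open>0 \<le> r\<close> \<open>r \<le> t\<close> in auto)
    from has_derivative_diff[OF this[of t] this[of 0]] \<open>t > 0\<close>
    have "(g has_derivative (\<lambda>d. D f (x + r *\<^sub>R v + t *\<^sub>R w) (d *\<^sub>R v) - D f (x + r *\<^sub>R v) (d *\<^sub>R v))) (at r)"
      by (simp add: g_def[abs_def])
    moreover have "D f (x + r *\<^sub>R v + s *\<^sub>R w) (d *\<^sub>R v) = d * D f (x + r *\<^sub>R v + s *\<^sub>R w) v"
      if "0 \<le> s" "s \<le> t" for s d
      using linear_scale[OF linear_D[OF assms(2) inU]] that \<open>0 \<le> r\<close> \<open>r \<le> t\<close> by fastforce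
    from this[of t] this[of 0] \<open>t > 0\<close>
    have "D f (x + r *\<^sub>R v + t *\<^sub>R w) (d *\<^sub>R v) - D f (x + r *\<^sub>R v) (d *\<^sub>R v) =
        (D f (x + r *\<^sub>R v + t *\<^sub>R w) v - D f (x + r *\<^sub>R v) v) * d" for d
      by (simp add: algebra_simps)
    ultimately show ?thesis
      by (simp add: has_field_derivative_def)
  qed
  obtain r where r: "0 < r" "r < t"
    "g t - g 0 = t * (D f (x + r *\<^sub>R v + t *\<^sub>R w) v - D f (x + r *\<^sub>R v) v)"
    using MVT2[OF \<open>t > 0\<close> dg] by auto
  define k where "k s = D f (x + r *\<^sub>R v + s *\<^sub>R w) v" for s
  have dk: "(k has_real_derivative D (\<lambda>y. D f y v) (x + r *\<^sub>R v + s *\<^sub>R w) w) (at s)"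
    if "0 \<le> s" "s \<le> t" for s
  proof -
    have l: "((\<lambda>s. x + r *\<^sub>R v + s *\<^sub>R w) has_derivative (\<lambda>d. d *\<^sub>R w)) (at s)"
      by (auto intro!: derivative_eq_intros)
    have "x + r *\<^sub>R v + s *\<^sub>R w \<in> U"
      using inU that r by simp
    note z = smooth_on_has_derivative[OF smooth_on_D[OF assms(2), of v] this] linear_D[OF smooth_on_D[OF assms(2), of v] this]
    have "(k has_derivative (\<lambda>d. D (\<lambda>y. D f y v) (x + r *\<^sub>R v + s *\<^sub>R w) (d *\<^sub>R w))) (at s)"
      unfolding k_def[abs_def] by (rule has_derivative_compose[OF l z(1)])
    then show ?thesis
      by (simp add: has_field_derivative_def linear_scale[OF z(2)] mult.commute[of _ "D _ _ w"])
  qed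
  obtain s where s: "0 < s" "s < t" "k t - k 0 = t * D (\<lambda>y. D f y v) (x + r *\<^sub>R v + s *\<^sub>R w) w"
    using MVT2[OF \<open>t > 0\<close> dk] by auto
  have "f (x + t *\<^sub>R v + t *\<^sub>R w) - f (x + t *\<^sub>R v) - f (x + t *\<^sub>R w) + f x = g t - g 0"
    by (simp add: g_def)
  also have "\<dots> = t * t * D (\<lambda>y. D f y v) (x + r *\<^sub>R v + s *\<^sub>R w) w"
    using r(3) s(3) by (simp add: k_def)
  finally show ?thesis
    using dist[of r s] r s by (intro exI[of _ "x + r *\<^sub>R v + s *\<^sub>R w"]) auto
qed

text \<open>By \<open>second_difference\<close> one and the same difference equals
  \<open>t * t\<close> times either mixed derivative, evaluated at points close to \<open>x\<close>.
  Continuity of both derivatives therefore excludes a gap at \<open>x\<close>.\<close>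

lemma DD_symmetric_real:
  fixes f :: "'a::euclidean_space \<Rightarrow> real"
  assumes "open U" "smooth_on U f" "x \<in> U"
  shows "D (\<lambda>y. D f y v) x w = D (\<lambda>y. D f y w) x v"
proof (rule ccontr)
  let ?P = "\<lambda>y. D (\<lambda>y. D f y v) y w" and ?Q = "\<lambda>y. D (\<lambda>y. D f y w) y v"
  assume ne: "?P x \<noteq> ?Q x"
  define \<epsilon> where "\<epsilon> = \<bar>?P x - ?Q x\<bar> / 2"
  have "\<epsilon> > 0"
    using ne by (simp add: \<epsilon>_def)
  have "smooth_on U ?P" "smooth_on U ?Q"
    by (intro smooth_on_D assms)+
  then have "continuous (at x) ?P" "continuous (at x) ?Q"
    using smooth_on_continuous continuous_on_eq_continuous_at[OF assms(1)] assms(3) by blast+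
  then have "\<exists>d>0. \<forall>y. dist y x < d \<longrightarrow> dist (?P y) (?P x) < \<epsilon>"
    "\<exists>d>0. \<forall>y. dist y x < d \<longrightarrow> dist (?Q y) (?Q x) < \<epsilon>"
    using \<open>\<epsilon> > 0\<close> unfolding continuous_at_eps_delta by blast+
  then obtain d1 d2 where d: "d1 > 0" "\<And>y. dist y x < d1 \<Longrightarrow> dist (?P y) (?P x) < \<epsilon>"
      "d2 > 0" "\<And>y. dist y x < d2 \<Longrightarrow> dist (?Q y) (?Q x) < \<epsilon>"
    by blast
  obtain d3 where d3: "d3 > 0" "ball x d3 \<subseteq> U"
    using assms open_contains_ball by blast
  define d where "d = min d3 (min d1 d2)"
  \<comment> \<open>The summand \<open>1\<close> keeps the denominator positive even if
    \<open>v\<close> and \<open>w\<close> vanish; both evaluation points then have distance less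
    than \<open>d\<close> from \<open>x\<close>.\<close>
  define t where "t = d / (2 * (norm v + norm w + 1))"
  have "d > 0"
    using d d3 by (simp add: d_def)
  have n: "norm v + norm w + 1 > 0"
    using norm_ge_zero[of v] norm_ge_zero[of w] by linarith
  have t: "t > 0"
    using \<open>d > 0\<close> n by (simp add: t_def)
  have "t * (norm v + norm w + 1) = d / 2"
    using n by (simp add: t_def field_simps)
  then have td: "t * (norm v + norm w) < d"
    using t \<open>d > 0\<close> by (simp add: algebra_simps)
  define e where "e = d - t * (norm v + norm w)"
  have sub: "ball x (t * (norm v + norm w) + e) \<subseteq> U" "ball x (t * (norm w + norm v) + e) \<subseteq> U" "e > 0"
    using td d3 by (auto simp: e_def d_def add.commute)
  obtain y where y: "dist x y \<le> t * (norm v + norm w)"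
      "f (x + t *\<^sub>R v + t *\<^sub>R w) - f (x + t *\<^sub>R v) - f (x + t *\<^sub>R w) + f x = t * t * ?P y"
    using second_difference[OF assms(1,2) t sub(1,3)] by auto
  obtain z where z: "dist x z \<le> t * (norm w + norm v)"
      "f (x + t *\<^sub>R w + t *\<^sub>R v) - f (x + t *\<^sub>R w) - f (x + t *\<^sub>R v) + f x = t * t * ?Q z"
    using second_difference[OF assms(1,2) t sub(2,3)] by auto
  have "x + t *\<^sub>R w + t *\<^sub>R v = x + t *\<^sub>R v + t *\<^sub>R w"
    by simp
  then have "?P y = ?Q z"
    using y(2) z(2) t by (simp add: algebra_simps)
  moreover have "dist y x < d1" "dist z x < d2"
    using y z td by (auto simp: d_def dist_commute add.commute)
  then have "dist (?P y) (?P x) < \<epsilon>" "dist (?Q z) (?Q x) < \<epsilon>"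
    using d by blast+
  ultimately show False
    unfolding \<epsilon>_def dist_real_def by (simp add: abs_if split: if_splits)
qed

lemma DD_symmetric:
  fixes f :: "'a::euclidean_space \<Rightarrow> 'b::euclidean_space"
  assumes "open U" "smooth_on U f" "x \<in> U"
  shows "D (\<lambda>y. D f y v) x w = D (\<lambda>y. D f y w) x v"
proof (rule euclidean_eqI)
  fix b :: 'b
  have D: "D (\<lambda>y. D f y v) x w \<bullet> b = D (\<lambda>y. D (\<lambda>z. f z \<bullet> b) y v) x w" for v w
  proof -
    have "D (\<lambda>y. D f y v) x w \<bullet> b = D (\<lambda>y. D f y v \<bullet> b) x w"
      by (rule D_bounded_linear[OF smooth_on_D _ bounded_linear_inner_left, symmetric]) (rule assms)+
    also have "\<dots> = D (\<lambda>y. D (\<lambda>z. f z \<bullet> b) y v) x w"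
      by (rule D_cong_open[OF assms(1,3), THEN fun_cong])
         (rule D_bounded_linear[OF assms(2) _ bounded_linear_inner_left, symmetric])
    finally show ?thesis .
  qed
  have "smooth_on U (\<lambda>z. f z \<bullet> b)"
    by (rule smooth_on_bounded_linear[OF assms(1) bounded_linear_inner_left assms(2)])
  then show "D (\<lambda>y. D f y v) x w \<bullet> b = D (\<lambda>y. D f y w) x v \<bullet> b"
    unfolding D by (rule DD_symmetric_real[OF assms(1) _ assms(3)])
qed

text \<open>The second derivatives of \<open>f\<close> cancel by symmetry, and the derivative along
  the Lie bracket of \<open>X\<close> and \<open>Y\<close> remains. Applied to the vectors
  \<open>E k\<close> this expresses the flatness of the ambient connection.\<close>

lemma D_commutator:
  fixes f :: "'a::euclidean_space \<Rightarrow> 'b::euclidean_space"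
  assumes "open U" "smooth_on U f" "smooth_on U X" "smooth_on U Y" "x \<in> U"
  shows "D (\<lambda>y. D f y (Y y)) x (X x) - D (\<lambda>y. D f y (X y)) x (Y x) = D f x (D Y x (X x) - D X x (Y x))"
  using DD_symmetric[OF assms(1,2,5), of "Y x" "X x"]
  by (simp add: D_D_field[OF assms(1,2,4,5)] D_D_field[OF assms(1,2,3,5)]
      linear_diff[OF linear_D[OF assms(2,5)]])

subsection \<open>The inverse function theorem\<close>

lemma matrix_mult_linear: "linear f \<Longrightarrow> matrix f *v x = f x" for f :: "real^'n \<Rightarrow> real^'m"
  by (simp add: matrix_works linear_matrix_vector_mul_eq)

text \<open>Cramer's rule expresses the derivative of \<open>g\<close> through \<open>D f \<circ> g\<close>, so that \<open>g\<close> gains one order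
  of differentiability at a time.\<close>

lemma smooth_on_inverse:
  fixes f :: "real^'n \<Rightarrow> real^'n"
  assumes "open U" "open V" "smooth_on U f" "g ` V \<subseteq> U"
    and g: "\<And>y. y \<in> V \<Longrightarrow> (g has_derivative g' y) (at y)"
    and inv: "\<And>y v. y \<in> V \<Longrightarrow> D f (g y) (g' y v) = v"
  shows "smooth_on V g"
  unfolding smooth_on_def
proof
  fix k show "Ck_on k V g"
  proof (induction k)
    case 0
    then show ?case
      using g by (auto intro!: continuous_at_imp_continuous_on has_derivative_continuous)
  next
    case (Suc k)
    have lin: "linear (D f (g y))" if "y \<in> V" for y
      using linear_D[OF assms(3)] assms(4) that by blast
    have mv: "matrix (D f (g y)) *v g' y v = v" if "y \<in> V" for y v
      using matrix_mult_linear[OF lin[OF that]] inv[OF that] by simp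
    show ?case
    proof (rule Ck_on_SucI[OF \<open>open V\<close> g])
      fix v
      show "Ck_on k V (\<lambda>y. g' y v)"
      proof (rule Ck_on_solve[OF \<open>open V\<close>, where A = "\<lambda>y. matrix (D f (g y))" and w = "\<lambda>y. v"])
        fix i j :: 'n
        have "Ck_on k U (\<lambda>x. D f x (axis j 1) $ i)"
          by (rule Ck_on_vec_nth[OF \<open>open U\<close>])
             (use smooth_on_D[OF assms(3)] in \<open>simp add: smooth_on_def\<close>)
        from Ck_on_compose[OF \<open>open V\<close> \<open>open U\<close> Suc this \<open>g ` V \<subseteq> U\<close>]
        show "Ck_on k V (\<lambda>y. matrix (D f (g y)) $ i $ j)"
          by (simp add: matrix_def)
      next
        fix y assume y: "y \<in> V"
        have "matrix (D f (g y)) ** matrix (g' y) = mat 1"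
          unfolding matrix_eq using mv[OF y] matrix_mult_linear[OF has_derivative_linear[OF g[OF y]]]
          by (simp flip: matrix_vector_mul_assoc)
        then show "det (matrix (D f (g y))) \<noteq> 0"
          by (metis invertible_det_nz invertible_right_inverse)
        show "matrix (D f (g y)) *v g' y v = v"
          by (rule mv[OF y])
      qed (rule Ck_on_const)
    qed
  qed
qed

text \<open>The inverse function theorem supplies a differentiable inverse together with its
  derivative, and \<open>smooth_on_inverse\<close> raises this to smoothness. The derivative is
  packed as a bounded linear function because the theorem asks for continuity in that space.\<close>

lemma smooth_inverse_function:
  fixes f :: "real^'n \<Rightarrow> real^'n"
  assumes "open U" "p \<in> U" "smooth_on U f" "inj (D f p)"
  obtains W V g where "open W" "W \<subseteq> U" "p \<in> W" "open V" "f ` W = V" "smooth_on V g"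
    "\<And>x. x \<in> W \<Longrightarrow> g (f x) = x" "\<And>y. y \<in> V \<Longrightarrow> g y \<in> W \<and> f (g y) = y"
    "\<And>y v. y \<in> V \<Longrightarrow> D f (g y) (D g y v) = v" "\<And>y v. y \<in> V \<Longrightarrow> D g y (D f (g y) v) = v"
proof -
  define f' where "f' x = Blinfun (D f x)" for x
  have bl: "bounded_linear (D f x)" if "x \<in> U" for x
    using linear_D[OF assms(3) that] by (simp add: linear_conv_bounded_linear)
  have f': "blinfun_apply (f' x) = D f x" if "x \<in> U" for x
    using bl[OF that] by (simp add: f'_def bounded_linear_Blinfun_apply)
  have "continuous_on U f'"
    by (rule continuous_on_blinfun_componentwise)
       (use smooth_on_continuous[OF smooth_on_D[OF assms(3)]] f' in \<open>simp cong: continuous_on_cong\<close>)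
  have "bij (D f p)"
    using linear_injective_imp_surjective[OF linear_D[OF assms(3,2)]] assms(4) by (simp add: bij_def)
  obtain L where L: "linear L" "L \<circ> D f p = id"
    using linear_injective_left_inverse[OF linear_D[OF assms(3,2)] assms(4)] by blast
  have "Blinfun L o\<^sub>L f' p = id_blinfun"
    by (rule blinfun_eqI)
       (use L f'[OF assms(2)] in \<open>simp add: bounded_linear_Blinfun_apply linear_conv_bounded_linear fun_eq_iff\<close>)
  moreover have "(f has_derivative blinfun_apply (f' x)) (at x)" if "x \<in> U" for x
    using smooth_on_has_derivative[OF assms(3) that] f'[OF that] by simp
  ultimately obtain W V g g' where W: "open W" "W \<subseteq> U" "p \<in> W" "open V" "homeomorphism W V f g"
    and g: "\<And>y. y \<in> V \<Longrightarrow> (g has_derivative (g' y)) (at y)"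
    and inv: "\<And>y. y \<in> V \<Longrightarrow> g' y = inv (blinfun_apply (f' (g y)))"
    and bij: "\<And>y. y \<in> V \<Longrightarrow> bij (blinfun_apply (f' (g y)))"
    using inverse_function_theorem[OF assms(1) _ \<open>continuous_on U f'\<close> assms(2)] by metis
  have gV: "g y \<in> W \<and> f (g y) = y" if "y \<in> V" for y
    using W(5) that by (auto simp: homeomorphism_def)
  have i1: "D f (g y) (g' y v) = v" and i2: "g' y (D f (g y) v) = v" if "y \<in> V" for y v
    using bij[OF that] inv[OF that] f' gV[OF that] W(2)
    by (auto simp: bij_is_surj surj_f_inv_f bij_is_inj inv_f_f subset_iff)
  have "smooth_on V g"
    by (rule smooth_on_inverse[OF assms(1) W(4) assms(3) _ g i1]) (use gV W in auto)
  then show thesis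
    using W gV g i1 i2 D_eq[OF g]
    by (intro that[of W V g]) (auto simp: homeomorphism_def)
qed

section \<open>Linear algebra\<close>

lemma vector_4 [simp]:
  "(vector [a, b, c, d] :: ('a::zero)^4) $ 1 = a" "(vector [a, b, c, d] :: 'a^4) $ 2 = b"
  "(vector [a, b, c, d] :: 'a^4) $ 3 = c" "(vector [a, b, c, d] :: 'a^4) $ 4 = d"
  unfolding vector_def by simp_all

definition indep4 :: "real^4 \<Rightarrow> real^4 \<Rightarrow> real^4 \<Rightarrow> real^4 \<Rightarrow> bool" where
  "indep4 a b c d \<longleftrightarrow> (\<forall>p q r s. p *\<^sub>R a + q *\<^sub>R b + r *\<^sub>R c + s *\<^sub>R d = 0 \<longrightarrow> p = 0 \<and> q = 0 \<and> r = 0 \<and> s = 0)"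

lemma columns4: "transpose (vector [a, b, c, d] :: real^4^4) *v y =
    (y $ 1) *\<^sub>R a + (y $ 2) *\<^sub>R b + (y $ 3) *\<^sub>R c + (y $ 4) *\<^sub>R d"
proof -
  have "(transpose (vector [a, b, c, d] :: real^4^4) *v y) $ i =
    ((y $ 1) *\<^sub>R a + (y $ 2) *\<^sub>R b + (y $ 3) *\<^sub>R c + (y $ 4) *\<^sub>R d) $ i" for i
    unfolding matrix_vector_mult_def transpose_def sum_4 vec_lambda_beta
    unfolding vector_4 by simp
  then show ?thesis
    unfolding vec_eq_iff by blast
qed

lemma det_columns4: "indep4 a b c d \<Longrightarrow> det (transpose (vector [a, b, c, d] :: real^4^4)) \<noteq> 0"
proof -
  assume ind: "indep4 a b c d"
  have "y = 0" if "transpose (vector [a, b, c, d] :: real^4^4) *v y = 0" for y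
    using ind[unfolded indep4_def, rule_format, OF that[unfolded columns4]]
    unfolding vec_eq_iff forall_4 by simp
  then show ?thesis
    unfolding invertible_det_nz[symmetric] invertible_left_inverse matrix_left_invertible_ker by blast
qed

lemma indep4_if_det: "det (vector [a, b, c, d] :: real^4^4) \<noteq> 0 \<Longrightarrow> indep4 a b c d"
proof -
  assume det: "det (vector [a, b, c, d] :: real^4^4) \<noteq> 0"
  have inj: "y = 0" if "transpose (vector [a, b, c, d] :: real^4^4) *v y = 0" for y
  proof -
    have "det (transpose (vector [a, b, c, d] :: real^4^4)) \<noteq> 0"
      using det by (simp add: det_transpose)
    then show ?thesis
      using that unfolding invertible_det_nz[symmetric] invertible_left_inverse matrix_left_invertible_ker by blast
  qed
  show ?thesis
    unfolding indep4_def
  proof (intro allI impI)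
    fix p q r s
    assume "p *\<^sub>R a + q *\<^sub>R b + r *\<^sub>R c + s *\<^sub>R d = 0"
    then have "(vector [p, q, r, s] :: real^4) = 0"
      by - (rule inj, simp only: columns4 vector_4)
    from this[unfolded vec_eq_iff forall_4] show "p = 0 \<and> q = 0 \<and> r = 0 \<and> s = 0"
      by simp
  qed
qed

lemma indep4_span:
  assumes "indep4 a b c d"
  obtains p q r s where "w = p *\<^sub>R a + q *\<^sub>R b + r *\<^sub>R c + s *\<^sub>R d"
proof -
  obtain y where "transpose (vector [a, b, c, d] :: real^4^4) *v y = w"
    using cramer[OF det_columns4[OF assms]] by blast
  then show thesis
    using that unfolding columns4 by metis
qed

lemma smooth_on_coeffs4:
  assumes "open U" "smooth_on U a" "smooth_on U b" "smooth_on U c" "smooth_on U d" "smooth_on U w"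
    and ind: "\<And>x. x \<in> U \<Longrightarrow> indep4 (a x) (b x) (c x) (d x)"
    and w: "\<And>x. x \<in> U \<Longrightarrow> w x = p x *\<^sub>R a x + q x *\<^sub>R b x + r x *\<^sub>R c x + s x *\<^sub>R d x"
  shows "smooth_on U p \<and> smooth_on U q \<and> smooth_on U r \<and> smooth_on U s"
proof -
  have "smooth_on U (\<lambda>x. vector [p x, q x, r x, s x] :: real^4)"
  proof (rule smooth_on_solve[OF \<open>open U\<close>, where A = "\<lambda>x. transpose (vector [a x, b x, c x, d x])" and w = w])
    fix i j :: 4
    show "smooth_on U (\<lambda>x. transpose (vector [a x, b x, c x, d x]) $ i $ j)"
      using exhaust_4[of j] smooth_on_vec_nth[OF assms(1,2)] smooth_on_vec_nth[OF assms(1,3)]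
        smooth_on_vec_nth[OF assms(1,4)] smooth_on_vec_nth[OF assms(1,5)]
      by (auto simp: transpose_def)
  next
    show "det (transpose (vector [a x, b x, c x, d x] :: real^4^4)) \<noteq> 0" if "x \<in> U" for x
      by (rule det_columns4[OF ind[OF that]])
    show "transpose (vector [a x, b x, c x, d x]) *v (vector [p x, q x, r x, s x] :: real^4) = w x" if "x \<in> U" for x
      by (simp only: columns4 vector_4 w[OF that])
  qed (rule assms)+
  from smooth_on_vec_nth[OF \<open>open U\<close> this, of 1] smooth_on_vec_nth[OF \<open>open U\<close> this, of 2]
    smooth_on_vec_nth[OF \<open>open U\<close> this, of 3] smooth_on_vec_nth[OF \<open>open U\<close> this, of 4]
  show ?thesis by simp
qed

text \<open>Only the diagonal entries \<open>C i i\<close> contribute, because a determinant with two equal rows vanishes.\<close>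

lemma has_derivative_det:
  fixes M :: "'a::real_normed_vector \<Rightarrow> real^'n^'n"
  assumes "\<And>i. ((\<lambda>y. M y $ i) has_derivative M' i) (at x)"
    and "\<And>i. M' i v = (\<Sum>k\<in>UNIV. C i k *\<^sub>R M x $ k)"
    and "((\<lambda>y. det (M y)) has_derivative d) (at x)"
  shows "d v = (\<Sum>i\<in>UNIV. C i i) * det (M x)"
proof -
  let ?U = "UNIV :: 'n set"
  have "((\<lambda>y. M y $ i $ j) has_derivative (\<lambda>v. M' i v $ j)) (at x)" for i j
    by (rule bounded_linear.has_derivative[OF bounded_linear_vec_nth assms(1)])
  then have "((\<lambda>y. \<Sum>p | p permutes ?U. of_int (sign p) * (\<Prod>i\<in>?U. M y $ i $ p i)) has_derivative
     (\<lambda>v. \<Sum>p | p permutes ?U. of_int (sign p) * (\<Sum>i\<in>?U. M' i v $ p i * (\<Prod>j\<in>?U - {i}. M x $ j $ p j)))) (at x)"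
    by (intro has_derivative_sum has_derivative_mult_right has_derivative_prod)
  then have "d = (\<lambda>v. \<Sum>p | p permutes ?U. of_int (sign p) * (\<Sum>i\<in>?U. M' i v $ p i * (\<Prod>j\<in>?U - {i}. M x $ j $ p j)))"
    using assms(3) unfolding det_def by (rule has_derivative_unique[symmetric])
  then have "d v = (\<Sum>p | p permutes ?U. \<Sum>i\<in>?U. of_int (sign p) * (M' i v $ p i * (\<Prod>j\<in>?U - {i}. M x $ j $ p j)))"
    by (simp add: sum_distrib_left)
  also have "\<dots> = (\<Sum>i\<in>?U. \<Sum>p | p permutes ?U. of_int (sign p) * (M' i v $ p i * (\<Prod>j\<in>?U - {i}. M x $ j $ p j)))"
    by (rule sum.swap)
  also have "\<dots> = (\<Sum>i\<in>?U. det (\<chi> j. if j = i then M' i v else M x $ j))"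
    unfolding det_def
    by (intro sum.cong refl arg_cong2[of _ _ _ _ "(*)"], subst prod.remove[of _ i for i]) auto
  also have "\<dots> = (\<Sum>i\<in>?U. C i i * det (M x))"
  proof (rule sum.cong[OF refl])
    fix i
    have "det (\<chi> j. if j = i then M' i v else M x $ j) =
        det (\<chi> j. if j = i then (\<Sum>k\<in>?U. C i k *s M x $ k) else M x $ j)"
      unfolding assms(2) scalar_mult_eq_scaleR ..
    also have "\<dots> = (\<Sum>k\<in>?U. det (\<chi> j. if j = i then C i k *s M x $ k else M x $ j))"
      by (rule det_linear_row_sum) simp
    also have "\<dots> = (\<Sum>k\<in>?U. C i k * det (\<chi> j. if j = i then M x $ k else M x $ j))"
      by (rule sum.cong[OF refl]) (rule det_row_mul)
    also have "\<dots> = (\<Sum>k\<in>?U. if k = i then C i i * det (M x) else 0)"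
    proof (rule sum.cong[OF refl])
      fix k
      show "C i k * det (\<chi> j. if j = i then M x $ k else M x $ j) = (if k = i then C i i * det (M x) else 0)"
      proof (cases "k = i")
        case True
        then have "(\<chi> j. if j = i then M x $ k else M x $ j) = M x"
          by (simp add: vec_eq_iff)
        then show ?thesis
          using True by simp
      next
        case False
        then have "det (\<chi> j. if j = i then M x $ k else M x $ j) = 0"
          by (intro det_identical_rows[of i k]) (auto simp: row_def vec_eq_iff)
        then show ?thesis
          using False by simp
      qed
    qed
    finally show "det (\<chi> j. if j = i then M' i v else M x $ j) = C i i * det (M x)"
      by simp
  qed
  finally show ?thesis
    by (simp add: sum_distrib_right)
qed

text \<open>Indexed by the type \<open>3\<close>, so that sums over \<open>UNIV\<close> are
  available, and with diagonal values exactly \<open>1\<close>; for a positive definite form this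
  agrees with \<open>orthonormal\<close>, which only fixes absolute values.\<close>

definition onb :: "('a \<Rightarrow> 'a \<Rightarrow> real) \<Rightarrow> (3 \<Rightarrow> 'a) \<Rightarrow> bool" where
  "onb g u \<longleftrightarrow> (\<forall>i j. g (u i) (u j) = (if i = j then 1 else 0))"

text \<open>The map \<open>L\<close> from coefficients to vectors is injective, since pairing with
  the basis recovers the coefficients; by dimension it is surjective.\<close>

lemma onb_expand:
  fixes g :: "real^3 \<Rightarrow> real^3 \<Rightarrow> real"
  assumes "bilinear g" "onb g u"
  shows "w = (\<Sum>k\<in>UNIV. g w (u k) *\<^sub>R u k)"
proof -
  define L where "L c = (\<Sum>k\<in>UNIV. (c $ k) *\<^sub>R u k)" for c :: "real^3"
  have lin: "linear L"
    by (intro linearI) (simp_all add: L_def sum.distrib scaleR_add_left scaleR_sum_right)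
  have gl: "g (L c) (u j) = c $ j" for c j
  proof -
    have lg: "linear (\<lambda>v. g v (u j))"
      using assms(1) by (simp add: bilinear_def)
    have "g (L c) (u j) = (\<Sum>k\<in>UNIV. c $ k * g (u k) (u j))"
      using linear_sum[OF lg, of "\<lambda>k. (c $ k) *\<^sub>R u k" UNIV] linear_scale[OF lg] by (simp add: L_def)
    also have "\<dots> = (\<Sum>k\<in>UNIV. if k = j then c $ k else 0)"
      using assms(2) by (intro sum.cong) (auto simp: onb_def)
    finally show ?thesis
      by simp
  qed
  have "inj L"
    unfolding linear_injective_0[OF lin]
    using gl bilinear_lzero[OF assms(1)] by (metis vec_eq_iff zero_index)
  then obtain c where "L c = w"
    using linear_injective_imp_surjective[OF lin] by (metis surj_def)
  then show ?thesis
    using gl[of c] by (simp add: L_def)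
qed

section \<open>Geometry of a hypersurface\<close>

locale hypersurface =
  fixes \<Omega> :: "(real^3) set" and \<Phi> \<xi> :: "real^3 \<Rightarrow> real^4"
  assumes blaschke: "blaschke_hypersurface \<Omega> \<Phi> \<xi>"
    and pos: "\<And>x v. x \<in> \<Omega> \<Longrightarrow> v \<noteq> 0 \<Longrightarrow> aff_metric \<Phi> \<xi> x v v > 0"
begin

abbreviation h where "h \<equiv> aff_metric \<Phi> \<xi>"
abbreviation \<Gamma> where "\<Gamma> x v w \<equiv> ind_conn \<Phi> \<xi> (\<lambda>_. v) (\<lambda>_. w) x"
abbreviation S where "S \<equiv> shape_op \<Phi> \<xi>"
abbreviation K where "K \<equiv> diff_tensor \<Phi> \<xi>"

lemma opn: "open \<Omega>" and smooth_\<Phi>: "smooth_on \<Omega> \<Phi>" and smooth_\<xi>: "smooth_on \<Omega> \<xi>"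
  and inj: "x \<in> \<Omega> \<Longrightarrow> inj (D \<Phi> x)" and transv: "x \<in> \<Omega> \<Longrightarrow> \<xi> x \<notin> range (D \<Phi> x)"
  and tang: "x \<in> \<Omega> \<Longrightarrow> range (D \<xi> x) \<subseteq> range (D \<Phi> x)"
  and vol: "x \<in> \<Omega> \<Longrightarrow> length Xs = 3 \<Longrightarrow> orthonormal (h x) Xs \<Longrightarrow>
    \<bar>det (vector (map (D \<Phi> x) Xs @ [\<xi> x]) :: real^4^4)\<bar> = 1"
  using blaschke unfolding blaschke_hypersurface_def by auto

lemma lin: "x \<in> \<Omega> \<Longrightarrow> linear (D \<Phi> x)"
  by (rule linear_D[OF smooth_\<Phi>])

section \<open>Tangential and transversal components\<close>

lemma decomp_unique:
  assumes "x \<in> \<Omega>" "D \<Phi> x Z + c *\<^sub>R \<xi> x = D \<Phi> x Z' + c' *\<^sub>R \<xi> x"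
  shows "Z = Z'" "c = c'"
proof -
  note l = linear_diff[OF lin[OF assms(1)]] linear_scale[OF lin[OF assms(1)]]
  have e: "D \<Phi> x (Z - Z') = (c' - c) *\<^sub>R \<xi> x"
    using assms(2) by (simp add: l algebra_simps)
  show "c = c'"
  proof (rule ccontr)
    assume "c \<noteq> c'"
    then have "\<xi> x = D \<Phi> x ((1 / (c' - c)) *\<^sub>R (Z - Z'))"
      unfolding l(2) e by simp
    then show False
      using transv[OF assms(1)] by blast
  qed
  with e have "D \<Phi> x Z = D \<Phi> x Z'"
    by (simp add: l)
  then show "Z = Z'"
    using inj[OF assms(1)] by (simp add: inj_def)
qed

lemma indep_axis:
  assumes "x \<in> \<Omega>"
  shows "indep4 (D \<Phi> x (axis 1 1)) (D \<Phi> x (axis 2 1)) (D \<Phi> x (axis 3 1)) (\<xi> x)"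
  unfolding indep4_def
proof (intro allI impI)
  fix p q r s
  assume "p *\<^sub>R D \<Phi> x (axis 1 1) + q *\<^sub>R D \<Phi> x (axis 2 1) + r *\<^sub>R D \<Phi> x (axis 3 1) + s *\<^sub>R \<xi> x = 0"
  then have "D \<Phi> x (p *\<^sub>R axis 1 1 + q *\<^sub>R axis 2 1 + r *\<^sub>R axis 3 1) + s *\<^sub>R \<xi> x = D \<Phi> x 0 + 0 *\<^sub>R \<xi> x"
    by (simp add: linear_add[OF lin[OF assms]] linear_scale[OF lin[OF assms]] linear_0[OF lin[OF assms]])
  from decomp_unique[OF assms this]
  have "p *\<^sub>R axis 1 1 + q *\<^sub>R axis 2 1 + r *\<^sub>R axis 3 1 = (0 :: real^3)" "s = 0"
    by auto
  then show "p = 0 \<and> q = 0 \<and> r = 0 \<and> s = 0"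
    unfolding vec_eq_iff forall_3 by (simp add: axis_def)
qed

lemma axis_expand3: "(Z :: real^3) = (Z $ 1) *\<^sub>R axis 1 1 + (Z $ 2) *\<^sub>R axis 2 1 + (Z $ 3) *\<^sub>R axis 3 1"
  unfolding vec_eq_iff forall_3 by (simp add: axis_def)

lemma D\<Phi>_axis:
  assumes "x \<in> \<Omega>"
  shows "D \<Phi> x Z = (Z $ 1) *\<^sub>R D \<Phi> x (axis 1 1) + (Z $ 2) *\<^sub>R D \<Phi> x (axis 2 1) + (Z $ 3) *\<^sub>R D \<Phi> x (axis 3 1)"
  by (subst axis_expand3[of Z]) (simp add: linear_add[OF lin[OF assms]] linear_scale[OF lin[OF assms]])

lemma decomp_exists:
  assumes "x \<in> \<Omega>"
  obtains Z c where "y = D \<Phi> x Z + c *\<^sub>R \<xi> x"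
proof -
  obtain p q r s where "y = p *\<^sub>R D \<Phi> x (axis 1 1) + q *\<^sub>R D \<Phi> x (axis 2 1) + r *\<^sub>R D \<Phi> x (axis 3 1) + s *\<^sub>R \<xi> x"
    using indep4_span[OF indep_axis[OF assms]] by metis
  then have "y = D \<Phi> x (vector [p, q, r]) + s *\<^sub>R \<xi> x"
    using D\<Phi>_axis[OF assms, of "vector [p, q, r]"] by simp
  then show thesis
    by (rule that)
qed

text \<open>Both components solve a linear system whose columns are the images of the coordinate
  vectors and \<open>\<xi>\<close>, so Cramer's rule applies. The smoothness of the connection, the
  metric and the shape operator all rests on this.\<close>

lemma smooth_decomp:
  assumes "open V" "V \<subseteq> \<Omega>" "smooth_on V y" "\<And>x. x \<in> V \<Longrightarrow> y x = D \<Phi> x (Z x) + c x *\<^sub>R \<xi> x"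
  shows "smooth_on V Z" "smooth_on V c"
proof -
  have *: "smooth_on V (\<lambda>x. Z x $ 1) \<and> smooth_on V (\<lambda>x. Z x $ 2) \<and> smooth_on V (\<lambda>x. Z x $ 3) \<and> smooth_on V c"
  proof (rule smooth_on_coeffs4[OF assms(1) _ _ _ _ assms(3)])
    show "indep4 (D \<Phi> x (axis 1 1)) (D \<Phi> x (axis 2 1)) (D \<Phi> x (axis 3 1)) (\<xi> x)" if "x \<in> V" for x
      using indep_axis assms(2) that by blast
    show "y x = (Z x $ 1) *\<^sub>R D \<Phi> x (axis 1 1) + (Z x $ 2) *\<^sub>R D \<Phi> x (axis 2 1) + (Z x $ 3) *\<^sub>R D \<Phi> x (axis 3 1) + c x *\<^sub>R \<xi> x"
      if "x \<in> V" for x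
      using assms(4)[OF that] D\<Phi>_axis[of x "Z x"] assms(2) that by auto
  qed (use smooth_on_subset[OF smooth_on_D[OF smooth_\<Phi>] assms(2)] smooth_on_subset[OF smooth_\<xi> assms(2)] in auto)
  then show "smooth_on V c"
    by blast
  show "smooth_on V Z"
  proof (rule smooth_on_vec[OF assms(1)])
    show "smooth_on V (\<lambda>x. Z x $ i)" for i
      using * exhaust_3[of i] by auto
  qed
qed

text \<open>Evaluates the definite descriptions behind \<open>\<Gamma>\<close> and \<open>h\<close>:
  the decomposition exists because the hypersurface is immersed with transversal
  \<open>\<xi>\<close>, and it is unique.\<close>

lemma push_const:
  assumes "x \<in> \<Omega>"
  shows "D (\<lambda>y. D \<Phi> y w) x v = D \<Phi> x (\<Gamma> x v w) + h x v w *\<^sub>R \<xi> x"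
proof -
  obtain Z c where Zc: "D (\<lambda>y. D \<Phi> y w) x v = D \<Phi> x Z + c *\<^sub>R \<xi> x"
    using decomp_exists[OF assms] by metis
  have "\<Gamma> x v w = Z"
    unfolding ind_conn_def d_push_def Zc using decomp_unique[OF assms]
    by (intro the_equality) (metis, metis)
  moreover have "h x v w = c"
    unfolding aff_metric_def d_push_def Zc using decomp_unique[OF assms]
    by (intro the_equality) (metis, metis)
  ultimately show ?thesis
    using Zc by simp
qed

lemma smooth_\<Gamma>: "smooth_on \<Omega> (\<lambda>x. \<Gamma> x v w)" and smooth_h_const: "smooth_on \<Omega> (\<lambda>x. h x v w)"
  using smooth_decomp[OF opn _ smooth_on_D[OF smooth_on_D[OF smooth_\<Phi>]] push_const] by auto

lemma \<Gamma>_h_sym: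
  assumes "x \<in> \<Omega>"
  shows "\<Gamma> x v w = \<Gamma> x w v" "h x v w = h x w v"
  using DD_symmetric[OF opn smooth_\<Phi> assms, of v w] decomp_unique[OF assms]
  unfolding push_const[OF assms] by metis+

lemma \<Gamma>_h_linear:
  assumes "x \<in> \<Omega>"
  shows "linear (\<Gamma> x v)" "linear (h x v)"
proof -
  note l = linear_add[OF lin[OF assms], symmetric] linear_scale[OF lin[OF assms], symmetric]
  note d = linear_add[OF linear_DD[OF opn smooth_\<Phi> assms, of v], unfolded push_const[OF assms]]
    linear_scale[OF linear_DD[OF opn smooth_\<Phi> assms, of v], unfolded push_const[OF assms]]
  have "\<Gamma> x v (w + w') = \<Gamma> x v w + \<Gamma> x v w' \<and> h x v (w + w') = h x v w + h x v w'" for w w'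
  proof -
    have "D \<Phi> x (\<Gamma> x v (w + w')) + h x v (w + w') *\<^sub>R \<xi> x =
      D \<Phi> x (\<Gamma> x v w + \<Gamma> x v w') + (h x v w + h x v w') *\<^sub>R \<xi> x"
      unfolding d by (simp add: linear_add[OF lin[OF assms]] algebra_simps)
    from decomp_unique[OF assms this] show ?thesis by blast
  qed
  moreover have "\<Gamma> x v (c *\<^sub>R w) = c *\<^sub>R \<Gamma> x v w \<and> h x v (c *\<^sub>R w) = c *\<^sub>R h x v w" for c w
  proof -
    have "D \<Phi> x (\<Gamma> x v (c *\<^sub>R w)) + h x v (c *\<^sub>R w) *\<^sub>R \<xi> x =
      D \<Phi> x (c *\<^sub>R \<Gamma> x v w) + (c *\<^sub>R h x v w) *\<^sub>R \<xi> x"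
      unfolding d by (simp add: linear_scale[OF lin[OF assms]] algebra_simps)
    from decomp_unique[OF assms this] show ?thesis by blast
  qed
  ultimately show "linear (\<Gamma> x v)" "linear (h x v)"
    by (auto intro: linearI)
qed

lemma bilin_\<Gamma>: "x \<in> \<Omega> \<Longrightarrow> bilinear (\<lambda>v w. \<Gamma> x v w)" and bilin_h: "x \<in> \<Omega> \<Longrightarrow> bilinear (h x)"
  using \<Gamma>_h_linear \<Gamma>_h_sym unfolding bilinear_def by (metis (no_types, lifting) ext)+

lemma push_field:
  assumes "open V" "V \<subseteq> \<Omega>" "smooth_on V Y" "x \<in> V"
  shows "D (\<lambda>y. D \<Phi> y (Y y)) x v = D \<Phi> x (D Y x v + \<Gamma> x v (Y x)) + h x v (Y x) *\<^sub>R \<xi> x"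
proof -
  have x: "x \<in> \<Omega>"
    using assms by blast
  have "smooth_on V \<Phi>"
    by (rule smooth_on_subset[OF smooth_\<Phi> assms(2)])
  from D_D_field[OF assms(1) this assms(3,4)] show ?thesis
    by (simp add: push_const[OF x] linear_add[OF lin[OF x]])
qed

lemma shape:
  assumes "x \<in> \<Omega>"
  shows "D \<xi> x v = - D \<Phi> x (S x v)"
proof -
  obtain w where "D \<xi> x v = D \<Phi> x w"
    using tang[OF assms] by blast
  then have w: "D \<xi> x v = - D \<Phi> x (- w)"
    by (simp add: linear_neg[OF lin[OF assms]])
  have "S x v = - w"
    unfolding shape_op_def w using inj[OF assms] by (intro the_equality) (auto simp: inj_def)
  then show ?thesis
    using w by simp
qed

lemma smooth_S: "smooth_on \<Omega> (\<lambda>x. S x v)"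
proof -
  have "D \<xi> x v = D \<Phi> x (- S x v) + 0 *\<^sub>R \<xi> x" if "x \<in> \<Omega>" for x
    using shape[OF that] by (simp add: linear_neg[OF lin[OF that]])
  from smooth_decomp(1)[OF opn _ smooth_on_D[OF smooth_\<xi>] this]
  have "smooth_on \<Omega> (\<lambda>x. - S x v)"
    by simp
  from smooth_on_minus[OF opn this] show ?thesis
    by simp
qed

lemma linear_S:
  assumes "x \<in> \<Omega>"
  shows "linear (S x)"
proof -
  note l = linear_D[OF smooth_\<xi> assms]
  have i: "D \<Phi> x a = D \<Phi> x b \<Longrightarrow> a = b" for a b
    using inj[OF assms] by (simp add: inj_def)
  have s: "D \<Phi> x (S x v) = - D \<xi> x v" for v
    by (simp add: shape[OF assms])
  show ?thesis
  proof
    fix v w :: "real^3" and c :: real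
    show "S x (v + w) = S x v + S x w"
      by (intro i) (simp add: linear_add[OF lin[OF assms]] s linear_add[OF l])
    show "S x (c *\<^sub>R v) = c *\<^sub>R S x v"
      by (intro i) (simp add: linear_scale[OF lin[OF assms]] s linear_scale[OF l])
  qed
qed

text \<open>Comparing the \<open>\<xi>\<close>-components of the symmetric second derivative of \<open>\<xi>\<close>.\<close>

lemma S_self_adjoint:
  assumes "x \<in> \<Omega>"
  shows "h x v (S x w) = h x w (S x v)"
proof -
  have *: "D (\<lambda>y. D \<xi> y w) x v = D \<Phi> x (- (D (\<lambda>y. S y w) x v + \<Gamma> x v (S x w))) + (- h x v (S x w)) *\<^sub>R \<xi> x" for v w
  proof -
    have "D (\<lambda>y. D \<xi> y w) x v = D (\<lambda>y. - D \<Phi> y (S y w)) x v"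
      by (rule D_cong_open[OF opn assms, THEN fun_cong]) (rule shape)
    also have "\<dots> = - D (\<lambda>y. D \<Phi> y (S y w)) x v"
      by (rule D_minus[OF smooth_on_D_field[OF opn smooth_\<Phi> smooth_S] assms])
    finally show ?thesis
      by (simp add: push_field[OF opn _ smooth_S assms] linear_neg[OF lin[OF assms]] del: minus_add_distrib)
  qed
  show ?thesis
    using decomp_unique(2)[OF assms DD_symmetric[OF opn smooth_\<xi> assms, of v w, unfolded *]] by simp
qed

abbreviation Dh where "Dh x u v w \<equiv> D (\<lambda>y. h y v w) x u"

text \<open>Third derivatives of \<open>\<Phi>\<close>; their symmetry in \<open>u\<close> and
  \<open>v\<close>, read off in the \<open>\<xi>\<close> component, is the Codazzi equation for
  \<open>h\<close>.\<close>

lemma D_push: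
  assumes "x \<in> \<Omega>"
  shows "D (\<lambda>y. D (\<lambda>z. D \<Phi> z w) y v) x u =
    D \<Phi> x (D (\<lambda>y. \<Gamma> y v w) x u + \<Gamma> x u (\<Gamma> x v w) - h x v w *\<^sub>R S x u) + (h x u (\<Gamma> x v w) + Dh x u v w) *\<^sub>R \<xi> x"
proof -
  have "D (\<lambda>y. D (\<lambda>z. D \<Phi> z w) y v) x u = D (\<lambda>y. D \<Phi> y (\<Gamma> y v w) + h y v w *\<^sub>R \<xi> y) x u"
    by (rule D_cong_open[OF opn assms, THEN fun_cong]) (rule push_const)
  also have "\<dots> = D (\<lambda>y. D \<Phi> y (\<Gamma> y v w)) x u + D (\<lambda>y. h y v w *\<^sub>R \<xi> y) x u"
    by (rule D_add[OF smooth_on_D_field[OF opn smooth_\<Phi> smooth_\<Gamma>] smooth_on_scaleR[OF opn smooth_h_const smooth_\<xi>] assms])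
  also have "D (\<lambda>y. h y v w *\<^sub>R \<xi> y) x u = h x v w *\<^sub>R D \<xi> x u + Dh x u v w *\<^sub>R \<xi> x"
    by (rule D_scaleR[OF smooth_h_const smooth_\<xi> assms])
  finally show ?thesis
    by (simp add: push_field[OF opn _ smooth_\<Gamma> assms] shape[OF assms] linear_diff[OF lin[OF assms]]
        linear_scale[OF lin[OF assms]] algebra_simps)
qed

text \<open>The cubic form of affine differential geometry, the covariant derivative of
  \<open>h\<close> with respect to the induced connection. \<open>K\<close> turns out to be
  \<open>- 1 / 2\<close> times it with one index raised.\<close>

definition nabla_h where "nabla_h x u v w = Dh x u v w - h x (\<Gamma> x u v) w - h x v (\<Gamma> x u w)"

lemma nabla_h_sym:
  assumes "x \<in> \<Omega>"
  shows "nabla_h x u v w = nabla_h x v u w" "nabla_h x u v w = nabla_h x u w v"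
proof -
  have "h x u (\<Gamma> x v w) + Dh x u v w = h x v (\<Gamma> x u w) + Dh x v u w"
    using DD_symmetric[OF opn smooth_on_D[OF smooth_\<Phi>, of w] assms, of v u] decomp_unique(2)[OF assms]
    unfolding D_push[OF assms] by blast
  then show "nabla_h x u v w = nabla_h x v u w"
    using \<Gamma>_h_sym(1)[OF assms, of u v] by (simp add: nabla_h_def)
  have "Dh x u v w = Dh x u w v"
    by (rule D_cong_open[OF opn assms, THEN fun_cong]) (rule \<Gamma>_h_sym)
  then show "nabla_h x u v w = nabla_h x u w v"
    using \<Gamma>_h_sym(2)[OF assms] by (simp add: nabla_h_def)
qed

end

context hypersurface
begin

section \<open>Calculus of the metric and smooth orthonormal fields\<close>

lemma h_add [simp]: "x \<in> \<Omega> \<Longrightarrow> h x (u + v) w = h x u w + h x v w" "x \<in> \<Omega> \<Longrightarrow> h x w (u + v) = h x w u + h x w v"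
  and h_scale [simp]: "x \<in> \<Omega> \<Longrightarrow> h x (c *\<^sub>R u) w = c * h x u w" "x \<in> \<Omega> \<Longrightarrow> h x w (c *\<^sub>R u) = c * h x w u"
  and h_diff [simp]: "x \<in> \<Omega> \<Longrightarrow> h x (u - v) w = h x u w - h x v w" "x \<in> \<Omega> \<Longrightarrow> h x w (u - v) = h x w u - h x w v"
  and h_minus [simp]: "x \<in> \<Omega> \<Longrightarrow> h x (- u) w = - h x u w" "x \<in> \<Omega> \<Longrightarrow> h x w (- u) = - h x w u"
  and h_zero [simp]: "x \<in> \<Omega> \<Longrightarrow> h x 0 w = 0" "x \<in> \<Omega> \<Longrightarrow> h x w 0 = 0"
  by (simp_all add: bilinear_ladd[OF bilin_h] bilinear_radd[OF bilin_h] bilinear_lmul[OF bilin_h] bilinear_rmul[OF bilin_h]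
      bilinear_lsub[OF bilin_h] bilinear_rsub[OF bilin_h] bilinear_lneg[OF bilin_h] bilinear_rneg[OF bilin_h]
      bilinear_lzero[OF bilin_h] bilinear_rzero[OF bilin_h])

lemma h_sum [simp]:
  assumes "x \<in> \<Omega>"
  shows "h x (\<Sum>i\<in>I. f i) w = (\<Sum>i\<in>I. h x (f i) w)" "h x w (\<Sum>i\<in>I. f i) = (\<Sum>i\<in>I. h x w (f i))"
  using linear_sum[OF \<Gamma>_h_linear(2)[OF assms], of w f I] \<Gamma>_h_sym(2)[OF assms] by simp_all

lemma h_eqI: "x \<in> \<Omega> \<Longrightarrow> (\<And>w. h x u w = h x v w) \<Longrightarrow> u = v"
  using pos[of x "u - v"] by (metis diff_numeral_special(9) h_diff(1) less_irrefl right_minus_eq)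

lemma bilinear_axis:
  fixes B :: "real^'n \<Rightarrow> real^'m \<Rightarrow> real"
  assumes "bilinear B"
  shows "B v w = (\<Sum>i\<in>UNIV. \<Sum>j\<in>UNIV. (v $ i * w $ j) * B (axis i 1) (axis j 1))"
proof -
  have l: "linear (\<lambda>u. B u w)" for w
    using assms by (simp add: bilinear_def)
  have r: "linear (B u)" for u
    using assms by (simp add: bilinear_def)
  have "B v w = (\<Sum>i\<in>UNIV. v $ i * B (axis i 1) w)"
    by (subst vec_eq_sum_axis[of v]) (simp add: linear_sum[OF l] linear_scale[OF l])
  also have "\<dots> = (\<Sum>i\<in>UNIV. v $ i * (\<Sum>j\<in>UNIV. w $ j * B (axis i 1) (axis j 1)))"
    by (subst vec_eq_sum_axis[of w]) (simp add: linear_sum[OF r] linear_scale[OF r])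
  finally show ?thesis
    by (simp add: sum_distrib_left mult.assoc)
qed

lemma Dh_bilinear:
  assumes "x \<in> \<Omega>"
  shows "bilinear (Dh x u)"
proof -
  have l: "linear (Dh x u v)" for v
  proof
    fix a b :: "real^3" and c :: real
    have "Dh x u v (a + b) = D (\<lambda>y. h y v a + h y v b) x u"
      by (rule D_cong_open[OF opn assms, THEN fun_cong]) simp
    then show "Dh x u v (a + b) = Dh x u v a + Dh x u v b"
      using D_add[OF smooth_h_const smooth_h_const assms] by metis
    have "Dh x u v (c *\<^sub>R a) = D (\<lambda>y. c * h y v a) x u"
      by (rule D_cong_open[OF opn assms, THEN fun_cong]) simp
    also have "\<dots> = c * Dh x u v a"
      using D_mult[OF smooth_on_const smooth_h_const assms, of c v a u] by simp
    finally show "Dh x u v (c *\<^sub>R a) = c *\<^sub>R Dh x u v a"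
      by simp
  qed
  moreover have "Dh x u v w = Dh x u w v" for v w
    by (rule D_cong_open[OF opn assms, THEN fun_cong]) (rule \<Gamma>_h_sym)
  ultimately show ?thesis
    unfolding bilinear_def by (metis (no_types, lifting) ext)
qed

lemma smooth_h:
  assumes "open V" "V \<subseteq> \<Omega>" "smooth_on V X" "smooth_on V Y"
  shows "smooth_on V (\<lambda>y. h y (X y) (Y y))"
proof -
  have "smooth_on V (\<lambda>y. \<Sum>i\<in>UNIV. \<Sum>j\<in>UNIV. (X y $ i * Y y $ j) * h y (axis i 1) (axis j 1))"
    by (intro smooth_rules assms smooth_on_subset[OF smooth_h_const assms(2)])
  then show ?thesis
    by (rule smooth_on_cong[OF assms(1), rotated]) (rule bilinear_axis[OF bilin_h, symmetric], use assms(2) in blast)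
qed

lemma D_h_field:
  assumes "open V" "V \<subseteq> \<Omega>" "smooth_on V X" "smooth_on V Y" "x \<in> V"
  shows "D (\<lambda>y. h y (X y) (Y y)) x v = Dh x v (X x) (Y x) + h x (D X x v) (Y x) + h x (X x) (D Y x v)"
proof -
  have x: "x \<in> \<Omega>"
    using assms by blast
  note sX = smooth_on_vec_nth[OF assms(1,3)] and sY = smooth_on_vec_nth[OF assms(1,4)]
  note sh = smooth_on_subset[OF smooth_h_const assms(2)]
  have "D (\<lambda>y. h y (X y) (Y y)) x v =
      D (\<lambda>y. \<Sum>i\<in>UNIV. \<Sum>j\<in>UNIV. (X y $ i * Y y $ j) * h y (axis i 1) (axis j 1)) x v"
    by (rule D_cong_open[OF assms(1,5), THEN fun_cong], rule bilinear_axis[OF bilin_h]) (use assms(2) in blast)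
  also have "\<dots> = (\<Sum>i\<in>UNIV. \<Sum>j\<in>UNIV. D (\<lambda>y. (X y $ i * Y y $ j) * h y (axis i 1) (axis j 1)) x v)"
    by (subst D_sum[OF _ assms(5)], intro smooth_rules assms(1) sX sY sh)
       (intro sum.cong refl D_sum[OF _ assms(5)] smooth_rules assms(1) sX sY sh)
  also have "\<dots> = (\<Sum>i\<in>UNIV. \<Sum>j\<in>UNIV. (X x $ i * Y x $ j) * Dh x v (axis i 1) (axis j 1)
      + ((D X x v $ i * Y x $ j) * h x (axis i 1) (axis j 1) + (X x $ i * D Y x v $ j) * h x (axis i 1) (axis j 1)))"
    unfolding D_mult[OF smooth_on_mult[OF assms(1) sX sY] sh assms(5)] D_mult[OF sX sY assms(5)]
      D_vec_nth[OF assms(3,5)] D_vec_nth[OF assms(4,5)]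
    by (intro sum.cong refl) (simp add: algebra_simps)
  finally show ?thesis
    unfolding sum.distrib bilinear_axis[OF Dh_bilinear[OF x], symmetric] bilinear_axis[OF bilin_h[OF x], symmetric]
    by simp
qed

text \<open>Besides orthonormality, two features matter later: the first field is only rescaled, so
  a chosen axis survives, and at a point where the given vectors are already orthonormal nothing
  changes, so the frame can be prescribed there.\<close>

lemma gram_schmidt:
  assumes "open V" "V \<subseteq> \<Omega>" "smooth_on V v1" "smooth_on V v2" "smooth_on V v3"
    and ind: "\<And>x p q r. x \<in> V \<Longrightarrow> p *\<^sub>R v1 x + q *\<^sub>R v2 x + r *\<^sub>R v3 x = 0 \<Longrightarrow> p = 0 \<and> q = 0 \<and> r = 0"
  obtains e :: "3 \<Rightarrow> real^3 \<Rightarrow> real^3" where "\<And>i. smooth_on V (e i)" "\<And>x. x \<in> V \<Longrightarrow> onb (h x) (\<lambda>i. e i x)"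
    "\<And>x. x \<in> V \<Longrightarrow> e 1 x = (1 / sqrt (h x (v1 x) (v1 x))) *\<^sub>R v1 x"
    "\<And>x. x \<in> V \<Longrightarrow> orthonormal (h x) [v1 x, v2 x, v3 x] \<Longrightarrow> e 1 x = v1 x \<and> e 2 x = v2 x \<and> e 3 x = v3 x"
proof -
  define n where "n w x = (1 / sqrt (h x (w x) (w x))) *\<^sub>R w x" for w and x :: "real^3"
  define u1 where "u1 = n v1"
  define w2 where "w2 x = v2 x - h x (v2 x) (u1 x) *\<^sub>R u1 x" for x
  define u2 where "u2 = n w2"
  define w3 where "w3 x = v3 x - h x (v3 x) (u1 x) *\<^sub>R u1 x - h x (v3 x) (u2 x) *\<^sub>R u2 x" for x
  define u3 where "u3 = n w3"
  have n1: "h x (n w x) (n w x) = 1" if "x \<in> V" "w x \<noteq> 0" for w x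
    using pos[of x "w x"] that assms(2) by (auto simp: n_def)
  have nz: "w x \<noteq> 0" if "n w x = 0 \<Longrightarrow> w x = 0" "n w x \<noteq> 0" for w x
    using that by (auto simp: n_def)
  have sn: "smooth_on V (n w)" if "smooth_on V w" "\<And>x. x \<in> V \<Longrightarrow> w x \<noteq> 0" for w
  proof -
    have hp: "h x (w x) (w x) > 0" if "x \<in> V" for x
      using pos[of x "w x"] that \<open>\<And>x. x \<in> V \<Longrightarrow> w x \<noteq> 0\<close> assms(2) by blast
    then have "sqrt (h x (w x) (w x)) \<noteq> 0" if "x \<in> V" for x
      using that by (metis less_irrefl real_sqrt_eq_zero_cancel_iff)
    then show ?thesis
      unfolding n_def[abs_def] by (intro smooth_rules smooth_h assms(1,2) that(1) hp)
  qed
  have v1: "v1 x \<noteq> 0" if "x \<in> V" for x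
    using ind[OF that, of 1 0 0] by auto
  have s1: "smooth_on V u1"
    unfolding u1_def by (intro sn assms v1)
  have w2: "w2 x \<noteq> 0" if "x \<in> V" for x
    using ind[OF that, of "- h x (v2 x) (u1 x) * (1 / sqrt (h x (v1 x) (v1 x)))" 1 0]
    by (auto simp: w2_def u1_def n_def)
  have s2': "smooth_on V w2"
    unfolding w2_def[abs_def] by (intro smooth_rules smooth_h assms(1,2,4) s1)
  then have s2: "smooth_on V u2"
    unfolding u2_def by (intro sn w2)
  have w3: "w3 x \<noteq> 0" if "x \<in> V" for x
  proof
    assume "w3 x = 0"
    \<comment> \<open>Written in terms of \<open>v1\<close>, \<open>v2\<close> and
      \<open>v3\<close>, the vector \<open>w3\<close> has coefficient \<open>1\<close> at
      \<open>v3\<close>, so it cannot vanish.\<close>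
    define c where "c = h x (v3 x) (u2 x) * (1 / sqrt (h x (w2 x) (w2 x)))"
    define d where "d = 1 / sqrt (h x (v1 x) (v1 x))"
    have "w3 x = v3 x - (h x (v3 x) (u1 x) * d) *\<^sub>R v1 x - c *\<^sub>R (v2 x - (h x (v2 x) (u1 x) * d) *\<^sub>R v1 x)"
      by (simp add: w3_def u2_def n_def c_def w2_def u1_def d_def)
    with \<open>w3 x = 0\<close> have "(- (h x (v3 x) (u1 x) * d) + c * (h x (v2 x) (u1 x) * d)) *\<^sub>R v1 x + (- c) *\<^sub>R v2 x + 1 *\<^sub>R v3 x = 0"
      by (simp add: algebra_simps)
    from ind[OF that this] show False by simp
  qed
  have "smooth_on V w3"
    unfolding w3_def[abs_def] by (intro smooth_rules smooth_h assms(1,2,5) s1 s2)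
  then have s3: "smooth_on V u3"
    unfolding u3_def by (intro sn w3)
  have o: "h x (u1 x) (u1 x) = 1" "h x (u2 x) (u2 x) = 1" "h x (u3 x) (u3 x) = 1"
    "h x (u2 x) (u1 x) = 0" "h x (u3 x) (u1 x) = 0" "h x (u3 x) (u2 x) = 0" if x: "x \<in> V" for x
  proof -
    have x': "x \<in> \<Omega>"
      using x assms(2) by blast
    show 1: "h x (u1 x) (u1 x) = 1" "h x (u2 x) (u2 x) = 1" "h x (u3 x) (u3 x) = 1"
      using x v1 w2 w3 by (auto simp: u1_def u2_def u3_def n1)
    show 2: "h x (u2 x) (u1 x) = 0"
      using 1(1) x' by (simp add: u2_def n_def w2_def)
    show "h x (u3 x) (u1 x) = 0" "h x (u3 x) (u2 x) = 0"
      using 1 2 x' \<Gamma>_h_sym(2)[OF x', of "u1 x" "u2 x"] by (simp_all add: u3_def n_def[of w3] w3_def)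
  qed
  define e where "e i = (if i = 1 then u1 else if i = 2 then u2 else u3)" for i :: 3
  have e: "e 1 = u1" "e 2 = u2" "e 3 = u3"
    by (simp_all add: e_def)
  show thesis
  proof
    show "smooth_on V (e i)" for i
      using s1 s2 s3 by (simp add: e_def)
    show "onb (h x) (\<lambda>i. e i x)" if "x \<in> V" for x
    proof -
      have "x \<in> \<Omega>"
        using that assms(2) by blast
      then show ?thesis
        using o[OF that] \<Gamma>_h_sym(2)[OF \<open>x \<in> \<Omega>\<close>, of "u1 x" "u2 x"] \<Gamma>_h_sym(2)[OF \<open>x \<in> \<Omega>\<close>, of "u1 x" "u3 x"]
          \<Gamma>_h_sym(2)[OF \<open>x \<in> \<Omega>\<close>, of "u2 x" "u3 x"]
        unfolding onb_def forall_3 e by simp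
    qed
    show "e 1 x = (1 / sqrt (h x (v1 x) (v1 x))) *\<^sub>R v1 x" for x
      by (simp add: e u1_def n_def)
    show "e 1 x = v1 x \<and> e 2 x = v2 x \<and> e 3 x = v3 x" if x: "x \<in> V" and on: "orthonormal (h x) [v1 x, v2 x, v3 x]" for x
    proof -
      have x': "x \<in> \<Omega>"
        using x assms(2) by blast
      have "\<bar>h x (v1 x) (v1 x)\<bar> = 1" "\<bar>h x (v2 x) (v2 x)\<bar> = 1" "\<bar>h x (v3 x) (v3 x)\<bar> = 1"
        and z: "h x (v2 x) (v1 x) = 0" "h x (v3 x) (v1 x) = 0" "h x (v3 x) (v2 x) = 0"
        using on[unfolded orthonormal_def, rule_format, of 0 0] on[unfolded orthonormal_def, rule_format, of 1 1]
          on[unfolded orthonormal_def, rule_format, of 2 2] on[unfolded orthonormal_def, rule_format, of 1 0]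
          on[unfolded orthonormal_def, rule_format, of 2 0] on[unfolded orthonormal_def, rule_format, of 2 1]
        by simp_all
      moreover have "v2 x \<noteq> 0" "v3 x \<noteq> 0"
        using ind[OF x, of 0 1 0] ind[OF x, of 0 0 1] by auto
      ultimately have "h x (v1 x) (v1 x) = 1" "h x (v2 x) (v2 x) = 1" "h x (v3 x) (v3 x) = 1"
        using pos[OF x' v1[OF x]] pos[OF x', of "v2 x"] pos[OF x', of "v3 x"] by auto
      then have "u1 x = v1 x" "u2 x = v2 x" "u3 x = v3 x"
        using z by (simp_all add: u1_def u2_def u3_def w2_def w3_def n_def)
      then show ?thesis
        by (simp add: e)
    qed
  qed
qed

lemma onb_exists:
  "\<exists>e :: 3 \<Rightarrow> real^3 \<Rightarrow> real^3. (\<forall>i. smooth_on \<Omega> (e i)) \<and> (\<forall>x\<in>\<Omega>. onb (h x) (\<lambda>i. e i x))"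
proof -
  have *: "p = 0 \<and> q = 0 \<and> r = 0" if "p *\<^sub>R axis 1 1 + q *\<^sub>R axis 2 1 + r *\<^sub>R axis 3 1 = (0 :: real^3)" for p q r :: real
    using that unfolding vec_eq_iff forall_3 by (simp add: axis_def)
  show ?thesis
  proof (rule gram_schmidt[OF opn subset_refl smooth_on_const smooth_on_const smooth_on_const *])
    fix e :: "3 \<Rightarrow> real^3 \<Rightarrow> real^3"
    assume "\<And>i. smooth_on \<Omega> (e i)" "\<And>x. x \<in> \<Omega> \<Longrightarrow> onb (h x) (\<lambda>i. e i x)"
    then show ?thesis
      by (intro exI[of _ e]) simp
  qed
qed

subsection \<open>The Levi-Civita connection and the difference tensor\<close>

lemma nabla_h_linear:
  assumes "x \<in> \<Omega>"
  shows "linear (nabla_h x u v)"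
proof
  fix w w' :: "real^3" and c :: real
  show "nabla_h x u v (w + w') = nabla_h x u v w + nabla_h x u v w'"
    unfolding nabla_h_def linear_add[OF \<Gamma>_h_linear(1)[OF assms]] bilinear_radd[OF Dh_bilinear[OF assms]] h_add[OF assms]
    by simp
  show "nabla_h x u v (c *\<^sub>R w) = c *\<^sub>R nabla_h x u v w"
    unfolding nabla_h_def linear_scale[OF \<Gamma>_h_linear(1)[OF assms]] bilinear_rmul[OF Dh_bilinear[OF assms]] h_scale[OF assms]
    by (simp add: right_diff_distrib)
qed

text \<open>Raises an index of the cubic form by means of an orthonormal basis. The bilinear map
  obtained is the candidate for the difference tensor.\<close>

lemma representer:
  assumes x: "x \<in> \<Omega>"
  shows "\<exists>B. bilinear B \<and> (\<forall>u v w. h x (B u v) w = - nabla_h x u v w / 2)"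
proof -
  obtain e :: "3 \<Rightarrow> real^3 \<Rightarrow> real^3" where o: "onb (h x) (\<lambda>i. e i x)"
    using onb_exists x by auto
  define B where "B u v = (\<Sum>k\<in>UNIV. (- nabla_h x u v (e k x) / 2) *\<^sub>R e k x)" for u v
  have B: "h x (B u v) w = - nabla_h x u v w / 2" for u v w
  proof -
    have "nabla_h x u v w = nabla_h x u v (\<Sum>k\<in>UNIV. h x w (e k x) *\<^sub>R e k x)"
      by (simp only: onb_expand[OF bilin_h[OF x] o, of w, symmetric])
    also have "\<dots> = (\<Sum>k\<in>UNIV. h x w (e k x) * nabla_h x u v (e k x))"
      by (simp add: linear_sum[OF nabla_h_linear[OF x]] linear_scale[OF nabla_h_linear[OF x]])
    finally show ?thesis
      using x \<Gamma>_h_sym(2)[OF x, of w] by (simp add: B_def sum_negf sum_divide_distrib mult.commute)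
  qed
  have "linear (B u)" for u
  proof -
    have "nabla_h x u (v + v') w = nabla_h x u v w + nabla_h x u v' w"
      "nabla_h x u (c *\<^sub>R v) w = c * nabla_h x u v w" for v v' c w
      using linear_add[OF nabla_h_linear[OF x], of u w v v'] linear_scale[OF nabla_h_linear[OF x], of u w c v]
      unfolding nabla_h_sym(2)[OF x, of u _ w] by simp_all
    then show ?thesis
      using x by (intro linearI h_eqI[OF x]) (simp_all add: B add_divide_distrib)
  qed
  moreover have "B u v = B v u" for u v
    using nabla_h_sym(1)[OF x, of u v] by (intro h_eqI[OF x]) (simp add: B)
  ultimately have "bilinear B"
    unfolding bilinear_def by (metis (no_types, lifting) ext)
  with B show ?thesis
    by (intro exI[of _ B]) simp
qed

text \<open>A form that is symmetric in the first two and skew in the last two arguments vanishes.\<close>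

lemma LC_gamma_eq:
  assumes x: "x \<in> \<Omega>" and "bilinear B" and B: "\<And>u v w. h x (B u v) w = - nabla_h x u v w / 2"
  shows "LC_gamma h x = (\<lambda>v w. \<Gamma> x v w - B v w)"
  unfolding LC_gamma_def
proof (rule the_equality)
  let ?P = "\<lambda>T. bilinear T \<and> (\<forall>v w. T v w = T w v) \<and> (\<forall>z v w. Dh x z v w = h x (T z v) w + h x v (T z w))"
  define G where "G v w = \<Gamma> x v w - B v w" for v w
  have eG: "(\<lambda>v w. \<Gamma> x v w - B v w) = G"
    by (simp add: fun_eq_iff G_def)
  have Bs: "B v w = B w v" for v w
    using nabla_h_sym(1)[OF x, of v w] by (intro h_eqI[OF x]) (simp add: B)
  have Gs: "G v w = G w v" for v w
    using \<Gamma>_h_sym(1)[OF x, of v w] Bs[of v w] by (simp add: G_def)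
  have l: "linear (G v)" for v
    using assms(2) linear_compose_sub[OF \<Gamma>_h_linear(1)[OF x], of "B v" v] by (simp add: bilinear_def G_def[abs_def])
  have "(\<lambda>v. G v w) = G w" for w
    using Gs by (intro ext)
  then have Gb: "bilinear G"
    using l by (simp add: bilinear_def)
  have m: "Dh x z v w = h x (G z v) w + h x v (G z w)" for z v w
    using x B[of z v w] B[of z w v] nabla_h_sym(2)[OF x, of z w v] \<Gamma>_h_sym(2)[OF x, of v "B z w"]
      nabla_h_def[of x z v w]
    by (simp add: G_def)
  show "?P (\<lambda>v w. \<Gamma> x v w - B v w)"
    unfolding G_def[symmetric] by (intro conjI allI Gb Gs m)
  fix T assume T: "?P T"
  define a where "a z v w = h x (T z v) w - h x (G z v) w" for z v w
  have a1: "a z v w = a v z w" for z v w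
    using T Gs[of z v] by (simp add: a_def)
  have a2: "a z v w = - a z w v" for z v w
    using conjunct2[OF conjunct2[OF T], rule_format, where z = z and v = v and w = w] m[where z = z and v = v and w = w]
      \<Gamma>_h_sym(2)[OF x, of v "T z w"] \<Gamma>_h_sym(2)[OF x, of v "G z w"] by (simp add: a_def)
  have "a z v w = 0" for z v w
    using a2[of z v w] a1[of z w v] a2[of w z v] a1[of w v z] a2[of v w z] a1[of v z w] by linarith
  then have "T z v = G z v" for z v
    by (intro h_eqI[OF x]) (simp add: a_def)
  then show "T = (\<lambda>v w. \<Gamma> x v w - B v w)"
    unfolding eG by blast
qed

text \<open>The Levi-Civita form found in \<open>LC_gamma_eq\<close> is \<open>\<Gamma>\<close>
  minus the representer of the cubic form, so this representer is \<open>K\<close>. Thereby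
  \<open>K\<close> inherits the total symmetry of \<open>nabla_h\<close>.\<close>

lemma K_facts:
  assumes x: "x \<in> \<Omega>"
  shows h_K: "h x (K x u v) w = - nabla_h x u v w / 2"
    and LC_conn_K: "LC_conn h X Y x = D Y x (X x) + \<Gamma> x (X x) (Y x) - K x (X x) (Y x)"
    and bilin_K: "bilinear (K x)"
proof -
  obtain B where B: "bilinear B" "\<And>u v w. h x (B u v) w = - nabla_h x u v w / 2"
    using representer[OF x] by auto
  have "K x = B"
    by (intro ext) (simp add: diff_tensor_def LC_conn_def LC_gamma_eq[OF x B])
  then show "h x (K x u v) w = - nabla_h x u v w / 2" "bilinear (K x)"
    and "LC_conn h X Y x = D Y x (X x) + \<Gamma> x (X x) (Y x) - K x (X x) (Y x)"
    using B by (simp_all add: LC_conn_def LC_gamma_eq[OF x B])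
qed

end

subsection \<open>Structure equations in an orthonormal frame\<close>

locale frame = hypersurface +
  fixes V :: "(real^3) set" and e :: "3 \<Rightarrow> real^3 \<Rightarrow> real^3"
  assumes openV: "open V" and sub: "V \<subseteq> \<Omega>" and smooth_e: "smooth_on V (e i)"
    and onb_e: "x \<in> V \<Longrightarrow> onb (h x) (\<lambda>i. e i x)"
begin

text \<open>\<open>N i j\<close> is the derivative of \<open>e j\<close> along \<open>e i\<close>
  for the induced connection and \<open>G i j k\<close> are its components; \<open>\<kappa>\<close>
  and \<open>\<sigma>\<close> are the components of the cubic form of \<open>K\<close> and of the
  shape operator, and \<open>E i\<close> is the frame vector moved into the ambient space.\<close>

definition N where "N i j x = D (e j) x (e i x) + \<Gamma> x (e i x) (e j x)"
definition G where "G i j k x = h x (N i j x) (e k x)"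
definition \<kappa> where "\<kappa> i j k x = h x (K x (e i x) (e j x)) (e k x)"
definition \<sigma> where "\<sigma> i j x = h x (S x (e i x)) (e j x)"
definition E where "E i x = D \<Phi> x (e i x)"

lemma in\<Omega>: "x \<in> V \<Longrightarrow> x \<in> \<Omega>"
  using sub by blast

lemma h_e: "x \<in> V \<Longrightarrow> h x (e i x) (e j x) = (if i = j then 1 else 0)"
  using onb_e by (simp add: onb_def)

lemma expand: "x \<in> V \<Longrightarrow> w = (\<Sum>k\<in>UNIV. h x w (e k x) *\<^sub>R e k x)"
  by (rule onb_expand[OF bilin_h[OF in\<Omega>] onb_e])

lemma N_expand: "x \<in> V \<Longrightarrow> N i j x = (\<Sum>k\<in>UNIV. G i j k x *\<^sub>R e k x)"
  unfolding G_def by (rule expand)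

lemma smooth_\<Phi>V: "smooth_on V \<Phi>" and smooth_\<xi>V: "smooth_on V \<xi>"
  using smooth_on_subset[OF smooth_\<Phi> sub] smooth_on_subset[OF smooth_\<xi> sub] by auto

lemma smooth_E: "smooth_on V (E i)"
  unfolding E_def[abs_def] by (rule smooth_on_D_field[OF openV smooth_\<Phi>V smooth_e])

lemma dE: "x \<in> V \<Longrightarrow> D (E j) x (e i x) = D \<Phi> x (N i j x) + (if i = j then 1 else 0) *\<^sub>R \<xi> x"
  unfolding E_def[abs_def] push_field[OF openV sub smooth_e] h_e by (simp add: N_def)

lemma smooth_N: "smooth_on V (N i j)"
  by (rule smooth_decomp(1)[OF openV sub smooth_on_D_field[OF openV smooth_E smooth_e] dE])

lemma smooth_G: "smooth_on V (G i j k)"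
  unfolding G_def[abs_def] by (rule smooth_h[OF openV sub smooth_N smooth_e])

lemma smooth_\<sigma>: "smooth_on V (\<sigma> i j)"
proof -
  have "D \<xi> x (e i x) = D \<Phi> x (- S x (e i x)) + 0 *\<^sub>R \<xi> x" if "x \<in> V" for x
    using shape[OF in\<Omega>[OF that]] by (simp add: linear_neg[OF lin[OF in\<Omega>[OF that]]])
  from smooth_decomp(1)[OF openV sub smooth_on_D_field[OF openV smooth_\<xi>V smooth_e] this]
  have "smooth_on V (\<lambda>x. - S x (e i x))" .
  from smooth_on_minus[OF openV this] have "smooth_on V (\<lambda>x. S x (e i x))"
    by simp
  then show ?thesis
    unfolding \<sigma>_def[abs_def] by (rule smooth_h[OF openV sub _ smooth_e])
qed

lemma dE_sum:
  assumes "x \<in> V"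
  shows "D (E j) x (e i x) = (\<Sum>k\<in>UNIV. G i j k x *\<^sub>R E k x) + (if i = j then 1 else 0) *\<^sub>R \<xi> x"
  unfolding dE[OF assms] N_expand[OF assms] linear_sum[OF lin[OF in\<Omega>[OF assms]]]
    linear_scale[OF lin[OF in\<Omega>[OF assms]]] E_def ..

lemma S_expand: "x \<in> V \<Longrightarrow> S x (e i x) = (\<Sum>k\<in>UNIV. \<sigma> i k x *\<^sub>R e k x)"
  unfolding \<sigma>_def by (rule expand)

lemma d\<xi>:
  assumes "x \<in> V"
  shows "D \<xi> x (e i x) = - (\<Sum>k\<in>UNIV. \<sigma> i k x *\<^sub>R E k x)"
  unfolding shape[OF in\<Omega>[OF assms]] S_expand[OF assms] linear_sum[OF lin[OF in\<Omega>[OF assms]]]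
    linear_scale[OF lin[OF in\<Omega>[OF assms]]] E_def ..

text \<open>\<open>G - \<kappa>\<close> consists of the coefficients of the Levi-Civita connection,
  which are skew in the last two indices, whereas \<open>\<kappa>\<close> is symmetric in
  them.\<close>

lemma G_skew:
  assumes x: "x \<in> V"
  shows "G i j k x + G i k j x = 2 * \<kappa> i j k x"
proof -
  note x' = in\<Omega>[OF x]
  have "D (\<lambda>y. h y (e j y) (e k y)) x (e i x) = D (\<lambda>y. if j = k then 1 else 0 :: real) x (e i x)"
    by (rule D_cong_open[OF openV x, THEN fun_cong]) (rule h_e)
  then have "Dh x (e i x) (e j x) (e k x) + h x (D (e j) x (e i x)) (e k x) + h x (e j x) (D (e k) x (e i x)) = 0"
    unfolding D_h_field[OF openV sub smooth_e smooth_e x] by simp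
  moreover have "\<kappa> i j k x = - nabla_h x (e i x) (e j x) (e k x) / 2"
    by (simp add: \<kappa>_def h_K[OF x'])
  ultimately show ?thesis
    using x' \<Gamma>_h_sym(2)[OF x', of "e j x" "D (e k) x (e i x)"] \<Gamma>_h_sym(2)[OF x', of "e j x" "\<Gamma> x (e i x) (e k x)"]
    by (simp add: G_def N_def nabla_h_def)
qed

text \<open>\<open>K\<close> involves the definite description of the Levi-Civita form;
  \<open>G_skew\<close> expresses its components through the smooth functions \<open>G\<close>
  instead.\<close>

lemma smooth_\<kappa>: "smooth_on V (\<kappa> i j k)"
proof (rule smooth_on_cong[OF openV])
  show "(G i j k y + G i k j y) / 2 = \<kappa> i j k y" if "y \<in> V" for y
    using G_skew[OF that, of i j k] by simp
  show "smooth_on V (\<lambda>y. (G i j k y + G i k j y) / 2)"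
    by (intro smooth_rules openV smooth_G) simp
qed

lemma LC_e: "x \<in> V \<Longrightarrow> h x (LC_conn h (e i) (e j) x) (e k x) = G i j k x - \<kappa> i j k x"
  by (simp add: LC_conn_K[OF in\<Omega>] in\<Omega> G_def N_def \<kappa>_def)

lemma bracket:
  assumes "x \<in> V"
  shows "D (e j) x (e i x) - D (e i) x (e j x) = (\<Sum>m\<in>UNIV. (G i j m x - G j i m x) *\<^sub>R e m x)"
proof -
  have "D (e j) x (e i x) - D (e i) x (e j x) = N i j x - N j i x"
    by (simp add: N_def \<Gamma>_h_sym(1)[OF in\<Omega>[OF assms], of "e i x"])
  then show ?thesis
    by (simp add: N_expand[OF assms] scaleR_left_diff_distrib sum_subtractf)
qed

lemma D_N:
  assumes x: "x \<in> V"
  shows "h x (D (N j k) x (e i x) + \<Gamma> x (e i x) (N j k x)) (e l x) =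
    D (G j k l) x (e i x) + (\<Sum>m\<in>UNIV. G j k m x * G i m l x)"
proof -
  note x' = in\<Omega>[OF x]
  have "D (N j k) x (e i x) = D (\<lambda>y. \<Sum>m\<in>UNIV. G j k m y *\<^sub>R e m y) x (e i x)"
    by (rule D_cong_open[OF openV x, THEN fun_cong]) (rule N_expand)
  also have "\<dots> = (\<Sum>m\<in>UNIV. D (\<lambda>y. G j k m y *\<^sub>R e m y) x (e i x))"
    by (rule D_sum[OF smooth_on_scaleR[OF openV smooth_G smooth_e] x])
  also have "\<dots> = (\<Sum>m\<in>UNIV. G j k m x *\<^sub>R D (e m) x (e i x) + D (G j k m) x (e i x) *\<^sub>R e m x)"
    by (simp only: D_scaleR[OF smooth_G smooth_e x])
  finally have 1: "D (N j k) x (e i x) = \<dots>" .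
  have 2: "\<Gamma> x (e i x) (N j k x) = (\<Sum>m\<in>UNIV. G j k m x *\<^sub>R \<Gamma> x (e i x) (e m x))"
    unfolding N_expand[OF x] linear_sum[OF \<Gamma>_h_linear(1)[OF x']] linear_scale[OF \<Gamma>_h_linear(1)[OF x']] ..
  have "D (N j k) x (e i x) + \<Gamma> x (e i x) (N j k x) =
      (\<Sum>m\<in>UNIV. G j k m x *\<^sub>R N i m x + D (G j k m) x (e i x) *\<^sub>R e m x)"
    unfolding 1 2 by (simp add: N_def sum.distrib scaleR_add_right)
  then have "h x (D (N j k) x (e i x) + \<Gamma> x (e i x) (N j k x)) (e l x) =
      (\<Sum>m\<in>UNIV. G j k m x * G i m l x) + (\<Sum>m\<in>UNIV. D (G j k m) x (e i x) * h x (e m x) (e l x))"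
    using x' by (simp add: G_def sum.distrib)
  also have "(\<Sum>m\<in>UNIV. D (G j k m) x (e i x) * h x (e m x) (e l x)) = (\<Sum>m\<in>UNIV. if m = l then D (G j k m) x (e i x) else 0)"
    by (intro sum.cong refl) (simp add: h_e[OF x])
  finally show ?thesis
    by simp
qed

text \<open>The tangential part of the identity for the commutator of \<open>D\<close> along
  \<open>e i\<close> and \<open>e j\<close>, applied to \<open>E k\<close>. Since \<open>D\<close>
  is flat, the curvature of the induced connection is given by the terms in
  \<open>\<sigma>\<close>.\<close>

lemma gauss:
  assumes x: "x \<in> V"
  shows "D (G j k l) x (e i x) + (\<Sum>m\<in>UNIV. G j k m x * G i m l x) - (if j = k then \<sigma> i l x else 0)
    - (D (G i k l) x (e j x) + (\<Sum>m\<in>UNIV. G i k m x * G j m l x) - (if i = k then \<sigma> j l x else 0))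
    = (\<Sum>m\<in>UNIV. (G i j m x - G j i m x) * G m k l x)"
proof -
  note x' = in\<Omega>[OF x]
  note ld = linear_add[OF lin[OF x']] linear_diff[OF lin[OF x']] linear_scale[OF lin[OF x']]
  define Z where "Z i j = D (N j k) x (e i x) + \<Gamma> x (e i x) (N j k x) - (if j = k then 1 else 0) *\<^sub>R S x (e i x)" for i j
  have A: "D (\<lambda>y. D (E k) y (e j y)) x (e i x) = D \<Phi> x (Z i j) + h x (e i x) (N j k x) *\<^sub>R \<xi> x" for i j
  proof -
    have "D (\<lambda>y. D (E k) y (e j y)) x (e i x) = D (\<lambda>y. D \<Phi> y (N j k y) + (if j = k then 1 else 0) *\<^sub>R \<xi> y) x (e i x)"
      by (rule D_cong_open[OF openV x, THEN fun_cong]) (rule dE)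
    also have "\<dots> = D (\<lambda>y. D \<Phi> y (N j k y)) x (e i x) + D (\<lambda>y. (if j = k then 1 else 0) *\<^sub>R \<xi> y) x (e i x)"
      by (rule D_add[OF smooth_on_D_field[OF openV smooth_\<Phi>V smooth_N] smooth_on_scaleR[OF openV smooth_on_const smooth_\<xi>V] x])
    also have "D (\<lambda>y. (if j = k then 1 else 0) *\<^sub>R \<xi> y) x (e i x) = (if j = k then 1 else 0) *\<^sub>R D \<xi> x (e i x)"
      using D_scaleR[OF smooth_on_const smooth_\<xi>V x] by simp
    finally show ?thesis
      unfolding push_field[OF openV sub smooth_N x] shape[OF x'] Z_def ld by simp
  qed
  define c where "c m = G i j m x - G j i m x" for m
  have "D (E k) x (D (e j) x (e i x) - D (e i) x (e j x)) = (\<Sum>m\<in>UNIV. c m *\<^sub>R D (E k) x (e m x))"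
    unfolding bracket[OF x] linear_sum[OF linear_D[OF smooth_E x]] linear_scale[OF linear_D[OF smooth_E x]] c_def ..
  also have "\<dots> = D \<Phi> x (\<Sum>m\<in>UNIV. c m *\<^sub>R N m k x) + (\<Sum>m\<in>UNIV. c m * (if m = k then 1 else 0)) *\<^sub>R \<xi> x"
    unfolding dE[OF x] linear_sum[OF lin[OF x']] ld by (simp add: scaleR_add_right sum.distrib scaleR_sum_left)
  finally have B: "D (E k) x (D (e j) x (e i x) - D (e i) x (e j x)) = \<dots>" .
  have "D \<Phi> x (Z i j - Z j i) + (h x (e i x) (N j k x) - h x (e j x) (N i k x)) *\<^sub>R \<xi> x =
      D \<Phi> x (\<Sum>m\<in>UNIV. c m *\<^sub>R N m k x) + (\<Sum>m\<in>UNIV. c m * (if m = k then 1 else 0)) *\<^sub>R \<xi> x"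
    using D_commutator[OF openV smooth_E smooth_e smooth_e x, of k j i] unfolding A B ld
    by (simp add: algebra_simps)
  from decomp_unique(1)[OF x' this] have "h x (Z i j - Z j i) (e l x) = h x (\<Sum>m\<in>UNIV. c m *\<^sub>R N m k x) (e l x)"
    by simp
  moreover have "h x (Z i j) (e l x) = D (G j k l) x (e i x) + (\<Sum>m\<in>UNIV. G j k m x * G i m l x) - (if j = k then \<sigma> i l x else 0)" for i j
    unfolding Z_def h_diff[OF x'] D_N[OF x] h_scale[OF x'] by (simp add: \<sigma>_def)
  ultimately show ?thesis
    by (simp add: x' G_def c_def)
qed

lemma det_E:
  assumes "x \<in> V"
  shows "\<bar>det (vector [E 1 x, E 2 x, E 3 x, \<xi> x] :: real^4^4)\<bar> = 1"
proof -
  have "\<forall>i<3. \<forall>j<3. \<bar>h x ([e 1 x, e 2 x, e 3 x] ! i) ([e 1 x, e 2 x, e 3 x] ! j)\<bar> = (if i = j then 1 else 0)"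
    unfolding numeral_3_eq_3 by (simp add: less_Suc_eq h_e[OF assms])
  then have "orthonormal (h x) [e 1 x, e 2 x, e 3 x]"
    by (simp add: orthonormal_def)
  from vol[OF in\<Omega>[OF assms] _ this] show ?thesis
    by (simp add: E_def)
qed

text \<open>Apolarity: the volume form \<open>det (\<cdot>, \<cdot>, \<cdot>, \<xi>)\<close> is parallel and equals \<open>\<plusminus> 1\<close> on the frame.\<close>

lemma apolar:
  assumes x: "x \<in> V"
  shows "(\<Sum>k\<in>UNIV. G i k k x) = 0"
proof -
  define M :: "real^3 \<Rightarrow> real^4^4" where "M y = vector [E 1 y, E 2 y, E 3 y, \<xi> y]" for y
  \<comment> \<open>Row \<open>r\<close> of \<open>C\<close> holds the coefficients of the
    derivative of row \<open>r\<close> of \<open>M\<close> with respect to the rows of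
    \<open>M\<close>, from \<open>dE_sum\<close> and \<open>d\<xi>\<close>. Its trace is the sum in
    question.\<close>
  define C :: "4 \<Rightarrow> 4 \<Rightarrow> real" where "C = (\<lambda>r s. (vector [
      vector [G i 1 1 x, G i 1 2 x, G i 1 3 x, if i = 1 then 1 else 0],
      vector [G i 2 1 x, G i 2 2 x, G i 2 3 x, if i = 2 then 1 else 0],
      vector [G i 3 1 x, G i 3 2 x, G i 3 3 x, if i = 3 then 1 else 0],
      vector [- \<sigma> i 1 x, - \<sigma> i 2 x, - \<sigma> i 3 x, 0]] :: real^4^4) $ r $ s)"
  have sM: "smooth_on V (\<lambda>y. M y $ r)" for r
    using exhaust_4[of r] smooth_E smooth_\<xi>V by (auto simp: M_def)
  have dM: "D (\<lambda>y. M y $ r) x (e i x) = (\<Sum>s\<in>UNIV. C r s *\<^sub>R M x $ s)" for r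
    using exhaust_4[of r]
    by (elim disjE) (simp_all add: M_def C_def sum_4 sum_3 dE_sum[OF x] d\<xi>[OF x])
  have "smooth_on V (\<lambda>y. det (M y))"
    by (intro smooth_on_det openV smooth_on_vec_nth sM)
  have "((\<lambda>y. det (M y)) has_derivative (\<lambda>v. 0)) (at x)"
  proof -
    have d: "((\<lambda>y. det (M y)) has_derivative D (\<lambda>y. det (M y)) x) (at x)"
      by (rule smooth_on_has_derivative[OF \<open>smooth_on V (\<lambda>y. det (M y))\<close> x])
    \<comment> \<open>The determinant is \<open>1\<close> or \<open>-1\<close>; differentiating its
      square avoids a choice of sign.\<close>
    have "det (M y) * det (M y) = 1" if "y \<in> V" for y
      using det_E[OF that] by (auto simp: M_def abs_if split: if_splits)
    then have "D (\<lambda>y. det (M y) * det (M y)) x v = D (\<lambda>y. 1 :: real) x v" for v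
      by (intro D_cong_open[OF openV x, THEN fun_cong])
    then have "2 * det (M x) * D (\<lambda>y. det (M y)) x v = 0" for v
      unfolding D_mult[OF \<open>smooth_on V (\<lambda>y. det (M y))\<close> \<open>smooth_on V (\<lambda>y. det (M y))\<close> x] by simp
    moreover have "det (M x) \<noteq> 0"
      using det_E[OF x] by (auto simp: M_def)
    ultimately have "D (\<lambda>y. det (M y)) x = (\<lambda>v. 0)"
      by (simp add: fun_eq_iff)
    with d show ?thesis
      by simp
  qed
  from has_derivative_det[OF smooth_on_has_derivative[OF sM x] dM this]
  have "(\<Sum>r\<in>UNIV. C r r) * det (M x) = 0"
    by simp
  moreover have "det (M x) \<noteq> 0"
    using det_E[OF x] by (auto simp: M_def)
  ultimately have "(\<Sum>r\<in>UNIV. C r r) = 0"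
    by simp
  then show ?thesis
    by (simp add: C_def sum_4 sum_3)
qed

lemma apolar_\<kappa>: "x \<in> V \<Longrightarrow> (\<Sum>k\<in>UNIV. \<kappa> i k k x) = 0"
  using apolar[of x i] G_skew[of x i 1 1] G_skew[of x i 2 2] G_skew[of x i 3 3] by (simp add: sum_3)

end

section \<open>The pointwise normal form\<close>

text \<open>The polarization of \<open>l (2 x\<^sup>3 - 3 x (y\<^sup>2 + z\<^sup>2)) + m (y\<^sup>3 - 3 y z\<^sup>2) + n (z\<^sup>3 - 3 y\<^sup>2 z)\<close>.\<close>

definition cubic_form :: "real \<Rightarrow> real \<Rightarrow> real \<Rightarrow> real^3 \<Rightarrow> real^3 \<Rightarrow> real^3 \<Rightarrow> real" where
  "cubic_form l m n v w r = l * (2 * v$1 * w$1 * r$1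
      - v$1 * (w$2 * r$2 + w$3 * r$3) - w$1 * (v$2 * r$2 + v$3 * r$3) - r$1 * (v$2 * w$2 + v$3 * w$3))
    + m * (v$2 * w$2 * r$2 - v$2 * w$3 * r$3 - w$2 * v$3 * r$3 - r$2 * v$3 * w$3)
    + n * (v$3 * w$3 * r$3 - v$3 * w$2 * r$2 - w$3 * v$2 * r$2 - r$3 * v$2 * w$2)"

definition diag_form :: "real \<Rightarrow> real \<Rightarrow> real^3 \<Rightarrow> real^3 \<Rightarrow> real" where
  "diag_form a b v w = a * (v$1 * w$1) + b * (v$2 * w$2 + v$3 * w$3)"

context hypersurface
begin

definition coords where "coords x u v = (\<chi> i. h x v (u i))" for x and u :: "3 \<Rightarrow> real^3"

text \<open>The last parameter \<open>n\<close> of the cubic form is kept so that every orthonormal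
  basis with the same axis has a normal form; \<open>n = 0\<close> is a further choice of rotation
  in the plane.\<close>

definition nform where
  "nform x u l m n a b \<longleftrightarrow> onb (h x) u \<and>
     (\<forall>v w r. h x (K x v w) r = cubic_form l m n (coords x u v) (coords x u w) (coords x u r)) \<and>
     (\<forall>v w. h x (S x v) w = diag_form a b (coords x u v) (coords x u w))"

lemma coords_u: "onb (h x) u \<Longrightarrow> coords x u (u i) = axis i 1"
  by (simp add: coords_def onb_def axis_def vec_eq_iff)

lemma coords_lin:
  assumes "x \<in> \<Omega>"
  shows "coords x u (v + w) = coords x u v + coords x u w" "coords x u (c *\<^sub>R v) = c *\<^sub>R coords x u v"
  using assms by (simp_all add: coords_def vec_eq_iff)

lemma K_sym:
  assumes "x \<in> \<Omega>"
  shows "h x (K x u v) w = h x (K x v u) w" "h x (K x u v) w = h x (K x u w) v"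
  using nabla_h_sym[OF assms, of u v w] by (simp_all add: h_K[OF assms])

lemma K_lin:
  assumes "x \<in> \<Omega>"
  shows "K x (u + v) w = K x u w + K x v w" "K x w (u + v) = K x w u + K x w v"
    "K x (c *\<^sub>R u) w = c *\<^sub>R K x u w" "K x w (c *\<^sub>R u) = c *\<^sub>R K x w u"
  by (simp_all add: bilinear_ladd[OF bilin_K[OF assms]] bilinear_radd[OF bilin_K[OF assms]]
      bilinear_lmul[OF bilin_K[OF assms]] bilinear_rmul[OF bilin_K[OF assms]])

text \<open>Makes results about smooth frames, such as apolarity, available for a basis given at a
  single point: the constant fields \<open>u i\<close> are independent everywhere and are
  orthonormalized.\<close>

lemma onb_to_frame:
  assumes "x \<in> \<Omega>" "onb (h x) u"
  shows "\<exists>e. frame \<Omega> \<Phi> \<xi> \<Omega> e \<and> (\<forall>i. e i x = u i)"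
proof -
  have ind: "p = 0 \<and> q = 0 \<and> r = 0" if "p *\<^sub>R u 1 + q *\<^sub>R u 2 + r *\<^sub>R u 3 = 0" for p q r
  proof -
    have "h x (p *\<^sub>R u 1 + q *\<^sub>R u 2 + r *\<^sub>R u 3) (u i) = 0" for i
      unfolding that using assms(1) by simp
    from this[of 1] this[of 2] this[of 3] show ?thesis
      using assms by (simp add: onb_def)
  qed
  have o: "orthonormal (h x) [u 1, u 2, u 3]"
  proof -
    have "\<forall>i<3. \<forall>j<3. \<bar>h x ([u 1, u 2, u 3] ! i) ([u 1, u 2, u 3] ! j)\<bar> = (if i = j then 1 else 0)"
      unfolding numeral_3_eq_3 using assms(2) by (simp add: less_Suc_eq onb_def)
    then show ?thesis
      by (simp add: orthonormal_def)
  qed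
  show ?thesis
  proof (rule gram_schmidt[OF opn subset_refl smooth_on_const smooth_on_const smooth_on_const ind])
    fix e :: "3 \<Rightarrow> real^3 \<Rightarrow> real^3"
    assume e: "\<And>i. smooth_on \<Omega> (e i)" "\<And>x. x \<in> \<Omega> \<Longrightarrow> onb (h x) (\<lambda>i. e i x)"
      "\<And>x. x \<in> \<Omega> \<Longrightarrow> orthonormal (h x) [u 1, u 2, u 3] \<Longrightarrow> e 1 x = u 1 \<and> e 2 x = u 2 \<and> e 3 x = u 3"
    have "frame \<Omega> \<Phi> \<xi> \<Omega> e"
      by unfold_locales (auto simp: opn e)
    moreover have "\<forall>i. e i x = u i"
      unfolding forall_3 using e(3)[OF assms(1) o] by blast
    ultimately show ?thesis
      by blast
  qed
qed

lemma trace_K: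
  assumes "x \<in> \<Omega>" "onb (h x) u"
  shows "(\<Sum>k\<in>UNIV. h x (K x (u i) (u k)) (u k)) = 0"
proof -
  obtain e where e: "frame \<Omega> \<Phi> \<xi> \<Omega> e" "\<And>i. e i x = u i"
    using onb_to_frame[OF assms] by blast
  interpret f: frame \<Omega> \<Phi> \<xi> \<Omega> e
    by (rule e)
  show ?thesis
    using f.apolar_\<kappa>[OF assms(1), of i] by (simp add: f.\<kappa>_def e)
qed

lemma K_expand:
  assumes "x \<in> \<Omega>" "onb (h x) u"
  shows "h x (K x v w) r = (\<Sum>i\<in>UNIV. \<Sum>j\<in>UNIV. \<Sum>k\<in>UNIV.
    coords x u v $ i * coords x u w $ j * coords x u r $ k * h x (K x (u i) (u j)) (u k))"
proof -
  note ex = onb_expand[OF bilin_h[OF assms(1)] assms(2)]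
  have l: "linear (\<lambda>v. K x v w)" "linear (K x w)" for w
    using bilin_K[OF assms(1)] by (simp_all add: bilinear_def)
  have "h x (K x v w) r = (\<Sum>i\<in>UNIV. h x v (u i) * h x (K x (u i) w) r)"
    by (subst ex[of v]) (simp add: linear_sum[OF l(1)] linear_scale[OF l(1)] assms(1))
  also have "\<dots> = (\<Sum>i\<in>UNIV. h x v (u i) * (\<Sum>j\<in>UNIV. h x w (u j) * h x (K x (u i) (u j)) r))"
    by (subst ex[of w]) (simp add: linear_sum[OF l(2)] linear_scale[OF l(2)] assms(1))
  also have "\<dots> = (\<Sum>i\<in>UNIV. h x v (u i) * (\<Sum>j\<in>UNIV. h x w (u j) * (\<Sum>k\<in>UNIV. h x r (u k) * h x (K x (u i) (u j)) (u k))))"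
    by (subst ex[of r]) (simp add: assms(1))
  finally show ?thesis
    by (simp add: coords_def sum_distrib_left mult.assoc)
qed

lemma S_expand_forms:
  assumes "x \<in> \<Omega>" "onb (h x) u"
  shows "h x (S x v) w = (\<Sum>i\<in>UNIV. \<Sum>j\<in>UNIV. coords x u v $ i * coords x u w $ j * h x (S x (u i)) (u j))"
proof -
  note ex = onb_expand[OF bilin_h[OF assms(1)] assms(2)]
  note l = linear_S[OF assms(1)]
  have "h x (S x v) w = (\<Sum>i\<in>UNIV. h x v (u i) * h x (S x (u i)) w)"
    by (subst ex[of v]) (simp add: linear_sum[OF l] linear_scale[OF l] assms(1))
  also have "\<dots> = (\<Sum>i\<in>UNIV. h x v (u i) * (\<Sum>j\<in>UNIV. h x w (u j) * h x (S x (u i)) (u j)))"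
    by (subst ex[of w]) (simp add: assms(1))
  finally show ?thesis
    by (simp add: coords_def sum_distrib_left mult.assoc)
qed

lemma h_expand:
  assumes "x \<in> \<Omega>" "onb (h x) u"
  shows "h x v w = diag_form 1 1 (coords x u v) (coords x u w)"
proof -
  note ex = onb_expand[OF bilin_h[OF assms(1)] assms(2)]
  have "h x v w = (\<Sum>i\<in>UNIV. h x w (u i) * h x v (u i))"
    by (subst ex[of w]) (simp add: assms(1))
  then show ?thesis
    by (simp add: coords_def diag_form_def sum_3)
qed

lemma S_sym: "x \<in> \<Omega> \<Longrightarrow> h x (S x v) w = h x (S x w) v"
  using S_self_adjoint[of x w v] \<Gamma>_h_sym(2)[of x w] \<Gamma>_h_sym(2)[of x v] by simp

text \<open>A symmetric cubic form in three variables has ten components. Apolarity removes three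
  and the conditions \<open>c\<close> four more, which leaves \<open>l\<close>, \<open>m\<close> and
  \<open>n\<close>.\<close>

lemma nformI:
  assumes x: "x \<in> \<Omega>" and u: "onb (h x) u"
    and c: "h x (K x (u 1) (u 1)) (u 2) = 0" "h x (K x (u 1) (u 1)) (u 3) = 0" "h x (K x (u 1) (u 2)) (u 3) = 0"
      "h x (K x (u 1) (u 2)) (u 2) = h x (K x (u 1) (u 3)) (u 3)"
    and s: "h x (S x (u 1)) (u 2) = 0" "h x (S x (u 1)) (u 3) = 0" "h x (S x (u 2)) (u 3) = 0"
      "h x (S x (u 2)) (u 2) = h x (S x (u 3)) (u 3)"
  shows "nform x u (h x (K x (u 1) (u 1)) (u 1) / 2) (h x (K x (u 2) (u 2)) (u 2)) (h x (K x (u 3) (u 3)) (u 3))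
    (h x (S x (u 1)) (u 1)) (h x (S x (u 2)) (u 2))"
proof -
  define t where "t i j k = h x (K x (u i) (u j)) (u k)" for i j k
  have tr: "t 1 1 1 + t 1 2 2 + t 1 3 3 = 0" "t 2 1 1 + t 2 2 2 + t 2 3 3 = 0" "t 3 1 1 + t 3 2 2 + t 3 3 3 = 0"
    using trace_K[OF x u] by (simp_all add: sum_3 t_def)
  have ts: "t i j k = t j i k" "t i j k = t i k j" for i j k
    using K_sym[OF x] by (simp_all add: t_def)
  have c': "t 1 1 2 = 0" "t 1 1 3 = 0" "t 1 2 3 = 0" "t 1 2 2 = t 1 3 3"
    using c by (simp_all add: t_def)
  have z: "t 1 1 2 = 0" "t 1 2 1 = 0" "t 2 1 1 = 0" "t 1 1 3 = 0" "t 1 3 1 = 0" "t 3 1 1 = 0"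
    "t 1 2 3 = 0" "t 1 3 2 = 0" "t 2 1 3 = 0" "t 2 3 1 = 0" "t 3 1 2 = 0" "t 3 2 1 = 0"
    using c' ts by metis+
  have l: "t 1 2 2 = - (t 1 1 1 / 2)" "t 1 3 3 = - (t 1 1 1 / 2)"
    using tr(1) c'(4) by simp_all
  have l': "t 2 1 2 = - (t 1 1 1 / 2)" "t 2 2 1 = - (t 1 1 1 / 2)" "t 3 1 3 = - (t 1 1 1 / 2)" "t 3 3 1 = - (t 1 1 1 / 2)"
    using l ts by metis+
  have m: "t 2 3 3 = - t 2 2 2" "t 3 2 2 = - t 3 3 3"
    using tr z by simp_all
  have m': "t 3 2 3 = - t 2 2 2" "t 3 3 2 = - t 2 2 2" "t 2 3 2 = - t 3 3 3" "t 2 2 3 = - t 3 3 3"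
    using m ts by metis+
  have s': "h x (S x (u 2)) (u 1) = 0" "h x (S x (u 3)) (u 1) = 0" "h x (S x (u 3)) (u 2) = 0"
    using s S_sym[OF x] by simp_all
  show ?thesis
    unfolding nform_def t_def[symmetric]
  proof (intro conjI allI u)
    fix v w r
    show "h x (K x v w) r = cubic_form (t 1 1 1 / 2) (t 2 2 2) (t 3 3 3) (coords x u v) (coords x u w) (coords x u r)"
    proof -
      have "h x (K x v w) r = (\<Sum>i\<in>UNIV. \<Sum>j\<in>UNIV. \<Sum>k\<in>UNIV.
          coords x u v $ i * coords x u w $ j * coords x u r $ k * t i j k)"
        unfolding t_def by (rule K_expand[OF x u])
      then show ?thesis
        unfolding sum_3 z l l' m m' cubic_form_def by (simp add: algebra_simps)
    qed
    show "h x (S x v) w = diag_form (h x (S x (u 1)) (u 1)) (h x (S x (u 2)) (u 2)) (coords x u v) (coords x u w)"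
      using S_expand_forms[OF x u, of v w] unfolding sum_3 s s' diag_form_def by (simp add: algebra_simps)
  qed
qed

lemma nform_comp:
  assumes "nform x u l m n a b"
  shows "h x (K x (u i) (u j)) (u k) = cubic_form l m n (axis i 1) (axis j 1) (axis k 1)"
    "h x (S x (u i)) (u j) = diag_form a b (axis i 1) (axis j 1)" "onb (h x) u"
proof -
  show o: "onb (h x) u"
    using assms by (simp add: nform_def)
  have "h x (K x v w) r = cubic_form l m n (coords x u v) (coords x u w) (coords x u r)"
    "h x (S x v) w = diag_form a b (coords x u v) (coords x u w)" for v w r
    using assms unfolding nform_def by blast+
  then show "h x (K x (u i) (u j)) (u k) = cubic_form l m n (axis i 1) (axis j 1) (axis k 1)"
    "h x (S x (u i)) (u j) = diag_form a b (axis i 1) (axis j 1)"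
    unfolding coords_u[OF o, symmetric] by blast+
qed

text \<open>The orthonormal bases with a fixed axis differ by an orthogonal transformation of the plane; \<open>\<epsilon>\<close> is
  its determinant.\<close>

lemma nform_change:
  assumes x: "x \<in> \<Omega>" and nf: "nform x u l m n a b" and u': "onb (h x) u'" and s: "u' 1 = s *\<^sub>R u 1"
  shows "\<exists>m' n'. nform x u' (s * l) m' n' a b \<and> m'\<^sup>2 + n'\<^sup>2 = m\<^sup>2 + n\<^sup>2 \<and>
    m' = cubic_form 0 m n (coords x u (u' 2)) (coords x u (u' 2)) (coords x u (u' 2)) \<and>
    n' = cubic_form 0 m n (coords x u (u' 3)) (coords x u (u' 3)) (coords x u (u' 3))"
proof -
  note u = nform_comp(3)[OF nf]
  have C: "h x (K x v w) r = cubic_form l m n (coords x u v) (coords x u w) (coords x u r)"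
    and SS: "h x (S x v) w = diag_form a b (coords x u v) (coords x u w)" for v w r
    using nf unfolding nform_def by blast+
  have s2: "s * s = 1"
  proof -
    have "h x (u' 1) (u' 1) = s * s"
      unfolding s using u x by (simp add: onb_def)
    then show ?thesis
      using u' by (simp add: onb_def)
  qed
  have f1: "coords x u (u' 1) $ 1 = s" "coords x u (u' 1) $ 2 = 0" "coords x u (u' 1) $ 3 = 0"
    using u x by (simp_all add: s coords_def onb_def)
  define p where "p i = coords x u (u' 2) $ i" for i
  define q where "q i = coords x u (u' 3) $ i" for i
  have f2: "coords x u (u' 2) $ i = p i" "coords x u (u' 3) $ i = q i" for i
    by (simp_all add: p_def q_def)
  have o: "diag_form 1 1 (coords x u (u' i)) (coords x u (u' j)) = (if i = j then 1 else 0)" for i j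
    using u' h_expand[OF x u, of "u' i" "u' j"] by (simp add: onb_def)
  have "s * p 1 = 0" "s * q 1 = 0"
    using o[of 1 2] o[of 1 3] by (simp_all add: diag_form_def f1 f2)
  then have pq1: "p 1 = 0" "q 1 = 0"
    using s2 by auto
  have pq: "p 2 * p 2 + p 3 * p 3 = 1" "q 2 * q 2 + q 3 * q 3 = 1" "p 2 * q 2 + p 3 * q 3 = 0"
    using o[of 2 2] o[of 3 3] o[of 2 3] by (simp_all add: diag_form_def f2 pq1)
  define \<epsilon> where "\<epsilon> = p 2 * q 3 - p 3 * q 2"
  have e: "q 2 = - \<epsilon> * p 3" "q 3 = \<epsilon> * p 2" "\<epsilon> * \<epsilon> = 1"
    using pq unfolding \<epsilon>_def by algebra+
  \<comment> \<open>For \<open>p 2 = cos \<theta>\<close> and \<open>p 3 = sin \<theta>\<close>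
    these are \<open>cos (3 * \<theta>)\<close> and \<open>sin (3 * \<theta>)\<close>: the pair
    \<open>(m, n)\<close> turns with three times the angle of the basis.\<close>
  define A where "A = p 2 ^ 3 - 3 * p 2 * (p 3)\<^sup>2"
  define B where "B = 3 * p 3 * (p 2)\<^sup>2 - p 3 ^ 3"
  have AB: "A\<^sup>2 + B\<^sup>2 = 1"
    using pq(1) unfolding A_def B_def by algebra
  have m': "cubic_form 0 m n (coords x u (u' 2)) (coords x u (u' 2)) (coords x u (u' 2)) = m * A - n * B"
    unfolding cubic_form_def f2 A_def B_def by algebra
  have n': "cubic_form 0 m n (coords x u (u' 3)) (coords x u (u' 3)) (coords x u (u' 3)) = \<epsilon> * (m * B + n * A)"
    unfolding cubic_form_def f2 A_def B_def e(1,2) using e(3) by algebra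
  have "nform x u' (h x (K x (u' 1) (u' 1)) (u' 1) / 2) (h x (K x (u' 2) (u' 2)) (u' 2)) (h x (K x (u' 3) (u' 3)) (u' 3))
    (h x (S x (u' 1)) (u' 1)) (h x (S x (u' 2)) (u' 2))"
  proof (rule nformI[OF x u'])
    show "h x (K x (u' 1) (u' 1)) (u' 2) = 0" "h x (K x (u' 1) (u' 1)) (u' 3) = 0"
      unfolding C cubic_form_def f1 f2 pq1 by simp_all
    show "h x (K x (u' 1) (u' 2)) (u' 3) = 0"
      unfolding C cubic_form_def f1 f2 pq1 using pq(3) by simp
    have "h x (K x (u' 1) (u' 2)) (u' 2) = - (l * s)"
      unfolding C cubic_form_def f1 f2 pq1 using pq(1) by simp
    moreover have "h x (K x (u' 1) (u' 3)) (u' 3) = - (l * s)"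
      unfolding C cubic_form_def f1 f2 pq1 using pq(2) by simp
    ultimately show "h x (K x (u' 1) (u' 2)) (u' 2) = h x (K x (u' 1) (u' 3)) (u' 3)"
      by simp
    show "h x (S x (u' 1)) (u' 2) = 0" "h x (S x (u' 1)) (u' 3) = 0" "h x (S x (u' 2)) (u' 3) = 0"
      "h x (S x (u' 2)) (u' 2) = h x (S x (u' 3)) (u' 3)"
      unfolding SS diag_form_def f1 f2 pq1 using pq by simp_all
  qed
  moreover have "h x (K x (u' 1) (u' 1)) (u' 1) / 2 = s * l"
    unfolding C cubic_form_def f1 using s2 by simp
  moreover have "h x (K x (u' 2) (u' 2)) (u' 2) = m * A - n * B"
    unfolding C m'[symmetric] by (simp add: cubic_form_def f2 pq1)
  moreover have "h x (K x (u' 3) (u' 3)) (u' 3) = \<epsilon> * (m * B + n * A)"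
    unfolding C n'[symmetric] by (simp add: cubic_form_def f2 pq1)
  moreover have "h x (S x (u' 1)) (u' 1) = a" "h x (S x (u' 2)) (u' 2) = b"
    unfolding SS diag_form_def f1 f2 pq1 using s2 pq(1) by simp_all
  moreover have "(m * A - n * B)\<^sup>2 + (\<epsilon> * (m * B + n * A))\<^sup>2 = m\<^sup>2 + n\<^sup>2"
    using AB e(3) by algebra
  ultimately show ?thesis
    unfolding m' n' by auto
qed

end

text \<open>Reduces the invariance of a symmetric trilinear form to its values on the diagonal,
  where explicit matrices are easier to check.\<close>

lemma cubic_form_polar:
  "cubic_form l m n v w r = (let q = \<lambda>v. cubic_form l m n v v v in
    (q (v + w + r) - q (v + w) - q (v + r) - q (w + r) + q v + q w + q r) / 6)"
  unfolding Let_def cubic_form_def by (simp add: algebra_simps)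

lemma diag_form_polar:
  "diag_form a b v w = (diag_form a b (v + w) (v + w) - diag_form a b v v - diag_form a b w w) / 2"
  unfolding diag_form_def by (simp add: algebra_simps)

text \<open>The rotation minus the identity has determinant \<open>(c - 1)^2 + s^2\<close>, which is
  nonzero; the identities multiply by its adjugate.\<close>

lemma rot_invariant_vector:
  fixes s c p q :: real
  assumes "c * p + s * q = p" "- s * p + c * q = q" "s \<noteq> 0"
  shows "p = 0 \<and> q = 0"
proof -
  have "((c - 1)\<^sup>2 + s\<^sup>2) * p = (c - 1) * (c * p + s * q - p) - s * (- s * p + c * q - q)"
    by algebra
  then have "((c - 1)\<^sup>2 + s\<^sup>2) * p = 0"
    unfolding assms(1,2) by simp
  moreover have "((c - 1)\<^sup>2 + s\<^sup>2) * q = s * (c * p + s * q - p) + (c - 1) * (- s * p + c * q - q)"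
    by algebra
  then have "((c - 1)\<^sup>2 + s\<^sup>2) * q = 0"
    unfolding assms(1,2) by simp
  moreover have "(c - 1)\<^sup>2 + s\<^sup>2 \<noteq> 0"
    using assms(3) by (simp add: sum_power2_eq_zero_iff)
  ultimately show ?thesis
    by (metis mult_eq_0_iff)
qed

text \<open>The trace-free part of a symmetric form turns by twice the angle, and this double turn
  is nontrivial when the sine of the angle is nonzero.\<close>

lemma rot_invariant_form:
  fixes s c A B F :: real
  assumes "c * c * A + 2 * c * s * F + s * s * B = A" "- (c * s * A) + (c * c - s * s) * F + c * s * B = F"
    "s \<noteq> 0" "c * c + s * s = 1"
  shows "A = B \<and> F = 0"
proof -
  have "s * (2 * c * F - s * (A - B)) = (c * c * A + 2 * c * s * F + s * s * B) - A * (c * c + s * s)"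
    by algebra
  then have "s * (2 * c * F - s * (A - B)) = 0"
    unfolding assms(1,4) by simp
  moreover have "s * (2 * s * F + c * (A - B)) = F * (c * c + s * s) - (- (c * s * A) + (c * c - s * s) * F + c * s * B)"
    by algebra
  then have "s * (2 * s * F + c * (A - B)) = 0"
    unfolding assms(2,4) by simp
  ultimately have "2 * c * F = s * (A - B)" "2 * s * F = - (c * (A - B))"
    using assms(3) by auto
  note CF = this
  have "(c * c + s * s) * (A - B) = s * (s * (A - B)) - c * (- (c * (A - B)))"
    by algebra
  then have "A - B = 0"
    unfolding CF[symmetric] assms(4) by simp
  moreover have "(c * c + s * s) * (2 * F) = c * (2 * c * F) + s * (2 * s * F)"
    by algebra
  then have "2 * F = 0"
    unfolding CF assms(4) by simp
  ultimately show ?thesis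
    by simp
qed

context hypersurface
begin

section \<open>From symmetry groups to normal forms\<close>

lemma onb_of_orthonormal:
  assumes x: "x \<in> \<Omega>" and o: "orthonormal (h x) [e1, e2, e3]"
  shows "onb (h x) (\<lambda>i::3. if i = 1 then e1 else if i = 2 then e2 else e3)"
proof -
  have a: "\<bar>h x e1 e1\<bar> = 1" "\<bar>h x e2 e2\<bar> = 1" "\<bar>h x e3 e3\<bar> = 1"
    "h x e1 e2 = 0" "h x e1 e3 = 0" "h x e2 e3 = 0" "h x e2 e1 = 0" "h x e3 e1 = 0" "h x e3 e2 = 0"
    using o[unfolded orthonormal_def, rule_format, of 0 0] o[unfolded orthonormal_def, rule_format, of 1 1]
      o[unfolded orthonormal_def, rule_format, of 2 2] o[unfolded orthonormal_def, rule_format, of 1 0]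
      o[unfolded orthonormal_def, rule_format, of 2 0] o[unfolded orthonormal_def, rule_format, of 2 1]
      o[unfolded orthonormal_def, rule_format, of 0 1] o[unfolded orthonormal_def, rule_format, of 0 2]
      o[unfolded orthonormal_def, rule_format, of 1 2]
    by simp_all
  have "h x v v = 1" if "\<bar>h x v v\<bar> = 1" for v
    using that pos[OF x, of v] h_zero(1)[OF x, of v] by (cases "v = 0") auto
  from this[OF a(1)] this[OF a(2)] this[OF a(3)] a(4-9) show ?thesis
    unfolding onb_def forall_3 by simp
qed

lemma sym_group_invariant:
  assumes "\<phi> \<in> sym_group \<Phi> \<xi> x"
  shows "h x (K x (\<phi> v) (\<phi> w)) (\<phi> r) = h x (K x v w) r" "h x (S x (\<phi> v)) (\<phi> w) = h x (S x v) w"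
  using assms unfolding sym_group_def by auto

lemma coords_sum:
  assumes "x \<in> \<Omega>" "onb (h x) u"
  shows "coords x u (\<Sum>i\<in>UNIV. c $ i *\<^sub>R u i) = c"
proof -
  have "(\<Sum>i\<in>UNIV. c $ i * h x (u i) (u j)) = (\<Sum>i\<in>UNIV. if i = j then c $ i else 0)" for j
    using assms(2) by (intro sum.cong) (auto simp: onb_def)
  then show ?thesis
    using assms(1) by (simp add: coords_def vec_eq_iff)
qed

text \<open>Produces symmetries from explicit matrices in normal coordinates. These serve to show
  that degenerate parameters would make the symmetry group too large.\<close>

lemma sym_group_memI:
  fixes M :: "real^3^3"
  assumes x: "x \<in> \<Omega>" and nf: "nform x u l m n a b" and det: "det M > 0"
    and M: "\<And>v. diag_form 1 1 (M *v v) (M *v v) = diag_form 1 1 v v"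
      "\<And>v. cubic_form l m n (M *v v) (M *v v) (M *v v) = cubic_form l m n v v v"
      "\<And>v. diag_form a b (M *v v) (M *v v) = diag_form a b v v"
  shows "\<exists>\<phi>\<in>sym_group \<Phi> \<xi> x. \<forall>v. coords x u (\<phi> v) = M *v coords x u v"
proof -
  note u = nform_comp(3)[OF nf]
  have C: "h x (K x v w) r = cubic_form l m n (coords x u v) (coords x u w) (coords x u r)"
    and SS: "h x (S x v) w = diag_form a b (coords x u v) (coords x u w)" for v w r
    using nf unfolding nform_def by blast+
  have M2: "diag_form c d (M *v v) (M *v w) = diag_form c d v w"
    if "\<And>v. diag_form c d (M *v v) (M *v v) = diag_form c d v v" for c d v w
    using diag_form_polar[of c d "M *v v" "M *v w"] diag_form_polar[of c d v w] that[of v] that[of w] that[of "v + w"]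
    by (simp only: matrix_vector_right_distrib)
  have M3: "cubic_form l m n (M *v v) (M *v w) (M *v r) = cubic_form l m n v w r" for v w r
    using cubic_form_polar[of l m n "M *v v" "M *v w" "M *v r"] cubic_form_polar[of l m n v w r]
      M(2)[of v] M(2)[of w] M(2)[of r] M(2)[of "v + w"] M(2)[of "v + r"] M(2)[of "w + r"] M(2)[of "v + w + r"]
    by (simp only: matrix_vector_right_distrib Let_def)
  define L where "L c = (\<Sum>i\<in>UNIV. c $ i *\<^sub>R u i)" for c :: "real^3"
  define \<phi> where "\<phi> v = L (M *v coords x u v)" for v
  have cL: "coords x u (L c) = c" for c
    unfolding L_def by (rule coords_sum[OF x u])
  have cp: "coords x u (\<phi> v) = M *v coords x u v" for v
    by (simp add: \<phi>_def cL)
  have lL: "linear L"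
    by (intro linearI) (simp_all add: L_def sum.distrib scaleR_add_left scaleR_sum_right)
  have lc: "linear (coords x u)"
    by (intro linearI) (simp_all add: coords_lin[OF x])
  have lp: "linear \<phi>"
    by (intro linearI) (simp_all add: \<phi>_def coords_lin[OF x] matrix_vector_right_distrib
        linear_add[OF lL] linear_scale[OF lL] matrix_vector_mult_scaleR)
  have hp: "h x (\<phi> v) (\<phi> w) = h x v w" for v w
    unfolding h_expand[OF x u] cp by (rule M2[OF M(1)])
  have "inj \<phi>"
    unfolding linear_injective_0[OF lp] using hp pos[OF x] by (metis h_zero(1) less_irrefl x)
  then have "surj \<phi>"
    using linear_injective_imp_surjective[OF lp] by simp
  have eq: "v = w" if "\<And>r. h x v (\<phi> r) = h x w (\<phi> r)" for v w
    using that \<open>surj \<phi>\<close> by (intro h_eqI[OF x]) (metis surj_def)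
  have "K x (\<phi> v) (\<phi> w) = \<phi> (K x v w)" for v w
    by (rule eq) (simp only: hp C cp M3)
  moreover have "S x (\<phi> v) = \<phi> (S x v)" for v
    by (rule eq) (simp only: hp SS cp M2[OF M(3)])
  moreover have "det (matrix \<phi>) > 0"
  proof -
    \<comment> \<open>\<open>L\<close> is invertible and intertwines \<open>\<phi>\<close> with
      multiplication by \<open>M\<close>, so the two determinants agree.\<close>
    have "matrix (coords x u \<circ> L) = matrix (coords x u) ** matrix L"
      by (rule matrix_compose[OF lL lc])
    moreover have "coords x u \<circ> L = id"
      using cL by (simp add: fun_eq_iff)
    ultimately have d: "det (matrix (coords x u)) * det (matrix L) = 1"
      by (metis det_I det_mul matrix_id_mat_1)
    have "matrix (\<phi> \<circ> L) = matrix \<phi> ** matrix L"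
      by (rule matrix_compose[OF lL lp])
    moreover have "\<phi> \<circ> L = L \<circ> (\<lambda>c. M *v c)"
      by (simp add: fun_eq_iff \<phi>_def cL)
    moreover have "matrix (L \<circ> (\<lambda>c. M *v c)) = matrix L ** M"
      using matrix_compose[OF matrix_vector_mul_linear lL] by simp
    ultimately have "det (matrix \<phi>) * det (matrix L) = det (matrix L) * det M"
      by (metis det_mul)
    then show ?thesis
      using d det by auto
  qed
  ultimately have "\<phi> \<in> sym_group \<Phi> \<xi> x"
    using lp hp by (simp add: sym_group_def)
  then show ?thesis
    using cp by blast
qed

lemma rot_apply:
  assumes "onb g u"
  shows "rot g (u 1) (u 2) (u 3) \<theta> (u 1) = u 1"
    "rot g (u 1) (u 2) (u 3) \<theta> (u 2) = cos \<theta> *\<^sub>R u 2 + sin \<theta> *\<^sub>R u 3"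
    "rot g (u 1) (u 2) (u 3) \<theta> (u 3) = - sin \<theta> *\<^sub>R u 2 + cos \<theta> *\<^sub>R u 3"
  using assms by (simp_all add: rot_def onb_def)

text \<open>Invariance makes \<open>K(u 1, u 1, _)\<close> and \<open>S(u 1, _)\<close> invariant
  vectors of the plane, hence zero, and the restrictions of \<open>K(u 1, _, _)\<close> and
  \<open>S\<close> to the plane invariant forms, hence multiples of the metric. These are the
  hypotheses of \<open>nformI\<close>.\<close>

lemma rot_nform:
  assumes x: "x \<in> \<Omega>" and u: "onb (h x) u" and r: "rot (h x) (u 1) (u 2) (u 3) \<theta> \<in> sym_group \<Phi> \<xi> x"
    and "sin \<theta> \<noteq> 0"
  shows "\<exists>l m n a b. nform x u l m n a b"
proof -
  define c s where "c = cos \<theta>" and "s = sin \<theta>"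
  have cs: "c * c + s * s = 1" "s \<noteq> 0"
    using assms(4) sin_cos_squared_add2[of \<theta>] by (auto simp: c_def s_def power2_eq_square)
  define \<phi> where "\<phi> = rot (h x) (u 1) (u 2) (u 3) \<theta>"
  have p: "\<phi> (u 1) = u 1" "\<phi> (u 2) = c *\<^sub>R u 2 + s *\<^sub>R u 3" "\<phi> (u 3) = (- s) *\<^sub>R u 2 + c *\<^sub>R u 3"
    unfolding \<phi>_def c_def s_def using rot_apply[OF u] by simp_all
  note inv = sym_group_invariant[OF r, folded \<phi>_def]
  define t where "t i j k = h x (K x (u i) (u j)) (u k)" for i j k
  define z where "z i j = h x (S x (u i)) (u j)" for i j
  have ts: "t i j k = t j i k" "t i j k = t i k j" for i j k
    using K_sym[OF x] by (simp_all add: t_def)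
  have zs: "z i j = z j i" for i j
    using S_sym[OF x] by (simp add: z_def)
  note S_lin = linear_add[OF linear_S[OF x]] linear_scale[OF linear_S[OF x]]
  have 1: "t 1 1 2 = 0 \<and> t 1 1 3 = 0"
  proof (rule rot_invariant_vector[OF _ _ cs(2)])
    show "c * t 1 1 2 + s * t 1 1 3 = t 1 1 2" "- s * t 1 1 2 + c * t 1 1 3 = t 1 1 3"
      using inv(1)[of "u 1" "u 1" "u 2"] inv(1)[of "u 1" "u 1" "u 3"] by (simp_all only: p t_def h_add[OF x] h_scale[OF x])
  qed
  have 2: "t 1 2 2 = t 1 3 3 \<and> t 1 2 3 = 0"
  proof (rule rot_invariant_form[OF _ _ cs(2,1)])
    show "c * c * t 1 2 2 + 2 * c * s * t 1 2 3 + s * s * t 1 3 3 = t 1 2 2"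
      using inv(1)[of "u 1" "u 2" "u 2"] ts(2)[of 1 2 3]
      by (simp only: p t_def h_add[OF x] h_scale[OF x] K_lin[OF x]) (simp add: algebra_simps)
    show "- (c * s * t 1 2 2) + (c * c - s * s) * t 1 2 3 + c * s * t 1 3 3 = t 1 2 3"
      using inv(1)[of "u 1" "u 2" "u 3"] ts(2)[of 1 2 3]
      by (simp only: p t_def h_add[OF x] h_scale[OF x] K_lin[OF x]) (simp add: algebra_simps)
  qed
  have 3: "z 1 2 = 0 \<and> z 1 3 = 0"
  proof (rule rot_invariant_vector[OF _ _ cs(2)])
    show "c * z 1 2 + s * z 1 3 = z 1 2" "- s * z 1 2 + c * z 1 3 = z 1 3"
      using inv(2)[of "u 1" "u 2"] inv(2)[of "u 1" "u 3"] by (simp_all only: p z_def h_add[OF x] h_scale[OF x])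
  qed
  have 4: "z 2 2 = z 3 3 \<and> z 2 3 = 0"
  proof (rule rot_invariant_form[OF _ _ cs(2,1)])
    show "c * c * z 2 2 + 2 * c * s * z 2 3 + s * s * z 3 3 = z 2 2"
      using inv(2)[of "u 2" "u 2"] zs[of 2 3]
      by (simp only: p z_def h_add[OF x] h_scale[OF x] S_lin) (simp add: algebra_simps)
    show "- (c * s * z 2 2) + (c * c - s * s) * z 2 3 + c * s * z 3 3 = z 2 3"
      using inv(2)[of "u 2" "u 3"] zs[of 2 3]
      by (simp only: p z_def h_add[OF x] h_scale[OF x] S_lin) (simp add: algebra_simps)
  qed
  show ?thesis
    using nformI[OF x u] 1 2 3 4 unfolding t_def z_def by blast
qed

text \<open>Used for refutation: a matrix that preserves all the data but moves the axis would be a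
  symmetry outside the given group.\<close>

lemma sym_group_fixes_axis:
  assumes x: "x \<in> \<Omega>" and nf: "nform x u l m n a b" and det: "det M > 0"
    and M: "\<And>v. diag_form 1 1 (M *v v) (M *v v) = diag_form 1 1 v v"
      "\<And>v. cubic_form l m n (M *v v) (M *v v) (M *v v) = cubic_form l m n v v v"
      "\<And>v. diag_form a b (M *v v) (M *v v) = diag_form a b v v"
    and fixes_axis: "\<And>\<phi>. \<phi> \<in> sym_group \<Phi> \<xi> x \<Longrightarrow> \<phi> (u 1) = u 1"
  shows "M $ 1 $ 1 = 1"
proof -
  obtain \<phi> where p: "\<phi> \<in> sym_group \<Phi> \<xi> x" "\<And>v. coords x u (\<phi> v) = M *v coords x u v"
    using sym_group_memI[OF x nf det M] by blast
  have "M *v axis 1 1 = axis 1 1"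
    using p(2)[of "u 1"] fixes_axis[OF p(1)] coords_u[OF nform_comp(3)[OF nf], of 1] by simp
  then have "(M *v axis 1 1) $ 1 = axis 1 1 $ 1"
    by simp
  then show ?thesis
    by (simp add: matrix_vector_mult_def sum_3 axis_def)
qed

lemma SO2_nform:
  assumes x: "x \<in> \<Omega>" and "SO2_at \<Phi> \<xi> x"
  shows "\<exists>u l a b. nform x u l 0 0 a b \<and> (l \<noteq> 0 \<or> a \<noteq> b)"
proof -
  obtain e1 e2 e3 where o: "orthonormal (h x) [e1, e2, e3]"
    and grp: "sym_group \<Phi> \<xi> x = range (rot (h x) e1 e2 e3)"
    using assms(2) unfolding SO2_at_def by blast
  define u where "u = (\<lambda>i::3. if i = 1 then e1 else if i = 2 then e2 else e3)"
  have u: "onb (h x) u"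
    unfolding u_def by (rule onb_of_orthonormal[OF x o])
  have g: "sym_group \<Phi> \<xi> x = range (rot (h x) (u 1) (u 2) (u 3))"
    unfolding grp by (simp add: u_def)
  \<comment> \<open>The quarter turn has nonzero sine and yields the normal form; the half turn is
    minus the identity on the plane and kills the odd terms \<open>m\<close> and
    \<open>n\<close>.\<close>
  have "rot (h x) (u 1) (u 2) (u 3) (pi / 2) \<in> sym_group \<Phi> \<xi> x" and r: "rot (h x) (u 1) (u 2) (u 3) pi \<in> sym_group \<Phi> \<xi> x"
    unfolding g by blast+
  then obtain l m n a b where nf: "nform x u l m n a b"
    using rot_nform[OF x u, of "pi / 2"] by (metis sin_pi_half zero_neq_one)
  have "m = 0" "n = 0"
  proof -
    have rp: "rot (h x) (u 1) (u 2) (u 3) pi (u 2) = - u 2" "rot (h x) (u 1) (u 2) (u 3) pi (u 3) = - u 3"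
      using rot_apply(2,3)[OF u, of pi] by simp_all
    have "K x (- v) (- v) = K x v v" for v
      using K_lin(3)[OF x, of "-1" v "- v"] K_lin(4)[OF x, of v "-1" v] by simp
    then have "- h x (K x (u 2) (u 2)) (u 2) = h x (K x (u 2) (u 2)) (u 2)"
      "- h x (K x (u 3) (u 3)) (u 3) = h x (K x (u 3) (u 3)) (u 3)"
      using sym_group_invariant(1)[OF r, of "u 2" "u 2" "u 2"] sym_group_invariant(1)[OF r, of "u 3" "u 3" "u 3"] x
      unfolding rp by simp_all
    then show "m = 0" "n = 0"
      unfolding nform_comp(1)[OF nf] by (simp_all add: cubic_form_def axis_def)
  qed
  moreover have "l \<noteq> 0 \<or> a \<noteq> b"
  proof (rule ccontr)
    assume "\<not> (l \<noteq> 0 \<or> a \<noteq> b)"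
    then have ab: "l = 0" "a = b"
      by auto
    \<comment> \<open>The quarter turn of the plane of the first two axes: if \<open>K = 0\<close>
      and \<open>a = b\<close>, it is a symmetry that moves the axis.\<close>
    define M :: "real^3^3" where "M = vector [vector [0, -1, 0], vector [1, 0, 0], vector [0, 0, 1]]"
    have Mv: "(M *v v) $ 1 = - v $ 2" "(M *v v) $ 2 = v $ 1" "(M *v v) $ 3 = v $ 3" for v
      by (simp_all add: M_def matrix_vector_mult_def sum_3)
    have "M $ 1 $ 1 = 1"
    proof (rule sym_group_fixes_axis[OF x nf])
      show "det M > 0"
        by (simp add: M_def det_3)
      show "diag_form 1 1 (M *v v) (M *v v) = diag_form 1 1 v v" "diag_form a b (M *v v) (M *v v) = diag_form a b v v" for v
        by (simp_all add: diag_form_def Mv ab algebra_simps)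
      show "cubic_form l m n (M *v v) (M *v v) (M *v v) = cubic_form l m n v v v" for v
        by (simp add: cubic_form_def ab \<open>m = 0\<close> \<open>n = 0\<close>)
      show "\<phi> (u 1) = u 1" if "\<phi> \<in> sym_group \<Phi> \<xi> x" for \<phi>
        using that rot_apply(1)[OF u] unfolding g by auto
    qed
    then show False
      by (simp add: M_def)
  qed
  ultimately show ?thesis
    using nf by blast
qed

text \<open>The planar cubic has weight three, so turning the basis by a third of the phase
  \<open>\<alpha>\<close> of \<open>(m, n)\<close> makes the second parameter vanish.\<close>

lemma nform_rotate:
  assumes x: "x \<in> \<Omega>" and nf: "nform x u l m n a b" and s: "s = 1 \<or> s = -1"
    and mn: "m = R * cos \<alpha>" "n = R * sin \<alpha>"
    and u'i: "u' 1 = s *\<^sub>R u 1" "u' 2 = cos (\<alpha> / 3) *\<^sub>R u 2 - sin (\<alpha> / 3) *\<^sub>R u 3"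
      "u' 3 = sin (\<alpha> / 3) *\<^sub>R u 2 + cos (\<alpha> / 3) *\<^sub>R u 3"
  shows "nform x u' (s * l) R 0 a b"
proof -
  note u = nform_comp(3)[OF nf]
  define c d where "c = cos (\<alpha> / 3)" and "d = - sin (\<alpha> / 3)"
  have cd: "c * c + d * d = 1"
    using sin_cos_squared_add2[of "\<alpha> / 3"] by (simp add: c_def d_def power2_eq_square)
  have c3: "c ^ 3 - 3 * c * d\<^sup>2 = cos \<alpha>"
  proof -
    have "cos \<alpha> = 4 * c ^ 3 - 3 * c"
      using cos_treble_cos[of "\<alpha> / 3"] by (simp add: c_def)
    then show ?thesis
      using cd by algebra
  qed
  have s3: "3 * d * c\<^sup>2 - d ^ 3 = - sin \<alpha>"
  proof -
    have "sin \<alpha> = sin (2 * (\<alpha> / 3) + \<alpha> / 3)"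
      by simp
    also have "\<dots> = - (3 * d * c\<^sup>2 - d ^ 3)"
      unfolding sin_add sin_double cos_double c_def d_def by algebra
    finally show ?thesis by simp
  qed
  have u'i: "u' 1 = s *\<^sub>R u 1" "u' 2 = c *\<^sub>R u 2 + d *\<^sub>R u 3" "u' 3 = (- d) *\<^sub>R u 2 + c *\<^sub>R u 3"
    using u'i by (simp_all add: c_def d_def)
  have hu: "h x (u i) (u j) = (if i = j then 1 else 0)" for i j
    using u by (simp add: onb_def)
  have "onb (h x) u'"
    unfolding onb_def forall_3 u'i using s cd
    by (auto simp: h_add[OF x] h_scale[OF x] h_diff[OF x] h_minus[OF x] hu algebra_simps)
  from nform_change[OF x nf this u'i(1)] obtain m' n' where nf': "nform x u' (s * l) m' n' a b"
    and m': "m' = cubic_form 0 m n (coords x u (u' 2)) (coords x u (u' 2)) (coords x u (u' 2))"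
    and n': "n' = cubic_form 0 m n (coords x u (u' 3)) (coords x u (u' 3)) (coords x u (u' 3))"
    by blast
  have co: "coords x u (u' 2) = vector [0, c, d]" "coords x u (u' 3) = vector [0, - d, c]"
    unfolding vec_eq_iff forall_3 u'i by (simp_all add: coords_def x hu)
  have "m' = m * (c ^ 3 - 3 * c * d\<^sup>2) - n * (3 * d * c\<^sup>2 - d ^ 3)"
    unfolding m' co cubic_form_def vector_3 by algebra
  also have "\<dots> = R * (cos \<alpha> * cos \<alpha> + sin \<alpha> * sin \<alpha>)"
    unfolding c3 s3 mn by algebra
  finally have "m' = R"
    using sin_cos_squared_add2[of \<alpha>] by (simp add: power2_eq_square)
  moreover have "n' = m * (3 * d * c\<^sup>2 - d ^ 3) + n * (c ^ 3 - 3 * c * d\<^sup>2)"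
    unfolding n' co cubic_form_def vector_3 by algebra
  then have "n' = 0"
    unfolding c3 s3 mn by simp
  ultimately show ?thesis
    using nf' by simp
qed

lemma nform_normalize:
  assumes x: "x \<in> \<Omega>" and nf: "nform x u l m n a b" and s: "s = 1 \<or> s = -1"
  shows "\<exists>u'. u' 1 = s *\<^sub>R u 1 \<and> nform x u' (s * l) (sqrt (m\<^sup>2 + n\<^sup>2)) 0 a b"
proof -
  define R where "R = sqrt (m\<^sup>2 + n\<^sup>2)"
  obtain \<alpha> where \<alpha>: "m = R * cos \<alpha>" "n = R * sin \<alpha>"
  proof (cases "R = 0")
    case True
    then show ?thesis
      using that[of 0] by (auto simp: R_def real_sqrt_eq_zero_cancel_iff sum_power2_eq_zero_iff)
  next
    case False
    have "R\<^sup>2 = m\<^sup>2 + n\<^sup>2"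
      by (simp add: R_def)
    moreover from this have "m\<^sup>2 + n\<^sup>2 \<noteq> 0"
      using False by (metis zero_eq_power2)
    ultimately have "(m / R)\<^sup>2 + (n / R)\<^sup>2 = 1"
      using False by (simp add: power_divide add_divide_distrib[symmetric] del: sum_power2_eq_zero_iff)
    then obtain \<alpha> where "m / R = cos \<alpha>" "n / R = sin \<alpha>"
      using sincos_total_2pi by metis
    then show ?thesis
      using that[of \<alpha>] False by (simp add: field_simps)
  qed
  define u' where "u' = (\<lambda>i::3. if i = 1 then s *\<^sub>R u 1 else if i = 2 then cos (\<alpha> / 3) *\<^sub>R u 2 - sin (\<alpha> / 3) *\<^sub>R u 3
      else sin (\<alpha> / 3) *\<^sub>R u 2 + cos (\<alpha> / 3) *\<^sub>R u 3)"
  have "nform x u' (s * l) R 0 a b"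
    by (rule nform_rotate[OF x nf s \<alpha>]) (simp_all add: u'_def)
  moreover have "u' 1 = s *\<^sub>R u 1"
    by (simp add: u'_def)
  ultimately show ?thesis
    unfolding R_def by blast
qed

text \<open>If a claimed inequality fails, there is a symmetry outside the group of order three: the
  half turn about the axis for \<open>m = 0\<close>, a half turn about the second vector for
  \<open>l = 0\<close>, and an element of the tetrahedral group for \<open>m^2 = 2 l^2\<close> and
  \<open>a = b\<close>.\<close>

lemma Z3_nform:
  assumes x: "x \<in> \<Omega>" and "Z3_at \<Phi> \<xi> x"
  shows "\<exists>u l m a b. nform x u l m 0 a b \<and> l > 0 \<and> m > 0 \<and> (m\<^sup>2 = 2 * l\<^sup>2 \<longrightarrow> a \<noteq> b)"
proof -
  obtain e1 e2 e3 where o: "orthonormal (h x) [e1, e2, e3]"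
    and grp: "sym_group \<Phi> \<xi> x = range (\<lambda>k::nat. rot (h x) e1 e2 e3 (2 * pi / 3) ^^ k)"
    using assms(2) unfolding Z3_at_def by blast
  define u where "u = (\<lambda>i::3. if i = 1 then e1 else if i = 2 then e2 else e3)"
  have u: "onb (h x) u"
    unfolding u_def by (rule onb_of_orthonormal[OF x o])
  define r where "r = rot (h x) (u 1) (u 2) (u 3) (2 * pi / 3)"
  have g: "sym_group \<Phi> \<xi> x = range (\<lambda>k::nat. r ^^ k)"
    unfolding grp by (simp add: u_def r_def)
  have "r ^^ 1 \<in> sym_group \<Phi> \<xi> x"
    unfolding g by (rule rangeI)
  then have rg: "r \<in> sym_group \<Phi> \<xi> x"
    by simp
  have cs: "cos (2 * pi / 3) = - 1 / 2" "sin (2 * pi / 3) = sqrt 3 / 2"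
    using cos_120 sin_120 by (simp_all add: mult.commute)
  obtain l0 m0 n0 a b where nf0: "nform x u l0 m0 n0 a b"
    using rot_nform[OF x u rg[unfolded r_def]] cs by auto
  have fix1: "\<phi> (u 1) = u 1" if \<phi>: "\<phi> \<in> sym_group \<Phi> \<xi> x" for \<phi>
  proof -
    obtain k where "\<phi> = r ^^ k"
      using \<phi> unfolding g by blast
    moreover have "(r ^^ k) (u 1) = u 1"
      by (induction k) (simp_all add: r_def rot_apply(1)[OF u])
    ultimately show ?thesis by simp
  qed
  have lr: "linear r"
    using rg by (simp add: sym_group_def)
  \<comment> \<open>The powers of \<open>r\<close> send \<open>u 2\<close> to three vectors at
    mutual angles of 120 degrees, none of them opposite to \<open>u 2\<close>. This is what excludes
    the half turn about the axis, which fixes \<open>u 1\<close>.\<close>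
  have r2: "h x (\<phi> (u 2)) (u 2) \<noteq> -1" if \<phi>: "\<phi> \<in> sym_group \<Phi> \<xi> x" for \<phi>
  proof -
    define w1 w2 where "w1 = (- 1 / 2) *\<^sub>R u 2 + (sqrt 3 / 2) *\<^sub>R u 3"
      and "w2 = (- 1 / 2) *\<^sub>R u 2 + (- (sqrt 3 / 2)) *\<^sub>R u 3"
    have ru: "r (u 2) = w1" "r (u 3) = (- (sqrt 3 / 2)) *\<^sub>R u 2 + (- 1 / 2) *\<^sub>R u 3"
      using rot_apply(2,3)[OF u, of "2 * pi / 3"] by (simp_all add: r_def cs w1_def)
    have rw1: "r w1 = w2"
    proof -
      have "r w1 = (- 1 / 2) *\<^sub>R w1 + (sqrt 3 / 2) *\<^sub>R ((- (sqrt 3 / 2)) *\<^sub>R u 2 + (- 1 / 2) *\<^sub>R u 3)"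
        unfolding w1_def linear_add[OF lr] linear_scale[OF lr] ru by (simp add: w1_def)
      also have "\<dots> = w2"
        unfolding vec_eq_iff w1_def w2_def by (simp add: field_simps)
      finally show ?thesis .
    qed
    have rw2: "r w2 = u 2"
    proof -
      have "r w2 = (- 1 / 2) *\<^sub>R w1 + (- (sqrt 3 / 2)) *\<^sub>R ((- (sqrt 3 / 2)) *\<^sub>R u 2 + (- 1 / 2) *\<^sub>R u 3)"
        unfolding w2_def linear_add[OF lr] linear_scale[OF lr] ru by (simp add: w1_def)
      also have "\<dots> = u 2"
        unfolding vec_eq_iff w1_def w2_def by (simp add: field_simps)
      finally show ?thesis .
    qed
    obtain k where "\<phi> = r ^^ k"
      using \<phi> unfolding g by blast
    moreover have "(r ^^ k) (u 2) = u 2 \<or> (r ^^ k) (u 2) = w1 \<or> (r ^^ k) (u 2) = w2"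
    proof (induction k)
      case (Suc k)
      then show ?case
        by (elim disjE) (simp_all add: ru rw1 rw2)
    qed simp
    ultimately have "\<phi> (u 2) = u 2 \<or> \<phi> (u 2) = w1 \<or> \<phi> (u 2) = w2"
      by simp
    moreover have "h x (u 2) (u 2) = 1" "h x (u 3) (u 2) = 0"
      using u by (simp_all add: onb_def)
    then have "h x (u 2) (u 2) = 1" "h x w1 (u 2) = - 1 / 2" "h x w2 (u 2) = - 1 / 2"
      unfolding w1_def w2_def by (simp_all add: h_add[OF x] h_scale[OF x] x)
    ultimately show ?thesis
      by auto
  qed
  define m where "m = sqrt (m0\<^sup>2 + n0\<^sup>2)"
  have "m > 0"
  proof (rule ccontr)
    assume "\<not> m > 0"
    then have mn: "m0 = 0" "n0 = 0"
      by (auto simp: m_def sum_power2_gt_zero_iff)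
    define M :: "real^3^3" where "M = vector [vector [1, 0, 0], vector [0, -1, 0], vector [0, 0, -1]]"
    have Mv: "(M *v v) $ 1 = v $ 1" "(M *v v) $ 2 = - v $ 2" "(M *v v) $ 3 = - v $ 3" for v
      by (simp_all add: M_def matrix_vector_mult_def sum_3)
    have "det M > 0"
      by (simp add: M_def det_3)
    moreover have "diag_form 1 1 (M *v v) (M *v v) = diag_form 1 1 v v" "diag_form a b (M *v v) (M *v v) = diag_form a b v v"
      "cubic_form l0 m0 n0 (M *v v) (M *v v) (M *v v) = cubic_form l0 m0 n0 v v v" for v
      by (simp_all add: diag_form_def cubic_form_def Mv mn)
    ultimately obtain \<phi> where p: "\<phi> \<in> sym_group \<Phi> \<xi> x" "\<And>v. coords x u (\<phi> v) = M *v coords x u v"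
      using sym_group_memI[OF x nf0, of M] by blast
    have "coords x u (\<phi> (u 2)) $ 2 = -1"
      unfolding p(2) Mv coords_u[OF u] by (simp add: axis_def)
    then show False
      using r2[OF p(1)] by (simp add: coords_def)
  qed
  \<comment> \<open>Reversing the axis changes the sign of \<open>l\<close>, so that
    \<open>l\<close> becomes nonnegative.\<close>
  define s :: real where "s = (if l0 < 0 then -1 else 1)"
  have s: "s = 1 \<or> s = -1"
    by (simp add: s_def)
  define l where "l = s * l0"
  have l0: "l \<ge> 0"
    by (simp add: l_def s_def)
  obtain u' where u'1: "u' 1 = s *\<^sub>R u 1" and nf: "nform x u' l m 0 a b"
    using nform_normalize[OF x nf0 s] unfolding m_def l_def by blast
  have fix1': "\<phi> (u' 1) = u' 1" if "\<phi> \<in> sym_group \<Phi> \<xi> x" for \<phi>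
  proof -
    have "linear \<phi>"
      using that by (simp add: sym_group_def)
    then show ?thesis
      unfolding u'1 using fix1[OF that] by (simp add: linear_scale)
  qed
  have "l \<noteq> 0"
  proof
    assume l: "l = 0"
    define M :: "real^3^3" where "M = vector [vector [-1, 0, 0], vector [0, 1, 0], vector [0, 0, -1]]"
    have Mv: "(M *v v) $ 1 = - v $ 1" "(M *v v) $ 2 = v $ 2" "(M *v v) $ 3 = - v $ 3" for v
      by (simp_all add: M_def matrix_vector_mult_def sum_3)
    have "M $ 1 $ 1 = 1"
    proof (rule sym_group_fixes_axis[OF x nf])
      show "det M > 0"
        by (simp add: M_def det_3)
      show "diag_form 1 1 (M *v v) (M *v v) = diag_form 1 1 v v" "diag_form a b (M *v v) (M *v v) = diag_form a b v v" for v
        by (simp_all add: diag_form_def Mv)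
      show "cubic_form l m 0 (M *v v) (M *v v) (M *v v) = cubic_form l m 0 v v v" for v
        by (simp add: cubic_form_def l Mv)
    qed (rule fix1')
    then show False
      by (simp add: M_def)
  qed
  moreover have "a \<noteq> b" if m2: "m\<^sup>2 = 2 * l\<^sup>2"
  proof
    assume ab: "a = b"
    \<comment> \<open>the cubic form is a multiple of \<open>xyz\<close> in suitable coordinates, with tetrahedral symmetry\<close>
    define k where "k = 2 * m / (3 * l)"
    have mk: "m = 3 / 2 * k * l"
      using \<open>l \<noteq> 0\<close> by (simp add: k_def)
    have "l\<^sup>2 * (k\<^sup>2 - 8 / 9) = 0"
      using m2 unfolding mk by algebra
    then have k: "k\<^sup>2 = 8 / 9"
      using \<open>l \<noteq> 0\<close> by simp
    \<comment> \<open>The first axis and \<open>(- 1 / 3, k, 0)\<close> are vertices of a regular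
      tetrahedron adapted to the cubic form; \<open>M\<close>, of trace \<open>-1\<close> and
      determinant \<open>1\<close>, is the half turn that exchanges them.\<close>
    define M :: "real^3^3" where "M = vector [vector [-1 / 3, k, 0], vector [k, 1 / 3, 0], vector [0, 0, -1]]"
    have Mv: "(M *v v) $ 1 = - (v $ 1) / 3 + k * v $ 2" "(M *v v) $ 2 = k * v $ 1 + v $ 2 / 3" "(M *v v) $ 3 = - v $ 3" for v
      by (simp_all add: M_def matrix_vector_mult_def sum_3)
    have "M $ 1 $ 1 = 1"
    proof (rule sym_group_fixes_axis[OF x nf])
      have "det M = 1 / 9 + k\<^sup>2"
        by (simp add: M_def det_3 power2_eq_square)
      then show "det M > 0"
        using k by simp
      have "diag_form c c (M *v v) (M *v v) = c * ((1 / 9 + k\<^sup>2) * (v $ 1 * v $ 1 + v $ 2 * v $ 2) + v $ 3 * v $ 3)" for c v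
        unfolding diag_form_def Mv by (simp add: power2_eq_square algebra_simps)
      then have d: "diag_form c c (M *v v) (M *v v) = diag_form c c v v" for c v
        unfolding k by (simp add: diag_form_def algebra_simps)
      show "diag_form 1 1 (M *v v) (M *v v) = diag_form 1 1 v v" "diag_form a b (M *v v) (M *v v) = diag_form a b v v" for v
        unfolding ab by (rule d)+
      show "cubic_form l m 0 (M *v v) (M *v v) (M *v v) = cubic_form l m 0 v v v" for v
      proof -
        \<comment> \<open>The difference of the two cubics is divisible by
          \<open>k^2 - 8 / 9\<close> as a polynomial; the long factor is the quotient.\<close>
        have "cubic_form l m 0 (M *v v) (M *v v) (M *v v) = cubic_form l m 0 v v v + l * (k\<^sup>2 - 8 / 9) *
          (3 / 2 * k\<^sup>2 * v $ 1 ^ 3 - 3 / 2 * k * (v $ 1)\<^sup>2 * v $ 2 + 2 * k * v $ 2 ^ 3 + 7 / 3 * v $ 1 ^ 3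
            - 7 / 2 * v $ 1 * (v $ 2)\<^sup>2 - 9 / 2 * v $ 1 * (v $ 3)\<^sup>2)"
          unfolding cubic_form_def Mv mk by (simp add: power2_eq_square power3_eq_cube divide_simps)
            (simp add: algebra_simps)
        then show ?thesis
          using k by simp
      qed
    qed (rule fix1')
    then show False
      by (simp add: M_def)
  qed
  ultimately show ?thesis
    using nf l0 \<open>m > 0\<close> by (intro exI[of _ u'] exI[of _ l] exI[of _ m] exI[of _ a] exI[of _ b]) auto
qed

end

section \<open>Smooth adapted frames\<close>

text \<open>Expanding \<open>F\<close> in one basis and \<open>F'\<close> in the other leads to the
  same double sum.\<close>

lemma parseval:
  fixes g :: "real^3 \<Rightarrow> real^3 \<Rightarrow> real" and F F' :: "real^3 \<Rightarrow> real"
  assumes g: "bilinear g" "\<And>v w. g v w = g w v" and f: "onb g f" and u: "onb g u"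
    and F: "linear F" "linear F'"
  shows "(\<Sum>k\<in>UNIV. F (f k) * F' (f k)) = (\<Sum>s\<in>UNIV. F (u s) * F' (u s))"
proof -
  have F1: "F (f k) = (\<Sum>s\<in>UNIV. g (f k) (u s) * F (u s))" for k
    using arg_cong[OF onb_expand[OF g(1) u, of "f k"], of F] by (simp add: linear_sum[OF F(1)] linear_scale[OF F(1)])
  have F2: "F' (u s) = (\<Sum>k\<in>UNIV. g (f k) (u s) * F' (f k))" for s
    using arg_cong[OF onb_expand[OF g(1) f, of "u s"], of F'] g(2)[of _ "u s"]
    by (simp add: linear_sum[OF F(2)] linear_scale[OF F(2)])
  have "(\<Sum>k\<in>UNIV. F (f k) * F' (f k)) = (\<Sum>k\<in>UNIV. \<Sum>s\<in>UNIV. F (u s) * (g (f k) (u s) * F' (f k)))"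
    unfolding F1 sum_distrib_right by (intro sum.cong refl) (simp add: mult.commute mult.left_commute)
  also have "\<dots> = (\<Sum>s\<in>UNIV. F (u s) * (\<Sum>k\<in>UNIV. g (f k) (u s) * F' (f k)))"
    by (subst sum.swap) (simp add: sum_distrib_left)
  finally show ?thesis
    unfolding F2[symmetric] .
qed

lemma open_Collect_pos:
  fixes g :: "'a::topological_space \<Rightarrow> real"
  assumes "open U" "continuous_on U g"
  shows "open {x \<in> U. g x > 0}"
proof -
  have "{x \<in> U. g x > 0} = U \<inter> g -` {0<..}"
    by auto
  then show ?thesis
    using continuous_open_preimage[OF assms(2,1) open_greaterThan] by simp
qed

text \<open>A symmetric matrix with a double eigenvalue: \<open>\<delta>\<close> and the projection onto the axis \<open>A\<close> are
  rational functions of its trace-free part \<open>Z\<close>.\<close>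

lemma axis_matrix:
  fixes A :: "3 \<Rightarrow> real" and Z :: "3 \<Rightarrow> 3 \<Rightarrow> real"
  assumes "(\<Sum>i\<in>UNIV. A i * A i) = 1" and Z: "\<And>i j. Z i j = \<delta> * (3 * A i * A j - (if i = j then 1 else 0))"
  shows "(\<Sum>i\<in>UNIV. \<Sum>j\<in>UNIV. Z i j * Z i j) = 6 * \<delta>\<^sup>2"
    "(\<Sum>i\<in>UNIV. \<Sum>j\<in>UNIV. \<Sum>k\<in>UNIV. Z i j * Z j k * Z k i) = 6 * \<delta> ^ 3"
proof -
  have A: "A 1 * A 1 + A 2 * A 2 + A 3 * A 3 = 1"
    using assms(1) by (simp add: sum_3)
  \<comment> \<open>\<open>Z\<close> has eigenvalues \<open>2 \<delta>\<close> and
    \<open>- \<delta>\<close>, so \<open>Z^2 = \<delta> Z + 2 \<delta>^2\<close>. With trace zero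
    this determines the traces of \<open>Z^2\<close> and \<open>Z^3\<close>.\<close>
  have ZZ: "(\<Sum>j\<in>UNIV. Z i j * Z j k) = \<delta> * Z i k + 2 * \<delta>\<^sup>2 * (if i = k then 1 else 0)" for i k
  proof -
    have "(\<Sum>j\<in>UNIV. Z i j * Z j k) = \<delta>\<^sup>2 * (9 * A i * A k * (\<Sum>j\<in>UNIV. A j * A j)
        - 3 * A i * (\<Sum>j\<in>UNIV. A j * (if j = k then 1 else 0)) - 3 * A k * (\<Sum>j\<in>UNIV. (if i = j then 1 else 0) * A j)
        + (\<Sum>j\<in>UNIV. (if i = j then 1 else 0) * (if j = k then 1 else 0)))"
      unfolding Z sum_3 by (simp add: power2_eq_square algebra_simps)
    also have "(\<Sum>j\<in>UNIV. A j * (if j = k then 1 else 0)) = A k"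
      using exhaust_3[of k] by (auto simp: sum_3)
    also have "(\<Sum>j\<in>UNIV. (if i = j then 1 else 0) * A j) = A i"
      using exhaust_3[of i] by (auto simp: sum_3)
    also have "(\<Sum>j\<in>UNIV. (if i = j then 1 else 0) * (if j = k then 1 else 0 :: real)) = (if i = k then 1 else 0)"
      using exhaust_3[of i] by (auto simp: sum_3)
    finally show ?thesis
      unfolding assms(1) Z by (simp add: power2_eq_square algebra_simps)
  qed
  have Zs: "Z i j = Z j i" for i j
    by (simp add: Z mult.commute mult.left_commute eq_commute)
  have t: "(\<Sum>i\<in>UNIV. Z i i) = 0"
  proof -
    have "(\<Sum>i\<in>UNIV. Z i i) = \<delta> * (3 * (A 1 * A 1 + A 2 * A 2 + A 3 * A 3) - 3)"
      unfolding Z sum_3 by (simp add: algebra_simps)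
    then show ?thesis
      unfolding A by simp
  qed
  have "(\<Sum>i\<in>UNIV. \<Sum>j\<in>UNIV. Z i j * Z i j) = (\<Sum>i\<in>UNIV. \<Sum>j\<in>UNIV. Z i j * Z j i)"
    using Zs by (intro sum.cong refl) metis
  also have "\<dots> = \<delta> * (\<Sum>i\<in>UNIV. Z i i) + 6 * \<delta>\<^sup>2"
    unfolding ZZ by (simp add: sum.distrib sum_distrib_left)
  finally show 2: "(\<Sum>i\<in>UNIV. \<Sum>j\<in>UNIV. Z i j * Z i j) = 6 * \<delta>\<^sup>2"
    using t by simp
  have "(\<Sum>i\<in>UNIV. \<Sum>j\<in>UNIV. \<Sum>k\<in>UNIV. Z i j * Z j k * Z k i) = (\<Sum>i\<in>UNIV. \<Sum>k\<in>UNIV. (\<Sum>j\<in>UNIV. Z i j * Z j k) * Z k i)"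
    unfolding sum_distrib_right by (intro sum.cong refl sum.swap)
  also have "\<dots> = (\<Sum>i\<in>UNIV. \<Sum>k\<in>UNIV. \<delta> * (Z i k * Z i k) + 2 * \<delta>\<^sup>2 * ((if i = k then 1 else 0) * Z k i))"
    unfolding ZZ using Zs by (intro sum.cong refl) (simp add: algebra_simps)
  also have "\<dots> = \<delta> * (\<Sum>i\<in>UNIV. \<Sum>k\<in>UNIV. Z i k * Z i k) + 2 * \<delta>\<^sup>2 * (\<Sum>i\<in>UNIV. Z i i)"
    by (simp add: sum.distrib sum_distrib_left if_distrib[of "\<lambda>z. z * _"] if_distrib[of "\<lambda>z. _ * z"] cong: if_cong)
  finally show "(\<Sum>i\<in>UNIV. \<Sum>j\<in>UNIV. \<Sum>k\<in>UNIV. Z i j * Z j k * Z k i) = 6 * \<delta> ^ 3"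
    unfolding 2 t by (simp add: power2_eq_square power3_eq_cube)
qed

context hypersurface
begin

text \<open>The contraction of \<open>K\<close> with itself does not depend on the orthonormal
  basis, by \<open>parseval\<close> in each of the two summation indices, and is computed in the
  normal form. It is diagonal, with \<open>6 l^2\<close> on the axis and
  \<open>2 (l^2 + m^2 + n^2)\<close> on the plane.\<close>

lemma trace_form:
  assumes x: "x \<in> \<Omega>" and nf: "nform x u l m n a b" and f: "onb (h x) f"
  shows "(\<Sum>k\<in>UNIV. \<Sum>j\<in>UNIV. h x (K x v (f k)) (f j) * h x (K x w (f k)) (f j)) =
    (let p = coords x u v; q = coords x u w in
      6 * l\<^sup>2 * (p $ 1 * q $ 1) + 2 * (l\<^sup>2 + m\<^sup>2 + n\<^sup>2) * (p $ 2 * q $ 2 + p $ 3 * q $ 3))"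
proof -
  note u = nform_comp(3)[OF nf]
  note hs = \<Gamma>_h_sym(2)[OF x]
  have lh: "linear (\<lambda>r. h x s r)" for s
    using \<Gamma>_h_linear(2)[OF x] .
  have lk: "linear (\<lambda>r. h x (K x s r) t)" for s t
    by (intro linearI) (simp_all add: K_lin[OF x] x)
  have "(\<Sum>k\<in>UNIV. \<Sum>j\<in>UNIV. h x (K x v (f k)) (f j) * h x (K x w (f k)) (f j)) =
    (\<Sum>k\<in>UNIV. \<Sum>t\<in>UNIV. h x (K x v (f k)) (u t) * h x (K x w (f k)) (u t))"
    by (rule sum.cong[OF refl]) (rule parseval[OF bilin_h[OF x] hs f u lh lh])
  also have "\<dots> = (\<Sum>t\<in>UNIV. \<Sum>k\<in>UNIV. h x (K x v (f k)) (u t) * h x (K x w (f k)) (u t))"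
    by (rule sum.swap)
  also have "\<dots> = (\<Sum>t\<in>UNIV. \<Sum>s\<in>UNIV. h x (K x v (u s)) (u t) * h x (K x w (u s)) (u t))"
    by (rule sum.cong[OF refl]) (rule parseval[OF bilin_h[OF x] hs f u lk lk])
  finally have 1: "(\<Sum>k\<in>UNIV. \<Sum>j\<in>UNIV. h x (K x v (f k)) (f j) * h x (K x w (f k)) (f j)) = \<dots>" .
  have C: "h x (K x v (u s)) (u t) = cubic_form l m n (coords x u v) (axis s 1) (axis t 1)" for v s t
    using nf unfolding nform_def by (simp only: coords_u[OF u])
  show ?thesis
    unfolding 1 unfolding C sum_3 Let_def cubic_form_def
    by (simp add: axis_def power2_eq_square algebra_simps)
qed

text \<open>The trace form of \<open>K\<close> plus \<open>c\<close> times \<open>S\<close> is a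
  smooth tensor with a simple eigenvalue on the axis. By \<open>axis_matrix\<close> the projection
  onto the axis is rational in its components, and a normalized column of it spans the axis. Only
  the sign is ambiguous.\<close>

lemma smooth_axis:
  assumes p: "p \<in> \<Omega>" and nf0: "nform p u0 l0 m0 n0 a0 b0" and gen: "m0\<^sup>2 + n0\<^sup>2 \<noteq> 2 * l0\<^sup>2 \<or> a0 \<noteq> b0"
    and ex: "\<And>x. x \<in> \<Omega> \<Longrightarrow> \<exists>u l m n a b. nform x u l m n a b"
  shows "\<exists>V e1. open V \<and> p \<in> V \<and> V \<subseteq> \<Omega> \<and> smooth_on V e1 \<and> e1 p = u0 1 \<and>
    (\<forall>x\<in>V. \<forall>u l m n a b. nform x u l m n a b \<longrightarrow> (\<exists>s. (s = 1 \<or> s = -1) \<and> e1 x = s *\<^sub>R u 1))"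
proof -
  obtain f :: "3 \<Rightarrow> real^3 \<Rightarrow> real^3" where f: "\<And>i. smooth_on \<Omega> (f i)" "\<And>x. x \<in> \<Omega> \<Longrightarrow> onb (h x) (\<lambda>i. f i x)"
    using onb_exists by auto
  interpret f: frame \<Omega> \<Phi> \<xi> \<Omega> f
    by unfold_locales (auto simp: opn f)
  \<comment> \<open>\<open>S\<close> enters precisely when the eigenvalues of the trace form agree
    at \<open>p\<close>; then \<open>a0 \<noteq> b0\<close> separates them.\<close>
  define c :: real where "c = (if m0\<^sup>2 + n0\<^sup>2 \<noteq> 2 * l0\<^sup>2 then 0 else 1)"
  define T where "T i j x = (\<Sum>k\<in>UNIV. \<Sum>r\<in>UNIV. f.\<kappa> i k r x * f.\<kappa> j k r x) + c * f.\<sigma> i j x" for i j x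
  define Z where "Z i j x = T i j x - (if i = j then 1 else 0) * ((\<Sum>k\<in>UNIV. T k k x) / 3)" for i j x
  define t2 where "t2 x = (\<Sum>i\<in>UNIV. \<Sum>j\<in>UNIV. Z i j x * Z i j x)" for x
  define t3 where "t3 x = (\<Sum>i\<in>UNIV. \<Sum>j\<in>UNIV. \<Sum>k\<in>UNIV. Z i j x * Z j k x * Z k i x)" for x
  \<comment> \<open>\<open>t2 / t3\<close> equals \<open>1 / \<delta>\<close>, so this solves
    \<open>Z i j = \<delta> * (3 * A i * A j - ...)\<close> for the rank one matrix
    \<open>A i * A j\<close>.\<close>
  define P where "P i j x = (Z i j x * t2 x / t3 x + (if i = j then 1 else 0)) / 3" for i j x
  have sT: "smooth_on \<Omega> (T i j)" for i j
    unfolding T_def[abs_def] by (intro smooth_rules opn f.smooth_\<kappa> f.smooth_\<sigma>)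
  have sZ: "smooth_on \<Omega> (Z i j)" for i j
    unfolding Z_def[abs_def] by (intro smooth_rules opn sT) simp
  have st2: "smooth_on \<Omega> t2"
    unfolding t2_def[abs_def] by (intro smooth_rules opn sZ)
  have st3: "smooth_on \<Omega> t3"
    unfolding t3_def[abs_def] by (intro smooth_rules opn sZ)
  have main: "t2 x = 6 * \<delta>\<^sup>2 \<and> t3 x = 6 * \<delta> ^ 3 \<and> (\<forall>i j. Z i j x = \<delta> * (3 * A i * A j - (if i = j then 1 else 0)))
      \<and> (\<Sum>i\<in>UNIV. A i * A i) = 1 \<and> u 1 = (\<Sum>i\<in>UNIV. A i *\<^sub>R f i x)"
    if x: "x \<in> \<Omega>" and nf: "nform x u l m n a b" and A: "A = (\<lambda>i. h x (f i x) (u 1))"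
      and \<delta>: "\<delta> = (4 * l\<^sup>2 - 2 * (m\<^sup>2 + n\<^sup>2) + c * (a - b)) / 3" for x u l m n a b A \<delta>
  proof -
    note u = nform_comp(3)[OF nf]
    note fx = f(2)[OF x]
    have co: "coords x u (f i x) $ 1 = A i" for i
      by (simp add: coords_def A)
    have o: "diag_form 1 1 (coords x u (f i x)) (coords x u (f j x)) = (if i = j then 1 else 0)" for i j
      using fx h_expand[OF x u, of "f i x" "f j x"] by (simp add: onb_def)
    define \<beta> where "\<beta> = 2 * (l\<^sup>2 + m\<^sup>2 + n\<^sup>2) + c * b"
    have d3: "3 * \<delta> = 4 * l\<^sup>2 - 2 * (m\<^sup>2 + n\<^sup>2) + c * (a - b)"
      unfolding \<delta> by simp
    have T: "T i j x = 3 * \<delta> * A i * A j + \<beta> * (if i = j then 1 else 0)" for i j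
    proof -
      have "T i j x = (let p = coords x u (f i x); q = coords x u (f j x) in
          6 * l\<^sup>2 * (p $ 1 * q $ 1) + 2 * (l\<^sup>2 + m\<^sup>2 + n\<^sup>2) * (p $ 2 * q $ 2 + p $ 3 * q $ 3)
          + c * (a * (p $ 1 * q $ 1) + b * (p $ 2 * q $ 2 + p $ 3 * q $ 3)))"
        using nf unfolding T_def f.\<kappa>_def f.\<sigma>_def trace_form[OF x nf fx] Let_def nform_def diag_form_def by simp
      also have "\<dots> = 3 * \<delta> * A i * A j + \<beta> * diag_form 1 1 (coords x u (f i x)) (coords x u (f j x))"
        unfolding Let_def diag_form_def co \<beta>_def d3 by (simp add: algebra_simps)
      finally show ?thesis
        unfolding o .
    qed
    have uA: "u 1 = (\<Sum>i\<in>UNIV. A i *\<^sub>R f i x)"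
      unfolding A using f.expand[OF x, of "u 1"] \<Gamma>_h_sym(2)[OF x, of "u 1"] by simp
    have "h x (u 1) (u 1) = (\<Sum>i\<in>UNIV. A i * A i)"
      by (subst uA) (simp add: x A)
    then have A1: "(\<Sum>i\<in>UNIV. A i * A i) = 1"
      using u by (simp add: onb_def)
    have "(\<Sum>k\<in>UNIV. T k k x) / 3 = \<delta> * (\<Sum>i\<in>UNIV. A i * A i) + \<beta>"
      unfolding T sum_3 by (simp add: algebra_simps)
    then have Z: "Z i j x = \<delta> * (3 * A i * A j - (if i = j then 1 else 0))" for i j
      unfolding Z_def A1 T by (simp add: algebra_simps)
    show ?thesis
      using axis_matrix[of A "\<lambda>i j. Z i j x", OF A1 Z] Z A1 uA unfolding t2_def t3_def by blast
  qed
  have PA: "P i j x = A i * A j" if x: "x \<in> \<Omega>" and nf: "nform x u l m n a b" and A: "A = (\<lambda>i. h x (f i x) (u 1))"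
    and "t2 x > 0" for x u l m n a b A i j
  proof -
    define \<delta> where "\<delta> = (4 * l\<^sup>2 - 2 * (m\<^sup>2 + n\<^sup>2) + c * (a - b)) / 3"
    note mm = main[OF x nf A \<delta>_def]
    have "\<delta> \<noteq> 0"
      using mm \<open>t2 x > 0\<close> by auto
    then have "Z i j x * t2 x / t3 x = 3 * A i * A j - (if i = j then 1 else 0)"
      using mm by (simp add: power2_eq_square power3_eq_cube)
    then show ?thesis
      unfolding P_def by simp
  qed
  define V1 where "V1 = {x \<in> \<Omega>. t2 x > 0}"
  have oV1: "open V1"
    unfolding V1_def by (rule open_Collect_pos[OF opn smooth_on_continuous[OF st2]])
  have t3: "t3 x \<noteq> 0" if x: "x \<in> V1" for x
  proof -
    have x': "x \<in> \<Omega>" "t2 x > 0"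
      using x by (auto simp: V1_def)
    obtain u l m n a b where nf: "nform x u l m n a b"
      using ex[OF x'(1)] by blast
    show ?thesis
      using main[OF x'(1) nf refl refl] x'(2) by auto
  qed
  have sP: "smooth_on V1 (P i j)" for i j
    unfolding P_def[abs_def]
    by (intro smooth_rules oV1 t3 smooth_on_subset[OF sZ] smooth_on_subset[OF st2] smooth_on_subset[OF st3])
       (auto simp: V1_def)
  define A0 where "A0 = (\<lambda>i. h p (f i p) (u0 1))"
  note m0 = main[OF p nf0 A0_def refl]
  have "t2 p > 0"
  proof -
    have "(4 * l0\<^sup>2 - 2 * (m0\<^sup>2 + n0\<^sup>2) + c * (a0 - b0)) / 3 \<noteq> 0"
      using gen by (auto simp: c_def)
    then show ?thesis
      using m0 by simp
  qed
  then have pV1: "p \<in> V1"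
    using p by (simp add: V1_def)
  obtain j where j: "A0 j \<noteq> 0"
  proof -
    have "\<exists>j. A0 j \<noteq> 0"
    proof (rule ccontr)
      assume "\<not> ?thesis"
      then have "(\<Sum>i\<in>UNIV. A0 i * A0 i) = 0"
        by simp
      then show False
        using m0 by simp
    qed
    then show thesis
      using that by blast
  qed
  define V where "V = {x \<in> V1. P j j x > 0}"
  have oV: "open V"
    unfolding V_def by (rule open_Collect_pos[OF oV1 smooth_on_continuous[OF sP]])
  have VV: "V \<subseteq> V1" "V \<subseteq> \<Omega>"
    by (auto simp: V_def V1_def)
  have pV: "p \<in> V"
    using pV1 PA[OF p nf0 A0_def \<open>t2 p > 0\<close>, of j j] j by (simp add: V_def) (metis not_real_square_gt_zero)
  \<comment> \<open>\<open>sqrt (P j j)\<close> is the absolute value of \<open>A j\<close>, so the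
    sum is the axis vector times the sign of \<open>A j\<close>; the factor
    \<open>sgn (A0 j)\<close> makes it equal to \<open>u0 1\<close> at \<open>p\<close>.\<close>
  define e1 where "e1 x = sgn (A0 j) *\<^sub>R (\<Sum>i\<in>UNIV. (P i j x / sqrt (P j j x)) *\<^sub>R f i x)" for x
  have se1: "smooth_on V e1"
    unfolding e1_def[abs_def]
    by (intro smooth_rules oV smooth_on_subset[OF sP VV(1)] smooth_on_subset[OF f(1) VV(2)]) (auto simp: V_def)
  have e1: "e1 x = (sgn (A0 j) * sgn (A j)) *\<^sub>R u 1 \<and> A j \<noteq> 0"
    if x: "x \<in> V" and nf: "nform x u l m n a b" and A: "A = (\<lambda>i. h x (f i x) (u 1))" for x u l m n a b A
  proof -
    have x': "x \<in> \<Omega>" "t2 x > 0" "P j j x > 0"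
      using x by (auto simp: V_def V1_def)
    note PP = PA[OF x'(1) nf A x'(2)]
    have Aj: "A j \<noteq> 0"
      using x'(3) unfolding PP by auto
    have "sqrt (P j j x) = \<bar>A j\<bar>"
      unfolding PP by (rule real_sqrt_abs2)
    then have "P i j x / sqrt (P j j x) = sgn (A j) * A i" for i
      unfolding PP using Aj by (auto simp: abs_if sgn_if)
    then have "e1 x = sgn (A0 j) *\<^sub>R (\<Sum>i\<in>UNIV. (sgn (A j) * A i) *\<^sub>R f i x)"
      unfolding e1_def by simp
    also have "(\<Sum>i\<in>UNIV. (sgn (A j) * A i) *\<^sub>R f i x) = sgn (A j) *\<^sub>R u 1"
      using main[OF x'(1) nf A refl] by (simp add: scaleR_sum_right)
    finally show ?thesis
      using Aj by simp
  qed
  have "e1 p = u0 1"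
    using e1[OF pV nf0 A0_def] by (auto simp: sgn_if)
  moreover have "\<exists>s. (s = 1 \<or> s = -1) \<and> e1 x = s *\<^sub>R u 1" if "x \<in> V" "nform x u l m n a b" for x u l m n a b
    using e1[OF that refl] j by (intro exI[of _ "sgn (A0 j) * sgn (h x (f j x) (u 1))"]) (auto simp: sgn_if)
  ultimately show ?thesis
    using oV pV VV(2) se1 by (intro exI[of _ V] exI[of _ e1]) blast
qed

lemma nform_comps:
  assumes "nform x u l m n a b"
  shows "h x (K x (u 1) (u 1)) (u 1) = 2 * l" "h x (K x (u 2) (u 2)) (u 2) = m" "h x (K x (u 3) (u 3)) (u 3) = n"
    "h x (S x (u 1)) (u 1) = a" "h x (S x (u 2)) (u 2) = b"
  unfolding nform_comp[OF assms] by (simp_all add: cubic_form_def diag_form_def axis_def)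

text \<open>The axis field is completed by the constant vectors \<open>u0 2\<close> and
  \<open>u0 3\<close> and orthonormalized. By \<open>nform_change\<close> every completion has a
  normal form; \<open>l\<close> may change sign, and of \<open>m\<close> and \<open>n\<close> only
  \<open>m^2 + n^2\<close> is controlled.\<close>

lemma frame_along_axis:
  assumes p: "p \<in> \<Omega>" and nf0: "nform p u0 l0 m0 n0 a0 b0" and gen: "m0\<^sup>2 + n0\<^sup>2 \<noteq> 2 * l0\<^sup>2 \<or> a0 \<noteq> b0"
    and ex: "\<And>x. x \<in> \<Omega> \<Longrightarrow> \<exists>u l m n a b. nform x u l m n a b"
  shows "\<exists>V e. p \<in> V \<and> frame \<Omega> \<Phi> \<xi> V e \<and> (\<forall>i. e i p = u0 i) \<and>
    (\<forall>x\<in>V. \<forall>u l m n a b. nform x u l m n a b \<longrightarrow>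
      (\<exists>s m' n'. (s = 1 \<or> s = -1) \<and> nform x (\<lambda>i. e i x) (s * l) m' n' a b \<and> m'\<^sup>2 + n'\<^sup>2 = m\<^sup>2 + n\<^sup>2))"
proof -
  note u0 = nform_comp(3)[OF nf0]
  obtain V e1 where V: "open V" "p \<in> V" "V \<subseteq> \<Omega>" "smooth_on V e1" "e1 p = u0 1"
    and ax: "\<And>x u l m n a b. x \<in> V \<Longrightarrow> nform x u l m n a b \<Longrightarrow> \<exists>s. (s = 1 \<or> s = -1) \<and> e1 x = s *\<^sub>R u 1"
    using smooth_axis[OF assms] by metis
  \<comment> \<open>Nonzero at \<open>p\<close>, hence nearby, which keeps the three fields
    independent; its square is a positive function to which \<open>open_Collect_pos\<close>
    applies.\<close>
  define dt where "dt x = det (vector [e1 x, u0 2, u0 3] :: real^3^3)" for x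
  have "smooth_on V (\<lambda>x. vector [e1 x, u0 2, u0 3] $ i $ j :: real)" for i j :: 3
    using exhaust_3[of i] smooth_on_vec_nth[OF V(1,4)] by (auto intro: smooth_on_const)
  then have "smooth_on V dt"
    unfolding dt_def[abs_def] by (rule smooth_on_det[OF V(1)])
  define W where "W = {x \<in> V. dt x * dt x > 0}"
  have oW: "open W"
    unfolding W_def by (rule open_Collect_pos[OF V(1)])
      (rule smooth_on_continuous[OF smooth_on_mult[OF V(1) \<open>smooth_on V dt\<close> \<open>smooth_on V dt\<close>]])
  have WV: "W \<subseteq> V" "W \<subseteq> \<Omega>"
    using V(3) by (auto simp: W_def)
  have rows: "v v* (vector [r1, r2, r3] :: real^3^3) = (v $ 1) *\<^sub>R r1 + (v $ 2) *\<^sub>R r2 + (v $ 3) *\<^sub>R r3" for v r1 r2 r3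
    unfolding vec_eq_iff vector_matrix_mult_def sum_3 vec_lambda_beta vector_3 by (simp add: mult.commute)
  have ind: "c1 = 0 \<and> c2 = 0 \<and> c3 = 0" if d: "det (vector [r1, r2, r3] :: real^3^3) \<noteq> 0"
    and z: "c1 *\<^sub>R r1 + c2 *\<^sub>R r2 + c3 *\<^sub>R r3 = 0" for c1 c2 c3 r1 r2 r3
  proof -
    have "det (transpose (vector [r1, r2, r3] :: real^3^3)) \<noteq> 0"
      using d by (simp add: det_transpose)
    then have "\<forall>v. transpose (vector [r1, r2, r3] :: real^3^3) *v v = 0 \<longrightarrow> v = 0"
      unfolding invertible_det_nz[symmetric] invertible_left_inverse matrix_left_invertible_ker .
    then have "(vector [c1, c2, c3] :: real^3) = 0"
      using z by (metis rows transpose_matrix_vector vector_3)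
    then show ?thesis
      unfolding vec_eq_iff forall_3 by simp
  qed
  have ind_det: "det (vector [r1, r2, r3] :: real^3^3) \<noteq> 0"
    if z: "\<And>c1 c2 c3. c1 *\<^sub>R r1 + c2 *\<^sub>R r2 + c3 *\<^sub>R r3 = 0 \<Longrightarrow> c1 = 0 \<and> c2 = 0 \<and> c3 = 0" for r1 r2 r3
  proof -
    have "v = 0" if "transpose (vector [r1, r2, r3] :: real^3^3) *v v = 0" for v
    proof -
      have "(v $ 1) *\<^sub>R r1 + (v $ 2) *\<^sub>R r2 + (v $ 3) *\<^sub>R r3 = 0"
        using that by (simp add: rows)
      from z[OF this] show ?thesis
        unfolding vec_eq_iff forall_3 by simp
    qed
    then have "det (transpose (vector [r1, r2, r3] :: real^3^3)) \<noteq> 0"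
      unfolding invertible_det_nz[symmetric] invertible_left_inverse matrix_left_invertible_ker by blast
    then show ?thesis
      by (simp add: det_transpose)
  qed
  have "det (vector [u0 1, u0 2, u0 3] :: real^3^3) \<noteq> 0"
  proof (rule ind_det)
    fix c1 c2 c3 assume z: "c1 *\<^sub>R u0 1 + c2 *\<^sub>R u0 2 + c3 *\<^sub>R u0 3 = 0"
    have "h p (c1 *\<^sub>R u0 1 + c2 *\<^sub>R u0 2 + c3 *\<^sub>R u0 3) (u0 i) = 0" for i
      unfolding z using p by simp
    from this[of 1] this[of 2] this[of 3] show "c1 = 0 \<and> c2 = 0 \<and> c3 = 0"
      using u0 p by (simp add: onb_def)
  qed
  then have pW: "p \<in> W"
    using V(2,5) by (simp add: W_def dt_def) (metis not_real_square_gt_zero)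
  have on0: "orthonormal (h p) [e1 p, u0 2, u0 3]"
  proof -
    have "\<forall>i<3. \<forall>j<3. \<bar>h p ([u0 1, u0 2, u0 3] ! i) ([u0 1, u0 2, u0 3] ! j)\<bar> = (if i = j then 1 else 0)"
      unfolding numeral_3_eq_3 using u0 by (simp add: less_Suc_eq onb_def)
    then show ?thesis
      by (simp add: orthonormal_def V(5))
  qed
  have unit: "h x (e1 x) (e1 x) = 1" if x: "x \<in> W" for x
  proof -
    obtain u l m n a b where nf: "nform x u l m n a b"
      using ex x WV by blast
    obtain s where s: "s = 1 \<or> s = -1" "e1 x = s *\<^sub>R u 1"
      using ax[OF _ nf] x WV by blast
    show ?thesis
      unfolding s(2) using s(1) nform_comp(3)[OF nf] x WV(2) by (auto simp: onb_def subset_iff)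
  qed
  have indW: "c1 = 0 \<and> c2 = 0 \<and> c3 = 0" if "x \<in> W" "c1 *\<^sub>R e1 x + c2 *\<^sub>R u0 2 + c3 *\<^sub>R u0 3 = 0" for x c1 c2 c3
    by (rule ind[OF _ that(2)]) (use that(1) in \<open>auto simp: W_def dt_def\<close>)
  show ?thesis
  proof (rule gram_schmidt[OF oW WV(2) smooth_on_subset[OF V(4) WV(1)] smooth_on_const smooth_on_const indW])
    fix e :: "3 \<Rightarrow> real^3 \<Rightarrow> real^3"
    assume e: "\<And>i. smooth_on W (e i)" "\<And>x. x \<in> W \<Longrightarrow> onb (h x) (\<lambda>i. e i x)"
      "\<And>x. x \<in> W \<Longrightarrow> e 1 x = (1 / sqrt (h x (e1 x) (e1 x))) *\<^sub>R e1 x"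
      "\<And>x. x \<in> W \<Longrightarrow> orthonormal (h x) [e1 x, u0 2, u0 3] \<Longrightarrow> e 1 x = e1 x \<and> e 2 x = u0 2 \<and> e 3 x = u0 3"
    have fe: "frame \<Omega> \<Phi> \<xi> W e"
      by unfold_locales (auto simp: oW WV e)
    have ei: "\<forall>i. e i p = u0 i"
      unfolding forall_3 using e(4)[OF pW on0] V(5) by simp
    have nfx: "\<exists>s m' n'. (s = 1 \<or> s = -1) \<and> nform x (\<lambda>i. e i x) (s * l) m' n' a b \<and> m'\<^sup>2 + n'\<^sup>2 = m\<^sup>2 + n\<^sup>2"
      if x: "x \<in> W" and nf: "nform x u l m n a b" for x u l m n a b
    proof -
      obtain s where s: "s = 1 \<or> s = -1" "e1 x = s *\<^sub>R u 1"
        using ax[OF _ nf] x WV by blast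
      have "e 1 x = s *\<^sub>R u 1"
        using e(3)[OF x] unit[OF x] s(2) by simp
      then show ?thesis
        using nform_change[OF _ nf e(2)[OF x]] s(1) x WV(2) by blast
    qed
    show ?thesis
    proof (intro exI conjI)
      show "p \<in> W" "frame \<Omega> \<Phi> \<xi> W e" "\<forall>i. e i p = u0 i"
        by (rule pW fe ei)+
      show "\<forall>x\<in>W. \<forall>u l m n a b. nform x u l m n a b \<longrightarrow>
        (\<exists>s m' n'. (s = 1 \<or> s = -1) \<and> nform x (\<lambda>i. e i x) (s * l) m' n' a b \<and> m'\<^sup>2 + n'\<^sup>2 = m\<^sup>2 + n\<^sup>2)"
        using nfx by (intro ballI allI impI)
    qed
  qed
qed

text \<open>Vanishing of \<open>m^2 + n^2\<close> holds for every completion of the axis, so no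
  rotation in the plane has to be adjusted. The sign of \<open>l\<close> stays open.\<close>

lemma SO2_frame:
  assumes SO2: "\<And>x. x \<in> \<Omega> \<Longrightarrow> SO2_at \<Phi> \<xi> x" and p: "p \<in> \<Omega>"
  shows "\<exists>V e. p \<in> V \<and> frame \<Omega> \<Phi> \<xi> V e \<and> (\<forall>x\<in>V. \<exists>l a b. nform x (\<lambda>i. e i x) l 0 0 a b \<and> (l \<noteq> 0 \<or> a \<noteq> b))"
proof -
  obtain u0 l0 a0 b0 where nf0: "nform p u0 l0 0 0 a0 b0" "l0 \<noteq> 0 \<or> a0 \<noteq> b0"
    using SO2_nform[OF p SO2[OF p]] by blast
  have "\<exists>u l m n a b. nform x u l m n a b" if "x \<in> \<Omega>" for x
    using SO2_nform[OF that SO2[OF that]] by blast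
  moreover have "0\<^sup>2 + 0\<^sup>2 \<noteq> 2 * l0\<^sup>2 \<or> a0 \<noteq> b0"
    using nf0(2) by simp
  ultimately obtain V e where V: "p \<in> V" "frame \<Omega> \<Phi> \<xi> V e"
    and "\<forall>i. e i p = u0 i"
    and c: "\<forall>x\<in>V. \<forall>u l m n a b. nform x u l m n a b \<longrightarrow>
      (\<exists>s m' n'. (s = 1 \<or> s = -1) \<and> nform x (\<lambda>i. e i x) (s * l) m' n' a b \<and> m'\<^sup>2 + n'\<^sup>2 = m\<^sup>2 + n\<^sup>2)"
    using frame_along_axis[OF p nf0(1)] by blast
  have c: "\<And>x u l m n a b. x \<in> V \<Longrightarrow> nform x u l m n a b \<Longrightarrow>
      \<exists>s m' n'. (s = 1 \<or> s = -1) \<and> nform x (\<lambda>i. e i x) (s * l) m' n' a b \<and> m'\<^sup>2 + n'\<^sup>2 = m\<^sup>2 + n\<^sup>2"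
    for x u l m n a b
    using c by blast
  interpret fr: frame \<Omega> \<Phi> \<xi> V e
    by (rule V)
  have "\<exists>l a b. nform x (\<lambda>i. e i x) l 0 0 a b \<and> (l \<noteq> 0 \<or> a \<noteq> b)" if x: "x \<in> V" for x
  proof -
    obtain u l a b where nf: "nform x u l 0 0 a b" "l \<noteq> 0 \<or> a \<noteq> b"
      using SO2_nform[OF fr.in\<Omega>[OF x] SO2[OF fr.in\<Omega>[OF x]]] by blast
    obtain s m' n' where "s = 1 \<or> s = -1" "nform x (\<lambda>i. e i x) (s * l) m' n' a b" "m'\<^sup>2 + n'\<^sup>2 = 0\<^sup>2 + 0\<^sup>2"
      using c[OF x nf(1)] by blast
    moreover from this(3) have "m' = 0" "n' = 0"
      by (simp_all add: sum_power2_eq_zero_iff)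
    ultimately show ?thesis
      using nf(2) by (intro exI[of _ "s * l"] exI[of _ a] exI[of _ b]) auto
  qed
  then show ?thesis
    using V by blast
qed

text \<open>The frame along the axis has an uncontrolled phase of \<open>(m, n)\<close>; turning it
  by a third of that phase achieves \<open>n = 0\<close>, provided the phase is smooth.\<close>

lemma Z3_frame:
  assumes Z3: "\<And>x. x \<in> \<Omega> \<Longrightarrow> Z3_at \<Phi> \<xi> x" and p: "p \<in> \<Omega>"
  shows "\<exists>V e. p \<in> V \<and> frame \<Omega> \<Phi> \<xi> V e \<and>
    (\<forall>x\<in>V. \<exists>l m a b. nform x (\<lambda>i. e i x) l m 0 a b \<and> l > 0 \<and> m > 0 \<and> (m\<^sup>2 = 2 * l\<^sup>2 \<longrightarrow> a \<noteq> b))"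
proof -
  obtain u0 l0 m0 a0 b0 where nf0: "nform p u0 l0 m0 0 a0 b0" "l0 > 0" "m0 > 0" "m0\<^sup>2 = 2 * l0\<^sup>2 \<longrightarrow> a0 \<noteq> b0"
    using Z3_nform[OF p Z3[OF p]] by blast
  have "\<exists>u l m n a b. nform x u l m n a b" if "x \<in> \<Omega>" for x
    using Z3_nform[OF that Z3[OF that]] by blast
  moreover have "m0\<^sup>2 + 0\<^sup>2 \<noteq> 2 * l0\<^sup>2 \<or> a0 \<noteq> b0"
    using nf0(4) by simp
  ultimately obtain V e where V: "p \<in> V" "frame \<Omega> \<Phi> \<xi> V e" and ep: "\<forall>i. e i p = u0 i"
    and c: "\<forall>x\<in>V. \<forall>u l m n a b. nform x u l m n a b \<longrightarrow>
      (\<exists>s m' n'. (s = 1 \<or> s = -1) \<and> nform x (\<lambda>i. e i x) (s * l) m' n' a b \<and> m'\<^sup>2 + n'\<^sup>2 = m\<^sup>2 + n\<^sup>2)"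
    using frame_along_axis[OF p nf0(1)] by blast
  have c: "\<And>x u l m n a b. x \<in> V \<Longrightarrow> nform x u l m n a b \<Longrightarrow>
      \<exists>s m' n'. (s = 1 \<or> s = -1) \<and> nform x (\<lambda>i. e i x) (s * l) m' n' a b \<and> m'\<^sup>2 + n'\<^sup>2 = m\<^sup>2 + n\<^sup>2"
    for x u l m n a b
    using c by blast
  interpret fr: frame \<Omega> \<Phi> \<xi> V e
    by (rule V)
  define l m n where "l x = fr.\<kappa> 1 1 1 x / 2" and "m x = fr.\<kappa> 2 2 2 x" and "n x = fr.\<kappa> 3 3 3 x" for x
  have sl: "smooth_on V l" and sm: "smooth_on V m" and sn: "smooth_on V n"
    unfolding l_def[abs_def] m_def[abs_def] n_def[abs_def]
    by (intro smooth_rules fr.openV fr.smooth_\<kappa>; simp)+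
  have lmn: "l x = l' \<and> m x = m' \<and> n x = n'" if "nform x (\<lambda>i. e i x) l' m' n' a b" for x l' m' n' a b
    using nform_comps[OF that] by (simp add: l_def m_def n_def fr.\<kappa>_def)
  have "(\<lambda>i. e i p) = u0"
    using ep by blast
  with nf0(1) have "nform p (\<lambda>i. e i p) l0 m0 0 a0 b0"
    by simp
  from lmn[OF this] nf0(2,3) have lmp: "l p > 0" "m p > 0"
    by simp_all
  \<comment> \<open>Positive \<open>l\<close> excludes the reversed axis, and positive
    \<open>m\<close> keeps the phase of \<open>(m, n)\<close> within the range of
    \<open>arctan\<close>; both hold at \<open>p\<close>, where \<open>n\<close> vanishes.\<close>
  define W1 where "W1 = {x \<in> V. l x > 0}"
  define W where "W = {x \<in> W1. m x > 0}"
  have oW1: "open W1"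
    unfolding W1_def by (rule open_Collect_pos[OF fr.openV smooth_on_continuous[OF sl]])
  have WV: "W \<subseteq> V" "W \<subseteq> W1"
    by (auto simp: W_def W1_def)
  have "smooth_on W1 m"
    by (rule smooth_on_subset[OF sm]) (auto simp: W1_def)
  then have oW: "open W"
    unfolding W_def by (rule open_Collect_pos[OF oW1 smooth_on_continuous])
  have pW: "p \<in> W"
    using V(1) lmp by (simp add: W_def W1_def)
  define \<alpha> where "\<alpha> x = arctan (n x / m x)" for x
  have s\<alpha>: "smooth_on W \<alpha>"
    unfolding \<alpha>_def[abs_def]
    by (intro smooth_rules oW smooth_on_subset[OF sm WV(1)] smooth_on_subset[OF sn WV(1)]) (auto simp: W_def)
  define e' where "e' = (\<lambda>i::3. if i = 1 then e 1 else if i = 2 then (\<lambda>x. cos (\<alpha> x / 3) *\<^sub>R e 2 x - sin (\<alpha> x / 3) *\<^sub>R e 3 x)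
      else (\<lambda>x. sin (\<alpha> x / 3) *\<^sub>R e 2 x + cos (\<alpha> x / 3) *\<^sub>R e 3 x))"
  have e'i: "e' 1 = e 1" "e' 2 = (\<lambda>x. cos (\<alpha> x / 3) *\<^sub>R e 2 x - sin (\<alpha> x / 3) *\<^sub>R e 3 x)"
    "e' 3 = (\<lambda>x. sin (\<alpha> x / 3) *\<^sub>R e 2 x + cos (\<alpha> x / 3) *\<^sub>R e 3 x)"
    by (simp_all add: e'_def)
  have se': "smooth_on W (e' i)" for i
  proof -
    have se: "smooth_on W (e i)" for i
      by (rule smooth_on_subset[OF fr.smooth_e WV(1)])
    have s3: "smooth_on W (\<lambda>x. \<alpha> x / 3)"
      by (intro smooth_rules oW s\<alpha>) simp
    have "smooth_on W (e' 2)" "smooth_on W (e' 3)"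
      unfolding e'i by (intro smooth_rules oW s3 se)+
    then show ?thesis
      using exhaust_3[of i] se[of 1] e'i(1) by auto
  qed
  have nf: "\<exists>l m a b. nform x (\<lambda>i. e' i x) l m 0 a b \<and> l > 0 \<and> m > 0 \<and> (m\<^sup>2 = 2 * l\<^sup>2 \<longrightarrow> a \<noteq> b)" if x: "x \<in> W" for x
  proof -
    have x': "x \<in> \<Omega>" "x \<in> V"
      using x WV(1) fr.in\<Omega> by auto
    obtain u k m1 a b where nu: "nform x u k m1 0 a b" "k > 0" "m1 > 0" "m1\<^sup>2 = 2 * k\<^sup>2 \<longrightarrow> a \<noteq> b"
      using Z3_nform[OF x'(1) Z3[OF x'(1)]] by blast
    obtain s m' n' where s: "s = 1 \<or> s = -1" and ne: "nform x (\<lambda>i. e i x) (s * k) m' n' a b"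
      and mn: "m'\<^sup>2 + n'\<^sup>2 = m1\<^sup>2 + 0\<^sup>2"
      using c[OF x'(2) nu(1)] by blast
    have lx: "l x = s * k" "m x = m'" "n x = n'" "l x > 0" "m x > 0"
      using lmn[OF ne] x by (auto simp: W_def W1_def)
    then have "s = 1"
      using s nu(2) by auto
    define R where "R = m' * sqrt (1 + (n' / m')\<^sup>2)"
    have p1: "1 + (n' / m')\<^sup>2 > 0"
      by (simp add: add_pos_nonneg)
    have m'0: "m' > 0"
      using lx by simp
    have R: "m' = R * cos (\<alpha> x)" "n' = R * sin (\<alpha> x)"
      unfolding \<alpha>_def lx R_def cos_arctan sin_arctan using p1 m'0 by (simp_all add: field_simps)
    have "R > 0"
      using m'0 p1 by (simp add: R_def)
    have "R\<^sup>2 = m'\<^sup>2 + n'\<^sup>2"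
      using p1 m'0 by (simp add: R_def power_mult_distrib distrib_left power_divide)
    then have R2: "R\<^sup>2 = m1\<^sup>2"
      using mn by simp
    have "nform x (\<lambda>i. e' i x) (1 * (s * k)) R 0 a b"
      by (rule nform_rotate[OF x'(1) ne _ R]) (simp_all add: e'i)
    then have "nform x (\<lambda>i. e' i x) k R 0 a b"
      using \<open>s = 1\<close> by simp
    then show ?thesis
      using nu(2,4) \<open>R > 0\<close> R2 by (intro exI[of _ k] exI[of _ R] exI[of _ a] exI[of _ b]) auto
  qed
  have "frame \<Omega> \<Phi> \<xi> W e'"
  proof unfold_locales
    show "onb (h x) (\<lambda>i. e' i x)" if "x \<in> W" for x
      using nf[OF that] nform_comp(3) by blast
  qed (use oW WV fr.sub se' in auto)
  then show ?thesis
    using pW nf by blast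
qed

end

section \<open>The structure equations of the adapted frame\<close>

text \<open>Adding the Gauss equation with \<open>k\<close> and \<open>l\<close> exchanged cancels
  the derivatives of the Levi-Civita coefficients, by \<open>G_skew\<close>. What remains
  differentiates only \<open>\<kappa>\<close>: the Codazzi equation for \<open>K\<close>.\<close>

lemma (in frame) gauss_sym:
  assumes x: "x \<in> V"
  shows "2 * (D (\<kappa> j k l) x (e i x) - D (\<kappa> i k l) x (e j x))
    + (\<Sum>m\<in>UNIV. G j k m x * G i m l x + G j l m x * G i m k x - G i k m x * G j m l x - G i l m x * G j m k x)
    - ((if j = k then \<sigma> i l x else 0) + (if j = l then \<sigma> i k x else 0)
      - (if i = k then \<sigma> j l x else 0) - (if i = l then \<sigma> j k x else 0))
    = (\<Sum>m\<in>UNIV. (G i j m x - G j i m x) * (2 * \<kappa> m k l x))"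
proof -
  have d: "D (G i k l) x v + D (G i l k) x v = 2 * D (\<kappa> i k l) x v" for i v
  proof -
    have "D (G i k l) x v + D (G i l k) x v = D (\<lambda>y. G i k l y + G i l k y) x v"
      by (rule D_add[OF smooth_G smooth_G x, symmetric])
    also have "\<dots> = D (\<lambda>y. 2 * \<kappa> i k l y) x v"
      by (rule D_cong_open[OF openV x, THEN fun_cong]) (rule G_skew)
    finally show ?thesis
      by (simp add: D_mult[OF smooth_on_const smooth_\<kappa> x])
  qed
  have r: "(\<Sum>m\<in>UNIV. (G i j m x - G j i m x) * (2 * \<kappa> m k l x)) =
      (\<Sum>m\<in>UNIV. (G i j m x - G j i m x) * G m k l x) + (\<Sum>m\<in>UNIV. (G i j m x - G j i m x) * G m l k x)"
    unfolding G_skew[OF x, symmetric] by (simp add: sum.distrib distrib_left)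
  show ?thesis
    using gauss[OF x, of j k l i] gauss[OF x, of j l k i] d[of j "e i x"] d[of i "e j x"]
    unfolding r by (simp add: sum.distrib sum_subtractf)
qed

text \<open>\<open>nf\<close> allows \<open>l\<close> of either sign and with zeros, since the
  \<open>SO(2)\<close> group condition does not exclude them. \<open>structure_fns\<close> speaks
  only of adapted frames, for which \<open>l\<close> is positive, and encodes \<open>b = 0\<close>
  and \<open>\<eta> = \<lambda>\<close>.\<close>

locale adapted = frame +
  assumes nf: "x \<in> V \<Longrightarrow> \<exists>l m a b. nform x (\<lambda>i. e i x) l m 0 a b \<and> (l = 0 \<longrightarrow> m = 0 \<and> a \<noteq> b)"
    and kind: "(\<forall>x\<in>V. \<kappa> 2 2 2 x = 0) \<or> (\<forall>x\<in>V. \<kappa> 1 1 1 x > 0 \<and> \<kappa> 2 2 2 x > 0 \<and>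
      ((\<kappa> 2 2 2 x)\<^sup>2 = 2 * (\<kappa> 1 1 1 x / 2)\<^sup>2 \<longrightarrow> \<sigma> 1 1 x \<noteq> \<sigma> 2 2 x))"
    and structure_fns: "\<lbrakk>W \<subseteq> V; adapted_frame \<Phi> \<xi> W e1 e2 e3 l m a b; x \<in> W\<rbrakk> \<Longrightarrow>
      b x = 0 \<and> h x (LC_conn h e2 e1 x) (e2 x) = l x \<and> h x (LC_conn h e3 e1 x) (e3 x) = l x"
begin

definition l where "l x = \<kappa> 1 1 1 x / 2"
definition m where "m x = \<kappa> 2 2 2 x"
definition a where "a x = \<sigma> 1 1 x"
definition b where "b x = \<sigma> 2 2 x"
text \<open>The Levi-Civita coefficients: \<open>p i\<close> and \<open>q i\<close> are the
  components along \<open>e 2\<close> and \<open>e 3\<close> of the derivative of \<open>e 1\<close>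
  along \<open>e i\<close>, and \<open>r i\<close> is the rotation of the plane. Thus
  \<open>\<eta>\<close> is \<open>p 2\<close> and also \<open>q 3\<close>.\<close>

definition p where "p i x = G i 1 2 x - \<kappa> i 1 2 x"
definition q where "q i x = G i 1 3 x - \<kappa> i 1 3 x"
definition r where "r i x = G i 2 3 x - \<kappa> i 2 3 x"

lemma nf_x:
  assumes "x \<in> V"
  shows "nform x (\<lambda>i. e i x) (l x) (m x) 0 (a x) (b x)" "l x = 0 \<Longrightarrow> m x = 0 \<and> a x \<noteq> b x"
proof -
  obtain l' m' a' b' where n: "nform x (\<lambda>i. e i x) l' m' 0 a' b'" "l' = 0 \<longrightarrow> m' = 0 \<and> a' \<noteq> b'"
    using nf[OF assms] by blast
  have "l x = l'" "m x = m'" "a x = a'" "b x = b'"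
    using nform_comps[OF n(1)] by (simp_all add: l_def m_def a_def b_def \<kappa>_def \<sigma>_def)
  with n show "nform x (\<lambda>i. e i x) (l x) (m x) 0 (a x) (b x)" "l x = 0 \<Longrightarrow> m x = 0 \<and> a x \<noteq> b x"
    by simp_all
qed

lemma \<kappa>_val: "x \<in> V \<Longrightarrow> \<kappa> i j k x = cubic_form (l x) (m x) 0 (axis i 1) (axis j 1) (axis k 1)"
  using nform_comp(1)[OF nf_x(1)] by (simp add: \<kappa>_def)

lemma \<sigma>_val: "x \<in> V \<Longrightarrow> \<sigma> i j x = diag_form (a x) (b x) (axis i 1) (axis j 1)"
  using nform_comp(2)[OF nf_x(1)] by (simp add: \<sigma>_def)

lemma \<kappa>_vals:
  assumes "x \<in> V"
  shows "\<kappa> 1 1 1 x = 2 * l x" "\<kappa> 1 1 2 x = 0" "\<kappa> 1 1 3 x = 0" "\<kappa> 1 2 1 x = 0" "\<kappa> 1 2 2 x = - l x" "\<kappa> 1 2 3 x = 0"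
    "\<kappa> 1 3 1 x = 0" "\<kappa> 1 3 2 x = 0" "\<kappa> 1 3 3 x = - l x"
    "\<kappa> 2 1 1 x = 0" "\<kappa> 2 1 2 x = - l x" "\<kappa> 2 1 3 x = 0" "\<kappa> 2 2 1 x = - l x" "\<kappa> 2 2 2 x = m x" "\<kappa> 2 2 3 x = 0"
    "\<kappa> 2 3 1 x = 0" "\<kappa> 2 3 2 x = 0" "\<kappa> 2 3 3 x = - m x"
    "\<kappa> 3 1 1 x = 0" "\<kappa> 3 1 2 x = 0" "\<kappa> 3 1 3 x = - l x" "\<kappa> 3 2 1 x = 0" "\<kappa> 3 2 2 x = 0" "\<kappa> 3 2 3 x = - m x"
    "\<kappa> 3 3 1 x = - l x" "\<kappa> 3 3 2 x = - m x" "\<kappa> 3 3 3 x = 0"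
  unfolding \<kappa>_val[OF assms] cubic_form_def by (simp_all add: axis_def)

lemma \<sigma>_vals:
  assumes "x \<in> V"
  shows "\<sigma> 1 1 x = a x" "\<sigma> 1 2 x = 0" "\<sigma> 1 3 x = 0" "\<sigma> 2 1 x = 0" "\<sigma> 2 2 x = b x" "\<sigma> 2 3 x = 0"
    "\<sigma> 3 1 x = 0" "\<sigma> 3 2 x = 0" "\<sigma> 3 3 x = b x"
  unfolding \<sigma>_val[OF assms] diag_form_def by (simp_all add: axis_def)

lemma G_vals:
  assumes x: "x \<in> V"
  shows "G 1 1 1 x = 2 * l x" "G 2 1 1 x = 0" "G 3 1 1 x = 0"
    "G 1 1 2 x = p 1 x" "G 2 1 2 x = p 2 x - l x" "G 3 1 2 x = p 3 x"
    "G 1 1 3 x = q 1 x" "G 2 1 3 x = q 2 x" "G 3 1 3 x = q 3 x - l x"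
    "G 1 2 1 x = - p 1 x" "G 2 2 1 x = - p 2 x - l x" "G 3 2 1 x = - p 3 x"
    "G 1 3 1 x = - q 1 x" "G 2 3 1 x = - q 2 x" "G 3 3 1 x = - q 3 x - l x"
    "G 1 2 2 x = - l x" "G 2 2 2 x = m x" "G 3 2 2 x = 0"
    "G 1 2 3 x = r 1 x" "G 2 2 3 x = r 2 x" "G 3 2 3 x = r 3 x - m x"
    "G 1 3 2 x = - r 1 x" "G 2 3 2 x = - r 2 x" "G 3 3 2 x = - r 3 x - m x"
    "G 1 3 3 x = - l x" "G 2 3 3 x = - m x" "G 3 3 3 x = 0"
  using G_skew[OF x, of _ 1 1] G_skew[OF x, of _ 2 2] G_skew[OF x, of _ 3 3]
    G_skew[OF x, of 1 1 2] G_skew[OF x, of 2 1 2] G_skew[OF x, of 3 1 2]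
    G_skew[OF x, of 1 1 3] G_skew[OF x, of 2 1 3] G_skew[OF x, of 3 1 3]
    G_skew[OF x, of 1 2 3] G_skew[OF x, of 2 2 3] G_skew[OF x, of 3 2 3]
  by (simp_all add: p_def q_def r_def \<kappa>_vals[OF x])

lemma smooth_lm: "smooth_on V l" "smooth_on V m" "smooth_on V a" "smooth_on V b"
  unfolding l_def[abs_def] m_def[abs_def] a_def[abs_def] b_def[abs_def]
  by (intro smooth_rules openV smooth_\<kappa> smooth_\<sigma>; simp)+

lemma smooth_pq: "smooth_on V (p i)" "smooth_on V (q i)" "smooth_on V (r i)"
  unfolding p_def[abs_def] q_def[abs_def] r_def[abs_def]
  by (intro smooth_rules openV smooth_\<kappa> smooth_G)+

lemma D\<kappa>:
  assumes x: "x \<in> V"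
  shows "D (\<kappa> 1 1 1) x v = 2 * D l x v" "D (\<kappa> 1 2 2) x v = - D l x v" "D (\<kappa> 2 1 2) x v = - D l x v"
    "D (\<kappa> 2 2 1) x v = - D l x v" "D (\<kappa> 1 3 3) x v = - D l x v" "D (\<kappa> 3 1 3) x v = - D l x v" "D (\<kappa> 3 3 1) x v = - D l x v"
    "D (\<kappa> 2 2 2) x v = D m x v" "D (\<kappa> 2 3 3) x v = - D m x v" "D (\<kappa> 3 2 3) x v = - D m x v" "D (\<kappa> 3 3 2) x v = - D m x v"
    "D (\<kappa> 1 1 2) x v = 0" "D (\<kappa> 1 2 1) x v = 0" "D (\<kappa> 2 1 1) x v = 0" "D (\<kappa> 1 1 3) x v = 0" "D (\<kappa> 1 3 1) x v = 0" "D (\<kappa> 3 1 1) x v = 0"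
    "D (\<kappa> 1 2 3) x v = 0" "D (\<kappa> 1 3 2) x v = 0" "D (\<kappa> 2 1 3) x v = 0" "D (\<kappa> 2 3 1) x v = 0" "D (\<kappa> 3 1 2) x v = 0" "D (\<kappa> 3 2 1) x v = 0"
    "D (\<kappa> 2 2 3) x v = 0" "D (\<kappa> 2 3 2) x v = 0" "D (\<kappa> 3 2 2) x v = 0" "D (\<kappa> 3 3 3) x v = 0"
proof -
  have c: "D (\<kappa> i j k) x v = D g x v" if "\<And>y. y \<in> V \<Longrightarrow> \<kappa> i j k y = g y" for i j k g
    by (rule D_cong_open[OF openV x, THEN fun_cong]) (rule that)
  have z: "D (\<kappa> i j k) x v = 0" if "\<And>y. y \<in> V \<Longrightarrow> \<kappa> i j k y = 0" for i j k
    using c[of i j k "\<lambda>y. 0", OF that] by simp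
  have n: "D (\<kappa> i j k) x v = - D g x v" if "\<And>y. y \<in> V \<Longrightarrow> \<kappa> i j k y = - g y" "smooth_on V g" for i j k g
    using c[of i j k "\<lambda>y. - g y", OF that(1)] D_minus[OF that(2) x] by simp
  show "D (\<kappa> 1 1 1) x v = 2 * D l x v"
    using c[of 1 1 1 "\<lambda>y. 2 * l y", OF \<kappa>_vals(1)] D_mult[OF smooth_on_const smooth_lm(1) x, of 2 v] by simp
  show "D (\<kappa> 2 2 2) x v = D m x v"
    by (rule c) (rule \<kappa>_vals)
  show "D (\<kappa> 1 2 2) x v = - D l x v" "D (\<kappa> 2 1 2) x v = - D l x v"
    "D (\<kappa> 2 2 1) x v = - D l x v" "D (\<kappa> 1 3 3) x v = - D l x v" "D (\<kappa> 3 1 3) x v = - D l x v" "D (\<kappa> 3 3 1) x v = - D l x v"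
    "D (\<kappa> 2 3 3) x v = - D m x v" "D (\<kappa> 3 2 3) x v = - D m x v" "D (\<kappa> 3 3 2) x v = - D m x v"
    by (rule n[OF _ smooth_lm(1)], erule \<kappa>_vals | rule n[OF _ smooth_lm(2)], erule \<kappa>_vals)+
  show "D (\<kappa> 1 1 2) x v = 0" "D (\<kappa> 1 2 1) x v = 0" "D (\<kappa> 2 1 1) x v = 0" "D (\<kappa> 1 1 3) x v = 0" "D (\<kappa> 1 3 1) x v = 0" "D (\<kappa> 3 1 1) x v = 0"
    "D (\<kappa> 1 2 3) x v = 0" "D (\<kappa> 1 3 2) x v = 0" "D (\<kappa> 2 1 3) x v = 0" "D (\<kappa> 2 3 1) x v = 0" "D (\<kappa> 3 1 2) x v = 0" "D (\<kappa> 3 2 1) x v = 0"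
    "D (\<kappa> 2 2 3) x v = 0" "D (\<kappa> 2 3 2) x v = 0" "D (\<kappa> 3 2 2) x v = 0" "D (\<kappa> 3 3 3) x v = 0"
    by (rule z, erule \<kappa>_vals)+
qed

text \<open>Components of \<open>gauss_sym\<close> written in \<open>p\<close>, \<open>q\<close> and
  \<open>r\<close>. No derivatives of these coefficients occur, so the system can be used
  algebraically.\<close>

lemma equations:
  assumes x: "x \<in> V"
  shows "2 * l x * p 1 x = D l x (e 2 x)" "2 * l x * q 1 x = D l x (e 3 x)"
    "- D l x (e 1 x) - p 1 x * m x - 4 * l x * p 2 x = (a x - b x) / 2"
    "q 1 x * m x = 4 * l x * q 2 x" "q 1 x * m x = 4 * l x * p 3 x"
    "D m x (e 1 x) = p 1 x * l x - p 2 x * m x"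
    "D m x (e 1 x) = - p 1 x * l x - q 3 x * m x"
    "3 * r 1 x * m x = q 1 x * l x + q 2 x * m x"
    "3 * r 1 x * m x = - q 1 x * l x - p 3 x * m x"
proof -
  note v = sum_3 G_vals[OF x] \<kappa>_vals[OF x] \<sigma>_vals[OF x] D\<kappa>[OF x]
  show "2 * l x * p 1 x = D l x (e 2 x)"
    using gauss_sym[OF x, of 2 1 1 1] by (simp add: v algebra_simps)
  show "2 * l x * q 1 x = D l x (e 3 x)"
    using gauss_sym[OF x, of 3 1 1 1] by (simp add: v algebra_simps)
  show "- D l x (e 1 x) - p 1 x * m x - 4 * l x * p 2 x = (a x - b x) / 2"
    using gauss_sym[OF x, of 2 1 2 1] by (simp add: v algebra_simps)
  show "q 1 x * m x = 4 * l x * q 2 x"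
    using gauss_sym[OF x, of 2 1 3 1] by (simp add: v algebra_simps)
  show "q 1 x * m x = 4 * l x * p 3 x"
    using gauss_sym[OF x, of 3 1 2 1] by (simp add: v algebra_simps)
  show "D m x (e 1 x) = p 1 x * l x - p 2 x * m x"
    using gauss_sym[OF x, of 2 2 2 1] gauss_sym[OF x, of 2 3 3 1] by (simp add: v algebra_simps)
  show "D m x (e 1 x) = - p 1 x * l x - q 3 x * m x"
    using gauss_sym[OF x, of 3 2 3 1] by (simp add: v algebra_simps)
  show "3 * r 1 x * m x = q 1 x * l x + q 2 x * m x"
    using gauss_sym[OF x, of 2 2 3 1] by (simp add: v algebra_simps)
  show "3 * r 1 x * m x = - q 1 x * l x - p 3 x * m x"
    using gauss_sym[OF x, of 3 2 2 1] gauss_sym[OF x, of 3 3 3 1] by (simp add: v algebra_simps)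
qed

text \<open>If \<open>g x \<noteq> 0\<close>, then \<open>l\<close> vanishes on the open set where
  \<open>g\<close> does not; at \<open>x\<close> also \<open>m\<close> vanishes, and the third of
  \<open>equations\<close> reduces to \<open>a x = b x\<close>, against \<open>nf_x\<close>.\<close>

lemma vanish:
  fixes g :: "real^3 \<Rightarrow> real"
  assumes "continuous_on V g" "\<And>y. y \<in> V \<Longrightarrow> l y \<noteq> 0 \<Longrightarrow> g y = 0" "x \<in> V"
  shows "g x = 0"
proof (rule ccontr)
  assume "g x \<noteq> 0"
  define U where "U = {y \<in> V. g y * g y > 0}"
  have oU: "open U"
    unfolding U_def by (rule open_Collect_pos[OF openV continuous_on_mult[OF assms(1,1)]])
  have xU: "x \<in> U"
    using assms(3) \<open>g x \<noteq> 0\<close> by (simp add: U_def) (metis not_real_square_gt_zero)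
  have l0: "l y = 0" if "y \<in> U" for y
    using assms(2)[of y] that by (cases "l y = 0") (auto simp: U_def)
  have "D l x (e 1 x) = D (\<lambda>y. 0 :: real) x (e 1 x)"
    by (rule D_cong_open[OF oU xU, THEN fun_cong]) (rule l0)
  then have "(a x - b x) / 2 = 0"
    using equations(3)[OF assms(3)] l0[OF xU] nf_x(2)[OF assms(3) l0[OF xU]] by simp
  then show False
    using nf_x(2)[OF assms(3) l0[OF xU]] by simp
qed

lemma K_val:
  assumes x: "x \<in> V"
  shows "K x (e i x) (e j x) = \<kappa> i j 1 x *\<^sub>R e 1 x + \<kappa> i j 2 x *\<^sub>R e 2 x + \<kappa> i j 3 x *\<^sub>R e 3 x"
  using expand[OF x, of "K x (e i x) (e j x)"] unfolding \<kappa>_def[symmetric] sum_3 .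

lemma S_val:
  assumes x: "x \<in> V"
  shows "S x (e i x) = \<sigma> i 1 x *\<^sub>R e 1 x + \<sigma> i 2 x *\<^sub>R e 2 x + \<sigma> i 3 x *\<^sub>R e 3 x"
  using S_expand[OF x, of i] unfolding sum_3 .

lemma ortho3:
  assumes "onb g u" "\<And>v w. g (- v) w = - g v w" "\<And>v w. g v (- w) = - g v w" "s = u 1 \<or> s = - u 1"
  shows "orthonormal g [s, u 2, u 3]"
proof -
  have "\<forall>i<3. \<forall>j<3. \<bar>g ([s, u 2, u 3] ! i) ([s, u 2, u 3] ! j)\<bar> = (if i = j then 1 else 0)"
    unfolding numeral_3_eq_3 using assms by (auto simp: less_Suc_eq onb_def)
  then show ?thesis
    by (simp add: orthonormal_def)
qed

text \<open>Where \<open>l < 0\<close> the frame with \<open>e\<^sub>1\<close> reversed is the adapted one.\<close>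

lemma off_zero:
  assumes x: "x \<in> V" and lx: "l x \<noteq> 0"
  shows "b x = 0 \<and> p 2 x = l x \<and> q 3 x = l x"
proof (cases "l x > 0")
  case True
  define W where "W = {y \<in> V. l y > 0}"
  have W: "open W" "W \<subseteq> V" "x \<in> W"
    using True x open_Collect_pos[OF openV smooth_on_continuous[OF smooth_lm(1)]] by (auto simp: W_def)
  have "adapted_frame \<Phi> \<xi> W (e 1) (e 2) (e 3) l m a b"
    unfolding adapted_frame_def Let_def
  proof (intro conjI ballI W smooth_on_subset[OF smooth_e W(2)])
    fix y assume y: "y \<in> W"
    then have yV: "y \<in> V"
      using W by blast
    show "orthonormal (h y) [e 1 y, e 2 y, e 3 y]"
      by (rule ortho3[OF onb_e[OF yV]]) (use in\<Omega>[OF yV] in auto)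
    show "l y > 0"
      using y by (simp add: W_def)
  next
    show "(\<forall>x\<in>W. m x = 0) \<or> (\<forall>x\<in>W. 0 < m x \<and> (m x = sqrt 2 * l x \<longrightarrow> a x \<noteq> b x))"
    proof -
      have "(m x)\<^sup>2 = 2 * (l x)\<^sup>2" if "m x = sqrt 2 * l x" for x
        using that by (simp add: power_mult_distrib)
      then show ?thesis
        using kind W(2) unfolding l_def m_def a_def b_def by blast
    qed
  qed (use W(2) in \<open>simp_all add: K_val S_val \<kappa>_vals \<sigma>_vals subset_iff\<close>)
  from structure_fns[OF W(2) this W(3)] show ?thesis
    unfolding LC_e[OF x] p_def q_def by simp
next
  case False
  then have neg: "- l x > 0"
    using lx by simp
  define W where "W = {y \<in> V. - l y > 0}"
  have W: "open W" "W \<subseteq> V" "x \<in> W"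
    using neg x open_Collect_pos[OF openV continuous_on_minus[OF smooth_on_continuous[OF smooth_lm(1)]]]
    by (auto simp: W_def)
  \<comment> \<open>A negative value of \<open>l\<close> rules out the second alternative of
    \<open>kind\<close>, so \<open>m\<close> vanishes on all of \<open>V\<close>.\<close>
  have m0: "m y = 0" if "y \<in> V" for y
    using kind that x neg unfolding m_def l_def by (auto; fastforce)
  have "adapted_frame \<Phi> \<xi> W (\<lambda>y. - e 1 y) (e 2) (e 3) (\<lambda>y. - l y) m a b"
    unfolding adapted_frame_def Let_def
  proof (intro conjI ballI W smooth_on_subset[OF smooth_e W(2)])
    show "smooth_on W (\<lambda>y. - e 1 y)"
      by (rule smooth_on_minus[OF W(1) smooth_on_subset[OF smooth_e W(2)]])
    fix y assume y: "y \<in> W"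
    then have yV: "y \<in> V"
      using W by blast
    show "orthonormal (h y) [- e 1 y, e 2 y, e 3 y]"
      by (rule ortho3[OF onb_e[OF yV]]) (use in\<Omega>[OF yV] in auto)
    show "- l y > 0"
      using y by (simp add: W_def)
    have K: "K y (- u) v = - K y u v" "K y u (- v) = - K y u v" for u v
      using K_lin(3)[OF in\<Omega>[OF yV], of "-1" u v] K_lin(4)[OF in\<Omega>[OF yV], of u "-1" v] by simp_all
    have S: "S y (- u) = - S y u" for u
      using linear_neg[OF linear_S[OF in\<Omega>[OF yV]]] .
    note * = K S K_val[OF yV] S_val[OF yV] \<kappa>_vals[OF yV] \<sigma>_vals[OF yV]
    show "K y (- e 1 y) (- e 1 y) = (2 * - l y) *\<^sub>R - e 1 y" "K y (- e 1 y) (e 2 y) = - (- l y) *\<^sub>R e 2 y"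
      "K y (- e 1 y) (e 3 y) = - (- l y) *\<^sub>R e 3 y" "K y (e 2 y) (- e 1 y) = - (- l y) *\<^sub>R e 2 y"
      "K y (e 2 y) (e 2 y) = - (- l y) *\<^sub>R - e 1 y + m y *\<^sub>R e 2 y" "K y (e 2 y) (e 3 y) = - m y *\<^sub>R e 3 y"
      "K y (e 3 y) (- e 1 y) = - (- l y) *\<^sub>R e 3 y" "K y (e 3 y) (e 2 y) = - m y *\<^sub>R e 3 y"
      "K y (e 3 y) (e 3 y) = - (- l y) *\<^sub>R - e 1 y + - m y *\<^sub>R e 2 y"
      "S y (- e 1 y) = a y *\<^sub>R - e 1 y" "S y (e 2 y) = b y *\<^sub>R e 2 y" "S y (e 3 y) = b y *\<^sub>R e 3 y"
      by (simp_all add: *)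
  next
    show "(\<forall>x\<in>W. m x = 0) \<or> (\<forall>x\<in>W. 0 < m x \<and> (m x = sqrt 2 * - l x \<longrightarrow> a x \<noteq> b x))"
      using m0 W(2) by blast
  qed
  note st = structure_fns[OF W(2) this W(3)]
  have "LC_conn h (e i) (\<lambda>y. - e 1 y) x = - LC_conn h (e i) (e 1) x" for i
  proof -
    have "\<Gamma> x v (- w) = - \<Gamma> x v w" for v w
      using linear_neg[OF \<Gamma>_h_linear(1)[OF in\<Omega>[OF x]]] .
    moreover have "K x v (- w) = - K x v w" for v w
      using K_lin(4)[OF in\<Omega>[OF x], of v "-1" w] by simp
    ultimately show ?thesis
      by (simp add: LC_conn_K[OF in\<Omega>[OF x]] D_minus[OF smooth_e x])
  qed
  then have "h x (LC_conn h (e i) (\<lambda>y. - e 1 y) x) (e i x) = - (G i 1 i x - \<kappa> i 1 i x)" for i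
    using LC_e[OF x, of i 1 i] by (simp add: in\<Omega>[OF x])
  with st show ?thesis
    unfolding p_def q_def by simp
qed

text \<open>Since \<open>p 2 = q 3\<close>, the two formulas for the derivative of \<open>m\<close>
  along \<open>e 1\<close> differ by \<open>2 * p 1 * l\<close>. The remaining equations give
  \<open>p 3 = q 2\<close> and \<open>q 2 * (4 * l^2 + m^2) = 0\<close>.\<close>

lemma p1q_off_zero:
  assumes x: "x \<in> V" and lx: "l x \<noteq> 0"
  shows "p 1 x = 0 \<and> q 1 x = 0 \<and> q 2 x = 0 \<and> p 3 x = 0"
proof -
  note o = off_zero[OF assms] and eq = equations[OF x]
  have "p 1 x * l x = 0"
    using eq(6,7) o by auto
  then have p1: "p 1 x = 0"
    using lx by simp
  have "4 * l x * q 2 x = 4 * l x * p 3 x"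
    using eq(4,5) by auto
  then have p3: "p 3 x = q 2 x"
    using lx by simp
  have ql: "q 1 x * l x = - (q 2 x * m x)"
    using eq(8) eq(9)[unfolded p3] by linarith
  have "(q 1 x * m x) * l x = - q 2 x * (m x * m x)"
    using ql by (metis (no_types, lifting) mult.assoc mult.commute mult_minus_left)
  then have "q 2 x * (4 * (l x * l x) + m x * m x) = 0"
    unfolding eq(4) by (simp add: algebra_simps)
  moreover have "4 * (l x * l x) + m x * m x > 0"
    using lx by (metis add_pos_nonneg mult_pos_pos not_real_square_gt_zero zero_le_square zero_less_numeral)
  ultimately have "q 2 x = 0"
    by simp
  with ql lx p1 p3 show ?thesis
    by simp
qed

lemma coefficients:
  assumes x: "x \<in> V"
  shows "b x = 0" "p 2 x = l x" "q 3 x = l x" "p 1 x = 0" "q 1 x = 0" "q 2 x = 0" "p 3 x = 0"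
proof -
  note c = smooth_on_continuous[OF smooth_pq(1)] smooth_on_continuous[OF smooth_pq(2)]
  show "b x = 0"
    by (rule vanish[OF smooth_on_continuous[OF smooth_lm(4)] _ x]) (use off_zero in blast)
  have "p 2 x - l x = 0"
    by (rule vanish[OF continuous_on_diff[OF c(1) smooth_on_continuous[OF smooth_lm(1)]] _ x]) (use off_zero in simp)
  then show "p 2 x = l x" by simp
  have "q 3 x - l x = 0"
    by (rule vanish[OF continuous_on_diff[OF c(2) smooth_on_continuous[OF smooth_lm(1)]] _ x]) (use off_zero in simp)
  then show "q 3 x = l x" by simp
  show "p 1 x = 0"
    by (rule vanish[OF c(1) _ x]) (use p1q_off_zero in blast)
  show "q 1 x = 0"
    by (rule vanish[OF c(2) _ x]) (use p1q_off_zero in blast)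
  show "q 2 x = 0"
    by (rule vanish[OF c(2) _ x]) (use p1q_off_zero in blast)
  show "p 3 x = 0"
    by (rule vanish[OF c(1) _ x]) (use p1q_off_zero in blast)
qed

text \<open>The derivatives of \<open>E 2\<close> along \<open>e 2\<close> and of \<open>E 3\<close>
  along \<open>e 3\<close> contain \<open>\<xi>\<close> together with \<open>- 2 * l\<close> times
  \<open>E 1\<close>; \<open>\<zeta>\<close> collects exactly these two terms.\<close>

definition \<zeta> where "\<zeta> x = \<xi> x - (2 * l x) *\<^sub>R E 1 x"

lemma smooth_\<zeta>: "smooth_on V \<zeta>"
  unfolding \<zeta>_def[abs_def] by (intro smooth_rules openV smooth_\<xi>V smooth_lm smooth_E)

lemma dE_adapted:
  assumes x: "x \<in> V"
  shows "D (E 1) x (e 1 x) = (4 * l x) *\<^sub>R E 1 x + \<zeta> x" "D (E 1) x (e 2 x) = 0" "D (E 1) x (e 3 x) = 0"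
    "D (E 2) x (e 1 x) = (- l x) *\<^sub>R E 2 x + r 1 x *\<^sub>R E 3 x"
    "D (E 2) x (e 2 x) = m x *\<^sub>R E 2 x + r 2 x *\<^sub>R E 3 x + \<zeta> x"
    "D (E 2) x (e 3 x) = (r 3 x - m x) *\<^sub>R E 3 x"
    "D (E 3) x (e 1 x) = (- r 1 x) *\<^sub>R E 2 x + (- l x) *\<^sub>R E 3 x"
    "D (E 3) x (e 2 x) = (- r 2 x) *\<^sub>R E 2 x + (- m x) *\<^sub>R E 3 x"
    "D (E 3) x (e 3 x) = (- r 3 x - m x) *\<^sub>R E 2 x + \<zeta> x"
proof -
  note v = dE_sum[OF x] sum_3 G_vals[OF x] coefficients[OF x]
  have "D (E 1) x (e 1 x) = (2 * l x) *\<^sub>R E 1 x + \<xi> x"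
    by (simp add: v)
  then show "D (E 1) x (e 1 x) = (4 * l x) *\<^sub>R E 1 x + \<zeta> x"
    by (simp add: \<zeta>_def vec_eq_iff)
qed (simp_all add: dE_sum[OF x] sum_3 G_vals[OF x] coefficients[OF x] \<zeta>_def algebra_simps)

text \<open>The third of \<open>equations\<close> now determines the derivative of \<open>l\<close>
  along \<open>e 1\<close> as \<open>- 4 * l * l - a / 2\<close>. It cancels both the shape operator
  and the \<open>E 1\<close> terms, so only a multiple of \<open>\<zeta>\<close> survives.\<close>

lemma d\<zeta>_adapted:
  assumes x: "x \<in> V"
  shows "D \<zeta> x (e 1 x) = (- 2 * l x) *\<^sub>R \<zeta> x" "D \<zeta> x (e 2 x) = 0" "D \<zeta> x (e 3 x) = 0"
proof -
  have l: "D l x (e 2 x) = 0" "D l x (e 3 x) = 0" "D l x (e 1 x) = - 4 * l x * l x - a x / 2"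
    using equations(1-3)[OF x] coefficients[OF x] by simp_all
  have d: "D \<zeta> x v = D \<xi> x v - ((2 * l x) *\<^sub>R D (E 1) x v + (2 * D l x v) *\<^sub>R E 1 x)" for v
  proof -
    have s2: "smooth_on V (\<lambda>x. 2 * l x)"
      by (intro smooth_rules openV smooth_lm)
    have "D (\<lambda>x. 2 * l x) x v = 2 * D l x v"
      using D_mult[OF smooth_on_const smooth_lm(1) x, of 2 v] by simp
    then show ?thesis
      unfolding \<zeta>_def[abs_def] D_diff[OF smooth_\<xi>V smooth_on_scaleR[OF openV s2 smooth_E] x] D_scaleR[OF s2 smooth_E x]
      by simp
  qed
  show "D \<zeta> x (e 2 x) = 0" "D \<zeta> x (e 3 x) = 0"
    unfolding d by (simp_all add: d\<xi>[OF x] sum_3 \<sigma>_vals[OF x] coefficients[OF x] dE_adapted[OF x] l)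
  show "D \<zeta> x (e 1 x) = (- 2 * l x) *\<^sub>R \<zeta> x"
    unfolding d dE_adapted[OF x] l
    by (simp add: d\<xi>[OF x] sum_3 \<sigma>_vals[OF x] \<zeta>_def algebra_simps)
qed

lemma det_adapted:
  assumes "x \<in> V"
  shows "\<bar>det (vector [E 1 x, E 2 x, E 3 x, \<zeta> x] :: real^4^4)\<bar> = 1"
proof -
  define M :: "real^4^4" where "M = vector [E 1 x, E 2 x, E 3 x, \<xi> x]"
  have "det (\<chi> i. if i = 4 then row 4 M + (- 2 * l x) *s row 1 M else row i M) = det M"
    by (rule det_row_operation) simp
  moreover have "(\<chi> i. if i = 4 then row 4 M + (- 2 * l x) *s row 1 M else row i M) = vector [E 1 x, E 2 x, E 3 x, \<zeta> x]"
    unfolding vec_eq_iff[of "vec_lambda _"] forall_4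
    by (simp add: row_def M_def \<zeta>_def vec_eq_iff)
  ultimately show ?thesis
    using det_E[OF assms] by (simp add: M_def)
qed

end

section \<open>Integration\<close>

text \<open>On a small closed ball the mean value inequality bounds the maximum of
  \<open>norm (u x)\<close> by half of itself, so this maximum is zero.\<close>

lemma linear_ode_zero:
  fixes u :: "'a::euclidean_space \<Rightarrow> 'b::real_normed_vector"
  assumes "open W" "z0 \<in> W" "smooth_on W u" "u z0 = 0" "continuous_on W c"
    and bound: "\<And>x v. x \<in> W \<Longrightarrow> norm (D u x v) \<le> c x * norm (u x) * norm v"
  shows "\<exists>r>0. ball z0 r \<subseteq> W \<and> (\<forall>x\<in>ball z0 r. u x = 0)"
proof -
  define M where "M = \<bar>c z0\<bar> + 1"
  have "continuous (at z0) c"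
    using assms(1,2,5) continuous_on_eq_continuous_at by blast
  then obtain d where d: "d > 0" "\<And>x. dist x z0 < d \<Longrightarrow> dist (c x) (c z0) < 1"
    unfolding continuous_at_eps_delta by (metis zero_less_one)
  obtain r0 where r0: "r0 > 0" "ball z0 r0 \<subseteq> W"
    using assms(1,2) open_contains_ball by blast
  \<comment> \<open>The bound \<open>1 / (2 * M)\<close> produces the factor one half in the
    estimate; halving \<open>d\<close> and \<open>r0\<close> keeps the closed ball inside the domain
    and within the control of \<open>c\<close>.\<close>
  define r where "r = min (min (d / 2) (r0 / 2)) (1 / (2 * M))"
  have M: "M > 0"
    by (simp add: M_def)
  have r: "r > 0" "r < d" "r < r0" "r * M \<le> 1 / 2"
  proof -
    show "r > 0"
      using d r0 M by (simp add: r_def)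
    have "r \<le> d / 2" "r \<le> r0 / 2" "r \<le> 1 / (2 * M)"
      unfolding r_def by linarith+
    then show "r < d" "r < r0" "r * M \<le> 1 / 2"
      using d(1) r0(1) M by (simp_all add: field_simps)
  qed
  have sub: "cball z0 r \<subseteq> W"
    using r(3) r0(2) by auto
  have cM: "c x \<le> M" if "x \<in> cball z0 r" for x
  proof -
    have "dist (c x) (c z0) < 1"
      by (rule d(2)) (use that r(2) in \<open>auto simp: dist_commute\<close>)
    then show ?thesis
      unfolding M_def dist_real_def by linarith
  qed
  have "continuous_on (cball z0 r) (\<lambda>x. norm (u x))"
    by (intro continuous_on_norm continuous_on_subset[OF smooth_on_continuous[OF assms(3)] sub])
  then obtain y where y: "y \<in> cball z0 r" "\<And>x. x \<in> cball z0 r \<Longrightarrow> norm (u x) \<le> norm (u y)"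
    using continuous_attains_sup[of "cball z0 r" "\<lambda>x. norm (u x)"] r(1) by auto
  have "norm (u y - u z0) \<le> (M * norm (u y)) * norm (y - z0)"
  proof (rule differentiable_bound[of "cball z0 r" u "\<lambda>x. D u x"])
    fix x assume x: "x \<in> cball z0 r"
    show "(u has_derivative D u x) (at x within cball z0 r)"
      using smooth_on_has_derivative[OF assms(3)] sub x has_derivative_at_withinI by blast
    show "onorm (D u x) \<le> M * norm (u y)"
    proof (rule onorm_le)
      fix v
      have "norm (D u x v) \<le> c x * norm (u x) * norm v"
        using bound sub x by blast
      also have "\<dots> \<le> M * norm (u y) * norm v"
        using cM[OF x] y(2)[OF x] M by (intro mult_right_mono mult_mono) auto
      finally show "norm (D u x v) \<le> M * norm (u y) * norm v" .
    qed
  qed (use y r in auto)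
  also have "\<dots> \<le> (M * norm (u y)) * r"
    using y(1) M by (intro mult_left_mono) (auto simp: dist_norm norm_minus_commute)
  also have "\<dots> \<le> norm (u y) / 2"
    using mult_right_mono[OF r(4), of "norm (u y)"] by (simp add: mult.commute mult.left_commute)
  finally have "norm (u y) = 0"
    using assms(4) by simp
  then have "u x = 0" if "x \<in> ball z0 r" for x
    using y(2)[of x] that by simp
  moreover have "ball z0 r \<subseteq> W"
    using sub ball_subset_cball by blast
  ultimately show ?thesis
    using r(1) by blast
qed

text \<open>Bounds along the frame suffice, because the coefficients \<open>h x v (e i x)\<close> of
  a vector \<open>v\<close> are at most \<open>norm v\<close> times a continuous function.\<close>

lemma (in frame) ode_zero:
  fixes u :: "real^3 \<Rightarrow> 'b::real_normed_vector"
  assumes W: "open W" "W \<subseteq> V" "z0 \<in> W" and u: "smooth_on W u" "u z0 = 0" and c: "continuous_on W c"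
    and bound: "\<And>x i. x \<in> W \<Longrightarrow> norm (D u x (e i x)) \<le> c x * norm (u x)"
  shows "\<exists>r>0. ball z0 r \<subseteq> W \<and> (\<forall>x\<in>ball z0 r. u x = 0)"
proof (rule linear_ode_zero[OF W(1,3) u])
  define H where "H x = (\<Sum>i\<in>UNIV. \<Sum>b\<in>Basis. \<bar>h x b (e i x)\<bar>)" for x
  have "continuous_on W (\<lambda>x. h x b (e i x))" for b i
    by (rule continuous_on_subset[OF smooth_on_continuous[OF smooth_h[OF openV sub smooth_on_const smooth_e]] W(2)])
  then show "continuous_on W (\<lambda>x. c x * H x)"
    unfolding H_def by (intro continuous_intros c)
  fix x v assume x: "x \<in> W"
  have x': "x \<in> V" "x \<in> \<Omega>"
    using x W(2) in\<Omega> by auto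
  have hv: "\<bar>h x v (e i x)\<bar> \<le> norm v * (\<Sum>b\<in>Basis. \<bar>h x b (e i x)\<bar>)" for i
  proof -
    have "linear (\<lambda>v. h x v (e i x))"
      using bilin_h[OF x'(2)] by (simp add: bilinear_def)
    from linear_eq_sum_Basis[OF this, of v]
    have "\<bar>h x v (e i x)\<bar> \<le> (\<Sum>b\<in>Basis. \<bar>(v \<bullet> b) * h x b (e i x)\<bar>)"
      by (simp add: sum_abs)
    also have "\<dots> \<le> (\<Sum>b\<in>Basis. norm v * \<bar>h x b (e i x)\<bar>)"
      unfolding abs_mult by (intro sum_mono mult_right_mono Basis_le_norm) auto
    finally show ?thesis
      by (simp add: sum_distrib_left)
  qed
  have l: "linear (D u x)"
    by (rule linear_D[OF u(1) x])
  have Du: "D u x v = (\<Sum>i\<in>UNIV. h x v (e i x) *\<^sub>R D u x (e i x))"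
    using arg_cong[OF expand[OF x'(1), of v], of "D u x"] by (simp add: linear_sum[OF l] linear_scale[OF l])
  have "norm (D u x v) \<le> (\<Sum>i\<in>UNIV. norm (h x v (e i x) *\<^sub>R D u x (e i x)))"
    unfolding Du by (rule norm_sum)
  also have "\<dots> \<le> (\<Sum>i\<in>UNIV. (norm v * (\<Sum>b\<in>Basis. \<bar>h x b (e i x)\<bar>)) * (c x * norm (u x)))"
    unfolding norm_scaleR by (intro sum_mono mult_mono hv bound x) (auto intro!: mult_nonneg_nonneg sum_nonneg)
  also have "\<dots> = c x * H x * norm (u x) * norm v"
    unfolding H_def by (simp add: sum_distrib_left sum_distrib_right mult.commute mult.left_commute mult.assoc)
  finally show "norm (D u x v) \<le> c x * H x * norm (u x) * norm v" .
qed

locale pointed = adapted +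
  fixes z0
  assumes z0: "z0 \<in> V"
begin

text \<open>\<open>B\<close> sends the basis \<open>E 1\<close>, \<open>E 2\<close>,
  \<open>E 3\<close>, \<open>\<zeta>\<close> at \<open>z0\<close> to the standard basis. In these
  coordinates the constancy of the spaces becomes the vanishing of components.\<close>

definition B :: "real^4^4" where "B = matrix_inv (transpose (vector [E 1 z0, E 2 z0, E 3 z0, \<zeta> z0]))"
definition \<epsilon> where "\<epsilon> i x = B *v E i x"
definition \<omega> where "\<omega> x = B *v \<zeta> x"
definition U where "U x = B *v \<Phi> x"

lemma indep_\<zeta>: "x \<in> V \<Longrightarrow> indep4 (E 1 x) (E 2 x) (E 3 x) (\<zeta> x)"
  using det_adapted[of x] by (intro indep4_if_det) auto

lemma B_inverse:
  "B ** transpose (vector [E 1 z0, E 2 z0, E 3 z0, \<zeta> z0]) = mat 1"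
  "transpose (vector [E 1 z0, E 2 z0, E 3 z0, \<zeta> z0]) ** B = mat 1"
proof -
  have "\<exists>A'. transpose (vector [E 1 z0, E 2 z0, E 3 z0, \<zeta> z0]) ** A' = mat 1 \<and>
      A' ** transpose (vector [E 1 z0, E 2 z0, E 3 z0, \<zeta> z0]) = (mat 1 :: real^4^4)"
    using det_columns4[OF indep_\<zeta>[OF z0]] unfolding invertible_det_nz[symmetric] invertible_def .
  from someI_ex[OF this] show
    "B ** transpose (vector [E 1 z0, E 2 z0, E 3 z0, \<zeta> z0]) = mat 1"
    "transpose (vector [E 1 z0, E 2 z0, E 3 z0, \<zeta> z0]) ** B = mat 1"
    unfolding B_def matrix_inv_def by blast+
qed

lemma bij_B: "bij ((*v) B)"
proof (rule bijI')
  fix v w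
  show "(B *v v = B *v w) = (v = w)"
    using B_inverse(2) by (metis matrix_vector_mul_assoc matrix_vector_mul_lid)
  show "\<exists>x. v = B *v x"
    using B_inverse(1) by (metis matrix_vector_mul_assoc matrix_vector_mul_lid)
qed

lemma at_z0: "\<epsilon> 1 z0 = axis 1 1" "\<epsilon> 2 z0 = axis 2 1" "\<epsilon> 3 z0 = axis 3 1" "\<omega> z0 = axis 4 1"
proof -
  let ?A = "transpose (vector [E 1 z0, E 2 z0, E 3 z0, \<zeta> z0]) :: real^4^4"
  have "?A *v axis 1 1 = E 1 z0" "?A *v axis 2 1 = E 2 z0" "?A *v axis 3 1 = E 3 z0" "?A *v axis 4 1 = \<zeta> z0"
    unfolding columns4 by (simp_all add: axis_def)
  moreover have "B *v (?A *v v) = v" for v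
    unfolding matrix_vector_mul_assoc B_inverse(1) by simp
  ultimately show "\<epsilon> 1 z0 = axis 1 1" "\<epsilon> 2 z0 = axis 2 1" "\<epsilon> 3 z0 = axis 3 1" "\<omega> z0 = axis 4 1"
    unfolding \<epsilon>_def \<omega>_def by metis+
qed

lemma smooth_\<epsilon>: "smooth_on V (\<epsilon> i)" and smooth_\<omega>: "smooth_on V \<omega>" and smooth_U: "smooth_on V U"
  unfolding \<epsilon>_def[abs_def] \<omega>_def[abs_def] U_def[abs_def]
  by (rule smooth_on_bounded_linear[OF openV matrix_vector_mul_bounded_linear], rule smooth_E smooth_\<zeta> smooth_\<Phi>V)+

lemma D_B:
  assumes "x \<in> V"
  shows "D (\<epsilon> i) x v = B *v D (E i) x v" "D \<omega> x v = B *v D \<zeta> x v" "D U x (e i x) = \<epsilon> i x"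
  unfolding \<epsilon>_def[abs_def] \<omega>_def[abs_def] U_def[abs_def]
  using D_bounded_linear[OF _ assms matrix_vector_mul_bounded_linear] smooth_E smooth_\<zeta> smooth_\<Phi>V
  by (blast, blast) (simp add: D_bounded_linear[OF smooth_\<Phi>V assms matrix_vector_mul_bounded_linear] E_def)

lemma d\<epsilon>:
  assumes x: "x \<in> V"
  shows "D (\<epsilon> 1) x (e 1 x) = (4 * l x) *\<^sub>R \<epsilon> 1 x + \<omega> x" "D (\<epsilon> 1) x (e 2 x) = 0" "D (\<epsilon> 1) x (e 3 x) = 0"
    "D (\<epsilon> 2) x (e 1 x) = (- l x) *\<^sub>R \<epsilon> 2 x + r 1 x *\<^sub>R \<epsilon> 3 x"
    "D (\<epsilon> 2) x (e 2 x) = m x *\<^sub>R \<epsilon> 2 x + r 2 x *\<^sub>R \<epsilon> 3 x + \<omega> x"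
    "D (\<epsilon> 2) x (e 3 x) = (r 3 x - m x) *\<^sub>R \<epsilon> 3 x"
    "D (\<epsilon> 3) x (e 1 x) = (- r 1 x) *\<^sub>R \<epsilon> 2 x + (- l x) *\<^sub>R \<epsilon> 3 x"
    "D (\<epsilon> 3) x (e 2 x) = (- r 2 x) *\<^sub>R \<epsilon> 2 x + (- m x) *\<^sub>R \<epsilon> 3 x"
    "D (\<epsilon> 3) x (e 3 x) = (- r 3 x - m x) *\<^sub>R \<epsilon> 2 x + \<omega> x"
    "D \<omega> x (e 1 x) = (- 2 * l x) *\<^sub>R \<omega> x" "D \<omega> x (e 2 x) = 0" "D \<omega> x (e 3 x) = 0"
  unfolding D_B[OF x] dE_adapted[OF x] d\<zeta>_adapted[OF x] matrix_vector_right_distrib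
    matrix_vector_mult_scaleR matrix_vector_mult_0_right \<epsilon>_def \<omega>_def by (rule refl)+

text \<open>The planes spanned by \<open>E\<^sub>1\<close> and \<open>\<zeta>\<close> are parallel, as are the lines \<open>\<real>\<zeta>\<close> and the hyperplanes
  spanned by \<open>E\<^sub>2\<close>, \<open>E\<^sub>3\<close>, \<open>\<zeta>\<close>.\<close>

lemma parallel:
  "\<exists>\<rho>>0. ball z0 \<rho> \<subseteq> V \<and> (\<forall>x\<in>ball z0 \<rho>. \<omega> x $ 1 = 0 \<and> \<omega> x $ 2 = 0 \<and> \<omega> x $ 3 = 0 \<and>
    \<epsilon> 1 x $ 2 = 0 \<and> \<epsilon> 1 x $ 3 = 0 \<and> \<epsilon> 2 x $ 1 = 0 \<and> \<epsilon> 3 x $ 1 = 0)"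
proof -
  define P1 :: "real^4 \<Rightarrow> real^3" where "P1 v = vector [v $ 1, v $ 2, v $ 3]" for v
  define P2 :: "real^4 \<Rightarrow> real^2" where "P2 v = vector [v $ 2, v $ 3]" for v
  have bl1: "bounded_linear P1"
    unfolding linear_conv_bounded_linear[symmetric]
    by (intro linearI; unfold vec_eq_iff forall_3; simp add: P1_def)
  have bl2: "bounded_linear P2"
    unfolding linear_conv_bounded_linear[symmetric]
    by (intro linearI; unfold vec_eq_iff forall_2; simp add: P2_def)
  have P1s: "P1 (c *\<^sub>R v) = c *\<^sub>R P1 v" "P1 (- v) = - P1 v" "P1 0 = 0" and P2s: "P2 (c *\<^sub>R v + w) = c *\<^sub>R P2 v + P2 w" "P2 0 = 0" for c v w
    unfolding vec_eq_iff forall_3 forall_2 by (simp_all add: P1_def P2_def)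
  have cl: "continuous_on W (\<lambda>x. \<bar>2 * l x\<bar>)" "continuous_on W (\<lambda>x. \<bar>4 * l x\<bar>)" if "W \<subseteq> V" for W
    using continuous_on_subset[OF smooth_on_continuous[OF smooth_lm(1)] that] by (auto intro!: continuous_intros)
  \<comment> \<open>Along each frame vector \<open>\<omega>\<close> changes by a multiple of itself,
    so the components that vanish at \<open>z0\<close> stay zero.\<close>
  have "\<exists>\<rho>>0. ball z0 \<rho> \<subseteq> V \<and> (\<forall>x\<in>ball z0 \<rho>. P1 (\<omega> x) = 0)"
  proof (rule ode_zero[OF openV subset_refl z0 _ _ cl(1)[OF subset_refl]])
    show "smooth_on V (\<lambda>x. P1 (\<omega> x))"
      by (rule smooth_on_bounded_linear[OF openV bl1 smooth_\<omega>])
    show "P1 (\<omega> z0) = 0"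
      unfolding at_z0 vec_eq_iff forall_3 by (simp add: P1_def axis_def)
    show "norm (D (\<lambda>x. P1 (\<omega> x)) x (e i x)) \<le> \<bar>2 * l x\<bar> * norm (P1 (\<omega> x))" if "x \<in> V" for x i
      unfolding D_bounded_linear[OF smooth_\<omega> that bl1]
      using exhaust_3[of i] by (auto simp: d\<epsilon>[OF that] P1s abs_mult)
  qed
  then obtain \<rho>1 where \<rho>1: "\<rho>1 > 0" "ball z0 \<rho>1 \<subseteq> V" "\<And>x. x \<in> ball z0 \<rho>1 \<Longrightarrow> P1 (\<omega> x) = 0"
    by blast
  have om: "\<omega> x $ 1 = 0" "\<omega> x $ 2 = 0" "\<omega> x $ 3 = 0" if "x \<in> ball z0 \<rho>1" for x
    using \<rho>1(3)[OF that] unfolding vec_eq_iff forall_3 by (simp_all add: P1_def)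
  have P2om: "P2 (\<omega> x) = 0" if "x \<in> ball z0 \<rho>1" for x
    unfolding vec_eq_iff forall_2 using om[OF that] by (simp add: P2_def)
  \<comment> \<open>The equation for these components of \<open>\<epsilon> 1\<close> is closed only
    now that those of \<open>\<omega>\<close> are known to vanish.\<close>
  have "\<exists>\<rho>>0. ball z0 \<rho> \<subseteq> ball z0 \<rho>1 \<and> (\<forall>x\<in>ball z0 \<rho>. P2 (\<epsilon> 1 x) = 0)"
  proof (rule ode_zero[OF open_ball \<rho>1(2) _ _ _ cl(2)[OF \<rho>1(2)]])
    show "z0 \<in> ball z0 \<rho>1"
      using \<rho>1 by simp
    show "smooth_on (ball z0 \<rho>1) (\<lambda>x. P2 (\<epsilon> 1 x))"
      by (rule smooth_on_bounded_linear[OF open_ball bl2 smooth_on_subset[OF smooth_\<epsilon> \<rho>1(2)]])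
    show "P2 (\<epsilon> 1 z0) = 0"
      unfolding at_z0 vec_eq_iff forall_2 by (simp add: P2_def axis_def)
    show "norm (D (\<lambda>x. P2 (\<epsilon> 1 x)) x (e i x)) \<le> \<bar>4 * l x\<bar> * norm (P2 (\<epsilon> 1 x))" if x: "x \<in> ball z0 \<rho>1" for x i
    proof -
      have xV: "x \<in> V"
        using x \<rho>1 by blast
      show ?thesis
        unfolding D_bounded_linear[OF smooth_\<epsilon> xV bl2]
        using exhaust_3[of i] P2om[OF x] by (auto simp: d\<epsilon>[OF xV] P2s abs_mult)
    qed
  qed
  then obtain \<rho>2 where \<rho>2: "\<rho>2 > 0" "ball z0 \<rho>2 \<subseteq> ball z0 \<rho>1" "\<And>x. x \<in> ball z0 \<rho>2 \<Longrightarrow> P2 (\<epsilon> 1 x) = 0"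
    by blast
  have e1: "\<epsilon> 1 x $ 2 = 0" "\<epsilon> 1 x $ 3 = 0" if "x \<in> ball z0 \<rho>2" for x
    using \<rho>2(3)[OF that] unfolding vec_eq_iff forall_2 by (simp_all add: P2_def)
  define c where "c x = \<bar>l x\<bar> + \<bar>m x\<bar> + \<bar>r 1 x\<bar> + \<bar>r 2 x\<bar> + \<bar>r 3 x\<bar>" for x
  \<comment> \<open>The coefficients \<open>r\<close> couple the first components of
    \<open>\<epsilon> 2\<close> and \<open>\<epsilon> 3\<close>, so they are treated as one pair;
    the terms in \<open>\<omega>\<close> contribute nothing to first components.\<close>
  define w where "w x = (\<epsilon> 2 x $ 1, \<epsilon> 3 x $ 1)" for x
  have \<rho>2V: "ball z0 \<rho>2 \<subseteq> V"
    using \<rho>1 \<rho>2 by blast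
  have sw: "smooth_on V (\<lambda>x. \<epsilon> i x $ 1)" for i
    by (rule smooth_on_vec_nth[OF openV smooth_\<epsilon>])
  have w_eq: "w = (\<lambda>x. (\<epsilon> 2 x $ 1) *\<^sub>R (1, 0) + (\<epsilon> 3 x $ 1) *\<^sub>R (0, 1))"
    by (simp add: w_def fun_eq_iff)
  have "\<exists>\<rho>>0. ball z0 \<rho> \<subseteq> ball z0 \<rho>2 \<and> (\<forall>x\<in>ball z0 \<rho>. w x = 0)"
  proof (rule ode_zero[OF open_ball \<rho>2V, where c = "\<lambda>x. 2 * c x"])
    show "z0 \<in> ball z0 \<rho>2"
      using \<rho>2 by simp
    show "smooth_on (ball z0 \<rho>2) w"
      unfolding w_eq by (intro smooth_rules open_ball smooth_on_subset[OF sw \<rho>2V])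
    show "w z0 = 0"
      unfolding w_def at_z0 by (simp add: axis_def zero_prod_def)
    show "continuous_on (ball z0 \<rho>2) (\<lambda>x. 2 * c x)"
      unfolding c_def
      by (intro continuous_intros; rule continuous_on_subset[OF smooth_on_continuous \<rho>2V], rule smooth_lm smooth_pq)
    show "norm (D w x (e i x)) \<le> 2 * c x * norm (w x)" if x: "x \<in> ball z0 \<rho>2" for x i
    proof -
      have xV: "x \<in> V" and om1: "\<omega> x $ 1 = 0"
        using x \<rho>2V om(1) \<rho>2(2) by auto
      have Dw: "D w x v = (D (\<epsilon> 2) x v $ 1, D (\<epsilon> 3) x v $ 1)" for v
      proof -
        have "(w has_derivative (\<lambda>v. (D (\<lambda>x. \<epsilon> 2 x $ 1) x v, D (\<lambda>x. \<epsilon> 3 x $ 1) x v))) (at x)"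
          unfolding w_def[abs_def]
          by (intro has_derivative_Pair smooth_on_has_derivative[OF sw xV])
        from D_eq[OF this] show ?thesis
          by (simp add: D_vec_nth[OF smooth_\<epsilon> xV])
      qed
      have w2: "\<bar>\<epsilon> 2 x $ 1\<bar> \<le> norm (w x)" "\<bar>\<epsilon> 3 x $ 1\<bar> \<le> norm (w x)"
        unfolding w_def using norm_fst_le[of "\<epsilon> 2 x $ 1" "\<epsilon> 3 x $ 1"] norm_snd_le[of "\<epsilon> 3 x $ 1" "\<epsilon> 2 x $ 1"] by simp_all
      have bnd: "\<bar>s * \<epsilon> 2 x $ 1 + t * \<epsilon> 3 x $ 1\<bar> \<le> c x * norm (w x)" if "\<bar>s\<bar> + \<bar>t\<bar> \<le> c x" for s t
      proof -
        have "\<bar>s * \<epsilon> 2 x $ 1 + t * \<epsilon> 3 x $ 1\<bar> \<le> \<bar>s\<bar> * \<bar>\<epsilon> 2 x $ 1\<bar> + \<bar>t\<bar> * \<bar>\<epsilon> 3 x $ 1\<bar>"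
          by (metis abs_mult abs_triangle_ineq)
        also have "\<dots> \<le> \<bar>s\<bar> * norm (w x) + \<bar>t\<bar> * norm (w x)"
          by (intro add_mono mult_left_mono w2) auto
        also have "\<dots> = (\<bar>s\<bar> + \<bar>t\<bar>) * norm (w x)"
          by (simp add: distrib_right)
        also have "\<dots> \<le> c x * norm (w x)"
          by (rule mult_right_mono[OF that]) simp
        finally show ?thesis .
      qed
      have comp: "\<bar>D (\<epsilon> 2) x (e i x) $ 1\<bar> \<le> c x * norm (w x) \<and> \<bar>D (\<epsilon> 3) x (e i x) $ 1\<bar> \<le> c x * norm (w x)"
        using exhaust_3[of i]
      proof (elim disjE)
        assume i: "i = 1"
        show ?thesis
          using bnd[of "- l x" "r 1 x"] bnd[of "- r 1 x" "- l x"] unfolding i d\<epsilon>[OF xV] by (simp add: c_def)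
      next
        assume i: "i = 2"
        show ?thesis
          using bnd[of "m x" "r 2 x"] bnd[of "- r 2 x" "- m x"] unfolding i d\<epsilon>[OF xV] by (simp add: c_def om1)
      next
        assume i: "i = 3"
        have "\<bar>r 3 x - m x\<bar> \<le> c x" "\<bar>- r 3 x - m x\<bar> \<le> c x"
          unfolding c_def by linarith+
        then show ?thesis
          using bnd[of 0 "r 3 x - m x"] bnd[of "- r 3 x - m x" 0] unfolding i d\<epsilon>[OF xV] by (simp add: om1)
      qed
      have "norm (D w x (e i x)) \<le> \<bar>D (\<epsilon> 2) x (e i x) $ 1\<bar> + \<bar>D (\<epsilon> 3) x (e i x) $ 1\<bar>"
        unfolding Dw using norm_Pair_le[of "D (\<epsilon> 2) x (e i x) $ 1" "D (\<epsilon> 3) x (e i x) $ 1"] by simp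
      with comp show ?thesis
        by linarith
    qed
  qed
  then obtain \<rho>3 where \<rho>3: "\<rho>3 > 0" "ball z0 \<rho>3 \<subseteq> ball z0 \<rho>2" "\<And>x. x \<in> ball z0 \<rho>3 \<Longrightarrow> w x = 0"
    by blast
  show ?thesis
  proof (intro exI conjI ballI)
    show "\<rho>3 > 0" "ball z0 \<rho>3 \<subseteq> V"
      using \<rho>3 \<rho>2V by auto
    fix x assume x: "x \<in> ball z0 \<rho>3"
    then have x2: "x \<in> ball z0 \<rho>2" and x1: "x \<in> ball z0 \<rho>1"
      using \<rho>3(2) \<rho>2(2) by blast+
    show "\<omega> x $ 1 = 0" "\<omega> x $ 2 = 0" "\<omega> x $ 3 = 0" "\<epsilon> 1 x $ 2 = 0" "\<epsilon> 1 x $ 3 = 0"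
      using om[OF x1] e1[OF x2] by auto
    show "\<epsilon> 2 x $ 1 = 0" "\<epsilon> 3 x $ 1 = 0"
      using \<rho>3(3)[OF x] by (auto simp: w_def zero_prod_def)
  qed
qed

end

section \<open>Graphs over the plane\<close>

abbreviation hess :: "(real^2 \<Rightarrow> real) \<Rightarrow> real^2 \<Rightarrow> real^2 \<Rightarrow> real^2 \<Rightarrow> real" where
  "hess f w v u \<equiv> D (\<lambda>y. D f y u) w v"

abbreviation graph :: "(real^2 \<Rightarrow> real) \<Rightarrow> real^2 \<Rightarrow> real^3" where
  "graph f w \<equiv> vector [w $ 1, w $ 2, f w]"

lemma constant_if_D_zero:
  fixes g :: "'a::euclidean_space \<Rightarrow> 'b::real_normed_vector"
  assumes "open N" "convex N" "\<And>x. x \<in> N \<Longrightarrow> (g has_derivative (\<lambda>_. 0)) (at x)" "x \<in> N" "y \<in> N"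
  shows "g x = g y"
proof -
  have "(g has_derivative (\<lambda>_. 0)) (at x within N)" if "x \<in> N" for x
    using assms(3)[OF that] has_derivative_at_withinI by blast
  from has_derivative_zero_constant[OF assms(2) this] assms(4,5) show ?thesis
    by metis
qed

lemma hess_bilinear:
  assumes "open N" "smooth_on N f" "w \<in> N"
  shows "linear (hess f w v)" "linear (\<lambda>v. hess f w v u)"
  using linear_DD[OF assms] linear_D[OF smooth_on_D[OF assms(2)] assms(3)] by auto

lemma smooth_graph:
  assumes "open N" "smooth_on N f"
  shows "smooth_on N (graph f)"
proof (rule smooth_on_vec[OF assms(1)])
  fix i :: 3
  show "smooth_on N (\<lambda>w. graph f w $ i)"
    using exhaust_3[of i] assms(2) smooth_on_vec_nth[OF assms(1) smooth_on_id] by auto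
qed

lemma D_graph:
  assumes "open N" "smooth_on N f" "w \<in> N"
  shows "D (graph f) w v = vector [v $ 1, v $ 2, D f w v]"
proof -
  note d = D_vec_nth[OF smooth_graph[OF assms(1,2)] assms(3), of _ v]
  have "D (\<lambda>w :: real^2. w $ i) w v = v $ i" for i
    using D_vec_nth[OF smooth_on_id assms(3), of i v] by simp
  then show ?thesis
    using d[of 1] d[of 2] d[of 3] unfolding vec_eq_iff forall_3 by simp
qed

text \<open>Only the last component of a second derivative of the graph is nonzero. It is a multiple
  of \<open>(0, 0, 1)\<close>, so the tangential part is zero and the coefficient is the
  Hessian.\<close>

lemma aff_metric_graph:
  assumes "open N" "smooth_on N f" "w \<in> N"
  shows "aff_metric (graph f) (\<lambda>w. vector [0, 0, 1]) w v u = hess f w v u"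
proof -
  have s: "smooth_on N (\<lambda>y. vector [u $ 1, u $ 2, D f y u] :: real^3)"
  proof (rule smooth_on_vec[OF assms(1)])
    fix i :: 3
    show "smooth_on N (\<lambda>y. (vector [u $ 1, u $ 2, D f y u] :: real^3) $ i)"
      using exhaust_3[of i] smooth_on_D[OF assms(2)] by (auto intro: smooth_on_const)
  qed
  note d = D_vec_nth[OF s assms(3), of _ v]
  have "D (\<lambda>y. D (graph f) y u) w v = D (\<lambda>y. vector [u $ 1, u $ 2, D f y u]) w v"
    by (rule D_cong_open[OF assms(1,3), THEN fun_cong]) (rule D_graph[OF assms(1,2)])
  also have "\<dots> = vector [0, 0, hess f w v u]"
    using d[of 1] d[of 2] d[of 3] unfolding vec_eq_iff forall_3 by simp
  finally have push: "d_push (graph f) (\<lambda>_. v) (\<lambda>_. u) w = vector [0, 0, hess f w v u]"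
    by (simp add: d_push_def)
  have l: "linear (D f w)"
    by (rule linear_D[OF assms(2,3)])
  show ?thesis
    unfolding aff_metric_def push D_graph[OF assms]
  proof (rule the_equality)
    show "\<exists>Z. vector [0, 0, hess f w v u] = (vector [Z $ 1, Z $ 2, D f w Z] :: real^3) + hess f w v u *\<^sub>R vector [0, 0, 1]"
      by (rule exI[of _ 0]) (unfold vec_eq_iff forall_3, simp add: linear_0[OF l])
    fix c assume "\<exists>Z. vector [0, 0, hess f w v u] = (vector [Z $ 1, Z $ 2, D f w Z] :: real^3) + c *\<^sub>R vector [0, 0, 1]"
    then obtain Z where Z: "vector [0, 0, hess f w v u] = (vector [Z $ 1, Z $ 2, D f w Z] :: real^3) + c *\<^sub>R vector [0, 0, 1]"
      by blast
    have z: "Z $ 1 = 0" "Z $ 2 = 0" and c: "hess f w v u = D f w Z + c"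
      using Z unfolding vec_eq_iff forall_3 by simp_all
    have "Z = 0"
      unfolding vec_eq_iff forall_2 using z by simp
    then show "c = hess f w v u"
      using c by (simp add: linear_0[OF l])
  qed
qed

text \<open>The assumption encodes \<open>det Hess f = 1\<close>. Any orthonormal pair arises from
  \<open>Y1\<close>, \<open>Y2\<close> by an orthogonal matrix, which changes the volume by a sign
  at most.\<close>

lemma graph_improper_affine_sphere:
  assumes N: "open N" "smooth_on N f"
    and frame: "\<And>w. w \<in> N \<Longrightarrow> \<exists>Y1 Y2. hess f w Y1 Y1 = 1 \<and> hess f w Y1 Y2 = 0 \<and> hess f w Y2 Y1 = 0 \<and> hess f w Y2 Y2 = 1 \<and>
      Y1 $ 1 * Y2 $ 2 - Y1 $ 2 * Y2 $ 1 = 1"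
  shows "improper_affine_sphere N (graph f) (\<lambda>w. vector [0, 0, 1])"
  unfolding improper_affine_sphere_def blaschke_hypersurface_def
proof (intro conjI ballI)
  show "CARD(3) = Suc DIM(real^2)"
    by simp
  show "open N" "smooth_on N (graph f)"
    by (rule N smooth_graph[OF N])+
  show "smooth_on N (\<lambda>w. vector [0, 0, 1] :: real^3)"
    by (rule smooth_on_const)
  show "\<exists>c. \<forall>x\<in>N. vector [0, 0, 1] = (c :: real^3)"
    by blast
  fix w assume w: "w \<in> N"
  note dg = D_graph[OF N w] and ag = aff_metric_graph[OF N w]
  note l = linear_D[OF N(2) w]
  obtain Y1 Y2 where Y: "hess f w Y1 Y1 = 1" "hess f w Y1 Y2 = 0" "hess f w Y2 Y1 = 0" "hess f w Y2 Y2 = 1"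
    and dY: "Y1 $ 1 * Y2 $ 2 - Y1 $ 2 * Y2 $ 1 = 1"
    using frame[OF w] by blast
  have ex: "\<exists>c d. v = c *\<^sub>R Y1 + d *\<^sub>R Y2" for v :: "real^2"
  proof (intro exI)
    have "v $ 1 = v $ 1 * (Y1 $ 1 * Y2 $ 2 - Y1 $ 2 * Y2 $ 1)" "v $ 2 = v $ 2 * (Y1 $ 1 * Y2 $ 2 - Y1 $ 2 * Y2 $ 1)"
      unfolding dY by simp_all
    then show "v = (v $ 1 * Y2 $ 2 - v $ 2 * Y2 $ 1) *\<^sub>R Y1 + (Y1 $ 1 * v $ 2 - Y1 $ 2 * v $ 1) *\<^sub>R Y2"
      unfolding vec_eq_iff forall_2 by (simp add: algebra_simps)
  qed
  note hl = hess_bilinear[OF N w]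
  have hq: "hess f w (c *\<^sub>R Y1 + d *\<^sub>R Y2) (c' *\<^sub>R Y1 + d' *\<^sub>R Y2) = c * c' + d * d'" for c d c' d'
    by (simp add: linear_add[OF hl(1)] linear_scale[OF hl(1)] linear_add[OF hl(2)] linear_scale[OF hl(2)] Y)
  show "inj (D (graph f) w)"
    unfolding inj_def dg vec_eq_iff forall_3 forall_2 by simp
  show "(vector [0, 0, 1] :: real^3) \<notin> range (D (graph f) w)"
  proof
    assume "(vector [0, 0, 1] :: real^3) \<in> range (D (graph f) w)"
    then obtain v where v: "(vector [0, 0, 1] :: real^3) = vector [v $ 1, v $ 2, D f w v]"
      unfolding dg by blast
    have "v $ 1 = 0" "v $ 2 = 0" and one: "1 = D f w v"
      using v unfolding vec_eq_iff forall_3 by simp_all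
    then have "v = 0"
      unfolding vec_eq_iff forall_2 by simp
    with one show False
      by (simp add: linear_0[OF l])
  qed
  show "range (D (\<lambda>w. vector [0, 0, 1] :: real^3) w) \<subseteq> range (D (graph f) w)"
  proof
    fix y assume "y \<in> range (D (\<lambda>w :: real^2. vector [0, 0, 1] :: real^3) w)"
    then have "y = 0"
      by simp
    moreover have "D (graph f) w 0 = 0"
      by (rule linear_0[OF linear_D[OF smooth_graph[OF N] w]])
    ultimately show "y \<in> range (D (graph f) w)"
      using rangeI[of "D (graph f) w" 0] by (simp only:)
  qed
  show "\<forall>v. (\<forall>u. aff_metric (graph f) (\<lambda>w. vector [0, 0, 1]) w v u = 0) \<longrightarrow> v = 0"
  proof (intro allI impI)
    fix v assume z: "\<forall>u. aff_metric (graph f) (\<lambda>w. vector [0, 0, 1]) w v u = 0"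
    obtain c d where v: "v = c *\<^sub>R Y1 + d *\<^sub>R Y2"
      using ex by blast
    have "c = 0" "d = 0"
      using z[unfolded ag v, rule_format, of "1 *\<^sub>R Y1 + 0 *\<^sub>R Y2"] z[unfolded ag v, rule_format, of "0 *\<^sub>R Y1 + 1 *\<^sub>R Y2"]
      unfolding hq by simp_all
    then show "v = 0"
      using v by simp
  qed
  show "\<forall>Xs. length Xs = DIM(real^2) \<and> orthonormal (aff_metric (graph f) (\<lambda>w. vector [0, 0, 1]) w) Xs \<longrightarrow>
      \<bar>det (vector (map (D (graph f) w) Xs @ [vector [0, 0, 1]]) :: real^3^3)\<bar> = 1"
  proof (intro allI impI)
    fix Xs :: "(real^2) list"
    assume Xs: "length Xs = DIM(real^2) \<and> orthonormal (aff_metric (graph f) (\<lambda>w. vector [0, 0, 1]) w) Xs"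
    then obtain X Y where XY: "Xs = [X, Y]"
      by (auto simp: length_Suc_conv numeral_2_eq_2)
    obtain c d c' d' where cd: "X = c *\<^sub>R Y1 + d *\<^sub>R Y2" "Y = c' *\<^sub>R Y1 + d' *\<^sub>R Y2"
      using ex by metis
    have o: "\<bar>hess f w ([X, Y] ! i) ([X, Y] ! j)\<bar> = (if i = j then 1 else 0)" if "i < 2" "j < 2" for i j
      using Xs that unfolding XY orthonormal_def ag by simp
    have "\<bar>c * c + d * d\<bar> = 1" "\<bar>c' * c' + d' * d'\<bar> = 1" "c * c' + d * d' = 0"
      using o[of 0 0] o[of 1 1] o[of 0 1] unfolding cd by (simp_all add: hq)
    then have n: "c * c + d * d = 1" "c' * c' + d' * d' = 1" "c * c' + d * d' = 0"
      by (simp_all add: abs_of_nonneg)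
    \<comment> \<open>Lagrange's identity for the coefficient matrix, which is orthogonal.\<close>
    have "(c * d' - d * c')\<^sup>2 = (c * c + d * d) * (c' * c' + d' * d') - (c * c' + d * d')\<^sup>2"
      by algebra
    then have "(c * d' - d * c')\<^sup>2 = 1"
      unfolding n by simp
    then have "\<bar>c * d' - d * c'\<bar> = 1"
      by (simp add: power2_eq_1_iff abs_if split: if_splits) auto
    moreover have "det (vector (map (D (graph f) w) Xs @ [vector [0, 0, 1]]) :: real^3^3) =
        (c * d' - d * c') * (Y1 $ 1 * Y2 $ 2 - Y1 $ 2 * Y2 $ 1)"
      unfolding XY dg cd by (simp add: det_3 algebra_simps)
    ultimately show "\<bar>det (vector (map (D (graph f) w) Xs @ [vector [0, 0, 1]]) :: real^3^3)\<bar> = 1"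
      unfolding dY by simp
  qed
qed

text \<open>The differential of \<open>f\<close> minus that of \<open>(w \<bullet> w) / 2\<close>
  has zero derivative and is a constant form \<open>L\<close> on the convex set; integrating once
  more leaves a constant.\<close>

lemma hess_identity_quadratic:
  assumes N: "open N" "convex N" "smooth_on N f" and h: "\<And>w v u. w \<in> N \<Longrightarrow> hess f w v u = v \<bullet> u"
  shows "\<exists>\<beta> c. \<forall>w\<in>N. f w = (w \<bullet> w) / 2 + \<beta> \<bullet> w + c"
proof (cases "N = {}")
  case False
  then obtain w0 where w0: "w0 \<in> N"
    by blast
  define L where "L u = D f w0 u - w0 \<bullet> u" for u
  have k: "D f w u - w \<bullet> u = L u" if "w \<in> N" for w u
  proof -
    have "((\<lambda>w. D f w u - w \<bullet> u) has_derivative (\<lambda>v. hess f x v u - v \<bullet> u)) (at x)" if "x \<in> N" for x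
      by (intro has_derivative_diff smooth_on_has_derivative[OF smooth_on_D[OF N(3)] that] has_derivative_inner_left has_derivative_ident)
    then show ?thesis
      unfolding L_def using h by (intro constant_if_D_zero[OF N(1,2) _ that w0, of "\<lambda>w. D f w u - w \<bullet> u"]) simp
  qed
  have lL: "linear L"
    unfolding L_def by (intro linear_compose_sub linear_D[OF N(3) w0] bounded_linear.linear bounded_linear_inner_right)
  define g where "g w = f w - (w \<bullet> w) / 2 - L w" for w
  have "(g has_derivative (\<lambda>v. D f x v - (x \<bullet> v + v \<bullet> x) / 2 - L v)) (at x)" if "x \<in> N" for x
  proof -
    have "((\<lambda>w. (w \<bullet> w) / 2) has_derivative (\<lambda>v. (x \<bullet> v + v \<bullet> x) / 2)) (at x)"
      by (rule bounded_linear.has_derivative[OF bounded_linear_divide has_derivative_inner[OF has_derivative_ident has_derivative_ident]])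
    then show ?thesis
      unfolding g_def[abs_def]
      by (rule has_derivative_diff[OF has_derivative_diff[OF smooth_on_has_derivative[OF N(3) that]] linear_imp_has_derivative[OF lL]])
  qed
  moreover have "D f x v - (x \<bullet> v + v \<bullet> x) / 2 - L v = 0" if "x \<in> N" for x v
    using k[OF that, of v] by (simp add: inner_commute)
  ultimately have g: "g w = g w0" if "w \<in> N" for w
    by (intro constant_if_D_zero[OF N(1,2) _ that w0]) simp
  define \<beta> :: "real^2" where "\<beta> = (\<chi> i. L (axis i 1))"
  have Lb: "L w = \<beta> \<bullet> w" for w
    using arg_cong[OF vec_eq_sum_axis[of w], of L]
    by (simp add: linear_sum[OF lL] linear_scale[OF lL] inner_vec_def \<beta>_def mult.commute)
  have "f w = (w \<bullet> w) / 2 + \<beta> \<bullet> w + g w0" if "w \<in> N" for w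
    using g[OF that] by (simp add: g_def[of w] Lb)
  then show ?thesis
    by blast
qed simp

text \<open>The affine map \<open>T\<close> halves the third coordinate of the standard paraboloid,
  adds the linear part of \<open>f\<close> as a shear and translates. The graph over
  \<open>N\<close> is what the open cylinder over \<open>N\<close> cuts out of the image.\<close>

lemma quadratic_graph_paraboloid:
  assumes "open N" and f: "\<And>w. w \<in> N \<Longrightarrow> f w = (w \<bullet> w) / 2 + \<beta> \<bullet> w + c"
  shows "\<exists>P. elliptic_paraboloid P \<and> openin (top_of_set P) (graph f ` N)"
proof -
  define L :: "real^3 \<Rightarrow> real^3" where "L y = vector [y $ 1, y $ 2, y $ 3 / 2 + \<beta> $ 1 * y $ 1 + \<beta> $ 2 * y $ 2]" for y
  define L' :: "real^3 \<Rightarrow> real^3" where "L' y = vector [y $ 1, y $ 2, 2 * (y $ 3 - \<beta> $ 1 * y $ 1 - \<beta> $ 2 * y $ 2)]" for y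
  have "linear L"
    by (intro linearI; unfold vec_eq_iff forall_3; simp add: L_def algebra_simps add_divide_distrib)
  moreover have "L (L' y) = y" "L' (L y) = y" for y
    unfolding vec_eq_iff forall_3 by (simp_all add: L_def L'_def field_simps)
  then have "bij L"
    by (intro o_bij[of L']) (simp_all add: fun_eq_iff)
  ultimately have iso: "affine_iso (\<lambda>y. L y + vector [0, 0, c])"
    unfolding affine_iso_def by blast
  define T where "T = (\<lambda>y. L y + vector [0, 0, c])"
  define P where "P = T ` {x. x $ 3 = (x $ 1)\<^sup>2 + (x $ 2)\<^sup>2}"
  have T: "T y $ 1 = y $ 1" "T y $ 2 = y $ 2" "T y $ 3 = y $ 3 / 2 + \<beta> $ 1 * y $ 1 + \<beta> $ 2 * y $ 2 + c" for y
    by (simp_all add: T_def L_def)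
  define \<pi> :: "real^3 \<Rightarrow> real^2" where "\<pi> y = vector [y $ 1, y $ 2]" for y
  have "linear \<pi>"
    by (intro linearI; unfold vec_eq_iff forall_2; simp add: \<pi>_def)
  then have "continuous_on UNIV \<pi>"
    by (simp add: linear_continuous_on linear_conv_bounded_linear)
  then have "open (\<pi> -` N)"
    using assms(1) continuous_open_preimage[of UNIV \<pi> N] by simp
  have fw: "f w = ((w $ 1)\<^sup>2 + (w $ 2)\<^sup>2) / 2 + \<beta> $ 1 * w $ 1 + \<beta> $ 2 * w $ 2 + c" if "w \<in> N" for w
    using f[OF that] by (simp add: inner_vec_def sum_2 power2_eq_square)
  have "graph f ` N = P \<inter> \<pi> -` N"
  proof (intro set_eqI iffI)
    fix y assume "y \<in> graph f ` N"
    then obtain w where w: "w \<in> N" "y = graph f w"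
      by blast
    have "y = T (vector [w $ 1, w $ 2, (w $ 1)\<^sup>2 + (w $ 2)\<^sup>2])"
      unfolding vec_eq_iff forall_3 T w(2) by (simp add: fw[OF w(1)])
    then have "y \<in> P"
      unfolding P_def by (intro image_eqI) auto
    moreover have "\<pi> y = w"
      unfolding vec_eq_iff forall_2 by (simp add: \<pi>_def w(2))
    ultimately show "y \<in> P \<inter> \<pi> -` N"
      using w(1) by simp
  next
    fix y assume y: "y \<in> P \<inter> \<pi> -` N"
    then obtain x where x: "y = T x" "x $ 3 = (x $ 1)\<^sup>2 + (x $ 2)\<^sup>2"
      unfolding P_def by blast
    have "y = graph f (\<pi> y)"
      unfolding vec_eq_iff forall_3 using fw[of "\<pi> y"] y by (simp add: \<pi>_def x T)
    then show "y \<in> graph f ` N"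
      using y by blast
  qed
  then have "openin (top_of_set P) (graph f ` N)"
    using \<open>open (\<pi> -` N)\<close> by (simp add: openin_open_Int)
  moreover have "elliptic_paraboloid P"
    unfolding elliptic_paraboloid_def P_def using iso T_def by blast
  ultimately show ?thesis
    by blast
qed

section \<open>The product decomposition\<close>

context pointed
begin

text \<open>The order of components matters: \<open>\<Theta> x = emb (t, w)\<close> says that
  \<open>t\<close> is the first component of \<open>U x\<close> and \<open>w\<close> the second and
  third. Dropping the fourth is the projection along \<open>\<zeta>\<close>.\<close>

definition emb :: "real \<times> (real^2) \<Rightarrow> real^3" where "emb tw = vector [snd tw $ 1, snd tw $ 2, fst tw]"
definition unemb :: "real^3 \<Rightarrow> real \<times> (real^2)" where "unemb y = (y $ 3, vector [y $ 1, y $ 2])"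
definition pr3 :: "real^4 \<Rightarrow> real^3" where "pr3 v = vector [v $ 2, v $ 3, v $ 1]"
definition pr2 :: "real^4 \<Rightarrow> real^2" where "pr2 v = vector [v $ 2, v $ 3]"
definition \<Theta> where "\<Theta> x = pr3 (U x)"

lemma bl_emb: "bounded_linear emb" and bl_unemb: "bounded_linear unemb"
  and bl_pr3: "bounded_linear pr3" and bl_pr2: "bounded_linear pr2"
proof -
  show "bounded_linear emb"
    unfolding linear_conv_bounded_linear[symmetric]
    by (intro linearI; unfold vec_eq_iff forall_3; simp add: emb_def)
  show "bounded_linear unemb"
    unfolding linear_conv_bounded_linear[symmetric]
    by (intro linearI; unfold unemb_def prod_eq_iff vec_eq_iff forall_2; simp)
  show "bounded_linear pr3"
    unfolding linear_conv_bounded_linear[symmetric]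
    by (intro linearI; unfold vec_eq_iff forall_3; simp add: pr3_def)
  show "bounded_linear pr2"
    unfolding linear_conv_bounded_linear[symmetric]
    by (intro linearI; unfold vec_eq_iff forall_2; simp add: pr2_def)
qed

lemma emb_unemb: "emb (unemb y) = y" "unemb (emb tw) = tw"
  by (unfold vec_eq_iff forall_3, simp add: emb_def unemb_def)
     (unfold prod_eq_iff unemb_def emb_def fst_conv snd_conv vec_eq_iff forall_2, simp)

lemma smooth_\<Theta>: "smooth_on V \<Theta>"
  unfolding \<Theta>_def[abs_def] by (rule smooth_on_bounded_linear[OF openV bl_pr3 smooth_U])

lemma D_\<Theta>: "x \<in> V \<Longrightarrow> D \<Theta> x (e i x) = pr3 (\<epsilon> i x)"
  unfolding \<Theta>_def[abs_def] by (simp add: D_bounded_linear[OF smooth_U _ bl_pr3] D_B)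

lemma D_expand:
  assumes "x \<in> V" "smooth_on V k"
  shows "D k x v = h x v (e 1 x) *\<^sub>R D k x (e 1 x) + h x v (e 2 x) *\<^sub>R D k x (e 2 x) + h x v (e 3 x) *\<^sub>R D k x (e 3 x)"
proof -
  note l = linear_D[OF assms(2,1)]
  show ?thesis
    using arg_cong[OF expand[OF assms(1), of v], of "D k x"]
    by (simp add: sum_3 linear_add[OF l] linear_scale[OF l])
qed

lemma inj_D_\<Theta>: "inj (D \<Theta> z0)"
  unfolding linear_injective_0[OF linear_D[OF smooth_\<Theta> z0]]
proof (intro allI impI)
  fix v assume "D \<Theta> z0 v = 0"
  then have "h z0 v (e 1 z0) *\<^sub>R pr3 (axis 1 1) + h z0 v (e 2 z0) *\<^sub>R pr3 (axis 2 1) + h z0 v (e 3 z0) *\<^sub>R pr3 (axis 3 1) = 0"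
    unfolding D_expand[OF z0 smooth_\<Theta>, of v] D_\<Theta>[OF z0] at_z0 .
  then have "h z0 v (e 1 z0) = 0" "h z0 v (e 2 z0) = 0" "h z0 v (e 3 z0) = 0"
    unfolding vec_eq_iff forall_3 by (simp_all add: pr3_def axis_def)
  then show "v = 0"
    using expand[OF z0, of v] by (simp add: sum_3)
qed

text \<open>With \<open>t\<close> and \<open>w\<close> read off from the first three components of
  \<open>U\<close>, the fourth is a height. Its derivative in \<open>t\<close> involves only
  \<open>\<epsilon> 1\<close>, which is constant on the slices of fixed \<open>t\<close>.\<close>

lemma product_coordinates:
  "\<exists>(I :: real set) (N :: (real^2) set) f (\<gamma> :: real \<Rightarrow> real^2) W G T.
     open I \<and> is_interval I \<and> smooth_on I \<gamma> \<and>
     improper_affine_sphere N (graph f) (\<lambda>w. vector [0, 0, 1]) \<and>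
     diffeomorphism (I \<times> N) W G \<and> W \<subseteq> V \<and> z0 \<in> W \<and> affine_iso T \<and>
     (\<forall>t\<in>I. \<forall>w\<in>N. T (\<Phi> (G (t, w))) = vector [w $ 1, w $ 2, f w + \<gamma> t $ 2, \<gamma> t $ 1]) \<and>
     ((\<forall>x\<in>V. m x = 0) \<longrightarrow> (\<exists>P. elliptic_paraboloid P \<and> openin (top_of_set P) (graph f ` N)))"
proof -
  obtain \<rho> where \<rho>: "\<rho> > 0" "ball z0 \<rho> \<subseteq> V" and par: "\<And>x. x \<in> ball z0 \<rho> \<Longrightarrow> \<omega> x $ 1 = 0 \<and> \<omega> x $ 2 = 0 \<and> \<omega> x $ 3 = 0 \<and>
      \<epsilon> 1 x $ 2 = 0 \<and> \<epsilon> 1 x $ 3 = 0 \<and> \<epsilon> 2 x $ 1 = 0 \<and> \<epsilon> 3 x $ 1 = 0"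
    using parallel by blast
  have zball: "z0 \<in> ball z0 \<rho>"
    using \<rho> by simp
  \<comment> \<open>Otherwise \<open>\<epsilon> 1 x\<close> and \<open>\<omega> x\<close> would both
    lie on the fourth coordinate axis, although they are independent.\<close>
  have \<tau>: "\<epsilon> 1 x $ 1 \<noteq> 0" if x: "x \<in> ball z0 \<rho>" for x
  proof
    assume z: "\<epsilon> 1 x $ 1 = 0"
    define c d where "c = \<omega> x $ 4" and "d = \<epsilon> 1 x $ 4"
    have "c *\<^sub>R \<epsilon> 1 x + (- d) *\<^sub>R \<omega> x = 0"
      unfolding vec_eq_iff forall_4 using par[OF x] z by (simp add: c_def d_def)
    then have "B *v (c *\<^sub>R E 1 x + (- d) *\<^sub>R \<zeta> x) = B *v 0"
      unfolding \<epsilon>_def \<omega>_def by (simp add: matrix_vector_right_distrib matrix_vector_mult_scaleR del: scaleR_minus_left)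
    then have "c *\<^sub>R E 1 x + (- d) *\<^sub>R \<zeta> x = 0"
      using bij_B by (metis bij_is_inj injD)
    then have "c *\<^sub>R E 1 x + 0 *\<^sub>R E 2 x + 0 *\<^sub>R E 3 x + (- d) *\<^sub>R \<zeta> x = 0"
      by simp
    from indep_\<zeta>[OF subsetD[OF \<rho>(2) x], unfolded indep4_def, rule_format, OF this] have cd: "c = 0"
      by simp
    have "\<omega> x = 0"
      unfolding vec_eq_iff forall_4 using par[OF x] cd by (simp add: c_def)
    then have "B *v \<zeta> x = B *v 0"
      by (simp add: \<omega>_def)
    then have "\<zeta> x = 0"
      using bij_B by (metis bij_is_inj injD)
    then have "0 *\<^sub>R E 1 x + 0 *\<^sub>R E 2 x + 0 *\<^sub>R E 3 x + 1 *\<^sub>R \<zeta> x = 0"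
      by simp
    from indep_\<zeta>[OF subsetD[OF \<rho>(2) x], unfolded indep4_def, rule_format, OF this] show False
      by simp
  qed
  have "\<exists>W1 V1 g. open W1 \<and> W1 \<subseteq> ball z0 \<rho> \<and> z0 \<in> W1 \<and> open V1 \<and> \<Theta> ` W1 = V1 \<and> smooth_on V1 g \<and>
      (\<forall>x\<in>W1. g (\<Theta> x) = x) \<and> (\<forall>y\<in>V1. g y \<in> W1 \<and> \<Theta> (g y) = y) \<and>
      (\<forall>y\<in>V1. \<forall>v. D \<Theta> (g y) (D g y v) = v \<and> D g y (D \<Theta> (g y) v) = v)"
  proof (rule smooth_inverse_function[OF open_ball zball smooth_on_subset[OF smooth_\<Theta> \<rho>(2)] inj_D_\<Theta>])
    fix W1 V1 g
    assume "open W1" "W1 \<subseteq> ball z0 \<rho>" "z0 \<in> W1" "open V1" "\<Theta> ` W1 = V1" "smooth_on V1 g"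
      "\<And>x. x \<in> W1 \<Longrightarrow> g (\<Theta> x) = x" "\<And>y. y \<in> V1 \<Longrightarrow> g y \<in> W1 \<and> \<Theta> (g y) = y"
      "\<And>y v. y \<in> V1 \<Longrightarrow> D \<Theta> (g y) (D g y v) = v" "\<And>y v. y \<in> V1 \<Longrightarrow> D g y (D \<Theta> (g y) v) = v"
    then show ?thesis
      by (intro exI[of _ W1] exI[of _ V1] exI[of _ g]) simp
  qed
  then obtain W1 V1 g where inverse: "open W1 \<and> W1 \<subseteq> ball z0 \<rho> \<and> z0 \<in> W1 \<and> open V1 \<and> \<Theta> ` W1 = V1 \<and> smooth_on V1 g \<and>
      (\<forall>x\<in>W1. g (\<Theta> x) = x) \<and> (\<forall>y\<in>V1. g y \<in> W1 \<and> \<Theta> (g y) = y) \<and>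
      (\<forall>y\<in>V1. \<forall>v. D \<Theta> (g y) (D g y v) = v \<and> D g y (D \<Theta> (g y) v) = v)"
    by (elim exE) (rule that)
  have W1: "open W1" "W1 \<subseteq> ball z0 \<rho>" "z0 \<in> W1" and V1: "open V1" "\<Theta> ` W1 = V1" and sg: "smooth_on V1 g"
    and g: "\<forall>x\<in>W1. g (\<Theta> x) = x" "\<forall>y\<in>V1. g y \<in> W1 \<and> \<Theta> (g y) = y"
      "\<forall>y\<in>V1. \<forall>v. D \<Theta> (g y) (D g y v) = v \<and> D g y (D \<Theta> (g y) v) = v"
    using inverse by - (elim conjE, assumption)+
  have g\<Theta>: "g (\<Theta> x) = x" if "x \<in> W1" for x
    using g(1) that by (rule bspec)
  have \<Theta>g: "g y \<in> W1 \<and> \<Theta> (g y) = y" if "y \<in> V1" for y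
    using g(2) that by (rule bspec)
  have Dg2: "D \<Theta> (g y) (D g y v) = v" and Dg: "D g y (D \<Theta> (g y) v) = v" if "y \<in> V1" for y v
    using spec[OF bspec[OF g(3) that], of v] by simp_all
  define t0 where "t0 = fst (unemb (\<Theta> z0))"
  define w0 where "w0 = snd (unemb (\<Theta> z0))"
  have emb0: "emb (t0, w0) = \<Theta> z0"
    by (simp add: t0_def w0_def emb_unemb)
  have "open (emb -` V1)"
    using continuous_open_preimage[OF linear_continuous_on[OF bl_emb] open_UNIV V1(1)] by simp
  moreover have "(t0, w0) \<in> emb -` V1"
    using V1(2) W1(3) emb0 by auto
  ultimately obtain A1 A2 where "open A1" "open A2" "(t0, w0) \<in> A1 \<times> A2" "A1 \<times> A2 \<subseteq> emb -` V1"
    by (rule open_prod_elim)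
  then have A: "open A1" "open A2" "t0 \<in> A1" "w0 \<in> A2" "A1 \<times> A2 \<subseteq> emb -` V1"
    by simp_all
  obtain d1 d2 where d: "d1 > 0" "ball t0 d1 \<subseteq> A1" "d2 > 0" "ball w0 d2 \<subseteq> A2"
    using A(1-4) unfolding open_contains_ball by blast
  \<comment> \<open>Balls provide an interval and a convex disc, as the constancy arguments on
    slices require.\<close>
  define I where "I = ball t0 d1"
  define N where "N = ball w0 d2"
  have I: "open I" "is_interval I" "convex I" "t0 \<in> I" and N: "open N" "convex N" "w0 \<in> N"
    using d by (simp_all add: I_def N_def is_interval_ball_real)
  define G where "G tw = g (emb tw)" for tw
  have embV1: "emb tw \<in> V1" if "tw \<in> I \<times> N" for tw
    using that A d unfolding I_def N_def by blast
  have G: "G tw \<in> W1" "\<Theta> (G tw) = emb tw" "G tw \<in> ball z0 \<rho>" "G tw \<in> V" if "tw \<in> I \<times> N" for tw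
    using \<Theta>g[OF embV1[OF that]] W1 \<rho> by (auto simp: G_def)
  have G0: "G (t0, w0) = z0"
    unfolding G_def emb0 by (rule g\<Theta>[OF W1(3)])
  have openIN: "open (I \<times> N)"
    by (rule open_Times[OF I(1) N(1)])
  have semb: "smooth_on S emb" for S
    by (rule smooth_on_linear[OF bl_emb])
  have sG: "smooth_on (I \<times> N) G"
    unfolding G_def[abs_def] by (rule smooth_on_compose[OF openIN V1(1) semb sg]) (use embV1 in auto)
  define W where "W = {x \<in> W1. unemb (\<Theta> x) \<in> I \<times> N}"
  have cU: "continuous_on W1 (\<lambda>x. unemb (\<Theta> x))"
    by (rule smooth_on_continuous[OF smooth_on_bounded_linear[OF W1(1) bl_unemb smooth_on_subset[OF smooth_\<Theta>]]])
       (use W1 \<rho> in auto)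
  have "W = W1 \<inter> (\<lambda>x. unemb (\<Theta> x)) -` (I \<times> N)"
    by (auto simp: W_def)
  then have oW: "open W"
    using continuous_open_preimage[OF cU W1(1) openIN] by simp
  have GW: "G tw \<in> W" if "tw \<in> I \<times> N" for tw
    using G[OF that] that by (simp add: W_def emb_unemb)
  have WG: "G (unemb (\<Theta> x)) = x" if "x \<in> W" for x
    using that g\<Theta>[of x] by (simp add: W_def G_def emb_unemb)
  have injG: "inj_on G (I \<times> N)"
    by (rule inj_onI) (metis G(2) emb_unemb(2))
  have bijG: "bij_betw G (I \<times> N) W"
    unfolding bij_betw_def using injG GW WG by (force simp: W_def)
  have inv: "inv_into (I \<times> N) G x = unemb (\<Theta> x)" if "x \<in> W" for x
    by (rule inv_into_f_eq[OF injG]) (use that WG in \<open>auto simp: W_def\<close>)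
  have diffeo: "diffeomorphism (I \<times> N) W G"
    unfolding diffeomorphism_def
  proof (intro conjI openIN oW bijG sG)
    have "smooth_on W (\<lambda>x. unemb (\<Theta> x))"
      by (rule smooth_on_bounded_linear[OF oW bl_unemb smooth_on_subset[OF smooth_\<Theta>]])
         (use W1 \<rho> in \<open>auto simp: W_def\<close>)
    then show "smooth_on W (inv_into (I \<times> N) G)"
      by (rule smooth_on_cong[OF oW, rotated]) (simp add: inv)
  qed
  have DG: "D g (emb tw) (pr3 (\<epsilon> i (G tw))) = e i (G tw)" if "tw \<in> I \<times> N" for tw i
    using Dg[OF embV1[OF that], of "e i (G tw)"] G(4)[OF that] by (simp add: D_\<Theta> G_def)

  \<comment> \<open>Differentiation along the slices\<close>
  have slice_w: "((\<lambda>w. k (G (t, w))) has_derivative (\<lambda>v. D k (G (t, w)) (D g (emb (t, w)) (emb (0, v))))) (at w)"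
    if k: "smooth_on V k" and "t \<in> I" "w \<in> N" for k :: "real^3 \<Rightarrow> 'z::real_normed_vector" and t w
  proof -
    have q: "(t, w) \<in> I \<times> N"
      using that by simp
    have "((\<lambda>w. (t, w)) has_derivative (\<lambda>v. (0, v))) (at w)"
      by (intro has_derivative_Pair has_derivative_const has_derivative_ident)
    from bounded_linear.has_derivative[OF bl_emb this]
    have "((\<lambda>w. emb (t, w)) has_derivative (\<lambda>v. emb (0, v))) (at w)" .
    from has_derivative_compose[OF this smooth_on_has_derivative[OF sg embV1[OF q]]]
    have "((\<lambda>w. G (t, w)) has_derivative (\<lambda>v. D g (emb (t, w)) (emb (0, v)))) (at w)"
      unfolding G_def .
    from has_derivative_compose[OF this smooth_on_has_derivative[OF k G(4)[OF q]]]
    show ?thesis .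
  qed
  have slice_t: "((\<lambda>t. k (G (t, w))) has_derivative (\<lambda>s. D k (G (t, w)) (D g (emb (t, w)) (emb (s, 0))))) (at t)"
    if k: "smooth_on V k" and "t \<in> I" "w \<in> N" for k :: "real^3 \<Rightarrow> 'z::real_normed_vector" and t w
  proof -
    have q: "(t, w) \<in> I \<times> N"
      using that by simp
    have "((\<lambda>t. (t, w)) has_derivative (\<lambda>s. (s, 0))) (at t)"
      by (intro has_derivative_Pair has_derivative_const has_derivative_ident)
    from bounded_linear.has_derivative[OF bl_emb this]
    have "((\<lambda>t. emb (t, w)) has_derivative (\<lambda>s. emb (s, 0))) (at t)" .
    from has_derivative_compose[OF this smooth_on_has_derivative[OF sg embV1[OF q]]]
    have "((\<lambda>t. G (t, w)) has_derivative (\<lambda>s. D g (emb (t, w)) (emb (s, 0)))) (at t)"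
      unfolding G_def .
    from has_derivative_compose[OF this smooth_on_has_derivative[OF k G(4)[OF q]]]
    show ?thesis .
  qed

  \<comment> \<open>For a vector \<open>u\<close> tangent to the slice the \<open>t\<close>
    component of \<open>D \<Theta> x u\<close> vanishes. This component is
    \<open>h x u (e 1 x)\<close> times the nonzero first component of \<open>\<epsilon> 1\<close>,
    so \<open>u\<close> is a combination of \<open>e 2\<close> and \<open>e 3\<close>.\<close>
  have const_w: "k (G (t, w)) = k (G (t, w'))"
    if k: "smooth_on V k" and k0: "\<And>x. x \<in> ball z0 \<rho> \<Longrightarrow> D k x (e 2 x) = 0 \<and> D k x (e 3 x) = 0"
      and t: "t \<in> I" and w: "w \<in> N" "w' \<in> N" for k :: "real^3 \<Rightarrow> 'z::real_normed_vector" and t w w'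
  proof (rule constant_if_D_zero[OF N(1,2) _ w, of "\<lambda>w. k (G (t, w))"])
    fix w assume w: "w \<in> N"
    define x where "x = G (t, w)"
    have q: "(t, w) \<in> I \<times> N"
      using t w by simp
    have x: "x \<in> ball z0 \<rho>" "x \<in> V"
      using G[OF q] by (auto simp: x_def)
    have "D k x (D g (emb (t, w)) (emb (0, v))) = 0" for v
    proof -
      define u where "u = D g (emb (t, w)) (emb (0, v))"
      have "D \<Theta> x u = emb (0, v)"
        using Dg2[OF embV1[OF q], of "emb (0, v)"] unfolding u_def x_def G_def .
      then have "(h x u (e 1 x) *\<^sub>R pr3 (\<epsilon> 1 x) + h x u (e 2 x) *\<^sub>R pr3 (\<epsilon> 2 x) + h x u (e 3 x) *\<^sub>R pr3 (\<epsilon> 3 x)) $ 3 = emb (0, v) $ 3"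
        unfolding D_expand[OF x(2) smooth_\<Theta>, of u] D_\<Theta>[OF x(2)] by simp
      then have "h x u (e 1 x) * \<epsilon> 1 x $ 1 = 0"
        using par[OF x(1)] by (simp add: pr3_def emb_def)
      then have "h x u (e 1 x) = 0"
        using \<tau>[OF x(1)] by simp
      then show ?thesis
        unfolding u_def[symmetric] D_expand[OF x(2) k, of u] using k0[OF x(1)] by simp
    qed
    with slice_w[OF k t w] show "((\<lambda>w. k (G (t, w))) has_derivative (\<lambda>_. 0)) (at w)"
      by (simp add: x_def)
  qed

  \<comment> \<open>Splitting of the height\<close>
  define F where "F t w = U (G (t, w)) $ 4" for t w
  define f where "f w = F t0 w" for w
  \<comment> \<open>The value \<open>F t0 w0\<close> is subtracted because \<open>f\<close>, the
    height on the slice \<open>t0\<close>, already contains it.\<close>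
  define \<gamma> :: "real \<Rightarrow> real^2" where "\<gamma> t = vector [t, F t w0 - F t0 w0]" for t
  have sU4: "smooth_on V (\<lambda>x. U x $ 4)"
    by (rule smooth_on_vec_nth[OF openV smooth_U])
  have dF: "((\<lambda>t. F t w) has_derivative (\<lambda>s. (\<epsilon> 1 (G (t, w0)) $ 4 / \<epsilon> 1 (G (t, w0)) $ 1) * s)) (at t)"
    if t: "t \<in> I" and w: "w \<in> N" for t w
  proof -
    define x where "x = G (t, w)"
    have q: "(t, w) \<in> I \<times> N"
      using t w by simp
    have x: "x \<in> ball z0 \<rho>" "x \<in> V"
      using G[OF q] by (auto simp: x_def)
    note lg = linear_D[OF sg embV1[OF q]]
    \<comment> \<open>\<open>\<epsilon> 1\<close> has no second and third component, so the
      coordinate direction of \<open>t\<close> is a multiple of its projection and corresponds to a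
      multiple of \<open>e 1\<close>.\<close>
    have "emb (s, 0) = (s / \<epsilon> 1 x $ 1) *\<^sub>R pr3 (\<epsilon> 1 x)" for s
      unfolding vec_eq_iff forall_3 using par[OF x(1)] \<tau>[OF x(1)] by (simp add: emb_def pr3_def)
    then have "D g (emb (t, w)) (emb (s, 0)) = (s / \<epsilon> 1 x $ 1) *\<^sub>R e 1 x" for s
      using DG[OF q, of 1] by (simp add: linear_scale[OF lg] x_def)
    then have "D (\<lambda>x. U x $ 4) x (D g (emb (t, w)) (emb (s, 0))) = (\<epsilon> 1 x $ 4 / \<epsilon> 1 x $ 1) * s" for s
      by (simp add: linear_scale[OF linear_D[OF smooth_U x(2)]] D_vec_nth[OF smooth_U x(2)] D_B[OF x(2)])
    moreover have "\<epsilon> 1 x = \<epsilon> 1 (G (t, w0))"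
      unfolding x_def by (rule const_w[OF smooth_\<epsilon> _ t w N(3)]) (use \<rho> d\<epsilon> in blast)
    ultimately show ?thesis
      using slice_t[OF sU4 t w] unfolding F_def x_def[symmetric] by simp
  qed
  \<comment> \<open>By \<open>dF\<close> the derivative of \<open>F\<close> along \<open>t\<close> does not depend on \<open>w\<close>.\<close>
  have F_split: "F t w = f w + \<gamma> t $ 2" if t: "t \<in> I" and w: "w \<in> N" for t w
  proof -
    have "F t w - F t w0 = F t0 w - F t0 w0"
    proof (rule constant_if_D_zero[OF I(1,3) _ t I(4), of "\<lambda>t. F t w - F t w0"])
      fix t assume t: "t \<in> I"
      show "((\<lambda>t. F t w - F t w0) has_derivative (\<lambda>_. 0)) (at t)"
        using has_derivative_diff[OF dF[OF t w] dF[OF t N(3)]] by simp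
    qed
    then show ?thesis
      by (simp add: f_def \<gamma>_def)
  qed

  \<comment> \<open>Geometry of the slice through \<open>z0\<close>\<close>
  define X where "X w = G (t0, w)" for w
  have sX: "smooth_on N X"
  proof -
    have "smooth_on N (\<lambda>w. emb (t0, 0) + emb (0, w))"
      by (intro smooth_rules N(1) smooth_on_linear bounded_linear_compose[OF bl_emb bounded_linear_Pair] bounded_linear_zero bounded_linear_ident)
    moreover have "emb (t0, 0) + emb (0, w) = emb (t0, w)" for w
      using linear_add[OF bounded_linear.linear[OF bl_emb], of "(t0, 0)" "(0, w)"] by simp
    ultimately have "smooth_on N (\<lambda>w. emb (t0, w))"
      by simp
    then show ?thesis
      unfolding X_def[abs_def] G_def by (rule smooth_on_compose[OF N(1) V1(1) _ sg]) (use embV1 I(4) in auto)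
  qed
  have XV: "X w \<in> V" "X w \<in> ball z0 \<rho>" if "w \<in> N" for w
    using G(3,4)[of "(t0, w)"] that I(4) by (auto simp: X_def)
  have sk: "smooth_on N (\<lambda>w. k (X w))" if "smooth_on V k" for k :: "real^3 \<Rightarrow> 'z::real_normed_vector"
    by (rule smooth_on_compose[OF N(1) openV sX that]) (use XV in auto)
  have sf: "smooth_on N f"
    unfolding f_def[abs_def] F_def X_def[symmetric] by (rule sk[OF sU4])
  have s\<gamma>: "smooth_on I \<gamma>"
  proof -
    have "smooth_on I (\<lambda>t. emb (t, 0) + emb (0, w0))"
      by (intro smooth_rules I(1) smooth_on_linear bounded_linear_compose[OF bl_emb bounded_linear_Pair] bounded_linear_zero bounded_linear_ident)
    moreover have "emb (t, 0) + emb (0, w0) = emb (t, w0)" for t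
      using linear_add[OF bounded_linear.linear[OF bl_emb], of "(t, 0)" "(0, w0)"] by simp
    ultimately have "smooth_on I (\<lambda>t. emb (t, w0))"
      by simp
    from smooth_on_compose[OF I(1) V1(1) this sg] have "smooth_on I (\<lambda>t. G (t, w0))"
      unfolding G_def using embV1 N(3) by auto
    from smooth_on_compose[OF I(1) openV this sU4] have "smooth_on I (\<lambda>t. F t w0)"
      unfolding F_def using G(4) N(3) by auto
    then have s2: "smooth_on I (\<lambda>t. F t w0 - F t0 w0)"
      by (intro smooth_rules I(1))
    show ?thesis
    proof (rule smooth_on_vec[OF I(1)])
      fix i :: 2
      show "smooth_on I (\<lambda>t. \<gamma> t $ i)"
        using exhaust_2[of i] s2 smooth_on_id[of I] by (auto simp: \<gamma>_def)
    qed
  qed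
  define Y where "Y j w = pr2 (\<epsilon> j (X w))" for j w
  have sY: "smooth_on N (Y j)" for j
    unfolding Y_def[abs_def] by (rule sk[OF smooth_on_bounded_linear[OF openV bl_pr2 smooth_\<epsilon>]])
  have D_Y: "D (\<lambda>w. k (X w)) w (Y j w) = D k (X w) (e j (X w))"
    if k: "smooth_on V k" and w: "w \<in> N" and j: "j = 2 \<or> j = 3" for k :: "real^3 \<Rightarrow> 'z::real_normed_vector" and w j
  proof -
    \<comment> \<open>\<open>\<epsilon> 2\<close> and \<open>\<epsilon> 3\<close> have no first
      component, so \<open>e 2\<close> and \<open>e 3\<close> are tangent to the slice and appear
      there as \<open>Y 2\<close> and \<open>Y 3\<close>.\<close>
    have "emb (0, Y j w) = pr3 (\<epsilon> j (X w))"
      unfolding vec_eq_iff forall_3 using par[OF XV(2)[OF w]] j by (auto simp: emb_def pr3_def Y_def pr2_def)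
    moreover have "D (\<lambda>w. k (X w)) w = (\<lambda>v. D k (X w) (D g (emb (t0, w)) (emb (0, v))))"
      unfolding X_def by (rule D_eq[OF slice_w[OF k I(4) w]])
    ultimately show ?thesis
      using DG[of "(t0, w)" j] I(4) w by (simp add: X_def)
  qed
  have \<omega>X: "\<omega> (X w) = axis 4 1" if w: "w \<in> N" for w
  proof -
    have "\<omega> (X w) = \<omega> (X w0)"
      unfolding X_def by (rule const_w[OF smooth_\<omega> _ I(4) w N(3)]) (use \<rho> d\<epsilon> in blast)
    then show ?thesis
      by (simp add: X_def G0 at_z0)
  qed
  have hess: "hess f w (Y i w) (Y j w) = (if i = j then 1 else 0)"
    if w: "w \<in> N" and i: "i = 2 \<or> i = 3" and j: "j = 2 \<or> j = 3" for w i j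
  proof -
    note xV = XV(1)[OF w]
    have Df: "D f y (Y j y) = \<epsilon> j (X y) $ 4" if "y \<in> N" "j = 2 \<or> j = 3" for y j
      using D_Y[OF sU4 that] by (simp add: f_def[abs_def] F_def X_def[symmetric] D_vec_nth[OF smooth_U XV(1)[OF that(1)]] D_B[OF XV(1)[OF that(1)]])
    \<comment> \<open>\<open>\<Lambda>\<close> annihilates the tangent plane of the graph, so it sends a vector to its component along \<open>\<omega>\<close>.\<close>
    define \<Lambda> where "\<Lambda> v = v $ 4 - D f w (pr2 v)" for v
    note lf = linear_D[OF sf w] and lp = bounded_linear.linear[OF bl_pr2]
    have lin: "\<Lambda> (v + v') = \<Lambda> v + \<Lambda> v'" "\<Lambda> (c *\<^sub>R v) = c * \<Lambda> v" for v v' c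
      by (simp_all add: \<Lambda>_def linear_add[OF lp] linear_scale[OF lp] linear_add[OF lf] linear_scale[OF lf] right_diff_distrib)
    have z: "\<Lambda> (\<epsilon> 2 (X w)) = 0" "\<Lambda> (\<epsilon> 3 (X w)) = 0"
      using Df[OF w, of 2] Df[OF w, of 3] by (simp_all add: \<Lambda>_def Y_def)
    have "pr2 (axis 4 1) = 0"
      unfolding vec_eq_iff forall_2 by (simp add: pr2_def axis_def)
    then have o: "\<Lambda> (\<omega> (X w)) = 1"
      unfolding \<omega>X[OF w] \<Lambda>_def by (simp add: linear_0[OF lf] axis_def)
    have "D (\<lambda>y. D f y (Y j y)) w (Y i w) = D (\<lambda>y. \<epsilon> j (X y) $ 4) w (Y i w)"
      by (rule D_cong_open[OF N(1) w, THEN fun_cong]) (rule Df[OF _ j])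
    also have "\<dots> = D (\<epsilon> j) (X w) (e i (X w)) $ 4"
      using D_Y[OF smooth_on_vec_nth[OF openV smooth_\<epsilon>] w i, of j 4] by (simp add: D_vec_nth[OF smooth_\<epsilon> xV])
    finally have "hess f w (Y i w) (Y j w) + D f w (D (Y j) w (Y i w)) = D (\<epsilon> j) (X w) (e i (X w)) $ 4"
      using D_D_field[OF N(1) sf sY w, of j "Y i w"] by simp
    moreover have "D (Y j) w (Y i w) = pr2 (D (\<epsilon> j) (X w) (e i (X w)))"
      using D_Y[OF smooth_on_bounded_linear[OF openV bl_pr2 smooth_\<epsilon>] w i, of j]
      by (simp add: Y_def[abs_def] D_bounded_linear[OF smooth_\<epsilon> xV bl_pr2])
    ultimately have "hess f w (Y i w) (Y j w) = \<Lambda> (D (\<epsilon> j) (X w) (e i (X w)))"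
      by (simp add: \<Lambda>_def)
    then show ?thesis
      using i j by (elim disjE) (simp_all add: d\<epsilon>[OF xV] lin z o del: scaleR_minus_left)
  qed
  \<comment> \<open>\<open>k\<close> is the area spanned by the projections of
    \<open>\<epsilon> 2\<close> and \<open>\<epsilon> 3\<close>. Modulo \<open>\<omega>\<close>, the
    derivatives along \<open>e 2\<close> and \<open>e 3\<close> act on this pair by matrices of
    trace zero, so the area keeps its value \<open>1\<close> from \<open>z0\<close>.\<close>
  have dY: "Y 2 w $ 1 * Y 3 w $ 2 - Y 2 w $ 2 * Y 3 w $ 1 = 1" if w: "w \<in> N" for w
  proof -
    define k where "k x = \<epsilon> 2 x $ 2 * \<epsilon> 3 x $ 3 - \<epsilon> 2 x $ 3 * \<epsilon> 3 x $ 2" for x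
    note s = smooth_on_vec_nth[OF openV smooth_\<epsilon>]
    have "smooth_on V k"
      unfolding k_def[abs_def] by (intro smooth_rules openV s)
    moreover have Dk: "D k x v = (\<epsilon> 2 x $ 2 * D (\<epsilon> 3) x v $ 3 + D (\<epsilon> 2) x v $ 2 * \<epsilon> 3 x $ 3)
        - (\<epsilon> 2 x $ 3 * D (\<epsilon> 3) x v $ 2 + D (\<epsilon> 2) x v $ 3 * \<epsilon> 3 x $ 2)" if "x \<in> V" for x v
      unfolding k_def[abs_def] D_diff[OF smooth_on_mult[OF openV s s] smooth_on_mult[OF openV s s] that] D_mult[OF s s that]
        D_vec_nth[OF smooth_\<epsilon> that] ..
    moreover have "D k x (e 2 x) = 0 \<and> D k x (e 3 x) = 0" if x: "x \<in> ball z0 \<rho>" for x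
    proof -
      have xV: "x \<in> V"
        using x \<rho> by blast
      show ?thesis
        unfolding Dk[OF xV] d\<epsilon>[OF xV] using par[OF x] by (simp add: algebra_simps)
    qed
    ultimately have "k (X w) = k (X w0)"
      unfolding X_def by (intro const_w[OF _ _ I(4) w N(3)])
    also have "\<dots> = 1"
      unfolding X_def G0 k_def at_z0 by (simp add: axis_def)
    finally show ?thesis
      by (simp add: k_def Y_def pr2_def)
  qed
  have improper: "improper_affine_sphere N (graph f) (\<lambda>w. vector [0, 0, 1])"
  proof (rule graph_improper_affine_sphere[OF N(1) sf])
    fix w assume w: "w \<in> N"
    show "\<exists>Y1 Y2. hess f w Y1 Y1 = 1 \<and> hess f w Y1 Y2 = 0 \<and> hess f w Y2 Y1 = 0 \<and> hess f w Y2 Y2 = 1 \<and>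
        Y1 $ 1 * Y2 $ 2 - Y1 $ 2 * Y2 $ 1 = 1"
      using hess[OF w, of 2 2] hess[OF w, of 2 3] hess[OF w, of 3 2] hess[OF w, of 3 3] dY[OF w]
      by (intro exI[of _ "Y 2 w"] exI[of _ "Y 3 w"]) simp
  qed
  have parab: "\<exists>P. elliptic_paraboloid P \<and> openin (top_of_set P) (graph f ` N)" if m0: "\<forall>x\<in>V. m x = 0"
  proof -
    \<comment> \<open>For \<open>m = 0\<close> these matrices are even skew, so the sum of the
      tensor squares of the two vectors stays the identity. As the vectors are orthonormal for the
      Hessian, this sum is the inverse of the Hessian.\<close>
    have Q: "Y 2 w $ a * Y 2 w $ b + Y 3 w $ a * Y 3 w $ b = (if a = b then 1 else 0)" if w: "w \<in> N" for w a b
    proof -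
      define k where "k a b x = \<epsilon> 2 x $ a * \<epsilon> 2 x $ b + \<epsilon> 3 x $ a * \<epsilon> 3 x $ b" for a b x
      note s = smooth_on_vec_nth[OF openV smooth_\<epsilon>]
      have sk: "smooth_on V (k a b)" for a b
        unfolding k_def[abs_def] by (intro smooth_rules openV s)
      have Dk: "D (k a b) x v = (\<epsilon> 2 x $ a * D (\<epsilon> 2) x v $ b + D (\<epsilon> 2) x v $ a * \<epsilon> 2 x $ b)
          + (\<epsilon> 3 x $ a * D (\<epsilon> 3) x v $ b + D (\<epsilon> 3) x v $ a * \<epsilon> 3 x $ b)" if "x \<in> V" for x v a b
        unfolding k_def[abs_def] D_add[OF smooth_on_mult[OF openV s s] smooth_on_mult[OF openV s s] that] D_mult[OF s s that]
          D_vec_nth[OF smooth_\<epsilon> that] ..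
      have k: "k a b (X w) = k a b (X w0)" if a: "a = 2 \<or> a = 3" and b: "b = 2 \<or> b = 3" for a b
        unfolding X_def
      proof (rule const_w[OF sk _ I(4) w N(3)])
        fix x assume x: "x \<in> ball z0 \<rho>"
        then have xV: "x \<in> V"
          using \<rho> by blast
        have om: "\<omega> x $ a = 0" "\<omega> x $ b = 0"
          using a b par[OF x] by auto
        show "D (k a b) x (e 2 x) = 0 \<and> D (k a b) x (e 3 x) = 0"
          unfolding Dk[OF xV] d\<epsilon>[OF xV] using om m0 xV by (simp add: algebra_simps)
      qed
      have "k a b (X w0) = (if a = b then 1 else 0)" if a: "a = 2 \<or> a = 3" and b: "b = 2 \<or> b = 3" for a b
        unfolding X_def G0 k_def at_z0 using a b by (auto simp: axis_def)
      with k have "k a b (X w) = (if a = b then 1 else 0)" if "a = 2 \<or> a = 3" "b = 2 \<or> b = 3" for a b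
        using that by simp
      from this[of 2 2] this[of 2 3] this[of 3 2] this[of 3 3] show ?thesis
        using exhaust_2[of a] exhaust_2[of b] by (auto simp: k_def Y_def pr2_def)
    qed
    have "hess f w v u = v \<bullet> u" if w: "w \<in> N" for w v u
    proof -
      have ex: "v = (v \<bullet> Y 2 w) *\<^sub>R Y 2 w + (v \<bullet> Y 3 w) *\<^sub>R Y 3 w" for v
      proof -
        have "((v \<bullet> Y 2 w) *\<^sub>R Y 2 w + (v \<bullet> Y 3 w) *\<^sub>R Y 3 w) $ a =
            v $ 1 * (Y 2 w $ 1 * Y 2 w $ a + Y 3 w $ 1 * Y 3 w $ a) + v $ 2 * (Y 2 w $ 2 * Y 2 w $ a + Y 3 w $ 2 * Y 3 w $ a)" for a
          by (simp add: inner_vec_def sum_2 algebra_simps)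
        then show ?thesis
          unfolding Q[OF w] vec_eq_iff forall_2 by simp
      qed
      note hl = hess_bilinear[OF N(1) sf w]
      have H: "hess f w (c *\<^sub>R Y 2 w + d *\<^sub>R Y 3 w) (c' *\<^sub>R Y 2 w + d' *\<^sub>R Y 3 w) = c * c' + d * d'" for c d c' d'
        using hess[OF w, of 2 2] hess[OF w, of 2 3] hess[OF w, of 3 2] hess[OF w, of 3 3]
        by (simp add: linear_add[OF hl(1)] linear_scale[OF hl(1)] linear_add[OF hl(2)] linear_scale[OF hl(2)])
      have "hess f w v u = (v \<bullet> Y 2 w) * (u \<bullet> Y 2 w) + (v \<bullet> Y 3 w) * (u \<bullet> Y 3 w)"
        using H[of "u \<bullet> Y 2 w" "u \<bullet> Y 3 w" "v \<bullet> Y 2 w" "v \<bullet> Y 3 w"] unfolding ex[symmetric] .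
      also have "\<dots> = ((v \<bullet> Y 2 w) *\<^sub>R Y 2 w + (v \<bullet> Y 3 w) *\<^sub>R Y 3 w) \<bullet> u"
        by (simp only: inner_add_left inner_scaleR_left inner_commute[of u])
      finally show ?thesis
        unfolding ex[symmetric] .
    qed
    from hess_identity_quadratic[OF N(1,2) sf this] obtain \<beta> c where "\<And>w. w \<in> N \<Longrightarrow> f w = (w \<bullet> w) / 2 + \<beta> \<bullet> w + c"
      by blast
    from quadratic_graph_paraboloid[OF N(1) this] show ?thesis
      by blast
  qed

  \<comment> \<open>A cyclic permutation that puts \<open>w\<close> first, then the height, then
    \<open>t\<close>.\<close>
  define C :: "real^4 \<Rightarrow> real^4" where "C v = vector [v $ 2, v $ 3, v $ 4, v $ 1]" for v
  define C' :: "real^4 \<Rightarrow> real^4" where "C' v = vector [v $ 4, v $ 1, v $ 2, v $ 3]" for v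
  have "linear C"
    by (intro linearI; unfold vec_eq_iff forall_4; simp add: C_def)
  have "C (C' v) = v" "C' (C v) = v" for v
    unfolding vec_eq_iff forall_4 by (simp_all add: C_def C'_def)
  then have "bij C"
    by (intro o_bij[of C']) (simp_all add: fun_eq_iff)
  have "affine_iso (\<lambda>v. C (B *v v))"
    unfolding affine_iso_def
  proof (intro exI conjI)
    show "linear (C \<circ> (*v) B)"
      by (rule linear_compose[OF matrix_vector_mul_linear \<open>linear C\<close>])
    show "bij (C \<circ> (*v) B)"
      by (rule bij_comp[OF bij_B \<open>bij C\<close>])
    show "(\<lambda>v. C (B *v v)) = (\<lambda>v. (C \<circ> (*v) B) v + 0)"
      by (simp add: fun_eq_iff)
  qed
  moreover have "C (B *v \<Phi> (G (t, w))) = vector [w $ 1, w $ 2, f w + \<gamma> t $ 2, \<gamma> t $ 1]" if t: "t \<in> I" and w: "w \<in> N" for t w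
  proof -
    have "pr3 (U (G (t, w))) = emb (t, w)"
      using G(2)[of "(t, w)"] t w by (simp add: \<Theta>_def)
    then have "U (G (t, w)) $ 2 = w $ 1" "U (G (t, w)) $ 3 = w $ 2" "U (G (t, w)) $ 1 = t"
      unfolding vec_eq_iff forall_3 by (simp_all add: pr3_def emb_def)
    moreover have "\<gamma> t $ 1 = t"
      by (simp add: \<gamma>_def)
    ultimately show ?thesis
      unfolding vec_eq_iff forall_4 F_split[OF t w, symmetric] U_def[symmetric] by (simp add: C_def F_def)
  qed
  moreover have "W \<subseteq> V"
    using W1 \<rho> by (auto simp: W_def)
  moreover have "z0 \<in> W"
    using GW[of "(t0, w0)"] I(4) N(3) by (simp add: G0)
  ultimately show ?thesis
    using I(1,2) s\<gamma> improper diffeo parab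
    by (intro exI[of _ I] exI[of _ N] exI[of _ f] exI[of _ \<gamma>] exI[of _ W] exI[of _ G] exI[of _ "\<lambda>v. C (B *v v)"] conjI) auto
qed

end

text \<open>The cases distinguish whether the \<open>SO(2)\<close> condition holds on the whole
  chart, so the clause on the paraboloid has to be proved only where \<open>m\<close> vanishes and
  is vacuous in the other case.\<close>

lemma (in hypersurface) local_form:
  assumes p: "p \<in> \<Omega>"
    and sym: "(\<forall>x\<in>\<Omega>. SO2_at \<Phi> \<xi> x) \<or> (\<forall>x\<in>\<Omega>. Z3_at \<Phi> \<xi> x)"
    and fns: "\<forall>W e1 e2 e3 l m a b x. W \<subseteq> \<Omega> \<longrightarrow> adapted_frame \<Phi> \<xi> W e1 e2 e3 l m a b \<longrightarrow> x \<in> W \<longrightarrow>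
      b x = 0 \<and> h x (LC_conn h e2 e1 x) (e2 x) = l x \<and> h x (LC_conn h e3 e1 x) (e3 x) = l x"
  shows "\<exists>(I :: real set) (N :: (real^2) set) f (\<gamma> :: real \<Rightarrow> real^2) W G T.
     open I \<and> is_interval I \<and> smooth_on I \<gamma> \<and>
     improper_affine_sphere N (graph f) (\<lambda>w. vector [0, 0, 1]) \<and>
     diffeomorphism (I \<times> N) W G \<and> W \<subseteq> \<Omega> \<and> p \<in> W \<and> affine_iso T \<and>
     (\<forall>t\<in>I. \<forall>w\<in>N. T (\<Phi> (G (t, w))) = vector [w $ 1, w $ 2, f w + \<gamma> t $ 2, \<gamma> t $ 1]) \<and>
     ((\<forall>x\<in>\<Omega>. SO2_at \<Phi> \<xi> x) \<longrightarrow> (\<exists>P. elliptic_paraboloid P \<and> openin (top_of_set P) (graph f ` N)))"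
proof (cases "\<forall>x\<in>\<Omega>. SO2_at \<Phi> \<xi> x")
  case True
  then obtain V e where V: "p \<in> V" "frame \<Omega> \<Phi> \<xi> V e"
    and nf: "\<forall>x\<in>V. \<exists>l a b. nform x (\<lambda>i. e i x) l 0 0 a b \<and> (l \<noteq> 0 \<or> a \<noteq> b)"
    using SO2_frame[OF _ p] by blast
  interpret fr: frame \<Omega> \<Phi> \<xi> V e
    by (rule V)
  have k: "fr.\<kappa> 2 2 2 x = 0" if "x \<in> V" for x
    using nf that nform_comps(2) unfolding fr.\<kappa>_def by blast
  interpret ad: pointed \<Omega> \<Phi> \<xi> V e p
  proof unfold_locales
    show "\<exists>l m a b. nform x (\<lambda>i. e i x) l m 0 a b \<and> (l = 0 \<longrightarrow> m = 0 \<and> a \<noteq> b)" if "x \<in> V" for x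
      using nf that by blast
    show "(\<forall>x\<in>V. fr.\<kappa> 2 2 2 x = 0) \<or> (\<forall>x\<in>V. fr.\<kappa> 1 1 1 x > 0 \<and> fr.\<kappa> 2 2 2 x > 0 \<and>
      ((fr.\<kappa> 2 2 2 x)\<^sup>2 = 2 * (fr.\<kappa> 1 1 1 x / 2)\<^sup>2 \<longrightarrow> fr.\<sigma> 1 1 x \<noteq> fr.\<sigma> 2 2 x))"
      using k by blast
    show "b x = 0 \<and> h x (LC_conn h e2 e1 x) (e2 x) = l x \<and> h x (LC_conn h e3 e1 x) (e3 x) = l x"
      if "W \<subseteq> V" "adapted_frame \<Phi> \<xi> W e1 e2 e3 l m a b" "x \<in> W" for W e1 e2 e3 l m a b x
      by (rule fns[rule_format, OF subset_trans[OF that(1) fr.sub] that(2,3)])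
    show "p \<in> V"
      by (rule V(1))
  qed
  have m: "\<forall>x\<in>V. ad.m x = 0"
    using k by (simp add: ad.m_def)
  obtain I N f and \<gamma> :: "real \<Rightarrow> real^2" and W G T where c: "open I \<and> is_interval I \<and> smooth_on I \<gamma> \<and>
     improper_affine_sphere N (graph f) (\<lambda>w. vector [0, 0, 1]) \<and>
     diffeomorphism (I \<times> N) W G \<and> W \<subseteq> V \<and> p \<in> W \<and> affine_iso T \<and>
     (\<forall>t\<in>I. \<forall>w\<in>N. T (\<Phi> (G (t, w))) = vector [w $ 1, w $ 2, f w + \<gamma> t $ 2, \<gamma> t $ 1]) \<and>
     ((\<forall>x\<in>V. ad.m x = 0) \<longrightarrow> (\<exists>P. elliptic_paraboloid P \<and> openin (top_of_set P) (graph f ` N)))"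
    using ad.product_coordinates by (elim exE) (rule that)
  have W: "W \<subseteq> \<Omega>"
    using c by (elim conjE) (rule subset_trans[OF _ fr.sub])
  have P: "(\<forall>x\<in>\<Omega>. SO2_at \<Phi> \<xi> x) \<longrightarrow> (\<exists>P. elliptic_paraboloid P \<and> openin (top_of_set P) (graph f ` N))"
    using c m by (elim conjE) simp
  show ?thesis
    using c
    by - (rule exI[of _ I], rule exI[of _ N], rule exI[of _ f], rule exI[of _ \<gamma>], rule exI[of _ W], rule exI[of _ G], rule exI[of _ T],
        (intro conjI W P; elim conjE; assumption))
next
  case False
  then have Z3: "\<And>x. x \<in> \<Omega> \<Longrightarrow> Z3_at \<Phi> \<xi> x"
    using sym by blast
  obtain V e where V: "p \<in> V" "frame \<Omega> \<Phi> \<xi> V e"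
    and nf: "\<forall>x\<in>V. \<exists>l m a b. nform x (\<lambda>i. e i x) l m 0 a b \<and> l > 0 \<and> m > 0 \<and> (m\<^sup>2 = 2 * l\<^sup>2 \<longrightarrow> a \<noteq> b)"
    using Z3_frame[OF Z3 p] by blast
  interpret fr: frame \<Omega> \<Phi> \<xi> V e
    by (rule V)
  have k: "fr.\<kappa> 1 1 1 x > 0 \<and> fr.\<kappa> 2 2 2 x > 0 \<and>
      ((fr.\<kappa> 2 2 2 x)\<^sup>2 = 2 * (fr.\<kappa> 1 1 1 x / 2)\<^sup>2 \<longrightarrow> fr.\<sigma> 1 1 x \<noteq> fr.\<sigma> 2 2 x)" if x: "x \<in> V" for x
  proof -
    obtain l m a b where n: "nform x (\<lambda>i. e i x) l m 0 a b" "l > 0" "m > 0" "m\<^sup>2 = 2 * l\<^sup>2 \<longrightarrow> a \<noteq> b"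
      using nf x by blast
    show ?thesis
      unfolding fr.\<kappa>_def fr.\<sigma>_def nform_comps[OF n(1)] using n(2-4) by simp
  qed
  interpret ad: pointed \<Omega> \<Phi> \<xi> V e p
  proof unfold_locales
    show "\<exists>l m a b. nform x (\<lambda>i. e i x) l m 0 a b \<and> (l = 0 \<longrightarrow> m = 0 \<and> a \<noteq> b)" if "x \<in> V" for x
      using nf that by (metis less_irrefl)
    show "(\<forall>x\<in>V. fr.\<kappa> 2 2 2 x = 0) \<or> (\<forall>x\<in>V. fr.\<kappa> 1 1 1 x > 0 \<and> fr.\<kappa> 2 2 2 x > 0 \<and>
      ((fr.\<kappa> 2 2 2 x)\<^sup>2 = 2 * (fr.\<kappa> 1 1 1 x / 2)\<^sup>2 \<longrightarrow> fr.\<sigma> 1 1 x \<noteq> fr.\<sigma> 2 2 x))"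
      using k by blast
    show "b x = 0 \<and> h x (LC_conn h e2 e1 x) (e2 x) = l x \<and> h x (LC_conn h e3 e1 x) (e3 x) = l x"
      if "W \<subseteq> V" "adapted_frame \<Phi> \<xi> W e1 e2 e3 l m a b" "x \<in> W" for W e1 e2 e3 l m a b x
      by (rule fns[rule_format, OF subset_trans[OF that(1) fr.sub] that(2,3)])
    show "p \<in> V"
      by (rule V(1))
  qed
  obtain I N f and \<gamma> :: "real \<Rightarrow> real^2" and W G T where c: "open I \<and> is_interval I \<and> smooth_on I \<gamma> \<and>
     improper_affine_sphere N (graph f) (\<lambda>w. vector [0, 0, 1]) \<and>
     diffeomorphism (I \<times> N) W G \<and> W \<subseteq> V \<and> p \<in> W \<and> affine_iso T \<and>
     (\<forall>t\<in>I. \<forall>w\<in>N. T (\<Phi> (G (t, w))) = vector [w $ 1, w $ 2, f w + \<gamma> t $ 2, \<gamma> t $ 1]) \<and>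
     ((\<forall>x\<in>V. ad.m x = 0) \<longrightarrow> (\<exists>P. elliptic_paraboloid P \<and> openin (top_of_set P) (graph f ` N)))"
    using ad.product_coordinates by (elim exE) (rule that)
  have W: "W \<subseteq> \<Omega>"
    using c by (elim conjE) (rule subset_trans[OF _ fr.sub])
  have P: "(\<forall>x\<in>\<Omega>. SO2_at \<Phi> \<xi> x) \<longrightarrow> (\<exists>P. elliptic_paraboloid P \<and> openin (top_of_set P) (graph f ` N))"
    by (rule impI, rule notE[OF False])
  show ?thesis
    using c
    by - (rule exI[of _ I], rule exI[of _ N], rule exI[of _ f], rule exI[of _ \<gamma>], rule exI[of _ W], rule exI[of _ G], rule exI[of _ T],
        (intro conjI W P; elim conjE; assumption))
qed

theorem theorem4p5:
  fixes X :: "'m topology"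
    and A :: "('m set \<times> ('m \<Rightarrow> real^3)) set"
    and F \<xi> :: "'m \<Rightarrow> real^4"
    and lam b \<eta> :: "'m \<Rightarrow> real"
  assumes "smooth_3_manifold X A"
    and "affine_hypersurface A F \<xi>"
    and "positive_definite A F \<xi>"
    and "pointwise_SO2 A F \<xi> \<or> pointwise_Z3 A F \<xi>"
    and "structure_functions A F \<xi> lam b \<eta>"
    and "\<forall>p\<in>topspace X. b p = 0 \<and> \<eta> p = lam p"
  shows "\<forall>p\<in>topspace X.
    \<exists>(I :: real set) (N :: (real^2) set) (f :: real^2 \<Rightarrow> real) (\<gamma> :: real \<Rightarrow> real^2).
      open I \<and> is_interval I \<and> smooth_on I \<gamma> \<and>
      improper_affine_sphere N (\<lambda>w. vector [w $ 1, w $ 2, f w]) (\<lambda>w. vector [0, 0, 1]) \<and>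
      affine_equivalent_near A F p (I \<times> N)
        (\<lambda>(t, w). vector [w $ 1, w $ 2, f w + \<gamma> t $ 2, \<gamma> t $ 1]) \<and>
      (pointwise_SO2 A F \<xi> \<longrightarrow>
        (\<exists>P. elliptic_paraboloid P \<and>
             openin (top_of_set P) ((\<lambda>w. vector [w $ 1, w $ 2, f w]) ` N)))"
proof
  fix p assume p: "p \<in> topspace X"
  have cover: "(\<Union>(U, \<phi>)\<in>A. U) = topspace X"
    using assms(1) by (simp add: smooth_3_manifold_def)
  then obtain U \<phi> where U: "(U, \<phi>) \<in> A" "p \<in> U"
    using p by blast
  define \<Phi> where "\<Phi> = F \<circ> inv_into U \<phi>"
  define \<Xi> where "\<Xi> = \<xi> \<circ> inv_into U \<phi>"
  interpret hypersurface "\<phi> ` U" \<Phi> \<Xi>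
  proof
    show "blaschke_hypersurface (\<phi> ` U) \<Phi> \<Xi>"
      using assms(2) U(1) unfolding affine_hypersurface_def \<Phi>_def \<Xi>_def by blast
    show "aff_metric \<Phi> \<Xi> x v v > 0" if "x \<in> \<phi> ` U" "v \<noteq> 0" for x v
      using assms(3) U(1) that unfolding positive_definite_def \<Phi>_def \<Xi>_def by blast
  qed
  have SO2: "\<forall>x\<in>\<phi> ` U. SO2_at \<Phi> \<Xi> x" if "pointwise_SO2 A F \<xi>"
    using that U(1) unfolding pointwise_SO2_def \<Phi>_def \<Xi>_def by blast
  have Z3: "\<forall>x\<in>\<phi> ` U. Z3_at \<Phi> \<Xi> x" if "pointwise_Z3 A F \<xi>"
    using that U(1) unfolding pointwise_Z3_def \<Phi>_def \<Xi>_def by blast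
  \<comment> \<open>The functions on the manifold are tied to the geometry through adapted frames
    only; the hypotheses on \<open>b\<close> and \<open>\<eta>\<close> thus become conditions on
    every adapted frame in the chart.\<close>
  have fns: "\<forall>W e1 e2 e3 l m a b' x. W \<subseteq> \<phi> ` U \<longrightarrow> adapted_frame \<Phi> \<Xi> W e1 e2 e3 l m a b' \<longrightarrow> x \<in> W \<longrightarrow>
      b' x = 0 \<and> h x (LC_conn h e2 e1 x) (e2 x) = l x \<and> h x (LC_conn h e3 e1 x) (e3 x) = l x"
  proof (intro allI impI)
    fix W e1 e2 e3 l m a b' x
    assume W: "W \<subseteq> \<phi> ` U" and ad: "adapted_frame \<Phi> \<Xi> W e1 e2 e3 l m a b'" and x: "x \<in> W"
    have "inv_into U \<phi> x \<in> U"
      using W x by (auto intro: inv_into_into)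
    then have "inv_into U \<phi> x \<in> topspace X"
      using cover U(1) by blast
    then have z: "b (inv_into U \<phi> x) = 0" "\<eta> (inv_into U \<phi> x) = lam (inv_into U \<phi> x)"
      using assms(6) by blast+
    have "let p = inv_into U \<phi> x; h = aff_metric (F \<circ> inv_into U \<phi>) (\<xi> \<circ> inv_into U \<phi>) in
           lam p = l x \<and> b p = b' x \<and>
           \<eta> p = h x (LC_conn h e2 e1 x) (e2 x) \<and>
           \<eta> p = h x (LC_conn h e3 e1 x) (e3 x)"
      using assms(5) U(1) W ad x unfolding structure_functions_def \<Phi>_def \<Xi>_def by blast
    then show "b' x = 0 \<and> h x (LC_conn h e2 e1 x) (e2 x) = l x \<and> h x (LC_conn h e3 e1 x) (e3 x) = l x"
      using z unfolding Let_def \<Phi>_def \<Xi>_def by simp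
  qed
  have sym: "(\<forall>x\<in>\<phi> ` U. SO2_at \<Phi> \<Xi> x) \<or> (\<forall>x\<in>\<phi> ` U. Z3_at \<Phi> \<Xi> x)"
    using SO2 Z3 assms(4) by (elim disjE) (rule disjI1, simp, rule disjI2, simp)
  from local_form[OF imageI[OF U(2)] sym fns]
  obtain I N f and \<gamma> :: "real \<Rightarrow> real^2" and W G T where c: "open I \<and> is_interval I \<and> smooth_on I \<gamma> \<and>
     improper_affine_sphere N (graph f) (\<lambda>w. vector [0, 0, 1]) \<and>
     diffeomorphism (I \<times> N) W G \<and> W \<subseteq> \<phi> ` U \<and> \<phi> p \<in> W \<and> affine_iso T \<and>
     (\<forall>t\<in>I. \<forall>w\<in>N. T (\<Phi> (G (t, w))) = vector [w $ 1, w $ 2, f w + \<gamma> t $ 2, \<gamma> t $ 1]) \<and>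
     ((\<forall>x\<in>\<phi> ` U. SO2_at \<Phi> \<Xi> x) \<longrightarrow> (\<exists>P. elliptic_paraboloid P \<and> openin (top_of_set P) (graph f ` N)))"
    by (elim exE) (rule that)
  note 1 = c[THEN conjunct1] c[THEN conjunct2, THEN conjunct1] c[THEN conjunct2, THEN conjunct2, THEN conjunct1]
  have 2: "diffeomorphism (I \<times> N) W G" "W \<subseteq> \<phi> ` U" "\<phi> p \<in> W" "affine_iso T"
    "\<forall>t\<in>I. \<forall>w\<in>N. T (\<Phi> (G (t, w))) = vector [w $ 1, w $ 2, f w + \<gamma> t $ 2, \<gamma> t $ 1]"
    "improper_affine_sphere N (graph f) (\<lambda>w. vector [0, 0, 1])"
    using c by simp_all
  have 3: "pointwise_SO2 A F \<xi> \<longrightarrow> (\<exists>P. elliptic_paraboloid P \<and> openin (top_of_set P) (graph f ` N))"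
    using c SO2 by (elim conjE) (rule impI, elim impE, simp_all)
  have "affine_equivalent_near A F p (I \<times> N) (\<lambda>(t, w). vector [w $ 1, w $ 2, f w + \<gamma> t $ 2, \<gamma> t $ 1])"
    unfolding affine_equivalent_near_def
  proof (rule bexI[OF _ U(1)], simp only: prod.case, intro conjI exI)
    show "p \<in> U" "diffeomorphism (I \<times> N) W G" "W \<subseteq> \<phi> ` U" "\<phi> p \<in> W" "affine_iso T"
      by (rule U(2) 2(1-4))+
    show "\<forall>y\<in>I \<times> N. T (F (inv_into U \<phi> (G y))) = (case y of (t, w) \<Rightarrow> vector [w $ 1, w $ 2, f w + \<gamma> t $ 2, \<gamma> t $ 1])"
      using 2(5) by (auto simp: \<Phi>_def)
  qed
  with 1 2(6) 3 show "\<exists>(I :: real set) (N :: (real^2) set) (f :: real^2 \<Rightarrow> real) (\<gamma> :: real \<Rightarrow> real^2).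
      open I \<and> is_interval I \<and> smooth_on I \<gamma> \<and>
      improper_affine_sphere N (\<lambda>w. vector [w $ 1, w $ 2, f w]) (\<lambda>w. vector [0, 0, 1]) \<and>
      affine_equivalent_near A F p (I \<times> N)
        (\<lambda>(t, w). vector [w $ 1, w $ 2, f w + \<gamma> t $ 2, \<gamma> t $ 1]) \<and>
      (pointwise_SO2 A F \<xi> \<longrightarrow>
        (\<exists>P. elliptic_paraboloid P \<and>
             openin (top_of_set P) ((\<lambda>w. vector [w $ 1, w $ 2, f w]) ` N)))"
    by (intro exI[of _ I] exI[of _ N] exI[of _ f] exI[of _ \<gamma>] conjI)
qed

end
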